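(* Let $m\ge3$, let $0<\tau\le1$, and let $g$ be a Riemannian metric on $B^m_1(0)\subset\mathbb{R}^m$, smooth away from the origin, with $$g_{\alpha\beta}(y)=\delta_{\alpha\beta}+\mathrm{O}_2(|y|^\tau),\qquad |y|\ll1 .$$ Let $\vec\Phi:D_1(0)\setminus\{0\}\to(B_1^m(0)\setminus\{0\},g)$ be a conformal immersion, with $\langle\partial_{x^i}\vec\Phi,\partial_{x^j}\vec\Phi\rangle_g=e^{2\lambda}\delta_{ij}$, which is Willmore on $D_1(0)\setminus\{0\}$ and satisfies $$\vec\Phi\in C^\infty(D_1(0)\setminus\{0\})\cap C^0(D_1(0)),\qquad \vec\Phi(0)=\vec0,\qquad \int_{D_1(0)}|\vec A^g_{\vec\Phi}|_g^2\,d\mathrm{vol}_{\vec\Phi^*g}<\infty,$$ and, for some integer $\theta_0\ge1$, $$e^{\lambda}(x)\simeq|x|^{\theta_0-1}\qquad\text{and}\qquad |x|\nabla\lambda\in\bigcap_{p<\infty}L^p(D_1(0)) .$$ Then there is a function $\mu$ with $\lim_{s\searrow0}\mu(s)=0$ such that $$|\vec A^g_{\vec\Phi}|(y)\;\lesssim\;|y|^{-1}\mu(|y|)\qquad\text{for all }y\in\vec\Phi(D_1(0)\setminus\{0\})\text{ with }|y|\ll1 .$$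
   Context: Notation. $D_1(0)$ is the unit disk in $\mathbb{R}^2\cong\mathbb{C}$ with coordinates $x=(x^1,x^2)$; $\nabla$ is the flat gradient. $f(X)=\mathrm{O}_N(|X|^s)$ means $f^{(j)}(X)=\mathrm{O}(|X|^{s-j})$ for all integers $0\le j\le N$. $a\lesssim b$ means $a\le Cb$ for a constant $C$; $a\simeq b$ means $|a/b|$ and $|b/a|$ are bounded as $x\to0$. $\vec A^g_{\vec\Phi}$ is the (normal-vector valued) second fundamental form of $\vec\Phi$ in $(\mathbb{R}^m,g)$ and $\vec H^g_{\vec\Phi}$ is half its trace with respect to $\vec\Phi^*g$. Willmore means critical point, for compactly supported variations in $D_1(0)\setminus\{0\}$, of $\int|\vec H^g_{\vec\Phi}|_g^2\,d\mathrm{vol}_{\vec\Phi^*g}$. A bound at $y$ is understood at every $x\ne0$ with $\vec\Phi(x)=y$.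
   Formalization: The threshold in "|y| ≪ 1" may depend on ρ<1, with the bound asserted for points x in D_ρ(0)\{0} (μ and the constant do not depend on ρ); with one threshold on all of the open disk the claim fails, since Φ may tend to 0 as |x|→1. *)

theory Defs
  imports "HOL-Analysis.Analysis" "HOL-Library.Landau_Symbols"
begin

section \<open>Calculus\<close>

text \<open>
  Only used for open \<open>S\<close>. Demanding that every directional derivative (in a constant direction)
  is again \<open>C\<^sup>k\<close> is the usual notion, because the domain is finite-dimensional.
\<close>
primrec Ck_on :: "nat \<Rightarrow> 'a::euclidean_space set \<Rightarrow> ('a \<Rightarrow> 'b::real_normed_vector) \<Rightarrow> bool" where
  "Ck_on 0 S f \<longleftrightarrow> continuous_on S f"
| "Ck_on (Suc k) S f \<longleftrightarrow>
     f differentiable_on S \<and> (\<forall>v. Ck_on k S (\<lambda>x. frechet_derivative f (at x) v))"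

definition smooth_on :: "'a::euclidean_space set \<Rightarrow> ('a \<Rightarrow> 'b::real_normed_vector) \<Rightarrow> bool" where
  "smooth_on S f \<longleftrightarrow> (\<forall>k. Ck_on k S f)"

definition pd :: "'n::finite \<Rightarrow> (real^'n \<Rightarrow> 'b::real_normed_vector) \<Rightarrow> real^'n \<Rightarrow> 'b" where
  "pd i f x = frechet_derivative f (at x) (axis i 1)"

definition grad :: "(real^'n::finite \<Rightarrow> real) \<Rightarrow> real^'n \<Rightarrow> real^'n" where
  "grad f x = (\<chi> i. pd i f x)"

text \<open>
  \<open>f(X) = O\<^sub>N(|X|\<^sup>s)\<close> as \<open>X \<rightarrow> 0\<close>: the components of the \<open>j\<close>-th derivative are the iterated
  partial derivatives along lists of \<open>j\<close> indices.
\<close>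
definition bigO_derivs :: "nat \<Rightarrow> real \<Rightarrow> (real^'n::finite \<Rightarrow> real) \<Rightarrow> bool" where
  "bigO_derivs N s f \<longleftrightarrow>
     (\<forall>is. length is \<le> N \<longrightarrow> foldr pd is f \<in> O[at 0](\<lambda>X. norm X powr (s - real (length is))))"

definition in_Lp :: "real \<Rightarrow> (real^'n::finite) set \<Rightarrow> (real^'n \<Rightarrow> 'b::euclidean_space) \<Rightarrow> bool" where
  "in_Lp p S f \<longleftrightarrow>
     set_borel_measurable lborel S f \<and> set_integrable lborel S (\<lambda>x. norm (f x) powr p)"


section \<open>The ambient metric\<close>

text \<open>A metric on a subset of \<open>\<real>\<^sup>m\<close> is given by its matrix of components \<open>g\<^sub>\<alpha>\<^sub>\<beta>(y)\<close>.\<close>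
type_synonym 'm metric_tensor = "real^'m \<Rightarrow> real^'m^'m"

definition ginner :: "'m::finite metric_tensor \<Rightarrow> real^'m \<Rightarrow> real^'m \<Rightarrow> real^'m \<Rightarrow> real" where
  "ginner g y u v = (\<Sum>\<alpha>\<in>UNIV. \<Sum>\<beta>\<in>UNIV. g y $ \<alpha> $ \<beta> * u $ \<alpha> * v $ \<beta>)"

definition riemannian_metric_on :: "(real^'m::finite) set \<Rightarrow> 'm metric_tensor \<Rightarrow> bool" where
  "riemannian_metric_on U g \<longleftrightarrow>
     continuous_on U g \<and>
     (\<forall>y\<in>U. transpose (g y) = g y \<and> (\<forall>v. v \<noteq> 0 \<longrightarrow> ginner g y v v > 0))"

definition christoffel :: "'m::finite metric_tensor \<Rightarrow> real^'m \<Rightarrow> 'm \<Rightarrow> 'm \<Rightarrow> 'm \<Rightarrow> real" where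
  "christoffel g y \<gamma> \<alpha> \<beta> =
     (\<Sum>\<delta>\<in>UNIV. matrix_inv (g y) $ \<gamma> $ \<delta> *
        (pd \<alpha> (\<lambda>z. g z $ \<beta> $ \<delta>) y + pd \<beta> (\<lambda>z. g z $ \<alpha> $ \<delta>) y - pd \<delta> (\<lambda>z. g z $ \<alpha> $ \<beta>) y)) / 2"


section \<open>Geometry of an immersed surface\<close>

definition immersion_on :: "(real^2) set \<Rightarrow> (real^2 \<Rightarrow> real^'m::finite) \<Rightarrow> bool" where
  "immersion_on S \<Phi> \<longleftrightarrow> smooth_on S \<Phi> \<and> (\<forall>x\<in>S. inj (frechet_derivative \<Phi> (at x)))"

definition induced_metric :: "'m::finite metric_tensor \<Rightarrow> (real^2 \<Rightarrow> real^'m) \<Rightarrow> real^2 \<Rightarrow> real^2^2" where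
  "induced_metric g \<Phi> x = (\<chi> i j. ginner g (\<Phi> x) (pd i \<Phi> x) (pd j \<Phi> x))"

definition area_density :: "'m::finite metric_tensor \<Rightarrow> (real^2 \<Rightarrow> real^'m) \<Rightarrow> real^2 \<Rightarrow> real" where
  "area_density g \<Phi> x = sqrt (det (induced_metric g \<Phi> x))"

text \<open>The Levi-Civita derivative of \<open>\<partial>\<^sub>j\<Phi>\<close> in direction \<open>\<partial>\<^sub>i\<Phi>\<close>.\<close>
definition cov_deriv2 :: "'m::finite metric_tensor \<Rightarrow> (real^2 \<Rightarrow> real^'m) \<Rightarrow> real^2 \<Rightarrow> 2 \<Rightarrow> 2 \<Rightarrow> real^'m" where
  "cov_deriv2 g \<Phi> x i j =
     (\<chi> \<gamma>. pd i (pd j \<Phi>) x $ \<gamma> +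
        (\<Sum>\<alpha>\<in>UNIV. \<Sum>\<beta>\<in>UNIV. christoffel g (\<Phi> x) \<gamma> \<alpha> \<beta> * pd i \<Phi> x $ \<alpha> * pd j \<Phi> x $ \<beta>))"

definition normal_proj :: "'m::finite metric_tensor \<Rightarrow> (real^2 \<Rightarrow> real^'m) \<Rightarrow> real^2 \<Rightarrow> real^'m \<Rightarrow> real^'m" where
  "normal_proj g \<Phi> x v =
     v - (\<Sum>k\<in>UNIV. \<Sum>l\<in>UNIV.
            (matrix_inv (induced_metric g \<Phi> x) $ k $ l * ginner g (\<Phi> x) v (pd k \<Phi> x)) *\<^sub>R pd l \<Phi> x)"

definition second_ff :: "'m::finite metric_tensor \<Rightarrow> (real^2 \<Rightarrow> real^'m) \<Rightarrow> real^2 \<Rightarrow> 2 \<Rightarrow> 2 \<Rightarrow> real^'m" where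
  "second_ff g \<Phi> x i j = normal_proj g \<Phi> x (cov_deriv2 g \<Phi> x i j)"

definition second_ff_normsq :: "'m::finite metric_tensor \<Rightarrow> (real^2 \<Rightarrow> real^'m) \<Rightarrow> real^2 \<Rightarrow> real" where
  "second_ff_normsq g \<Phi> x =
     (let G = matrix_inv (induced_metric g \<Phi> x) in
      \<Sum>i\<in>UNIV. \<Sum>j\<in>UNIV. \<Sum>k\<in>UNIV. \<Sum>l\<in>UNIV.
        G $ i $ k * G $ j $ l * ginner g (\<Phi> x) (second_ff g \<Phi> x i j) (second_ff g \<Phi> x k l))"

definition second_ff_norm :: "'m::finite metric_tensor \<Rightarrow> (real^2 \<Rightarrow> real^'m) \<Rightarrow> real^2 \<Rightarrow> real" where
  "second_ff_norm g \<Phi> x = sqrt (second_ff_normsq g \<Phi> x)"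

definition mean_curv :: "'m::finite metric_tensor \<Rightarrow> (real^2 \<Rightarrow> real^'m) \<Rightarrow> real^2 \<Rightarrow> real^'m" where
  "mean_curv g \<Phi> x =
     (1/2) *\<^sub>R (\<Sum>i\<in>UNIV. \<Sum>j\<in>UNIV. matrix_inv (induced_metric g \<Phi> x) $ i $ j *\<^sub>R second_ff g \<Phi> x i j)"

definition willmore_energy :: "'m::finite metric_tensor \<Rightarrow> (real^2) set \<Rightarrow> (real^2 \<Rightarrow> real^'m) \<Rightarrow> real" where
  "willmore_energy g K \<Phi> =
     (LINT x:K|lborel. ginner g (\<Phi> x) (mean_curv g \<Phi> x) (mean_curv g \<Phi> x) * area_density g \<Phi> x)"

text \<open>
  \<open>\<Phi>\<close>, a map from the open set \<open>S\<close> into the open set \<open>U\<close> on which \<open>g\<close> is smooth, is critical for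
  the Willmore energy with respect to smooth compactly supported variations through immersions.
  The variation is constant in time off \<open>K\<close>, so the energy need only be integrated over \<open>K\<close>, where
  it is finite.
\<close>
definition willmore_on ::
  "(real^2) set \<Rightarrow> (real^'m::finite) set \<Rightarrow> 'm metric_tensor \<Rightarrow> (real^2 \<Rightarrow> real^'m) \<Rightarrow> bool" where
  "willmore_on S U g \<Phi> \<longleftrightarrow>
     (\<forall>F K \<epsilon>. 0 < \<epsilon> \<and> compact K \<and> K \<subseteq> S \<and>
        smooth_on ({-\<epsilon><..<\<epsilon>} \<times> S) (\<lambda>(t::real, x). F t x) \<and>
        (\<forall>t\<in>{-\<epsilon><..<\<epsilon>}. immersion_on S (F t) \<and> F t ` S \<subseteq> U \<and> (\<forall>x\<in>S - K. F t x = \<Phi> x)) \<and>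
        (\<forall>x\<in>S. F 0 x = \<Phi> x)
      \<longrightarrow> ((\<lambda>t. willmore_energy g K (F t)) has_real_derivative 0) (at 0))"

end

theory Submission
  imports Defs
begin

text \<open>
  Around \<open>x\<^sub>0\<close> consider the disc of radius comparable to \<open>|\<Phi>(x\<^sub>0)| / e\<^sup>\<lambda>\<close>. There \<open>|\<Phi>|\<close> is comparable to \<open>|\<Phi>(x\<^sub>0)|\<close>, so
  after rescaling to unit size the conformal factor is bounded above and below, the metric and its connection are
  constant up to \<open>O(|\<Phi>(x\<^sub>0)|\<^sup>\<tau>)\<close>, and the second fundamental form is small in \<open>L\<^sup>2\<close>.

  The first variation in a fixed direction \<open>v\<close> with profile \<open>\<zeta>\<close> has leading term \<open>\<integral> E\<^sup>-\<^sup>1 \<langle>Z, v\<rangle> \<Delta>\<zeta>\<close>, where \<open>Z\<close> is the trace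
  of the covariant Hessian, which conformality makes normal; all other terms are at most \<open>(1 + K) |Z| (|\<zeta>| + |\<nabla>\<zeta>|)\<close> if the
  Hessian is bounded by \<open>K\<close>. Taking for \<open>\<zeta>\<close> a second derivative of the regularised fundamental solution
  \<open>|z|\<^sup>2 log |z|\<^sup>2\<close> of \<open>\<Delta>\<^sup>2\<close> and integrating by parts reproduces the Hessian at the centre up to errors that are small with
  the energy. For general \<open>v\<close> this bounds the Hessian by a universal constant, a bound that point picking makes
  unconditional. For \<open>v\<close> normal at the centre the term that was merely bounded is \<open>O(K\<^sup>2)\<close>; on discs smaller by a factor
  \<open>\<theta>\<close> one has \<open>K = O(\<theta>)\<close>, so the scale invariant quantity \<open>|\<Phi>| |A|\<close> is \<open>O(\<theta>)\<close> plus a remainder that vanishes as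
  \<open>x\<^sub>0 \<rightarrow> 0\<close>.
\<close>

text \<open>Two obstacles shape the argument. First, the energy controls only the normal part of the
  Hessian. The tangential part belongs to the conformal parametrisation, so small energy yields a
  bound for the Hessian but no smallness. Hence the two rounds; the second gains by shrinking the
  disc, because there both the tangential Hessian and the tilt of the tangent planes against the one
  at the centre are O(K). Second, the error (1 + K) |Z| (|\<zeta>| + |grad \<zeta>|) pairs Z, which
  is small only in L^2, with a gradient of size 1/|z|, which just fails to be square integrable. A
  cubic Young inequality together with |Z| <= 2 (1 + K) interpolates, since |z|^(-3/2) is integrable
  in the plane. The direction v is a constant vector of the ambient space and not a normal field, so
  no derivative of the normal ever appears. Variations must be smooth, hence the regularisation by
  s. All bounds are uniform in s, and the one uncontrolled quantity, a Lipschitz constant of the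
  Hessian, is multiplied by sqrt s.\<close>

section \<open>Calculus of \<open>Ck_on\<close> and \<open>smooth_on\<close>\<close>

lemma frechet_derivative_cong_open:
  assumes "open S" "x \<in> S" "\<And>y. y \<in> S \<Longrightarrow> f y = g y"
  shows "frechet_derivative f (at x) = frechet_derivative g (at x)"
proof -
  \<comment> \<open>\<open>frechet_derivative\<close> is a choice among all derivatives, so equality
    of the two sets of derivatives gives equality of the choices, whether or not the functions are
    differentiable at \<open>x\<close>.\<close>
  have "(f has_derivative D) (at x) \<longleftrightarrow> (g has_derivative D) (at x)" for D
    using assms has_derivative_transform_within_open[of f D x UNIV S g]
      has_derivative_transform_within_open[of g D x UNIV S f] by metis
  then show ?thesis unfolding frechet_derivative_def by presburger
qed

lemma Ck_on_cong:
  assumes "open S" "\<And>x. x \<in> S \<Longrightarrow> f x = g x" "Ck_on k S f"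
  shows "Ck_on k S g"
  using assms
proof (induction k arbitrary: f g)
  case 0
  then show ?case by (metis Ck_on.simps(1) continuous_on_cong)
next
  case (Suc k)
  have eq: "frechet_derivative f (at x) = frechet_derivative g (at x)" if "x \<in> S" for x
    by (rule frechet_derivative_cong_open[OF Suc.prems(1) that Suc.prems(2)])
  have "g differentiable_on S"
    using Suc.prems by (metis Ck_on.simps(2) differentiable_on_def differentiable_transform_within zero_less_one)
  moreover have "Ck_on k S (\<lambda>x. frechet_derivative g (at x) v)" for v
    by (rule Suc.IH[of "\<lambda>x. frechet_derivative f (at x) v"]) (use Suc.prems eq in auto)
  ultimately show ?case by simp
qed

text \<open>The introduction rule behind all smoothness proofs: any derivative may be supplied,
  because uniqueness identifies it with the chosen \<open>frechet_derivative\<close> on the open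
  set.\<close>

lemma Ck_on_SucI:
  assumes "open S" "\<And>x. x \<in> S \<Longrightarrow> (f has_derivative f' x) (at x)"
    and "\<And>v. Ck_on k S (\<lambda>x. f' x v)"
  shows "Ck_on (Suc k) S f"
proof -
  have "f differentiable_on S"
    using assms(1,2) by (meson differentiableI differentiable_at_withinI differentiable_on_def)
  moreover have "Ck_on k S (\<lambda>x. frechet_derivative f (at x) v)" for v
    by (rule Ck_on_cong[OF assms(1) _ assms(3)[of v]])
      (use assms(2) frechet_derivative_at in metis)
  ultimately show ?thesis by simp
qed

lemma Ck_on_has_derivative:
  assumes "open S" "Ck_on (Suc k) S f" "x \<in> S"
  shows "(f has_derivative frechet_derivative f (at x)) (at x)"
  using assms by (metis Ck_on.simps(2) differentiable_on_eq_differentiable_at frechet_derivative_works)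

lemma Ck_on_SucD: "Ck_on (Suc k) S f \<Longrightarrow> Ck_on k S f"
  by (induction k arbitrary: f) (auto intro: differentiable_imp_continuous_on)

lemma Ck_on_mono: "Ck_on k S f \<Longrightarrow> j \<le> k \<Longrightarrow> Ck_on j S f"
  by (induction k) (auto simp: le_Suc_eq simp del: Ck_on.simps dest: Ck_on_SucD)

lemma Ck_on_continuous: "Ck_on k S f \<Longrightarrow> continuous_on S f"
  using Ck_on_mono[of k S f 0] by simp

lemma Ck_on_const: "open S \<Longrightarrow> Ck_on k S (\<lambda>x. c)"
proof (induction k arbitrary: c)
  case (Suc k)
  show ?case by (rule Ck_on_SucI[where f' = "\<lambda>_ _. 0"]) (use Suc in \<open>auto intro!: derivative_eq_intros\<close>)
qed auto

lemma Ck_on_bounded_linear: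
  assumes "open S" "bounded_linear f" shows "Ck_on k S f"
proof (cases k)
  case 0
  then show ?thesis using assms linear_continuous_on by auto
next
  case (Suc j)
  show ?thesis unfolding Suc
    by (rule Ck_on_SucI[where f' = "\<lambda>_. f"])
      (use assms in \<open>auto intro: bounded_linear_imp_has_derivative Ck_on_const\<close>)
qed

lemma Ck_on_add:
  assumes "open S" "Ck_on k S f" "Ck_on k S g"
  shows "Ck_on k S (\<lambda>x. f x + g x)"
  using assms(2,3)
proof (induction k arbitrary: f g)
  case (Suc k)
  show ?case
    by (rule Ck_on_SucI[OF assms(1)
          has_derivative_add[OF Ck_on_has_derivative[OF assms(1) Suc.prems(1)]
            Ck_on_has_derivative[OF assms(1) Suc.prems(2)]]])
      (use Suc in auto)
qed (auto intro: continuous_intros)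

lemma (in bounded_bilinear) Ck_on_bilinear:
  assumes "open S" "Ck_on k S f" "Ck_on k S g"
  shows "Ck_on k S (\<lambda>x. prod (f x) (g x))"
  using assms(2,3)
proof (induction k arbitrary: f g)
  case (Suc k)
  have "Ck_on k S f" "Ck_on k S g" using Suc.prems Ck_on_SucD by blast+
  then show ?case
    by (intro Ck_on_SucI[OF assms(1)
          FDERIV[OF Ck_on_has_derivative[OF assms(1) Suc.prems(1)]
            Ck_on_has_derivative[OF assms(1) Suc.prems(2)]]] Ck_on_add assms(1) Suc.IH)
      (use Suc.prems in auto)
qed (auto intro: continuous_on)

lemmas Ck_on_scaleR = bounded_bilinear.Ck_on_bilinear[OF bounded_bilinear_scaleR]
lemmas Ck_on_mult = bounded_bilinear.Ck_on_bilinear[OF bounded_bilinear_mult]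

lemma Ck_on_sum:
  assumes "open S" "\<And>i. i \<in> I \<Longrightarrow> Ck_on k S (f i)"
  shows "Ck_on k S (\<lambda>x. \<Sum>i\<in>I. f i x)"
  using assms(2) by (induction I rule: infinite_finite_induct) (auto intro: Ck_on_const Ck_on_add assms(1))

lemma linear_basis_expansion:
  fixes D :: "'a::euclidean_space \<Rightarrow> 'b::real_vector"
  assumes "linear D" shows "D v = (\<Sum>b\<in>Basis. (v \<bullet> b) *\<^sub>R D b)"
proof -
  have "D v = D (\<Sum>b\<in>Basis. (v \<bullet> b) *\<^sub>R b)" by (simp add: euclidean_representation)
  also have "\<dots> = (\<Sum>b\<in>Basis. (v \<bullet> b) *\<^sub>R D b)"
    using assms by (simp add: linear_sum linear_cmul)
  finally show ?thesis .
qed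

lemma Ck_on_compose:
  fixes q :: "'a::euclidean_space \<Rightarrow> 'b::euclidean_space"
  assumes "open S" "open T" "q ` S \<subseteq> T" "Ck_on k S q" "Ck_on k T f"
  shows "Ck_on k S (\<lambda>x. f (q x))"
  using assms(4,5)
proof (induction k arbitrary: f)
  case 0
  then show ?case using assms(3) by (auto intro: continuous_on_compose2)
next
  case (Suc k)
  let ?Dq = "\<lambda>x. frechet_derivative q (at x)" and ?Df = "\<lambda>y. frechet_derivative f (at y)"
  have d: "((\<lambda>x. f (q x)) has_derivative (\<lambda>v. ?Df (q x) (?Dq x v))) (at x)" if "x \<in> S" for x
    using has_derivative_compose[OF Ck_on_has_derivative[OF assms(1) Suc.prems(1) that]
        Ck_on_has_derivative[OF assms(2) Suc.prems(2)]] that assms(3) by blast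
  show ?case
  proof (rule Ck_on_SucI[OF assms(1) d])
    fix v
    \<comment> \<open>The definition of \<open>Ck_on\<close> only differentiates in constant
      directions, whereas \<open>?Dq x v\<close> moves with \<open>x\<close>. Expanding it in the
      basis leaves constant directions \<open>b\<close> with scalar coefficients, to which the
      induction hypothesis applies.\<close>
    have 1: "Ck_on k S (\<lambda>x. \<Sum>b\<in>Basis. (?Dq x v \<bullet> b) *\<^sub>R ?Df (q x) b)"
    proof (intro Ck_on_sum Ck_on_scaleR assms(1))
      fix b :: 'b
      have "Ck_on k S (\<lambda>x. ?Dq x v)" using Suc.prems by simp
      then show "Ck_on k S (\<lambda>x. ?Dq x v \<bullet> b)"
        using bounded_bilinear.Ck_on_bilinear[OF bounded_bilinear_inner assms(1)] Ck_on_const[OF assms(1)] by blast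
      show "Ck_on k S (\<lambda>x. ?Df (q x) b)"
        by (rule Suc.IH) (use Suc.prems Ck_on_SucD in auto)
    qed
    show "Ck_on k S (\<lambda>x. ?Df (q x) (?Dq x v))"
      by (rule Ck_on_cong[OF assms(1) _ 1])
        (metis linear_basis_expansion Ck_on_has_derivative[OF assms(2) Suc.prems(2)] assms(3)
          has_derivative_linear image_subset_iff)
  qed
qed

lemma Ck_on_subset: "Ck_on k T f \<Longrightarrow> S \<subseteq> T \<Longrightarrow> Ck_on k S f"
  by (induction k arbitrary: f) (auto intro: continuous_on_subset differentiable_on_subset)

lemma smooth_on_subset: "smooth_on T f \<Longrightarrow> S \<subseteq> T \<Longrightarrow> smooth_on S f"
  unfolding smooth_on_def using Ck_on_subset by blast

lemma smooth_on_const: "open S \<Longrightarrow> smooth_on S (\<lambda>x. c)"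
  and smooth_on_bounded_linear: "open S \<Longrightarrow> bounded_linear h \<Longrightarrow> smooth_on S h"
  and smooth_on_add: "open S \<Longrightarrow> smooth_on S f \<Longrightarrow> smooth_on S g \<Longrightarrow> smooth_on S (\<lambda>x. f x + g x)"
  and smooth_on_scaleR: "open S \<Longrightarrow> smooth_on S r \<Longrightarrow> smooth_on S f \<Longrightarrow> smooth_on S (\<lambda>x. r x *\<^sub>R f x)"
  and smooth_on_cong: "open S \<Longrightarrow> (\<And>x. x \<in> S \<Longrightarrow> f x = g x) \<Longrightarrow> smooth_on S f \<Longrightarrow> smooth_on S g"
  unfolding smooth_on_def
  by (auto intro: Ck_on_const Ck_on_bounded_linear Ck_on_add Ck_on_scaleR simp del: Ck_on.simps)
    (metis Ck_on_cong)

lemma smooth_on_mult: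
  fixes f g :: "'a::euclidean_space \<Rightarrow> real"
  shows "open S \<Longrightarrow> smooth_on S f \<Longrightarrow> smooth_on S g \<Longrightarrow> smooth_on S (\<lambda>x. f x * g x)"
  using smooth_on_scaleR[of S f g] by simp

lemma smooth_on_compose:
  fixes q :: "'a::euclidean_space \<Rightarrow> 'b::euclidean_space"
  shows "open S \<Longrightarrow> open T \<Longrightarrow> q ` S \<subseteq> T \<Longrightarrow> smooth_on S q \<Longrightarrow> smooth_on T f \<Longrightarrow> smooth_on S (\<lambda>x. f (q x))"
  unfolding smooth_on_def using Ck_on_compose by blast

lemma smooth_on_affine:
  assumes "open S" shows "smooth_on S (\<lambda>x::'a::euclidean_space. c *\<^sub>R x + b)"
  by (intro smooth_on_add smooth_on_const smooth_on_bounded_linear assms bounded_linear_scaleR_right)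

lemma smooth_on_derivative: "smooth_on S f \<Longrightarrow> smooth_on S (\<lambda>x. frechet_derivative f (at x) v)"
  unfolding smooth_on_def by (metis Ck_on.simps(2))

lemma smooth_on_pd: "smooth_on S f \<Longrightarrow> smooth_on S (pd i f)"
  unfolding pd_def[abs_def] by (rule smooth_on_derivative)

lemma smooth_on_continuous: "smooth_on S f \<Longrightarrow> continuous_on S f"
  unfolding smooth_on_def using Ck_on_continuous by blast

lemma smooth_on_has_derivative:
  "open S \<Longrightarrow> smooth_on S f \<Longrightarrow> x \<in> S \<Longrightarrow> (f has_derivative frechet_derivative f (at x)) (at x)"
  unfolding smooth_on_def using Ck_on_has_derivative by blast

lemma smooth_on_derivI:
  fixes f :: "real \<Rightarrow> real"
  assumes "open S" "\<And>x. x \<in> S \<Longrightarrow> (f has_real_derivative f' x) (at x)" "smooth_on S f'"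
  shows "smooth_on S f"
  unfolding smooth_on_def
proof
  fix k
  have "Ck_on k S (\<lambda>x. f' x * v)" for v
    using Ck_on_mult[OF assms(1), of k f' "\<lambda>_. v"] Ck_on_const[OF assms(1)] assms(3)
    by (auto simp: smooth_on_def)
  then have "Ck_on (Suc k) S f"
    by (intro Ck_on_SucI[OF assms(1), where f' = "\<lambda>x v. f' x * v"])
      (use assms(2) in \<open>auto simp: has_field_derivative_def\<close>)
  then show "Ck_on k S f" by (rule Ck_on_SucD)
qed

lemma smooth_on_inverse: "smooth_on (- {0}) (inverse :: real \<Rightarrow> real)"
  unfolding smooth_on_def
proof
  fix k show "Ck_on k (- {0}) (inverse :: real \<Rightarrow> real)"
  proof (induction k)
    case 0
    show ?case by (auto intro!: continuous_intros)
  next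
    case (Suc k)
    have o: "open (- {0::real})" by auto
    show ?case
    proof (rule Ck_on_SucI[OF o, where f' = "\<lambda>x v. - (inverse x * v * inverse x)"])
      show "Ck_on k (- {0::real}) (\<lambda>x. - (inverse x * v * inverse x))" for v
        using Ck_on_mult[OF o Ck_on_mult[OF o Suc Ck_on_const[OF o, of k "- v"]] Suc] by simp
    qed (auto intro!: derivative_eq_intros simp: field_simps)
  qed
qed

lemma smooth_on_ln: "smooth_on {0<..} (ln :: real \<Rightarrow> real)"
proof (rule smooth_on_derivI)
  show "smooth_on {0<..} (inverse :: real \<Rightarrow> real)"
    by (rule smooth_on_subset[OF smooth_on_inverse]) auto
qed (auto intro!: derivative_eq_intros simp: inverse_eq_divide)

subsection \<open>Partial derivatives\<close>

lemma pd_eq: "(f has_derivative f') (at x) \<Longrightarrow> pd i f x = f' (axis i 1)"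
  unfolding pd_def by (metis frechet_derivative_at)

lemma pd_cong_open:
  assumes "open S" "x \<in> S" "\<And>y. y \<in> S \<Longrightarrow> f y = g y"
  shows "pd i f x = pd i g x"
  unfolding pd_def using frechet_derivative_cong_open[OF assms] by simp

lemma axis_expansion: "(\<Sum>i\<in>UNIV. v $ i *\<^sub>R axis i 1) = (v::real^'n::finite)"
  unfolding vec_eq_iff sum_component vector_scaleR_component axis_def vec_lambda_beta
  by (auto simp: if_distrib[where f="\<lambda>x. _ * x"] sum.delta cong: if_cong)

lemma has_derivative_axis_sum:
  fixes f :: "real^'n::finite \<Rightarrow> 'b::real_normed_vector"
  assumes "(f has_derivative f') (at x)"
  shows "f' v = (\<Sum>i\<in>UNIV. v $ i *\<^sub>R pd i f x)"
proof -
  have "f' (\<Sum>i\<in>UNIV. v $ i *\<^sub>R axis i 1) = (\<Sum>i\<in>UNIV. v $ i *\<^sub>R f' (axis i 1))"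
    using has_derivative_linear[OF assms] by (simp add: linear_sum linear_cmul)
  then show ?thesis unfolding axis_expansion pd_eq[OF assms] .
qed

lemma pd_vector_derivative:
  fixes f :: "real^'n::finite \<Rightarrow> 'b::real_normed_vector"
  assumes "open S" "smooth_on S f" "x + t *\<^sub>R axis i 1 \<in> S"
  shows "((\<lambda>t. f (x + t *\<^sub>R axis i 1)) has_vector_derivative pd i f (x + t *\<^sub>R axis i 1)) (at t)"
proof -
  let ?D = "frechet_derivative f (at (x + t *\<^sub>R axis i 1))"
  have "((\<lambda>t. f (x + t *\<^sub>R axis i 1)) has_derivative (\<lambda>h. ?D (h *\<^sub>R axis i 1))) (at t)"
    by (rule has_derivative_compose[where g = f and f = "\<lambda>t. x + t *\<^sub>R axis i 1" and x = t, OF _ smooth_on_has_derivative[OF assms]])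
      (auto intro!: derivative_eq_intros)
  moreover have "?D (h *\<^sub>R axis i 1) = h *\<^sub>R pd i f (x + t *\<^sub>R axis i 1)" for h
    using has_derivative_linear[OF smooth_on_has_derivative[OF assms]] by (simp add: linear_cmul pd_def)
  ultimately show ?thesis by (simp add: has_vector_derivative_def)
qed

text \<open>Schwarz's theorem. The identity f(s,t) - f(s,0) = integral of the j-th partial
  derivative is differentiated in \<open>s\<close> at 0, under the integral sign on the right.
  Differentiating the result in the upper limit at 0 then exchanges the two derivatives.\<close>

lemma pd_commute:
  fixes f :: "real^'n::finite \<Rightarrow> 'b::banach"
  assumes S: "open S" "x \<in> S" and f: "smooth_on S f"
  shows "pd i (pd j f) x = pd j (pd i f) x"
proof -
  obtain e where e: "e > 0" "ball x e \<subseteq> S" using S openE by blast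
  \<comment> \<open>Two displacements of length at most \<open>d\<close> add up to less than
    \<open>e\<close>.\<close>
  define d where "d = e / 3"
  let ?q = "\<lambda>s t. x + s *\<^sub>R axis i 1 + t *\<^sub>R (axis j 1 :: real^'n)"
  have d: "d > 0" and inS: "?q s t \<in> S" if "s \<in> {-d..d}" "t \<in> {-d..d}" for s t
  proof -
    show "d > 0" using e d_def by simp
    have "norm (s *\<^sub>R axis i 1 + t *\<^sub>R (axis j 1 :: real^'n)) \<le> \<bar>s\<bar> + \<bar>t\<bar>"
      using norm_triangle_ineq[of "s *\<^sub>R axis i 1" "t *\<^sub>R (axis j 1 :: real^'n)"] by simp
    moreover have "dist x (?q s t) = norm (s *\<^sub>R axis i 1 + t *\<^sub>R (axis j 1 :: real^'n))"
      by (subst dist_commute) (simp add: dist_norm add.assoc)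
    moreover have "\<bar>s\<bar> \<le> d" "\<bar>t\<bar> \<le> d" using that by auto
    ultimately have "dist x (?q s t) < e" using e d_def by linarith
    then show "?q s t \<in> S" using e by (metis mem_ball subsetD)
  qed
  have d0: "d > 0" using e d_def by simp
  have q': "?q s t = x + t *\<^sub>R axis j 1 + s *\<^sub>R axis i 1" for s t by simp
  have vj: "((\<lambda>t. h (?q s t)) has_vector_derivative pd j h (?q s t)) (at t)"
    if "smooth_on S h" "s \<in> {-d..d}" "t \<in> {-d..d}" for h :: "real^'n \<Rightarrow> 'b" and s t
    by (rule pd_vector_derivative[OF S(1) that(1)]) (use inS that in auto)
  have vi: "((\<lambda>s. h (?q s t)) has_vector_derivative pd i h (?q s t)) (at s)"
    if "smooth_on S h" "s \<in> {-d..d}" "t \<in> {-d..d}" for h :: "real^'n \<Rightarrow> 'b" and s t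
    unfolding q' by (rule pd_vector_derivative[OF S(1) that(1)]) (use inS[OF that(2,3)] in \<open>simp only: q'\<close>)
  have ch: "continuous_on ({-d..d} \<times> {-d..d}) (\<lambda>(s, t). h (?q s t))"
    if "smooth_on S h" for h :: "real^'n \<Rightarrow> 'b"
    unfolding split_beta
    by (rule continuous_on_compose2[OF smooth_on_continuous[OF that]])
      (use inS in \<open>auto intro!: continuous_intros\<close>)
  have ct: "continuous_on {-d..d} (\<lambda>t. h (?q s t))"
    if "smooth_on S h" "s \<in> {-d..d}" for h :: "real^'n \<Rightarrow> 'b" and s
    by (rule continuous_on_compose2[OF smooth_on_continuous[OF that(1)]])
      (use inS that(2) in \<open>auto intro!: continuous_intros\<close>)
  have sj: "smooth_on S (pd j f)" "smooth_on S (pd i (pd j f))" "smooth_on S (pd i f)"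
    using f by (auto intro: smooth_on_pd)
  have key: "integral {0..t} (\<lambda>\<tau>. pd i (pd j f) (?q 0 \<tau>)) = pd i f (?q 0 t) - pd i f (?q 0 0)"
    if t: "t \<in> {0..d}" for t
  proof -
    have A: "integral {0..t} (\<lambda>\<tau>. pd j f (?q s \<tau>)) = f (?q s t) - f (?q s 0)" if "s \<in> {-d..d}" for s
    proof (rule integral_unique, rule fundamental_theorem_of_calculus)
      show "((\<lambda>t. f (?q s t)) has_vector_derivative pd j f (?q s \<tau>)) (at \<tau> within {0..t})"
        if "\<tau> \<in> {0..t}" for \<tau>
        by (rule has_vector_derivative_at_within, rule vj[OF f \<open>s \<in> {-d..d}\<close>]) (use that t d0 in auto)
    qed (use t in auto)
    have B: "((\<lambda>s. integral (cbox 0 t) (\<lambda>\<tau>. pd j f (?q s \<tau>))) has_vector_derivative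
        integral (cbox 0 t) (\<lambda>\<tau>. pd i (pd j f) (?q 0 \<tau>))) (at 0 within {-d..d})"
    proof (rule leibniz_rule_vector_derivative)
      show "continuous_on ({- d..d} \<times> cbox 0 t) (\<lambda>(s, \<tau>). pd i (pd j f) (?q s \<tau>))"
        by (rule continuous_on_subset[OF ch[OF sj(2)]]) (use t d0 in auto)
      show "(\<lambda>\<tau>. pd j f (?q s \<tau>)) integrable_on cbox 0 t" if "s \<in> {-d..d}" for s
        by (rule integrable_continuous, rule continuous_on_subset[OF ct[OF sj(1) that]]) (use t d0 in auto)
      show "((\<lambda>s. pd j f (?q s \<tau>)) has_vector_derivative pd i (pd j f) (?q s \<tau>)) (at s within {-d..d})"
        if "s \<in> {-d..d}" "\<tau> \<in> cbox 0 t" for s \<tau>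
        by (rule has_vector_derivative_at_within, rule vi[OF sj(1) that(1)]) (use that(2) t d0 in auto)
    qed (use d0 in auto)
    have C: "((\<lambda>s. f (?q s t) - f (?q s 0)) has_vector_derivative pd i f (?q 0 t) - pd i f (?q 0 0)) (at 0 within {-d..d})"
      by (rule has_vector_derivative_diff; rule has_vector_derivative_at_within; rule vi[OF f])
        (use t d0 in auto)
    have D: "((\<lambda>s. f (?q s t) - f (?q s 0)) has_vector_derivative
        integral {0..t} (\<lambda>\<tau>. pd i (pd j f) (?q 0 \<tau>))) (at 0 within {-d..d})"
      by (rule has_vector_derivative_transform[OF _ _ B[unfolded box_real]]) (use A d0 in auto)
    have nt: "at 0 within {-d..d} \<noteq> bot"
      using d0 by (simp add: at_within_Icc_at)
    show ?thesis using vector_derivative_unique_within[OF nt D C] .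
  qed
  have E: "((\<lambda>t. integral {0..t} (\<lambda>\<tau>. pd i (pd j f) (?q 0 \<tau>))) has_vector_derivative pd i (pd j f) (?q 0 0)) (at 0 within {0..d})"
    by (rule integral_has_vector_derivative, rule continuous_on_subset[OF ct[OF sj(2)]]) (use d0 in auto)
  have F: "((\<lambda>t. pd i f (?q 0 t) - pd i f (?q 0 0)) has_vector_derivative pd j (pd i f) (?q 0 0)) (at 0 within {0..d})"
    using has_vector_derivative_diff[OF has_vector_derivative_at_within[OF vj[OF sj(3), of 0 0]]
        has_vector_derivative_const] d0 by simp
  have G: "((\<lambda>t. pd i f (?q 0 t) - pd i f (?q 0 0)) has_vector_derivative pd i (pd j f) (?q 0 0)) (at 0 within {0..d})"
    by (rule has_vector_derivative_transform[OF _ _ E]) (use key d0 in auto)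
  have nt: "at 0 within {0..d} \<noteq> bot"
    using d0 by (simp add: at_within_Icc_at_right)
  show ?thesis using vector_derivative_unique_within[OF nt G F] by simp
qed

lemma Ck_on_Un:
  assumes "open S" "open T" "Ck_on k S f" "Ck_on k T f" shows "Ck_on k (S \<union> T) f"
  using assms(3,4)
proof (induction k arbitrary: f)
  case 0
  then show ?case using assms by (simp add: continuous_on_open_Un)
next
  case (Suc k)
  have "f differentiable_on S \<union> T"
    using Suc.prems assms(1,2)
    by (auto simp: differentiable_on_eq_differentiable_at[OF open_Un[OF assms(1,2)]]
        differentiable_on_eq_differentiable_at)
  then show ?case using Suc by simp
qed

lemma smooth_on_Un: "open S \<Longrightarrow> open T \<Longrightarrow> smooth_on S f \<Longrightarrow> smooth_on T f \<Longrightarrow> smooth_on (S \<union> T) f"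
  unfolding smooth_on_def using Ck_on_Un by blast

lemma pd_add:
  assumes "open S" "x \<in> S" "smooth_on S f" "smooth_on S g"
  shows "pd i (\<lambda>x. f x + g x) x = pd i f x + pd i g x"
  using pd_eq[OF has_derivative_add[OF smooth_on_has_derivative[OF assms(1,3,2)] smooth_on_has_derivative[OF assms(1,4,2)]]]
  by (simp add: pd_def)

lemma pd_mult:
  fixes f g :: "real^'n::finite \<Rightarrow> real"
  assumes "open S" "x \<in> S" "smooth_on S f" "smooth_on S g"
  shows "pd i (\<lambda>x. f x * g x) x = f x * pd i g x + pd i f x * g x"
  using pd_eq[OF has_derivative_mult[OF smooth_on_has_derivative[OF assms(1,3,2)] smooth_on_has_derivative[OF assms(1,4,2)]]]
  by (simp add: pd_def)

lemma smooth_on_inner_left: "open S \<Longrightarrow> smooth_on S f \<Longrightarrow> smooth_on S (\<lambda>x. v \<bullet> f x)"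
  unfolding smooth_on_def
  using bounded_bilinear.Ck_on_bilinear[OF bounded_bilinear_inner] Ck_on_const by blast

lemma pd_inner_left:
  assumes "open S" "x \<in> S" "smooth_on S f"
  shows "pd i (\<lambda>x. v \<bullet> f x) x = v \<bullet> pd i f x"
  using pd_eq[OF has_derivative_inner_right[OF smooth_on_has_derivative[OF assms(1,3,2)]]]
  by (simp add: pd_def)

lemma pd_lipschitz:
  fixes f :: "real^'n::finite \<Rightarrow> 'b::real_normed_vector"
  assumes "convex S" "open T" "S \<subseteq> T" "smooth_on T f" "\<And>x i. x \<in> S \<Longrightarrow> norm (pd i f x) \<le> B"
    and "x \<in> S" "y \<in> S"
  shows "norm (f x - f y) \<le> real CARD('n) * B * norm (x - y)"
proof (rule differentiable_bound[OF assms(1)])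
  fix z assume z: "z \<in> S"
  have d: "(f has_derivative frechet_derivative f (at z)) (at z)"
    using smooth_on_has_derivative[OF assms(2,4)] z assms(3) by blast
  then show "(f has_derivative frechet_derivative f (at z)) (at z within S)"
    by (rule has_derivative_at_withinI)
  show "onorm (frechet_derivative f (at z)) \<le> real CARD('n) * B"
  proof (rule onorm_le)
    fix v
    have "norm (frechet_derivative f (at z) v) = norm (\<Sum>i\<in>UNIV. v $ i *\<^sub>R pd i f z)"
      by (subst has_derivative_axis_sum[OF d]) simp
    also have "\<dots> \<le> (\<Sum>i\<in>(UNIV::'n set). norm v * B)"
      by (intro sum_norm_le, simp, intro mult_mono assms(5) z component_le_norm_cart) auto
    finally show "norm (frechet_derivative f (at z) v) \<le> real CARD('n) * B * norm v" by (simp add: mult_ac)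
  qed
qed (use assms in auto)

subsection \<open>Integration by parts against compactly supported functions\<close>

definition unit_box :: "(real^2) set" where "unit_box = cbox (-1) 1"

lemma unit_box_iff: "x \<in> unit_box \<longleftrightarrow> \<bar>x $ 1\<bar> \<le> 1 \<and> \<bar>x $ 2\<bar> \<le> 1"
  unfolding unit_box_def mem_box_cart by (auto simp: forall_2)

lemma norm_real2: "norm (x::real^2) ^ 2 = (x $ 1)^2 + (x $ 2)^2"
  by (subst power2_norm_eq_inner) (simp add: inner_vec_def sum_2 power2_eq_square)

lemma cball_subset_unit_box: "cball 0 1 \<subseteq> unit_box"
proof
  fix x :: "real^2" assume "x \<in> cball 0 1"
  then show "x \<in> unit_box"
    unfolding unit_box_iff using component_le_norm_cart[of x 1] component_le_norm_cart[of x 2] by simp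
qed

lemma unit_box_subset_ball: "unit_box \<subseteq> ball 0 2"
proof
  fix x assume "x \<in> unit_box"
  then have "(x $ 1)^2 \<le> 1^2" "(x $ 2)^2 \<le> 1^2"
    unfolding unit_box_iff abs_le_square_iff[symmetric] by simp_all
  then have "norm x ^ 2 < 2 ^ 2" unfolding norm_real2 by simp
  then have "norm x < 2" by (rule power2_less_imp_less) simp
  then show "x \<in> ball 0 2" by simp
qed

lemma unit_box_integrable: "continuous_on unit_box f \<Longrightarrow> (f::real^2 \<Rightarrow> 'b::banach) integrable_on unit_box"
  unfolding unit_box_def by (rule integrable_continuous)

text \<open>Translation invariance replaces an iterated integral: the integral of the shifted
  function does not depend on the shift \<open>h\<close>, and its derivative at \<open>h = 0\<close>
  is the integral of the partial derivative.\<close>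

lemma integral_pd_eq_0:
  fixes F :: "real^2 \<Rightarrow> real"
  assumes F: "smooth_on UNIV F" and z: "\<And>x. x \<notin> cball 0 1 \<Longrightarrow> F x = 0"
  shows "integral unit_box (pd i F) = 0"
proof -
  \<comment> \<open>Room for the shifts: the support lies in \<open>cbox (-3) 3\<close>, and
    displacements by at most 1 keep it inside the larger box.\<close>
  let ?B = "cbox (-5) (5::real^2)" and ?e = "axis i 1 :: real^2"
  have c: "continuous_on A F" "continuous_on A (pd i F)" for A
    by (rule continuous_on_subset[OF smooth_on_continuous[OF F] subset_UNIV])
      (rule continuous_on_subset[OF smooth_on_continuous[OF smooth_on_pd[OF F]] subset_UNIV])
  have sub: "cball 0 1 \<subseteq> cbox (-3) (3::real^2)"
  proof
    fix x :: "real^2" assume "x \<in> cball 0 1"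
    then have b: "\<bar>x $ j\<bar> \<le> 1" for j using order_trans[OF component_le_norm_cart[of x j]] by simp
    have "- 3 \<le> x $ j \<and> x $ j \<le> 3" for j using b[of j] by linarith
    then show "x \<in> cbox (-3) 3" unfolding mem_box_cart by (simp only: vector_uminus_component numeral_index) simp
  qed
  define I where "I = integral (cbox (-3) (3::real^2)) F"
  have I: "(F has_integral I) (cbox (-3) 3)"
    unfolding I_def by (intro integrable_integral integrable_continuous c)
  have hI: "((\<lambda>x. F (x + h *\<^sub>R ?e)) has_integral I) ?B" if h: "h \<in> {-1..1}" for h
  proof -
    have "((\<lambda>x. F (x + h *\<^sub>R ?e)) has_integral I) (cbox (-3 - h *\<^sub>R ?e) (3 - h *\<^sub>R ?e))"
      using has_integral_affinity'[OF I, of 1 "h *\<^sub>R ?e"] by simp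
    then show ?thesis
    proof (rule has_integral_on_superset)
      show "F (x + h *\<^sub>R ?e) = 0" if "x \<notin> cbox (-3 - h *\<^sub>R ?e) (3 - h *\<^sub>R ?e)" for x
      proof -
        have "x + h *\<^sub>R ?e \<notin> cbox (-3) 3" using that by (auto simp: mem_box_cart algebra_simps)
        then show ?thesis using sub z by blast
      qed
      show "cbox (-3 - h *\<^sub>R ?e) (3 - h *\<^sub>R ?e) \<subseteq> ?B"
      proof
        fix x assume x: "x \<in> cbox (-3 - h *\<^sub>R ?e) (3 - h *\<^sub>R ?e)"
        have "- 5 \<le> x $ j \<and> x $ j \<le> 5" for j
        proof -
          have "- 3 - h * ?e $ j \<le> x $ j" "x $ j \<le> 3 - h * ?e $ j"
            using x unfolding mem_box_cart by (simp_all only: vector_minus_component vector_uminus_component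
                numeral_index vector_scaleR_component real_scaleR_def)
          moreover have "\<bar>h * ?e $ j\<bar> \<le> 1" using h by (auto simp: axis_def)
          ultimately show ?thesis by linarith
        qed
        then show "x \<in> ?B" unfolding mem_box_cart by (simp only: vector_uminus_component numeral_index) simp
      qed
    qed
  qed
  have A: "((\<lambda>h. integral ?B (\<lambda>x. F (x + h *\<^sub>R ?e))) has_vector_derivative
      integral ?B (\<lambda>x. pd i F (x + 0 *\<^sub>R ?e))) (at 0 within {-1..1})"
  proof (rule leibniz_rule_vector_derivative)
    show "((\<lambda>h. F (x + h *\<^sub>R ?e)) has_vector_derivative pd i F (x + h *\<^sub>R ?e)) (at h within {-1..1})" for h x
      by (rule has_vector_derivative_at_within, rule pd_vector_derivative[OF open_UNIV F]) auto
    show "continuous_on ({-1..1} \<times> ?B) (\<lambda>(h, x). pd i F (x + h *\<^sub>R ?e))"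
      unfolding split_beta
      by (rule continuous_on_compose2[OF c(2)[of UNIV]]) (auto intro!: continuous_intros)
  qed (use hI in auto)
  have B: "((\<lambda>h. integral ?B (\<lambda>x. F (x + h *\<^sub>R ?e))) has_vector_derivative 0) (at 0 within {-1..1})"
    by (rule has_vector_derivative_transform[OF _ _ has_vector_derivative_const[of I]]) (use hI in auto)
  have nt: "at (0::real) within {-1..1} \<noteq> bot" by (simp add: at_within_Icc_at)
  have "integral ?B (pd i F) = 0"
    using vector_derivative_unique_within[OF nt A B] by simp
  moreover have "pd i F x = 0" if "x \<notin> unit_box" for x
  proof -
    have "pd i F x = pd i (\<lambda>_. 0) x"
      by (rule pd_cong_open[of "- cball 0 1"]) (use that z cball_subset_unit_box in auto)
    then show ?thesis by (simp add: pd_eq[OF has_derivative_const])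
  qed
  moreover have "unit_box \<subseteq> ?B"
  proof
    fix x assume "x \<in> unit_box"
    then have "- 5 \<le> x $ j \<and> x $ j \<le> 5" for j using exhaust_2[of j] by (auto simp: unit_box_iff)
    then show "x \<in> ?B" unfolding mem_box_cart by (simp only: vector_uminus_component numeral_index) simp
  qed
  ultimately show ?thesis
    using has_integral_on_superset[of "pd i F" _ unit_box ?B] unit_box_integrable[OF c(2)]
    by (metis integrable_integral integral_unique)
qed

text \<open>\<open>f\<close> is arbitrary outside \<open>ball 0 2\<close>, but there the product is
  zero. The ball and the complement of the support are open and cover the plane, so the two local
  statements glue.\<close>

lemma smooth_on_mult_supported:
  fixes f h :: "real^2 \<Rightarrow> real"
  assumes "smooth_on (ball 0 2) f" "smooth_on UNIV h" "\<And>x. x \<notin> cball 0 1 \<Longrightarrow> h x = 0"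
  shows "smooth_on UNIV (\<lambda>x. f x * h x)"
proof -
  have "smooth_on (ball 0 2 \<union> - cball 0 1) (\<lambda>x. f x * h x)"
  proof (rule smooth_on_Un)
    show "smooth_on (ball 0 2) (\<lambda>x. f x * h x)"
      by (intro smooth_on_mult assms(1) smooth_on_subset[OF assms(2)]) auto
    show "smooth_on (- cball 0 1) (\<lambda>x. f x * h x)"
      by (rule smooth_on_cong[OF _ _ smooth_on_const[of _ 0]]) (use assms(3) in auto)
  qed auto
  moreover have "ball 0 2 \<union> - cball 0 1 = (UNIV :: (real^2) set)" by (auto simp: dist_norm)
  ultimately show ?thesis by simp
qed

lemma pd_supported:
  assumes "\<And>x. x \<notin> cball 0 1 \<Longrightarrow> h x = 0" "x \<notin> cball 0 1"
  shows "pd i h x = (0::'b::real_normed_vector)"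
proof -
  have "pd i h x = pd i (\<lambda>_. 0) x"
    by (rule pd_cong_open[of "- cball 0 1"]) (use assms in auto)
  then show ?thesis by (simp add: pd_eq[OF has_derivative_const])
qed

lemma integral_by_parts:
  fixes f h :: "real^2 \<Rightarrow> real"
  assumes f: "smooth_on (ball 0 2) f" and h: "smooth_on UNIV h" "\<And>x. x \<notin> cball 0 1 \<Longrightarrow> h x = 0"
  shows "integral unit_box (\<lambda>x. pd i f x * h x) = - integral unit_box (\<lambda>x. f x * pd i h x)"
proof -
  have c: "continuous_on unit_box f" "continuous_on unit_box h" "continuous_on unit_box (pd i f)"
     "continuous_on unit_box (pd i h)"
    by (rule continuous_on_subset[OF smooth_on_continuous[OF f] unit_box_subset_ball]
        continuous_on_subset[OF smooth_on_continuous[OF h(1)] subset_UNIV]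
        continuous_on_subset[OF smooth_on_continuous[OF smooth_on_pd[OF f]] unit_box_subset_ball]
        continuous_on_subset[OF smooth_on_continuous[OF smooth_on_pd[OF h(1)]] subset_UNIV])+
  have h2: "smooth_on (ball 0 2) h" by (rule smooth_on_subset[OF h(1)]) auto
  have "0 = integral unit_box (pd i (\<lambda>x. f x * h x))"
    by (rule integral_pd_eq_0[symmetric]) (use smooth_on_mult_supported[OF f h] h in auto)
  also have "\<dots> = integral unit_box (\<lambda>x. f x * pd i h x + pd i f x * h x)"
    by (rule integral_cong, rule pd_mult[OF _ _ f h2]) (use unit_box_subset_ball in auto)
  also have "\<dots> = integral unit_box (\<lambda>x. f x * pd i h x) + integral unit_box (\<lambda>x. pd i f x * h x)"
    by (intro integral_add unit_box_integrable continuous_intros c)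
  finally show ?thesis by simp
qed

lemma integral_by_parts2:
  fixes f h :: "real^2 \<Rightarrow> real"
  assumes f: "smooth_on (ball 0 2) f" and h: "smooth_on UNIV h" "\<And>x. x \<notin> cball 0 1 \<Longrightarrow> h x = 0"
  shows "integral unit_box (\<lambda>x. pd i (pd j f) x * h x) = integral unit_box (\<lambda>x. f x * pd j (pd i h) x)"
proof -
  have "pd i h x = 0" if "x \<notin> cball 0 1" for x by (rule pd_supported[OF h(2) that])
  then show ?thesis
    using integral_by_parts[OF smooth_on_pd[OF f] h, of i j]
      integral_by_parts[OF f smooth_on_pd[OF h(1)], of i j] by simp
qed

section \<open>The Laplacian and its symmetry under the integral\<close>

definition lap :: "(real^2 \<Rightarrow> 'b::real_normed_vector) \<Rightarrow> real^2 \<Rightarrow> 'b" where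
  "lap f x = pd 1 (pd 1 f) x + pd 2 (pd 2 f) x"

lemma smooth_on_lap: "open S \<Longrightarrow> smooth_on S f \<Longrightarrow> smooth_on S (lap f)"
  unfolding lap_def[abs_def] by (intro smooth_on_add smooth_on_pd)

lemma lap_supported:
  assumes "\<And>x. x \<notin> cball 0 1 \<Longrightarrow> h x = 0" "x \<notin> cball 0 1"
  shows "lap h x = (0::'b::real_normed_vector)"
proof -
  have "pd i h y = 0" if "y \<notin> cball 0 1" for i y by (rule pd_supported[OF assms(1) that])
  then have "pd i (pd i h) x = 0" for i using pd_supported[of "pd i h"] assms(2) by blast
  then show ?thesis by (simp add: lap_def)
qed

lemma integral_lap_by_parts:
  fixes f h :: "real^2 \<Rightarrow> real"
  assumes f: "smooth_on (ball 0 2) f" and h: "smooth_on UNIV h" "\<And>x. x \<notin> cball 0 1 \<Longrightarrow> h x = 0"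
  shows "integral unit_box (\<lambda>x. lap f x * h x) = integral unit_box (\<lambda>x. f x * lap h x)"
proof -
  have c: "continuous_on unit_box f" "continuous_on unit_box h" "continuous_on unit_box (pd i (pd i f))"
     "continuous_on unit_box (pd i (pd i h))" for i
    by (rule continuous_on_subset[OF smooth_on_continuous[OF f] unit_box_subset_ball]
        continuous_on_subset[OF smooth_on_continuous[OF h(1)] subset_UNIV]
        continuous_on_subset[OF smooth_on_continuous[OF smooth_on_pd[OF smooth_on_pd[OF f]]] unit_box_subset_ball]
        continuous_on_subset[OF smooth_on_continuous[OF smooth_on_pd[OF smooth_on_pd[OF h(1)]]] subset_UNIV])+
  have "integral unit_box (\<lambda>x. lap f x * h x)
      = integral unit_box (\<lambda>x. pd 1 (pd 1 f) x * h x) + integral unit_box (\<lambda>x. pd 2 (pd 2 f) x * h x)"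
    unfolding lap_def distrib_right by (intro integral_add unit_box_integrable continuous_intros c)
  also have "\<dots> = integral unit_box (\<lambda>x. f x * pd 1 (pd 1 h) x) + integral unit_box (\<lambda>x. f x * pd 2 (pd 2 h) x)"
    using integral_by_parts2[OF f h] by simp
  also have "\<dots> = integral unit_box (\<lambda>x. f x * lap h x)"
    unfolding lap_def distrib_left by (intro integral_add[symmetric] unit_box_integrable continuous_intros c)
  finally show ?thesis .
qed

lemma pd_lap:
  fixes h :: "real^2 \<Rightarrow> 'b::banach"
  assumes "open S" "smooth_on S h" "x \<in> S"
  shows "pd i (lap h) x = lap (pd i h) x"
proof -
  have "pd i (lap h) x = pd i (pd 1 (pd 1 h)) x + pd i (pd 2 (pd 2 h)) x"
    unfolding lap_def[abs_def] by (rule pd_add[OF assms(1,3)]; intro smooth_on_pd assms)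
  moreover have "pd i (pd j (pd j h)) x = pd j (pd j (pd i h)) x" for j
  proof -
    have "pd i (pd j (pd j h)) x = pd j (pd i (pd j h)) x"
      by (rule pd_commute[OF assms(1,3) smooth_on_pd[OF assms(2)]])
    also have "\<dots> = pd j (pd j (pd i h)) x"
      by (rule pd_cong_open[OF assms(1,3)]) (rule pd_commute[OF assms(1) _ assms(2)])
    finally show ?thesis .
  qed
  ultimately show ?thesis by (simp add: lap_def)
qed

text \<open>All derivatives of \<open>u\<close> are first moved to \<open>h\<close>, and then
  exactly the two mixed ones are moved back. With a near fundamental solution of the bilaplacian as
  \<open>h\<close>, the right-hand side almost evaluates the Hessian of \<open>u\<close> at
  0.\<close>

lemma integral_lap_lap_pd:
  fixes u h :: "real^2 \<Rightarrow> real"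
  assumes u: "smooth_on (ball 0 2) u" and h: "smooth_on UNIV h" "\<And>x. x \<notin> cball 0 1 \<Longrightarrow> h x = 0"
  shows "integral unit_box (\<lambda>x. lap u x * lap (pd k (pd l h)) x) = integral unit_box (\<lambda>x. pd k (pd l u) x * lap (lap h) x)"
proof -
  have sl: "smooth_on UNIV (lap h)" by (rule smooth_on_lap[OF _ h(1)]) simp
  have sz: "lap h x = 0" if "x \<notin> cball 0 1" for x by (rule lap_supported[OF h(2) that])
  have pz: "pd l (lap h) x = 0" if "x \<notin> cball 0 1" for x by (rule pd_supported[OF sz that])
  have e: "lap (pd k (pd l f)) x = pd k (pd l (lap f)) x" if "smooth_on UNIV f" for f :: "real^2 \<Rightarrow> real" and x
  proof -
    have "pd k (pd l (lap f)) x = pd k (lap (pd l f)) x"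
      by (rule pd_cong_open[of UNIV]) (use pd_lap[OF open_UNIV that] in auto)
    then show ?thesis using pd_lap[OF open_UNIV smooth_on_pd[OF that]] by simp
  qed
  have "integral unit_box (\<lambda>x. lap u x * lap (pd k (pd l h)) x) = integral unit_box (\<lambda>x. lap u x * pd k (pd l (lap h)) x)"
    by (simp add: e[OF h(1)])
  also have "\<dots> = integral unit_box (\<lambda>x. u x * lap (pd k (pd l (lap h))) x)"
    by (rule integral_lap_by_parts[OF u smooth_on_pd[OF smooth_on_pd[OF sl]] pd_supported[OF pz]])
  also have "\<dots> = integral unit_box (\<lambda>x. u x * pd k (pd l (lap (lap h))) x)"
    by (simp add: e[OF sl])
  also have "\<dots> = integral unit_box (\<lambda>x. pd l (pd k u) x * lap (lap h) x)"
    by (rule integral_by_parts2[symmetric, OF u smooth_on_lap[OF _ sl] lap_supported[OF sz]]) auto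
  also have "\<dots> = integral unit_box (\<lambda>x. pd k (pd l u) x * lap (lap h) x)"
    by (rule integral_cong) (use pd_commute[of "ball 0 2" _ u] u unit_box_subset_ball in auto)
  finally show ?thesis .
qed

subsection \<open>A smooth cutoff\<close>

text \<open>The prefactor \<open>(1 / t) ^ n\<close> makes the family closed under differentiation
  up to linear combinations (\<open>flat_exp_deriv\<close>), so that smoothness is an induction on
  the order with \<open>n\<close> arbitrary.\<close>

definition flat_exp :: "nat \<Rightarrow> real \<Rightarrow> real" where
  "flat_exp n t = (if t \<le> 0 then 0 else (1 / t) ^ n * exp (- (1 / t)))"

lemma flat_exp_deriv:
  "(flat_exp n has_real_derivative flat_exp (n + 2) t - real n * flat_exp (n + 1) t) (at t)"
proof (cases t "0::real" rule: linorder_cases)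
  case less
  have "((\<lambda>_. 0) has_real_derivative 0) (at t)" by simp
  then have "(flat_exp n has_real_derivative 0) (at t)"
    by (rule has_field_derivative_transform_within_open[where S = "{..<0}"]) (use less in \<open>auto simp: flat_exp_def\<close>)
  then show ?thesis using less by (simp add: flat_exp_def)
next
  case greater
  have "((\<lambda>t. inverse (t ^ n) * exp (- (1 / t))) has_real_derivative
      - (inverse (t ^ n) * (real n * t ^ (n - 1)) * inverse (t ^ n)) * exp (- (1 / t)) + exp (- (1 / t)) * (1 / (t * t)) * inverse (t ^ n)) (at t)"
    using greater by (auto intro!: derivative_eq_intros simp: field_simps)
  then have "((\<lambda>t. inverse (t ^ n) * exp (- (1 / t))) has_real_derivative flat_exp (n + 2) t - real n * flat_exp (n + 1) t) (at t)"
    by (rule DERIV_cong) (use greater in \<open>cases n; simp add: flat_exp_def field_simps\<close>)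
  then show ?thesis
    by (rule has_field_derivative_transform_within_open[where S = "{0<..}"])
      (use greater in \<open>auto simp: flat_exp_def field_simps\<close>)
next
  case equal
  have "((\<lambda>h. flat_exp n h / h) \<longlongrightarrow> 0) (at 0)"
  proof (subst filterlim_at_split, intro conjI)
    show "((\<lambda>h. flat_exp n h / h) \<longlongrightarrow> 0) (at_left 0)"
      by (rule Lim_transform_eventually[OF tendsto_const])
        (auto simp: eventually_at_left_field flat_exp_def intro!: exI[of _ "-1"])
    have "((\<lambda>h::real. inverse h ^ (n + 1) / exp (inverse h)) \<longlongrightarrow> 0) (at_right 0)"
      by (rule filterlim_compose[OF tendsto_power_div_exp_0 filterlim_inverse_at_top_right])
    then show "((\<lambda>h. flat_exp n h / h) \<longlongrightarrow> 0) (at_right 0)"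
      by (rule Lim_transform_eventually)
        (auto simp: eventually_at_right_field flat_exp_def field_simps exp_minus intro!: exI[of _ 1])
  qed
  then show ?thesis using equal by (simp add: DERIV_def flat_exp_def)
qed

lemma smooth_on_flat_exp: "smooth_on UNIV (flat_exp n)"
  unfolding smooth_on_def
proof
  fix k show "Ck_on k UNIV (flat_exp n)"
  proof (induction k arbitrary: n)
    case 0
    show ?case using flat_exp_deriv by (auto intro!: continuous_at_imp_continuous_on DERIV_isCont)
  next
    case (Suc k)
    show ?case
    proof (rule Ck_on_SucI[OF open_UNIV flat_exp_deriv[unfolded has_field_derivative_def]])
      fix v
      have 1: "Ck_on k UNIV (\<lambda>x. - (real n * v) * flat_exp (n + 1) x)" "Ck_on k UNIV (\<lambda>x. v * flat_exp (n + 2) x)"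
        by (rule Ck_on_mult[OF open_UNIV Ck_on_const[OF open_UNIV] Suc])+
      show "Ck_on k UNIV (\<lambda>x. (flat_exp (n + 2) x - real n * flat_exp (n + 1) x) * v)"
        by (rule Ck_on_cong[OF open_UNIV _ Ck_on_add[OF open_UNIV 1]]) (simp add: algebra_simps)
    qed
  qed
qed

text \<open>Always evaluated at \<open>t = x \<bullet> x\<close>, which keeps radial functions
  smooth at the origin. It is 1 for |x| <= 1/2 and 0 once |x|^2 >= 3/4, hence supported inside the
  unit disc.\<close>

definition cutoff :: "real \<Rightarrow> real" where
  "cutoff t = flat_exp 0 (3/4 - t) * inverse (flat_exp 0 (3/4 - t) + flat_exp 0 (t - 1/4))"

lemma flat_exp_0: "flat_exp 0 t \<ge> 0" "t > 0 \<Longrightarrow> flat_exp 0 t > 0" "t \<le> 0 \<Longrightarrow> flat_exp 0 t = 0"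
  by (auto simp: flat_exp_def)

lemma cutoff_denom: "flat_exp 0 (3/4 - t) + flat_exp 0 (t - 1/4) > 0"
  using flat_exp_0(1)[of "3/4 - t"] flat_exp_0(1)[of "t - 1/4"] flat_exp_0(2)[of "3/4 - t"] flat_exp_0(2)[of "t - 1/4"]
  by (cases "t < 3/4") (auto intro: add_pos_nonneg add_nonneg_pos)

lemma cutoff_bounds: "0 \<le> cutoff t" "cutoff t \<le> 1"
  using cutoff_denom[of t] flat_exp_0(1)[of "3/4 - t"] flat_exp_0(1)[of "t - 1/4"]
  by (auto simp: cutoff_def field_simps)

lemma cutoff_eq_0: "t \<ge> 3/4 \<Longrightarrow> cutoff t = 0"
  by (simp add: cutoff_def flat_exp_0)

lemma cutoff_eq_1: "t \<le> 1/4 \<Longrightarrow> cutoff t = 1"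
  using flat_exp_0(2)[of "3/4 - t"] flat_exp_0(3)[of "t - 1/4"] by (simp add: cutoff_def)

lemma smooth_on_cutoff: "smooth_on UNIV cutoff"
proof -
  have 1: "smooth_on UNIV (\<lambda>t. flat_exp 0 (c *\<^sub>R t + d))" for c d
    by (rule smooth_on_compose[OF _ _ _ smooth_on_affine smooth_on_flat_exp]) auto
  have 2: "smooth_on UNIV (\<lambda>t. flat_exp 0 (3/4 - t))" "smooth_on UNIV (\<lambda>t. flat_exp 0 (t - 1/4))"
    using 1[of "-1" "3/4"] 1[of 1 "-1/4"] by simp_all
  show ?thesis unfolding cutoff_def[abs_def]
    by (intro smooth_on_mult 2 open_UNIV smooth_on_compose[OF _ _ _ smooth_on_add[OF _ 2] smooth_on_inverse])
      (use cutoff_denom in \<open>auto simp: less_imp_neq[THEN not_sym]\<close>)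
qed

lemma smooth_on_real_deriv:
  fixes f :: "real \<Rightarrow> real"
  assumes "open S" "smooth_on S f"
  shows "smooth_on S (deriv f)" "x \<in> S \<Longrightarrow> (f has_real_derivative deriv f x) (at x)"
proof -
  have d: "(f has_real_derivative frechet_derivative f (at x) 1) (at x)" if "x \<in> S" for x
  proof -
    have D: "(f has_derivative frechet_derivative f (at x)) (at x)" by (rule smooth_on_has_derivative[OF assms that])
    have "frechet_derivative f (at x) h = frechet_derivative f (at x) 1 * h" for h
      using linear_cmul[OF has_derivative_linear[OF D], of h 1] by (simp add: mult.commute)
    then show ?thesis using D unfolding has_field_derivative_def by (metis (no_types) ext)
  qed
  then have e: "deriv f x = frechet_derivative f (at x) 1" if "x \<in> S" for x
    using that DERIV_imp_deriv by blast
  show "smooth_on S (deriv f)"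
    by (rule smooth_on_cong[OF assms(1) _ smooth_on_derivative[OF assms(2)]]) (simp add: e)
  show "(f has_real_derivative deriv f x) (at x)" if "x \<in> S" using d e that by simp
qed

definition cutoff_d :: "nat \<Rightarrow> real \<Rightarrow> real" where "cutoff_d j = (deriv ^^ j) cutoff"

lemma cutoff_d_0: "cutoff_d 0 = cutoff" by (simp add: cutoff_d_def)

lemma smooth_on_cutoff_d: "smooth_on UNIV (cutoff_d j)"
  by (induction j) (auto simp: cutoff_d_def smooth_on_cutoff intro: smooth_on_real_deriv(1))

lemma cutoff_d_deriv: "(cutoff_d j has_real_derivative cutoff_d (Suc j) t) (at t)"
  using smooth_on_real_deriv(2)[OF open_UNIV smooth_on_cutoff_d] by (simp add: cutoff_d_def)

lemma cutoff_d_cont: "continuous_on A (cutoff_d j)"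
  using smooth_on_continuous[OF smooth_on_cutoff_d] continuous_on_subset by blast

lemma cutoff_d_eq_0: "t < 1/4 \<Longrightarrow> cutoff_d (Suc j) t = 0"
proof (induction j arbitrary: t)
  case 0
  have "(cutoff has_real_derivative 0) (at t)"
    by (rule has_field_derivative_transform_within_open[OF DERIV_const[of 1], where S = "{..<1/4}"])
      (use 0 in \<open>auto simp: cutoff_eq_1\<close>)
  then show ?case using DERIV_unique[OF cutoff_d_deriv[of 0]] by (simp add: cutoff_d_0)
next
  case (Suc j)
  have "(cutoff_d (Suc j) has_real_derivative 0) (at t)"
    by (rule has_field_derivative_transform_within_open[OF DERIV_const[of 0], where S = "{..<1/4}"])
      (use Suc in auto)
  then show ?case using DERIV_unique[OF cutoff_d_deriv] by blast
qed

text \<open>The interval \<open>{0..2}\<close> is the range of \<open>x \<bullet> x\<close> on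
  \<open>unit_box\<close>. Five derivatives suffice: four from the bilaplacian of the kernel and one
  more for the gradient of the cutoff error.\<close>

lemma cutoff_d_bounded: "\<exists>X\<ge>1. \<forall>j\<le>5. \<forall>t\<in>{0..2}. \<bar>cutoff_d j t\<bar> \<le> X"
proof -
  have "\<exists>B. \<forall>t\<in>{0..2}. \<bar>cutoff_d j t\<bar> \<le> B" for j
    using compact_imp_bounded[OF compact_continuous_image[OF cutoff_d_cont compact_Icc]]
    by (fastforce simp: bounded_iff)
  then obtain B where B: "\<bar>cutoff_d j t\<bar> \<le> B j" if "t \<in> {0..2}" for j t by metis
  have "\<bar>cutoff_d j t\<bar> \<le> (\<Sum>i\<le>5. \<bar>B i\<bar>) + 1" if "j \<le> 5" "t \<in> {0..2}" for j t
  proof -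
    have "\<bar>B j\<bar> \<le> (\<Sum>i\<le>5. \<bar>B i\<bar>)" by (rule member_le_sum) (use that in auto)
    then show ?thesis using B[OF that(2), of j] by linarith
  qed
  moreover have "(\<Sum>i\<le>5. \<bar>B i\<bar>) + 1 \<ge> 1" by (simp add: sum_nonneg)
  ultimately show ?thesis by blast
qed

subsection \<open>Radial functions\<close>

lemma radial_has_derivative:
  assumes "(\<phi> has_real_derivative \<phi>') (at (x \<bullet> x))"
  shows "((\<lambda>x. \<phi> (x \<bullet> x)) has_derivative (\<lambda>v. \<phi>' * (2 * (x \<bullet> v)))) (at x)"
proof -
  have "((\<lambda>x. x \<bullet> x) has_derivative (\<lambda>v. 2 * (x \<bullet> v))) (at x)"
    by (auto intro!: derivative_eq_intros simp: inner_commute)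
  from has_derivative_compose[OF this assms[unfolded has_field_derivative_def]] show ?thesis .
qed

lemma pd_radial:
  assumes "(\<phi> has_real_derivative \<phi>') (at (x \<bullet> x))"
  shows "pd l (\<lambda>x. \<phi> (x \<bullet> x)) x = 2 * x $ l * \<phi>'"
  using pd_eq[OF radial_has_derivative[OF assms]] by (simp add: inner_axis)

lemma coord_has_derivative: "((\<lambda>x. x $ l) has_derivative (\<lambda>v. v $ l)) (at (x::real^'n))"
  using bounded_linear_imp_has_derivative[OF bounded_linear_vec_nth] .

lemma axis_component: "axis k 1 $ l = (if k = l then 1 else 0)"
  by (simp add: axis_def)

lemma pd_coord_radial:
  assumes "(\<phi> has_real_derivative \<phi>') (at (x \<bullet> x))"
  shows "pd k (\<lambda>x. x $ l * \<phi> (x \<bullet> x)) x = (if k = l then \<phi> (x \<bullet> x) else 0) + 2 * (x $ k * x $ l) * \<phi>'"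
  using pd_eq[OF has_derivative_mult[OF coord_has_derivative[of l] radial_has_derivative[OF assms]], of k]
  by (auto simp: inner_axis axis_component)

lemma smooth_on_normsq: "smooth_on UNIV (\<lambda>x. x \<bullet> (x::'a::euclidean_space))"
  unfolding smooth_on_def
  using bounded_bilinear.Ck_on_bilinear[OF bounded_bilinear_inner open_UNIV
      Ck_on_bounded_linear[OF open_UNIV bounded_linear_ident] Ck_on_bounded_linear[OF open_UNIV bounded_linear_ident]]
  by blast

lemma smooth_on_radial:
  assumes "open T" "smooth_on T \<phi>" "{0..} \<subseteq> T"
  shows "smooth_on UNIV (\<lambda>x::'a::euclidean_space. \<phi> (x \<bullet> x))"
  by (rule smooth_on_compose[OF _ assms(1) _ smooth_on_normsq assms(2)]) (use assms(3) in auto)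

lemma pd_pd_radial:
  assumes "\<And>t. t \<ge> 0 \<Longrightarrow> (\<phi> has_real_derivative \<phi>1 t) (at t)" "\<And>t. t \<ge> 0 \<Longrightarrow> (\<phi>1 has_real_derivative \<phi>2 t) (at t)"
  shows "pd k (pd l (\<lambda>x. \<phi> (x \<bullet> x))) x = (if k = l then 2 * \<phi>1 (x \<bullet> x) else 0) + 4 * (x $ k * x $ l) * \<phi>2 (x \<bullet> x)"
proof -
  have e: "pd l (\<lambda>x. \<phi> (x \<bullet> x)) = (\<lambda>x. x $ l * (2 * \<phi>1 (x \<bullet> x)))"
    by (rule ext) (simp add: pd_radial[OF assms(1)])
  have "((\<lambda>t. 2 * \<phi>1 t) has_real_derivative 2 * \<phi>2 (x \<bullet> x)) (at (x \<bullet> x))"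
    by (rule DERIV_cmult[OF assms(2)]) simp
  from pd_coord_radial[OF this] show ?thesis unfolding e by simp
qed

lemma lap_radial:
  assumes "\<And>t. t \<ge> 0 \<Longrightarrow> (\<phi> has_real_derivative \<phi>1 t) (at t)" "\<And>t. t \<ge> 0 \<Longrightarrow> (\<phi>1 has_real_derivative \<phi>2 t) (at t)"
  shows "lap (\<lambda>x. \<phi> (x \<bullet> x)) x = 4 * \<phi>1 (x \<bullet> x) + 4 * (x \<bullet> x) * \<phi>2 (x \<bullet> x)"
proof -
  have p: "pd k (pd k (\<lambda>x. \<phi> (x \<bullet> x))) x = 2 * \<phi>1 (x \<bullet> x) + 4 * (x $ k * x $ k) * \<phi>2 (x \<bullet> x)" for k
    by (subst pd_pd_radial[of \<phi> \<phi>1 \<phi>2]) (use assms in auto)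
  have "lap (\<lambda>x. \<phi> (x \<bullet> x)) x = 4 * \<phi>1 (x \<bullet> x) + 4 * (x $ 1 * x $ 1 + x $ 2 * x $ 2) * \<phi>2 (x \<bullet> x)"
    unfolding lap_def p by (simp add: algebra_simps)
  moreover have "x $ 1 * x $ 1 + x $ 2 * x $ 2 = x \<bullet> x" by (simp add: inner_vec_def sum_2)
  ultimately show ?thesis by (simp only:)
qed

subsection \<open>The regularised biharmonic kernel\<close>

text \<open>The derivatives of t log t up to order four. With \<open>t = x \<bullet> x\<close> the
  function of order 0 is |x|^2 log |x|^2, whose bilaplacian is 16 pi times the Dirac mass at
  0.\<close>

definition tlogt_d :: "nat \<Rightarrow> real \<Rightarrow> real" where
  "tlogt_d j t = (if j = 0 then t * ln t else if j = 1 then ln t + 1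
     else if j = 2 then 1 / t else if j = 3 then - (1 / t^2) else 2 / t^3)"

lemma tlogt_d_deriv:
  assumes "j < 4" "t + s > 0"
  shows "((\<lambda>t. tlogt_d j (t + s)) has_real_derivative tlogt_d (Suc j) (t + s)) (at t)"
proof -
  consider "j = 0" | "j = 1" | "j = 2" | "j = 3" using assms(1) by linarith
  then have "(tlogt_d j has_real_derivative tlogt_d (Suc j) u) (at u)" if "u > 0" for u
    by cases (use that in \<open>auto simp: tlogt_d_def[abs_def] field_simps power2_eq_square power3_eq_cube intro!: derivative_eq_intros\<close>)
  from this[OF assms(2)] show ?thesis by (simp add: DERIV_shift)
qed

text \<open>The parameter \<open>s\<close> enters only the logarithmic factor, so the cutoff stays
  fixed as \<open>s\<close> tends to 0. The functions \<open>kern1\<close> to \<open>kern4\<close>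
  below are the successive derivatives in \<open>t\<close> by the Leibniz rule.\<close>

definition kern0 :: "real \<Rightarrow> real \<Rightarrow> real" where
  "kern0 s t = cutoff_d 0 t * tlogt_d 0 (t + s^2)"
definition kern1 :: "real \<Rightarrow> real \<Rightarrow> real" where
  "kern1 s t = cutoff_d 1 t * tlogt_d 0 (t + s^2) + cutoff_d 0 t * tlogt_d 1 (t + s^2)"
definition kern2 :: "real \<Rightarrow> real \<Rightarrow> real" where
  "kern2 s t = cutoff_d 2 t * tlogt_d 0 (t + s^2) + 2 * (cutoff_d 1 t * tlogt_d 1 (t + s^2))
    + cutoff_d 0 t * tlogt_d 2 (t + s^2)"
definition kern3 :: "real \<Rightarrow> real \<Rightarrow> real" where
  "kern3 s t = cutoff_d 3 t * tlogt_d 0 (t + s^2) + 3 * (cutoff_d 2 t * tlogt_d 1 (t + s^2))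
    + 3 * (cutoff_d 1 t * tlogt_d 2 (t + s^2)) + cutoff_d 0 t * tlogt_d 3 (t + s^2)"
definition kern4 :: "real \<Rightarrow> real \<Rightarrow> real" where
  "kern4 s t = cutoff_d 4 t * tlogt_d 0 (t + s^2) + 4 * (cutoff_d 3 t * tlogt_d 1 (t + s^2))
    + 6 * (cutoff_d 2 t * tlogt_d 2 (t + s^2)) + 4 * (cutoff_d 1 t * tlogt_d 3 (t + s^2))
    + cutoff_d 0 t * tlogt_d 4 (t + s^2)"

lemma kern_deriv:
  assumes "t + s^2 > 0"
  shows "(kern0 s has_real_derivative kern1 s t) (at t)"
    and "(kern1 s has_real_derivative kern2 s t) (at t)"
    and "(kern2 s has_real_derivative kern3 s t) (at t)"
    and "(kern3 s has_real_derivative kern4 s t) (at t)"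
proof -
  have L: "((\<lambda>t. tlogt_d 0 (t + s^2)) has_real_derivative tlogt_d 1 (t + s^2)) (at t)"
    "((\<lambda>t. tlogt_d 1 (t + s^2)) has_real_derivative tlogt_d 2 (t + s^2)) (at t)"
    "((\<lambda>t. tlogt_d 2 (t + s^2)) has_real_derivative tlogt_d 3 (t + s^2)) (at t)"
    "((\<lambda>t. tlogt_d 3 (t + s^2)) has_real_derivative tlogt_d 4 (t + s^2)) (at t)"
    using tlogt_d_deriv[OF _ assms, of 0] tlogt_d_deriv[OF _ assms, of 1]
      tlogt_d_deriv[OF _ assms, of 2] tlogt_d_deriv[OF _ assms, of 3]
    by (simp_all add: eval_nat_numeral)
  have X: "(cutoff_d 0 has_real_derivative cutoff_d 1 t) (at t)" "(cutoff_d 1 has_real_derivative cutoff_d 2 t) (at t)"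
    "(cutoff_d 2 has_real_derivative cutoff_d 3 t) (at t)" "(cutoff_d 3 has_real_derivative cutoff_d 4 t) (at t)"
    using cutoff_d_deriv[of 0] cutoff_d_deriv[of 1] cutoff_d_deriv[of 2] cutoff_d_deriv[of 3]
    by (simp_all add: eval_nat_numeral)
  show "(kern0 s has_real_derivative kern1 s t) (at t)"
    unfolding kern0_def[abs_def] by (rule DERIV_cong, (rule DERIV_add DERIV_cmult DERIV_mult X L)+) (simp add: kern1_def)
  show "(kern1 s has_real_derivative kern2 s t) (at t)"
    unfolding kern1_def[abs_def] by (rule DERIV_cong, (rule DERIV_add DERIV_cmult DERIV_mult X L)+) (simp add: kern2_def)
  show "(kern2 s has_real_derivative kern3 s t) (at t)"
    unfolding kern2_def[abs_def] by (rule DERIV_cong, (rule DERIV_add DERIV_cmult DERIV_mult X L)+) (simp add: kern3_def)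
  show "(kern3 s has_real_derivative kern4 s t) (at t)"
    unfolding kern3_def[abs_def] by (rule DERIV_cong, (rule DERIV_add DERIV_cmult DERIV_mult X L)+) (simp add: kern4_def)
qed

definition biharm :: "real \<Rightarrow> real^2 \<Rightarrow> real" where "biharm s x = kern0 s (x \<bullet> x)"

lemma smooth_on_kern0:
  assumes "s > 0" shows "smooth_on {-(s^2)<..} (kern0 s)"
proof -
  let ?T = "{-(s^2)<..}"
  have a: "smooth_on ?T (\<lambda>t. t + s^2)" using smooth_on_affine[of ?T 1 "s^2"] by simp
  have l: "smooth_on ?T (\<lambda>t. ln (t + s^2))" by (rule smooth_on_compose[OF _ _ _ a smooth_on_ln]) auto
  show ?thesis
    unfolding kern0_def[abs_def] tlogt_d_def cutoff_d_0
    by (simp, intro smooth_on_mult a l smooth_on_subset[OF smooth_on_cutoff]) auto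
qed

lemma smooth_on_biharm: "s > 0 \<Longrightarrow> smooth_on UNIV (biharm s)"
  unfolding biharm_def[abs_def] by (rule smooth_on_radial[OF _ smooth_on_kern0]) (auto intro: less_le_trans[of _ 0])

lemma cutoff_normsq_eq_0: "(x::real^2) \<notin> cball 0 1 \<Longrightarrow> cutoff (x \<bullet> x) = 0"
proof (rule cutoff_eq_0)
  assume "x \<notin> cball 0 1"
  then have "1 \<le> norm x ^ 2" by (intro one_le_power) simp
  then show "3/4 \<le> x \<bullet> x" by (simp add: dot_square_norm)
qed

lemma biharm_supported: "x \<notin> cball 0 1 \<Longrightarrow> biharm s x = 0"
  using cutoff_normsq_eq_0 by (simp add: biharm_def kern0_def cutoff_d_0)

lemma pd_pd_biharm:
  assumes "s > 0"
  shows "pd k (pd l (biharm s)) = (\<lambda>x. (if k = l then 2 * kern1 s (x \<bullet> x) else 0) + 4 * (x $ k * x $ l) * kern2 s (x \<bullet> x))"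
proof
  fix x
  have p: "t + s^2 > 0" if "t \<ge> 0" for t using that assms by (simp add: add_nonneg_pos)
  show "pd k (pd l (biharm s)) x = (if k = l then 2 * kern1 s (x \<bullet> x) else 0) + 4 * (x $ k * x $ l) * kern2 s (x \<bullet> x)"
    unfolding biharm_def[abs_def] by (rule pd_pd_radial) (use kern_deriv p in auto)
qed

lemma lap_biharm:
  assumes "s > 0"
  shows "lap (biharm s) = (\<lambda>x. 4 * kern1 s (x \<bullet> x) + 4 * (x \<bullet> x) * kern2 s (x \<bullet> x))"
proof
  fix x
  have p: "t + s^2 > 0" if "t \<ge> 0" for t using that assms by (simp add: add_nonneg_pos)
  show "lap (biharm s) x = 4 * kern1 s (x \<bullet> x) + 4 * (x \<bullet> x) * kern2 s (x \<bullet> x)"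
    unfolding biharm_def[abs_def] by (rule lap_radial) (use kern_deriv p in auto)
qed

lemma kern_lap_deriv:
  assumes "t + s^2 > 0"
  shows "((\<lambda>t. 4 * kern1 s t + 4 * t * kern2 s t) has_real_derivative 8 * kern2 s t + 4 * t * kern3 s t) (at t)"
    and "((\<lambda>t. 8 * kern2 s t + 4 * t * kern3 s t) has_real_derivative 12 * kern3 s t + 4 * t * kern4 s t) (at t)"
  by (rule DERIV_cong, (rule DERIV_add DERIV_cmult DERIV_mult kern_deriv[OF assms] DERIV_ident)+, simp)+

text \<open>The Laplacian is commuted to the inside, because \<open>lap (biharm s)\<close> is again
  radial and \<open>pd_pd_radial\<close> applies to it.\<close>

lemma lap_pd_pd_biharm:
  assumes "s > 0"
  shows "lap (pd k (pd l (biharm s))) x = (if k = l then 2 * (8 * kern2 s (x \<bullet> x) + 4 * (x \<bullet> x) * kern3 s (x \<bullet> x)) else 0)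
     + 4 * (x $ k * x $ l) * (12 * kern3 s (x \<bullet> x) + 4 * (x \<bullet> x) * kern4 s (x \<bullet> x))"
proof -
  have p: "t + s^2 > 0" if "t \<ge> 0" for t using that assms by (simp add: add_nonneg_pos)
  note sm = smooth_on_biharm[OF assms]
  have "lap (pd k (pd l (biharm s))) x = pd k (lap (pd l (biharm s))) x"
    by (rule pd_lap[symmetric, OF open_UNIV smooth_on_pd[OF sm]]) simp
  also have "\<dots> = pd k (pd l (lap (biharm s))) x"
    by (rule pd_cong_open[of UNIV]) (use pd_lap[OF open_UNIV sm] in auto)
  also have "\<dots> = (if k = l then 2 * (8 * kern2 s (x \<bullet> x) + 4 * (x \<bullet> x) * kern3 s (x \<bullet> x)) else 0)
     + 4 * (x $ k * x $ l) * (12 * kern3 s (x \<bullet> x) + 4 * (x \<bullet> x) * kern4 s (x \<bullet> x))"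
    unfolding lap_biharm[OF assms]
    by (rule pd_pd_radial[where \<phi> = "\<lambda>t. 4 * kern1 s t + 4 * t * kern2 s t"]) (use kern_lap_deriv p in auto)
  finally show ?thesis .
qed

lemma lap_lap_biharm:
  assumes "s > 0"
  shows "lap (lap (biharm s)) x = 32 * kern2 s (x \<bullet> x) + 64 * (x \<bullet> x) * kern3 s (x \<bullet> x) + 16 * (x \<bullet> x)^2 * kern4 s (x \<bullet> x)"
proof -
  have p: "t + s^2 > 0" if "t \<ge> 0" for t using that assms by (simp add: add_nonneg_pos)
  have "lap (lap (biharm s)) x = 4 * (8 * kern2 s (x \<bullet> x) + 4 * (x \<bullet> x) * kern3 s (x \<bullet> x))
    + 4 * (x \<bullet> x) * (12 * kern3 s (x \<bullet> x) + 4 * (x \<bullet> x) * kern4 s (x \<bullet> x))"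
    unfolding lap_biharm[OF assms]
    by (rule lap_radial[where \<phi> = "\<lambda>t. 4 * kern1 s t + 4 * t * kern2 s t"]) (use kern_lap_deriv p in auto)
  then show ?thesis by (simp add: algebra_simps power2_eq_square)
qed

text \<open>
  \<open>\<Delta>\<^sup>2\<close> of the kernel splits into \<open>approx_id\<close>, where all derivatives fall on \<open>\<tau> log \<tau>\<close>, and \<open>cut_err\<close>, which collects
  the terms with a derivative of the cutoff and is therefore bounded as \<open>s \<rightarrow> 0\<close>.
\<close>

definition approx_id :: "real \<Rightarrow> real^2 \<Rightarrow> real" where
  "approx_id s x = cutoff (x \<bullet> x) * (32 * s^4 / (x \<bullet> x + s^2)^3)"

definition cut_err :: "real \<Rightarrow> real \<Rightarrow> real" where
  "cut_err s t = 32 * (cutoff_d 2 t * tlogt_d 0 (t + s^2) + 2 * (cutoff_d 1 t * tlogt_d 1 (t + s^2)))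
   + 64 * t * (cutoff_d 3 t * tlogt_d 0 (t + s^2) + 3 * (cutoff_d 2 t * tlogt_d 1 (t + s^2)) + 3 * (cutoff_d 1 t * tlogt_d 2 (t + s^2)))
   + 16 * t^2 * (cutoff_d 4 t * tlogt_d 0 (t + s^2) + 4 * (cutoff_d 3 t * tlogt_d 1 (t + s^2))
    + 6 * (cutoff_d 2 t * tlogt_d 2 (t + s^2)) + 4 * (cutoff_d 1 t * tlogt_d 3 (t + s^2)))"

lemma lap_lap_biharm_eq:
  assumes "s > 0"
  shows "lap (lap (biharm s)) x = approx_id s x + cut_err s (x \<bullet> x)"
proof -
  define t where "t = x \<bullet> x"
  define a where "a = t + s^2"
  have a: "a > 0" "t = a - s^2" using assms by (auto simp: a_def t_def add_nonneg_pos)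
  \<comment> \<open>The left side is \<open>32 * (a - t)^2 / a^3\<close>, and
    \<open>a - t = s^2\<close>: the regularised kernel produces a concentrating density instead of a
    singularity.\<close>
  have "32 * (1 / a) + 64 * t * (- (1 / a^2)) + 16 * t^2 * (2 / a^3) = 32 * s^4 / a^3"
    using a(1) unfolding a(2) by (simp add: field_simps power2_eq_square power3_eq_cube power4_eq_xxxx)
  then have "32 * (cutoff_d 0 t * (1 / a)) + 64 * t * (cutoff_d 0 t * (- (1 / a^2))) + 16 * t^2 * (cutoff_d 0 t * (2 / a^3))
     = cutoff_d 0 t * (32 * s^4 / a^3)"
    by (metis (no_types, opaque_lifting) distrib_left mult.left_commute)
  then show ?thesis
    unfolding lap_lap_biharm[OF assms] approx_id_def cut_err_def kern2_def kern3_def kern4_def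
      t_def[symmetric] a_def[symmetric] cutoff_d_0[symmetric]
    by (simp add: tlogt_d_def algebra_simps)
qed

lemma abs_mult_le: "\<bar>a\<bar> \<le> A \<Longrightarrow> \<bar>b\<bar> \<le> B \<Longrightarrow> \<bar>a * b\<bar> \<le> A * (B::real)"
  by (simp add: abs_mult mult_mono')

lemma abs_mult_ln_le:
  assumes "0 < (r::real)" "r \<le> 2" shows "\<bar>r * ln r\<bar> \<le> 2"
proof -
  have A: "r * ln r \<le> r * 1" using ln_le_minus_one[OF assms(1)] assms by (intro mult_left_mono) auto
  have B: "r * ln (1 / r) \<le> r * (1 / r - 1)"
    using ln_le_minus_one[of "1 / r"] assms by (intro mult_left_mono) auto
  have C: "r * ln (1 / r) = - (r * ln r)" "r * (1 / r - 1) = 1 - r"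
    using assms by (simp_all add: ln_div right_diff_distrib)
  show ?thesis using A B[unfolded C] assms by (intro abs_leI) linarith+
qed

text \<open>Here \<open>r\<close> stands for sqrt (|x|^2 + s^2). The orders 2 to 4 carry their exact
  singular power. In order 1 a spare factor \<open>r\<close> absorbs the logarithm, which is what
  later replaces log by 1/r.\<close>

lemma tlogt_d_bounds:
  assumes "0 < r" "r \<le> 2"
  shows "\<bar>tlogt_d 0 (r^2)\<bar> \<le> 8" "\<bar>r * tlogt_d 1 (r^2)\<bar> \<le> 6" "\<bar>r^2 * tlogt_d 2 (r^2)\<bar> \<le> 1"
    "\<bar>r^4 * tlogt_d 3 (r^2)\<bar> \<le> 1" "\<bar>r^6 * tlogt_d 4 (r^2)\<bar> \<le> 2"
proof -
  note l = abs_mult_ln_le[OF assms]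
  have ln2: "ln (r^2) = 2 * ln r" unfolding power2_eq_square using assms by (subst ln_mult_pos) auto
  have "r^2 * ln (r^2) = (2 * r) * (r * ln r)" unfolding ln2 by (simp add: power2_eq_square)
  moreover have "\<bar>(2 * r) * (r * ln r)\<bar> \<le> 4 * 2" by (rule abs_mult_le[OF _ l]) (use assms in auto)
  ultimately show "\<bar>tlogt_d 0 (r^2)\<bar> \<le> 8" by (simp add: tlogt_d_def)
  have "r * (ln (r^2) + 1) = 2 * (r * ln r) + r" by (simp add: ln2 algebra_simps)
  then show "\<bar>r * tlogt_d 1 (r^2)\<bar> \<le> 6" unfolding tlogt_d_def using l assms by simp
  show "\<bar>r^2 * tlogt_d 2 (r^2)\<bar> \<le> 1" "\<bar>r^4 * tlogt_d 3 (r^2)\<bar> \<le> 1" "\<bar>r^6 * tlogt_d 4 (r^2)\<bar> \<le> 2"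
    using assms by (auto simp: tlogt_d_def power_mult[symmetric])
qed

lemma abs_power_mult_le:
  assumes "0 < r" "r \<le> 2" "\<bar>b\<bar> \<le> B" shows "\<bar>r^k * b\<bar> \<le> 2^k * (B::real)"
  by (rule abs_mult_le) (use assms in \<open>auto intro: power_mono\<close>)

text \<open>The weights match the term in which all derivatives fall on the logarithmic factor;
  surplus powers of \<open>r\<close> are at most powers of 2. The constants are Leibniz sums, for
  instance 57 = 32 + 2 * 12 + 1 and 1394 = 512 + 4 * 192 + 6 * 16 + 4 * 4 + 2.\<close>

lemma kern_bounds:
  assumes X: "\<And>j. j \<le> 5 \<Longrightarrow> \<bar>cutoff_d j t\<bar> \<le> X" and r: "0 < r" "r \<le> 2" "r^2 = t + s^2"
  shows "\<bar>r * kern1 s t\<bar> \<le> 22 * X" "\<bar>r^2 * kern2 s t\<bar> \<le> 57 * X"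
    "\<bar>r^4 * kern3 s t\<bar> \<le> 285 * X" "\<bar>r^6 * kern4 s t\<bar> \<le> 1394 * X"
proof -
  note L = tlogt_d_bounds[OF r(1,2)]
  note P = abs_power_mult_le[OF r(1,2)]
  let ?L = "\<lambda>j. tlogt_d j (r^2)" and ?X = "\<lambda>j. cutoff_d j t"
  have M: "\<bar>?X j * b\<bar> \<le> X * B" if "j \<le> 5" "\<bar>b\<bar> \<le> B" for j b B
    by (rule abs_mult_le[OF X[OF that(1)] that(2)])
  have p1: "\<bar>r * ?L 0\<bar> \<le> 16" using P[OF L(1), of 1] by simp
  have p2: "\<bar>r^2 * ?L 0\<bar> \<le> 32" "\<bar>r^2 * ?L 1\<bar> \<le> 12"
    using P[OF L(1), of 2] P[OF L(2), of 1] by (simp_all add: power2_eq_square mult.assoc)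
  have p4: "\<bar>r^4 * ?L 0\<bar> \<le> 128" "\<bar>r^4 * ?L 1\<bar> \<le> 48" "\<bar>r^4 * ?L 2\<bar> \<le> 4"
    using P[OF L(1), of 4] P[OF L(2), of 3] P[OF L(3), of 2] by (simp_all add: eval_nat_numeral mult.assoc)
  have p6: "\<bar>r^6 * ?L 0\<bar> \<le> 512" "\<bar>r^6 * ?L 1\<bar> \<le> 192" "\<bar>r^6 * ?L 2\<bar> \<le> 16" "\<bar>r^6 * ?L 3\<bar> \<le> 4"
    using P[OF L(1), of 6] P[OF L(2), of 5] P[OF L(3), of 4] P[OF L(4), of 2] by (simp_all add: eval_nat_numeral mult.assoc)
  have "r * kern1 s t = ?X 1 * (r * ?L 0) + ?X 0 * (r * ?L 1)" by (simp add: kern1_def r(3) algebra_simps)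
  then show "\<bar>r * kern1 s t\<bar> \<le> 22 * X" using M[of 1, OF _ p1] M[of 0, OF _ L(2)] by linarith
  have "r^2 * kern2 s t = ?X 2 * (r^2 * ?L 0) + 2 * (?X 1 * (r^2 * ?L 1)) + ?X 0 * (r^2 * ?L 2)"
    unfolding kern2_def r(3)[symmetric] by algebra
  then show "\<bar>r^2 * kern2 s t\<bar> \<le> 57 * X" using M[of 2, OF _ p2(1)] M[of 1, OF _ p2(2)] M[of 0, OF _ L(3)] by linarith
  have "r^4 * kern3 s t = ?X 3 * (r^4 * ?L 0) + 3 * (?X 2 * (r^4 * ?L 1)) + 3 * (?X 1 * (r^4 * ?L 2)) + ?X 0 * (r^4 * ?L 3)"
    unfolding kern3_def r(3)[symmetric] by algebra
  then show "\<bar>r^4 * kern3 s t\<bar> \<le> 285 * X"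
    using M[of 3, OF _ p4(1)] M[of 2, OF _ p4(2)] M[of 1, OF _ p4(3)] M[of 0, OF _ L(4)] by linarith
  have "r^6 * kern4 s t = ?X 4 * (r^6 * ?L 0) + 4 * (?X 3 * (r^6 * ?L 1)) + 6 * (?X 2 * (r^6 * ?L 2))
      + 4 * (?X 1 * (r^6 * ?L 3)) + ?X 0 * (r^6 * ?L 4)"
    unfolding kern4_def r(3)[symmetric] by algebra
  then show "\<bar>r^6 * kern4 s t\<bar> \<le> 1394 * X"
    using M[of 4, OF _ p6(1)] M[of 3, OF _ p6(2)] M[of 2, OF _ p6(3)] M[of 1, OF _ p6(4)] M[of 0, OF _ L(5)] by linarith
qed

lemma normsq_unit_box: "x \<in> unit_box \<Longrightarrow> 0 \<le> x \<bullet> x \<and> x \<bullet> x \<le> 2"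
proof -
  assume "x \<in> unit_box"
  then have "(x $ 1)^2 \<le> 1^2" "(x $ 2)^2 \<le> 1^2"
    unfolding unit_box_iff abs_le_square_iff[symmetric] by simp_all
  then show ?thesis using norm_real2[of x] by (simp add: power2_norm_eq_inner)
qed

lemma pd_pd_pd_biharm:
  assumes "s > 0"
  shows "pd m (pd k (pd l (biharm s))) x = (if k = l then 4 * x $ m * kern2 s (x \<bullet> x) else 0)
    + 4 * (((if m = k then x $ l else 0) + (if m = l then x $ k else 0)) * kern2 s (x \<bullet> x) + 2 * (x $ k * x $ l * x $ m * kern3 s (x \<bullet> x)))"
proof -
  have p: "x \<bullet> x + s^2 > 0" using assms by (simp add: add_nonneg_pos)
  note k = kern_deriv[OF p]
  define c where "c = (if k = l then 2 else 0 :: real)"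
  have "pd k (pd l (biharm s)) = (\<lambda>x. c * kern1 s (x \<bullet> x) + 4 * (x $ k * x $ l * kern2 s (x \<bullet> x)))"
    unfolding pd_pd_biharm[OF assms] c_def by (auto simp: fun_eq_iff)
  moreover have "pd m (\<lambda>x. c * kern1 s (x \<bullet> x) + 4 * (x $ k * x $ l * kern2 s (x \<bullet> x))) x
     = c * (2 * x $ m * kern2 s (x \<bullet> x)) + 4 * (((if m = k then x $ l else 0) + (if m = l then x $ k else 0)) * kern2 s (x \<bullet> x) + 2 * (x $ k * x $ l * x $ m * kern3 s (x \<bullet> x)))"
    by (subst pd_eq[OF has_derivative_add[OF has_derivative_mult_right[OF radial_has_derivative[OF k(2)]]
         has_derivative_mult_right[OF has_derivative_mult[OF has_derivative_mult[OF coord_has_derivative coord_has_derivative]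
         radial_has_derivative[OF k(3)]]]]])
      (auto simp: inner_axis axis_component algebra_simps)
  ultimately show ?thesis by (simp add: c_def)
qed

text \<open>Second derivatives of the kernel are only logarithmically singular, but they get the
  weight of the third ones so that a test function and its gradient share one bound. The number
  40000 rounds up 16 * 57 + 56 * 285 + 16 * 1394, the worst of the three.\<close>

lemma biharm_bounds:
  "\<exists>C>0. \<forall>s\<in>{0<..1}. \<forall>x\<in>unit_box. \<forall>k l m.
     \<bar>pd k (pd l (biharm s)) x\<bar> * sqrt (x \<bullet> x + s^2) \<le> C \<and>
     \<bar>pd m (pd k (pd l (biharm s))) x\<bar> * sqrt (x \<bullet> x + s^2) \<le> C \<and>
     \<bar>lap (pd k (pd l (biharm s))) x\<bar> * (x \<bullet> x + s^2) \<le> C"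
proof -
  obtain X where X: "X \<ge> 1" "\<And>j t. j \<le> 5 \<Longrightarrow> t \<in> {0..2} \<Longrightarrow> \<bar>cutoff_d j t\<bar> \<le> X"
    using cutoff_d_bounded by blast
  have "\<bar>pd k (pd l (biharm s)) x\<bar> * sqrt (x \<bullet> x + s^2) \<le> 40000 * X \<and>
     \<bar>pd m (pd k (pd l (biharm s))) x\<bar> * sqrt (x \<bullet> x + s^2) \<le> 40000 * X \<and>
     \<bar>lap (pd k (pd l (biharm s))) x\<bar> * (x \<bullet> x + s^2) \<le> 40000 * X"
    if s: "s \<in> {0<..1}" and x: "x \<in> unit_box" for s x k l m
  proof -
    define t where "t = x \<bullet> x"
    define r where "r = sqrt (t + s^2)"
    have t: "t \<in> {0..2}" using normsq_unit_box[OF x] by (simp add: t_def)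
    have s1: "s^2 \<le> 1" "s^2 > 0" using s by (auto simp: power_le_one)
    have r2: "r^2 = t + s^2" using t s1 by (simp add: r_def)
    have "t + s^2 > 0" using t s1(2) by (intro add_nonneg_pos) auto
    then have r0: "r > 0" by (simp add: r_def)
    have "r^2 \<le> 2^2" using r2 t s1 by simp
    then have r1: "r \<le> 2" by (rule power2_le_imp_le) simp
    note K = kern_bounds[OF X(2)[OF _ t] r0 r1 r2]
    have c: "\<bar>x $ i\<bar> \<le> r" for i
    proof -
      have "(x $ i)^2 \<le> r^2"
        using norm_real2[of x] s1 exhaust_2[of i] unfolding r2 t_def by (auto simp: power2_norm_eq_inner)
      then show ?thesis using r0 by (metis abs_le_square_iff abs_of_pos)
    qed
    have cc: "\<bar>x $ i * x $ j\<bar> \<le> r * r" for i j by (rule abs_mult_le[OF c c])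
    have ccc: "\<bar>x $ i * x $ j * x $ n\<bar> \<le> r * r * r" for i j n by (rule abs_mult_le[OF cc c])
    let ?K1 = "\<bar>kern1 s t\<bar>" and ?K2 = "\<bar>kern2 s t\<bar>" and ?K3 = "\<bar>kern3 s t\<bar>" and ?K4 = "\<bar>kern4 s t\<bar>"
    have k1: "r * ?K1 \<le> 22 * X" and k2: "r^2 * ?K2 \<le> 57 * X" and k3: "r^4 * ?K3 \<le> 285 * X" and k4: "r^6 * ?K4 \<le> 1394 * X"
      using K r0 by (simp_all add: abs_mult)
    have k2': "r^3 * ?K2 \<le> 114 * X"
    proof -
      have "r * (r^2 * ?K2) \<le> 2 * (57 * X)" by (rule mult_mono[OF r1 k2]) auto
      then show ?thesis by (simp add: power3_eq_cube power2_eq_square mult_ac)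
    qed
    have tr: "\<bar>t\<bar> \<le> r^2" using r2 s1 t by simp
    have "\<bar>pd k (pd l (biharm s)) x\<bar> \<le> 2 * ?K1 + 4 * (r * r * ?K2)"
      unfolding pd_pd_biharm[OF s[THEN greaterThanAtMost_iff[THEN iffD1, THEN conjunct1]]] t_def[symmetric]
      using abs_mult_le[OF cc[of k l] order_refl[of ?K2]] unfolding mult.assoc
      by (split if_split) (intro conjI impI; linarith)
    then have "\<bar>pd k (pd l (biharm s)) x\<bar> * r \<le> (2 * ?K1 + 4 * (r * r * ?K2)) * r"
      using r0 by (simp add: mult_right_mono)
    also have "\<dots> = 2 * (r * ?K1) + 4 * (r^3 * ?K2)" by (simp add: algebra_simps power3_eq_cube)
    also have "\<dots> \<le> 40000 * X" using k1 k2' X(1) by linarith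
    finally have 1: "\<bar>pd k (pd l (biharm s)) x\<bar> * r \<le> 40000 * X" .
    have a1: "\<bar>(if k = l then 4 * x $ m * kern2 s t else 0)\<bar> \<le> 4 * (r * ?K2)"
      using abs_mult_le[OF c[of m] order_refl[of ?K2]] r0 by (auto simp: abs_mult)
    have "\<bar>(if m = k then x $ l else 0) + (if m = l then x $ k else 0)\<bar> \<le> 2 * r"
      using c[of k] c[of l] r0 by (smt (verit))
    from abs_mult_le[OF this order_refl[of ?K2]]
    have a2: "\<bar>((if m = k then x $ l else 0) + (if m = l then x $ k else 0)) * kern2 s t\<bar> \<le> 2 * (r * ?K2)" by (simp add: mult.assoc)
    have a3: "\<bar>x $ k * x $ l * x $ m * kern3 s t\<bar> \<le> r * r * r * ?K3"
      by (rule abs_mult_le[OF ccc order_refl])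
    have gen: "\<And>a b c A B C :: real. \<bar>a\<bar> \<le> A \<Longrightarrow> \<bar>b\<bar> \<le> B \<Longrightarrow> \<bar>c\<bar> \<le> C \<Longrightarrow> \<bar>a + 4 * b + 8 * c\<bar> \<le> A + 4 * B + 8 * C"
      by linarith
    have "\<bar>pd m (pd k (pd l (biharm s))) x\<bar> \<le> 12 * (r * ?K2) + 8 * (r * r * r * ?K3)"
      unfolding pd_pd_pd_biharm[OF s[THEN greaterThanAtMost_iff[THEN iffD1, THEN conjunct1]]] t_def[symmetric]
      using gen[OF a1 a2 a3] by (simp add: distrib_left)
    then have "\<bar>pd m (pd k (pd l (biharm s))) x\<bar> * r \<le> (12 * (r * ?K2) + 8 * (r * r * r * ?K3)) * r"
      using r0 by (simp add: mult_right_mono)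
    also have "\<dots> = 12 * (r^2 * ?K2) + 8 * (r^4 * ?K3)" by (simp add: algebra_simps eval_nat_numeral)
    also have "\<dots> \<le> 40000 * X" using k2 k3 X(1) by linarith
    finally have 2: "\<bar>pd m (pd k (pd l (biharm s))) x\<bar> * r \<le> 40000 * X" .
    have b1: "\<bar>t * kern3 s t\<bar> \<le> r^2 * ?K3" and b2: "\<bar>t * kern4 s t\<bar> \<le> r^2 * ?K4"
      by (rule abs_mult_le[OF tr order_refl])+
    have b3: "\<bar>(if k = l then 2 * (8 * kern2 s t + 4 * t * kern3 s t) else 0)\<bar> \<le> 16 * ?K2 + 8 * (r^2 * ?K3)"
      using b1 order_trans[OF abs_ge_zero b1] by (auto simp: distrib_left)
    have "\<bar>12 * kern3 s t + 4 * t * kern4 s t\<bar> \<le> 12 * ?K3 + 4 * (r^2 * ?K4)"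
      using b2 unfolding mult.assoc by linarith
    from abs_mult_le[OF cc[of k l] this]
    have b4: "\<bar>x $ k * x $ l * (12 * kern3 s t + 4 * t * kern4 s t)\<bar> \<le> r * r * (12 * ?K3 + 4 * (r^2 * ?K4))" .
    have gen2: "\<And>a b A B :: real. \<bar>a\<bar> \<le> A \<Longrightarrow> \<bar>b\<bar> \<le> B \<Longrightarrow> \<bar>a + 4 * b\<bar> \<le> A + 4 * B"
      by linarith
    have "\<bar>lap (pd k (pd l (biharm s))) x\<bar> \<le> 16 * ?K2 + 8 * (r^2 * ?K3) + 4 * (r * r * (12 * ?K3 + 4 * (r^2 * ?K4)))"
      unfolding lap_pd_pd_biharm[OF s[THEN greaterThanAtMost_iff[THEN iffD1, THEN conjunct1]]] t_def[symmetric]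
      using gen2[OF b3 b4] by (simp only: mult.assoc[of 4])
    then have "\<bar>lap (pd k (pd l (biharm s))) x\<bar> * r^2 \<le> (16 * ?K2 + 8 * (r^2 * ?K3) + 4 * (r * r * (12 * ?K3 + 4 * (r^2 * ?K4)))) * r^2"
      using r0 by (simp add: mult_right_mono)
    also have "\<dots> = 16 * (r^2 * ?K2) + 56 * (r^4 * ?K3) + 16 * (r^6 * ?K4)" by (simp add: algebra_simps eval_nat_numeral)
    also have "\<dots> \<le> 40000 * X" using k2 k3 k4 X(1) by linarith
    finally have 3: "\<bar>lap (pd k (pd l (biharm s))) x\<bar> * r^2 \<le> 40000 * X" .
    show ?thesis using 1 2 3 unfolding r2 unfolding r_def t_def by blast
  qed
  then show ?thesis using X(1) by (intro exI[of _ "40000 * X"]) auto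
qed

subsection \<open>The cutoff error\<close>

text \<open>Bounds for a function and its \<open>t\<close>-derivative that are uniform as
  \<open>s\<close> tends to 0. The derivative is included because the Hessian estimate integrates by
  parts onto the cutoff error.\<close>

definition tame :: "(real \<Rightarrow> real \<Rightarrow> real) \<Rightarrow> bool" where
  "tame f \<longleftrightarrow> (\<exists>f' C. \<forall>s\<in>{0<..1}. \<forall>t\<in>{0..2}.
     (f s has_real_derivative f' s t) (at t) \<and> \<bar>f s t\<bar> \<le> C \<and> \<bar>f' s t\<bar> \<le> C)"

lemma tame_add:
  assumes "tame f" "tame g" shows "tame (\<lambda>s t. f s t + g s t)"
proof -
  obtain f' C g' D where
    f: "\<And>s t. s \<in> {0<..1} \<Longrightarrow> t \<in> {0..2} \<Longrightarrow> (f s has_real_derivative f' s t) (at t) \<and> \<bar>f s t\<bar> \<le> C \<and> \<bar>f' s t\<bar> \<le> C"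
    and g: "\<And>s t. s \<in> {0<..1} \<Longrightarrow> t \<in> {0..2} \<Longrightarrow> (g s has_real_derivative g' s t) (at t) \<and> \<bar>g s t\<bar> \<le> D \<and> \<bar>g' s t\<bar> \<le> D"
    using assms unfolding tame_def by metis
  show ?thesis unfolding tame_def
  proof (intro exI ballI)
    fix s t :: real assume st: "s \<in> {0<..1}" "t \<in> {0..2}"
    show "((\<lambda>t. f s t + g s t) has_real_derivative f' s t + g' s t) (at t) \<and> \<bar>f s t + g s t\<bar> \<le> C + D \<and> \<bar>f' s t + g' s t\<bar> \<le> C + D"
      using f[OF st] g[OF st] by (intro conjI DERIV_add) linarith+
  qed
qed

lemma tame_cmult:
  assumes "tame f" shows "tame (\<lambda>s t. c * f s t)"
proof -
  obtain f' C where
    f: "\<And>s t. s \<in> {0<..1} \<Longrightarrow> t \<in> {0..2} \<Longrightarrow> (f s has_real_derivative f' s t) (at t) \<and> \<bar>f s t\<bar> \<le> C \<and> \<bar>f' s t\<bar> \<le> C"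
    using assms unfolding tame_def by metis
  show ?thesis unfolding tame_def
  proof (intro exI ballI)
    fix s t :: real assume st: "s \<in> {0<..1}" "t \<in> {0..2}"
    show "((\<lambda>t. c * f s t) has_real_derivative c * f' s t) (at t) \<and> \<bar>c * f s t\<bar> \<le> \<bar>c\<bar> * C \<and> \<bar>c * f' s t\<bar> \<le> \<bar>c\<bar> * C"
      using f[OF st] by (auto intro!: DERIV_cmult abs_mult_le)
  qed
qed

lemma tame_ident_mult:
  assumes "tame f" shows "tame (\<lambda>s t. t * f s t)"
proof -
  obtain f' C where
    f: "\<And>s t. s \<in> {0<..1} \<Longrightarrow> t \<in> {0..2} \<Longrightarrow> (f s has_real_derivative f' s t) (at t) \<and> \<bar>f s t\<bar> \<le> C \<and> \<bar>f' s t\<bar> \<le> C"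
    using assms unfolding tame_def by metis
  show ?thesis unfolding tame_def
  proof (intro exI ballI)
    fix s t :: real assume st: "s \<in> {0<..1}" "t \<in> {0..2}"
    have "\<bar>t * f s t\<bar> \<le> 2 * C" "\<bar>t * f' s t\<bar> \<le> 2 * C" using f[OF st] st by (auto intro!: abs_mult_le)
    then show "((\<lambda>t. t * f s t) has_real_derivative 1 * f s t + f' s t * t) (at t) \<and> \<bar>t * f s t\<bar> \<le> 3 * C \<and> \<bar>1 * f s t + f' s t * t\<bar> \<le> 3 * C"
      using f[OF st] by (intro conjI DERIV_mult DERIV_ident) (auto simp: mult.commute)
  qed
qed

text \<open>Since \<open>1 \<le> a\<close>, the factor \<open>cutoff_d a\<close> vanishes for
  \<open>t < 1/4\<close>. The logarithmic factor is therefore only seen at arguments in [1/4, 3],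
  away from its singularity.\<close>

lemma tame_base:
  assumes "1 \<le> a" "a \<le> 4" "b \<le> 3"
  shows "tame (\<lambda>s t. cutoff_d a t * tlogt_d b (t + s^2))"
proof -
  obtain X where X: "X \<ge> 1" "\<And>j t. j \<le> 5 \<Longrightarrow> t \<in> {0..2} \<Longrightarrow> \<bar>cutoff_d j t\<bar> \<le> X"
    using cutoff_d_bounded by blast
  \<comment> \<open>From r >= 1/2, removing the weight r^n costs at most 2^n. The worst case is 2^6
    * 2 = 128 for the fourth derivative.\<close>
  have L: "\<bar>tlogt_d j u\<bar> \<le> 200" if "1/4 \<le> u" "u \<le> 3" "j \<le> 4" for u j
  proof -
    define r where "r = sqrt u"
    have u: "u = r^2" using that by (simp add: r_def)
    have r: "0 < r" "r \<le> 2" "1/2 \<le> r"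
      using that real_le_rsqrt[of "1/2" u] by (auto simp: r_def power2_eq_square intro!: real_le_lsqrt)
    note B = tlogt_d_bounds[OF r(1,2)]
    have i: "\<bar>inverse r\<bar> \<le> 2" using r by (simp add: field_simps)
    have ip: "\<bar>inverse r ^ n\<bar> \<le> 2 ^ n" for n
      unfolding power_abs by (rule power_mono[OF i]) simp
    have d: "\<bar>y\<bar> \<le> 2^n * M" if "\<bar>r^n * y\<bar> \<le> M" for y n M
    proof -
      have "inverse r ^ n * (r ^ n * y) = (inverse r * r) ^ n * y" by (simp only: power_mult_distrib mult.assoc)
      also have "\<dots> = y" using r by simp
      finally have "inverse r ^ n * (r ^ n * y) = y" .
      then show ?thesis using abs_mult_le[OF ip[of n] that] by (simp only:)
    qed
    have "j \<le> 4" by (rule that(3))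
    then consider "j = 0" | "j = 1" | "j = 2" | "j = 3" | "j = 4" by linarith
    then show ?thesis unfolding u
      using B(1) d[of 1, simplified, OF B(2)[simplified]] d[OF B(3)] d[OF B(4)] d[OF B(5)]
      by cases (simp_all, linarith?)
  qed
  have T: "\<bar>cutoff_d j t * tlogt_d i (t + s^2)\<bar> \<le> X * 200"
    if "1 \<le> j" "j \<le> 5" "i \<le> 4" "s \<in> {0<..1}" "t \<in> {0..2}" for i j s t
  proof (cases "t < 1/4")
    case True
    then have "cutoff_d j t = 0" using cutoff_d_eq_0[of t "j - 1"] that by simp
    then show ?thesis using X by simp
  next
    case False
    have "s^2 \<le> 1" "s^2 \<ge> 0" using that by (auto simp: power_le_one)
    then have "1/4 \<le> t + s^2" "t + s^2 \<le> 3" using that(5) False unfolding atLeastAtMost_iff not_less by linarith+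
    then show ?thesis by (intro abs_mult_le X L) (use that in auto)
  qed
  show ?thesis unfolding tame_def
  proof (intro exI ballI)
    fix s t :: real assume st: "s \<in> {0<..1}" "t \<in> {0..2}"
    have p: "t + s^2 > 0" using st by (simp add: add_nonneg_pos)
    have D: "((\<lambda>t. cutoff_d a t * tlogt_d b (t + s^2)) has_real_derivative
        cutoff_d (Suc a) t * tlogt_d b (t + s^2) + tlogt_d (Suc b) (t + s^2) * cutoff_d a t) (at t)"
      by (rule DERIV_mult[OF cutoff_d_deriv tlogt_d_deriv[OF _ p]]) (use assms in simp)
    have 1: "\<bar>cutoff_d a t * tlogt_d b (t + s^2)\<bar> \<le> X * 200" by (rule T) (use assms st in auto)
    have 2: "\<bar>cutoff_d (Suc a) t * tlogt_d b (t + s^2)\<bar> \<le> X * 200" by (rule T) (use assms st in auto)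
    have 3: "\<bar>cutoff_d a t * tlogt_d (Suc b) (t + s^2)\<bar> \<le> X * 200" by (rule T) (use assms st in auto)
    show "((\<lambda>t. cutoff_d a t * tlogt_d b (t + s^2)) has_real_derivative
        cutoff_d (Suc a) t * tlogt_d b (t + s^2) + tlogt_d (Suc b) (t + s^2) * cutoff_d a t) (at t) \<and>
      \<bar>cutoff_d a t * tlogt_d b (t + s^2)\<bar> \<le> X * 400 \<and>
      \<bar>cutoff_d (Suc a) t * tlogt_d b (t + s^2) + tlogt_d (Suc b) (t + s^2) * cutoff_d a t\<bar> \<le> X * 400"
      using D 1 2 3 X(1) by (simp add: mult.commute[of "tlogt_d (Suc b) (t + s^2)"])
  qed
qed

lemma tame_cut_err: "tame cut_err"
proof -
  have e: "cut_err s t = 32 * (cutoff_d 2 t * tlogt_d 0 (t + s^2) + 2 * (cutoff_d 1 t * tlogt_d 1 (t + s^2)))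
   + 64 * (t * (cutoff_d 3 t * tlogt_d 0 (t + s^2) + 3 * (cutoff_d 2 t * tlogt_d 1 (t + s^2)) + 3 * (cutoff_d 1 t * tlogt_d 2 (t + s^2))))
   + 16 * (t * (t * (cutoff_d 4 t * tlogt_d 0 (t + s^2) + 4 * (cutoff_d 3 t * tlogt_d 1 (t + s^2))
    + 6 * (cutoff_d 2 t * tlogt_d 2 (t + s^2)) + 4 * (cutoff_d 1 t * tlogt_d 3 (t + s^2)))))" for s t
    unfolding cut_err_def by (simp only: power2_eq_square mult.assoc)
  show ?thesis
    unfolding e[abs_def] by (intro tame_add tame_cmult tame_ident_mult tame_base) auto
qed

lemma cut_err_bounds:
  "\<exists>C>0. \<forall>s\<in>{0<..1}. \<forall>x\<in>unit_box. \<forall>l. \<bar>cut_err s (x \<bullet> x)\<bar> \<le> C \<and> \<bar>pd l (\<lambda>x. cut_err s (x \<bullet> x)) x\<bar> \<le> C"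
proof -
  obtain f' C where
    f: "\<And>s t. s \<in> {0<..1} \<Longrightarrow> t \<in> {0..2} \<Longrightarrow> (cut_err s has_real_derivative f' s t) (at t) \<and> \<bar>cut_err s t\<bar> \<le> C \<and> \<bar>f' s t\<bar> \<le> C"
    using tame_cut_err unfolding tame_def by metis
  have "\<bar>cut_err s (x \<bullet> x)\<bar> \<le> 2 * \<bar>C\<bar> + 1 \<and> \<bar>pd l (\<lambda>x. cut_err s (x \<bullet> x)) x\<bar> \<le> 2 * \<bar>C\<bar> + 1"
    if "s \<in> {0<..1}" "x \<in> unit_box" for s x l
  proof -
    have t: "x \<bullet> x \<in> {0..2}" using normsq_unit_box[OF that(2)] by simp
    note F = f[OF that(1) t]
    have "\<bar>2 * x $ l\<bar> \<le> 2" using that(2) exhaust_2[of l] by (auto simp: unit_box_iff)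
    then have "\<bar>2 * x $ l * f' s (x \<bullet> x)\<bar> \<le> 2 * C" using F by (intro abs_mult_le) auto
    then show ?thesis using F pd_radial[of "cut_err s" "f' s (x \<bullet> x)" x l] by auto
  qed
  then show ?thesis by (intro exI[of _ "2 * \<bar>C\<bar> + 1"]) auto
qed

section \<open>Uniform integral bounds on the unit box\<close>

lemma smooth_on_powr: "smooth_on {0<..} (\<lambda>t::real. t powr a)"
  unfolding smooth_on_def
proof
  have o: "open {0::real<..}" by simp
  fix k show "Ck_on k {0<..} (\<lambda>t::real. t powr a)"
  proof (induction k arbitrary: a)
    case 0
    show ?case by (auto intro!: continuous_intros)
  next
    case (Suc k)
    show ?case
    proof (rule Ck_on_SucI[OF o, where f' = "\<lambda>t v. (a * v) * t powr (a - 1)"])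
      show "Ck_on k {0<..} (\<lambda>t. (a * v) * t powr (a - 1))" for v
        by (rule Ck_on_mult[OF o Ck_on_const[OF o] Suc])
    next
      fix t :: real assume "t \<in> {0<..}"
      then have "((\<lambda>t. t powr a) has_derivative (*) (a * t powr (a - 1))) (at t)"
        using has_real_derivative_powr[of t a] by (simp add: has_field_derivative_def)
      moreover have "(*) (a * t powr (a - 1)) = (\<lambda>v. (a * v) * t powr (a - 1))" by (auto simp: fun_eq_iff)
      ultimately show "((\<lambda>t. t powr a) has_derivative (\<lambda>v. (a * v) * t powr (a - 1))) (at t)" by simp
    qed
  qed
qed

lemma measure_unit_box: "measure lborel unit_box = 4"
  unfolding unit_box_def by (subst content_cbox_cart) (auto simp: UNIV_2 interval_ne_empty_cart)

lemma integral_unit_box_le: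
  assumes "continuous_on unit_box f" "\<And>x. x \<in> unit_box \<Longrightarrow> f x \<le> M"
  shows "integral unit_box f \<le> 4 * (M::real)"
proof -
  have "integral unit_box f \<le> integral unit_box (\<lambda>_. M)"
    by (intro integral_le unit_box_integrable assms continuous_on_const)
  also have "\<dots> = 4 * M" using measure_unit_box by (simp add: unit_box_def)
  finally show ?thesis .
qed

lemma integral_unit_box_mono:
  fixes f g :: "real^2 \<Rightarrow> real"
  assumes "continuous_on unit_box f" "continuous_on unit_box g" "\<And>x. x \<in> unit_box \<Longrightarrow> f x \<le> g x"
  shows "integral unit_box f \<le> integral unit_box g"
  by (intro integral_le unit_box_integrable assms)

lemma abs_integral_unit_box_le:
  fixes f g :: "real^2 \<Rightarrow> real"
  assumes "continuous_on unit_box f" "continuous_on unit_box g" "\<And>x. x \<in> unit_box \<Longrightarrow> \<bar>f x\<bar> \<le> g x"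
  shows "\<bar>integral unit_box f\<bar> \<le> integral unit_box g"
  using integral_norm_bound_integral[OF unit_box_integrable[OF assms(1)] unit_box_integrable[OF assms(2)]] assms(3)
  by simp

lemma compact_unit_box: "compact unit_box" unfolding unit_box_def by (rule compact_cbox)

lemma continuous_on_unit_box_bounded:
  fixes f :: "real^2 \<Rightarrow> real"
  assumes "continuous_on unit_box f" shows "\<exists>B\<ge>0. \<forall>x\<in>unit_box. \<bar>f x\<bar> \<le> B"
proof -
  obtain B where "\<forall>y\<in>f ` unit_box. norm y \<le> B"
    using compact_imp_bounded[OF compact_continuous_image[OF assms compact_unit_box]] unfolding bounded_iff by blast
  then have "\<forall>x\<in>unit_box. \<bar>f x\<bar> \<le> max B 0" by (simp add: le_max_iff_disj)
  then show ?thesis by (intro exI[of _ "max B 0"]) auto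
qed

lemma smooth_on_cutoff_normsq: "smooth_on UNIV (\<lambda>x::real^2. cutoff (x \<bullet> x))"
  by (rule smooth_on_radial[OF open_UNIV smooth_on_cutoff]) simp

lemma smooth_on_UNIV_continuous: "smooth_on UNIV f \<Longrightarrow> continuous_on A f"
  using smooth_on_continuous continuous_on_subset by blast

lemma continuous_tau_powr:
  "s \<noteq> 0 \<Longrightarrow> continuous_on A (\<lambda>x::real^2. (x \<bullet> x + s^2) powr a)"
  by (intro continuous_intros) (auto simp: add_nonneg_eq_0_iff)

text \<open>\<open>(|x|\<^sup>2 + s\<^sup>2)\<^sup>-\<^sup>3\<^sup>/\<^sup>4\<close> is dominated by the Laplacian of the bounded function \<open>4 (|x|\<^sup>2 + s\<^sup>2)\<^sup>1\<^sup>/\<^sup>4\<close>.\<close>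

lemma integral_tau_powr_bounded:
  "\<exists>C>0. \<forall>s\<in>{0<..1}. integral unit_box (\<lambda>x. (x \<bullet> x + s^2) powr (- 3/4)) \<le> C"
proof -
  let ?h = "\<lambda>x::real^2. cutoff (x \<bullet> x)"
  note hs = smooth_on_cutoff_normsq
  have lh: "smooth_on UNIV (lap ?h)" by (rule smooth_on_lap[OF open_UNIV hs])
  obtain B where B: "B \<ge> 0" "\<And>x. x \<in> unit_box \<Longrightarrow> \<bar>lap ?h x\<bar> \<le> B"
    using continuous_on_unit_box_bounded[OF smooth_on_UNIV_continuous[OF lh]] by blast
  have "integral unit_box (\<lambda>x. (x \<bullet> x + s^2) powr (- 3/4)) \<le> 48 * B + 17" if s: "s \<in> {0<..1}" for s
  proof -
    let ?u = "\<lambda>x::real^2. (x \<bullet> x + s^2) powr (1/4)" and ?k = "\<lambda>x::real^2. (x \<bullet> x + s^2) powr (- 3/4)"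
    have s0: "s \<noteq> 0" "s^2 > 0" "s^2 \<le> 1" using s by (auto simp: power_le_one)
    have pos: "t + s^2 > 0" if "t \<ge> 0" for t using that s0(2) by linarith
    have us: "smooth_on UNIV ?u"
    proof (rule smooth_on_compose[OF open_UNIV _ _ _ smooth_on_powr])
      show "smooth_on UNIV (\<lambda>x::real^2. x \<bullet> x + s^2)"
        by (intro smooth_on_add smooth_on_normsq smooth_on_const open_UNIV)
    qed (use pos in auto)
    have us2: "smooth_on (ball 0 2) ?u" by (rule smooth_on_subset[OF us]) simp
    have d: "((\<lambda>t. (t + s^2) powr a) has_real_derivative a * (t + s^2) powr (a - 1)) (at t)" if "t \<ge> 0" for t a
      using has_real_derivative_powr[OF pos[OF that], of a] by (simp add: DERIV_shift)
    have d1: "((\<lambda>t. 1/4 * (t + s^2) powr (-3/4)) has_real_derivative - 3/16 * (t + s^2) powr (-7/4)) (at t)" if "t \<ge> 0" for t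
      using DERIV_cmult[OF d[OF that, of "-3/4"], of "1/4"] by simp
    have lap: "lap ?u x = 4 * (1/4 * (x \<bullet> x + s^2) powr (-3/4)) + 4 * (x \<bullet> x) * (- 3/16 * (x \<bullet> x + s^2) powr (-7/4))" for x
      by (rule lap_radial[where \<phi> = "\<lambda>t. (t + s^2) powr (1/4)"]) (use d[of _ "1/4"] d1 in auto)
    \<comment> \<open>Up to the factor 4, the Laplacian is \<open>?k\<close> minus three quarters of
      a term that is at most \<open>?k\<close>. A quarter of \<open>?k\<close> survives.\<close>
    have low: "?k x \<le> 4 * lap ?u x" for x
    proof -
      have p: "x \<bullet> x + s^2 > 0" by (rule pos) simp
      have "(x \<bullet> x) * (x \<bullet> x + s^2) powr (-7/4) \<le> (x \<bullet> x + s^2) * (x \<bullet> x + s^2) powr (-7/4)"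
        by (intro mult_right_mono) auto
      also have "\<dots> = ?k x" using powr_mult_base[of "x \<bullet> x + s^2" "-7/4"] p by simp
      finally have "(x \<bullet> x) * (x \<bullet> x + s^2) powr (-7/4) \<le> ?k x" .
      moreover have "4 * lap ?u x = 4 * ?k x - 3 * ((x \<bullet> x) * (x \<bullet> x + s^2) powr (-7/4))"
        unfolding lap by (simp add: distrib_left)
      ultimately show ?thesis by linarith
    qed
    \<comment> \<open>Multiplying by the cutoff \<open>?h\<close> permits integration by parts.
      Where \<open>?h\<close> is below 1 one has |x|^2 > 1/4, and there \<open>?k\<close> is at most
      4.\<close>
    have pw: "?k x \<le> 4 * (lap ?u x * ?h x) + 4" if "x \<in> unit_box" for x
    proof -
      have k0: "?k x \<ge> 0" by simp
      have "?k x * ?h x \<le> 4 * lap ?u x * ?h x" using low[of x] cutoff_bounds[of "x \<bullet> x"] by (intro mult_right_mono) auto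
      moreover have "?k x * (1 - ?h x) \<le> 4"
      proof (cases "x \<bullet> x \<le> 1/4")
        case True then show ?thesis by (simp add: cutoff_eq_1)
      next
        case False
        have "1/4 \<le> x \<bullet> x + s^2" using False s0(2) by linarith
        then have "?k x \<le> (1/4) powr (- 3/4)" by (intro powr_mono2') auto
        also have "\<dots> = 4 powr (3/4)" by (simp add: powr_divide powr_minus)
        also have "\<dots> \<le> 4 powr 1" by (intro powr_mono) auto
        finally have "?k x * (1 - ?h x) \<le> 4 * 1" using cutoff_bounds[of "x \<bullet> x"] k0 by (intro mult_mono) auto
        then show ?thesis by simp
      qed
      ultimately show ?thesis by (simp add: algebra_simps)
    qed
    note cu = smooth_on_UNIV_continuous[OF us] smooth_on_UNIV_continuous[OF smooth_on_lap[OF open_UNIV us]]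
      smooth_on_UNIV_continuous[OF hs] smooth_on_UNIV_continuous[OF lh]
    have "integral unit_box ?k \<le> integral unit_box (\<lambda>x. 4 * (lap ?u x * ?h x) + 4)"
      by (rule integral_unit_box_mono) (use pw in \<open>auto intro!: continuous_intros continuous_tau_powr s0 cu\<close>)
    also have "\<dots> = 4 * integral unit_box (\<lambda>x. lap ?u x * ?h x) + integral unit_box (\<lambda>x. 4)"
      by (subst integral_add) (auto intro!: unit_box_integrable continuous_intros cu)
    also have "integral unit_box (\<lambda>x. lap ?u x * ?h x) = integral unit_box (\<lambda>x. ?u x * lap ?h x)"
      by (rule integral_lap_by_parts[OF us2 hs cutoff_normsq_eq_0])
    also have "\<dots> \<le> 4 * (3 * B)"
    proof (rule integral_unit_box_le)
      fix x assume x: "x \<in> unit_box"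
      have "?u x \<le> 3 powr (1/4)" using normsq_unit_box[OF x] s0 by (intro powr_mono2) auto
      also have "\<dots> \<le> 3 powr 1" by (intro powr_mono) auto
      finally have "\<bar>?u x\<bar> \<le> 3" by simp
      then have "\<bar>?u x * lap ?h x\<bar> \<le> 3 * B" by (intro abs_mult_le B x)
      then show "?u x * lap ?h x \<le> 3 * B" by simp
    qed (auto intro!: continuous_intros cu)
    also have "integral unit_box (\<lambda>x. 4::real) = 16" using measure_unit_box by (simp add: unit_box_def)
    finally show ?thesis by simp
  qed
  then show ?thesis using B(1) by (intro exI[of _ "48 * B + 17"]) auto
qed

section \<open>The approximate identity and the recovery of the Hessian at the centre\<close>

lemma smooth_on_approx_id:
  assumes "s > 0" shows "smooth_on UNIV (approx_id s)"
proof -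
  have q: "smooth_on UNIV (\<lambda>x::real^2. x \<bullet> x + s^2)"
    by (intro smooth_on_add smooth_on_normsq smooth_on_const open_UNIV)
  have i: "smooth_on UNIV (\<lambda>x::real^2. inverse (x \<bullet> x + s^2))"
    by (rule smooth_on_compose[OF _ _ _ q smooth_on_inverse]) (use assms in \<open>auto simp: add_nonneg_eq_0_iff\<close>)
  have "approx_id s = (\<lambda>x. cutoff (x \<bullet> x) * ((32 * s^4) * (inverse (x \<bullet> x + s^2) * (inverse (x \<bullet> x + s^2) * inverse (x \<bullet> x + s^2)))))"
    by (auto simp: approx_id_def fun_eq_iff field_simps power3_eq_cube)
  then show ?thesis
    by (simp only:) (intro smooth_on_mult open_UNIV i smooth_on_const smooth_on_cutoff_normsq)
qed

lemma smooth_on_cut_err: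
  assumes "s > 0" shows "smooth_on UNIV (\<lambda>x::real^2. cut_err s (x \<bullet> x))"
proof -
  have "smooth_on UNIV (\<lambda>x. lap (lap (biharm s)) x + (-1) *\<^sub>R approx_id s x)"
    by (intro smooth_on_add smooth_on_scaleR smooth_on_const smooth_on_lap smooth_on_biharm smooth_on_approx_id assms open_UNIV)
  then show ?thesis using lap_lap_biharm_eq[OF assms] by simp
qed

lemma cut_err_supported: "s > 0 \<Longrightarrow> (x::real^2) \<notin> cball 0 1 \<Longrightarrow> cut_err s (x \<bullet> x) = 0"
proof -
  assume s: "s > 0" and x: "x \<notin> cball 0 1"
  have "lap (biharm s) y = 0" if "y \<notin> cball 0 1" for y by (rule lap_supported[OF biharm_supported that])
  from lap_supported[OF this x] lap_lap_biharm_eq[OF s, of x] cutoff_normsq_eq_0[OF x]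
  show ?thesis by (simp add: approx_id_def)
qed

lemma approx_id_nonneg: "approx_id s x \<ge> 0"
  unfolding approx_id_def using cutoff_bounds[of "x \<bullet> x"] by (intro mult_nonneg_nonneg divide_nonneg_nonneg) auto

text \<open>Only a lower bound for the mass that survives \<open>s\<close> tending to 0 is needed,
  so the square of side \<open>s\<close> suffices. There |x|^2 + s^2 <= 3/2 s^2, the density is at
  least 32 * (8/27) / s^2 > 9 / s^2, and \<open>s \<le> 1/2\<close> keeps the cutoff equal to
  1.\<close>

lemma integral_approx_id_ge:
  assumes s: "s \<in> {0<..1/2}" shows "integral unit_box (approx_id s) \<ge> 9"
proof -
  let ?Q = "cbox (- ((s/2) *\<^sub>R 1)) ((s/2) *\<^sub>R (1::real^2))"
  have sub: "?Q \<subseteq> unit_box"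
  proof
    fix x assume "x \<in> ?Q"
    then have b: "- (s/2) \<le> x $ i \<and> x $ i \<le> s/2" for i by (simp add: mem_box_cart)
    have "\<bar>x $ i\<bar> \<le> 1" for i using b[of i] s unfolding greaterThanAtMost_iff by linarith
    then show "x \<in> unit_box" by (simp add: unit_box_iff)
  qed
  have ge: "9 / s^2 \<le> approx_id s x" if "x \<in> ?Q" for x
  proof -
    have b: "- (s/2) \<le> x $ i \<and> x $ i \<le> s/2" for i using that by (simp add: mem_box_cart)
    have "\<bar>x $ i\<bar> \<le> \<bar>s/2\<bar>" for i using b[of i] by linarith
    then have "(x $ i)^2 \<le> (s/2)^2" for i by (simp only: abs_le_square_iff)
    from this[of 1] this[of 2] have t: "x \<bullet> x \<le> s^2 / 2" using norm_real2[of x] by (simp add: power2_norm_eq_inner power_divide)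
    have "s^2 \<le> (1/2)^2" using s by (intro power_mono) auto
    then have c: "cutoff (x \<bullet> x) = 1" using t by (intro cutoff_eq_1) (simp add: power2_eq_square)
    have p: "s^2 > 0" using s by simp
    have "(x \<bullet> x + s^2)^3 \<le> (3/2 * s^2)^3" using t by (intro power_mono) auto
    also have "\<dots> = 27/8 * s^2 * s^4" by (simp add: power_mult_distrib eval_nat_numeral)
    finally have le: "(x \<bullet> x + s^2)^3 \<le> 27/8 * s^2 * s^4" .
    have pp: "(x \<bullet> x + s^2)^3 > 0" using p by (simp add: add_nonneg_pos)
    have "9 / s^2 * (x \<bullet> x + s^2)^3 \<le> 9 / s^2 * (27/8 * s^2 * s^4)" using le by (intro mult_left_mono) auto
    also have "\<dots> = 243/8 * s^4" using s by (simp add: field_simps eval_nat_numeral)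
    also have "\<dots> \<le> 32 * s^4" by simp
    finally show ?thesis unfolding approx_id_def c using pp by (simp add: field_simps)
  qed
  note ca = smooth_on_UNIV_continuous[OF smooth_on_approx_id]
  have "measure lborel ?Q = s^2"
    using s by (subst content_cbox_cart) (auto simp: UNIV_2 interval_ne_empty_cart power2_eq_square)
  then have "9 = integral ?Q (\<lambda>x. 9 / s^2)" using s by simp
  also have "\<dots> \<le> integral ?Q (approx_id s)"
    by (intro integral_le integrable_continuous ca ge continuous_on_const) (use s in auto)
  also have "\<dots> \<le> integral unit_box (approx_id s)"
    by (intro integral_subset_le sub integrable_continuous unit_box_integrable ca) (use s in \<open>auto simp: approx_id_nonneg\<close>)
  finally show ?thesis .
qed

text \<open>The density lives at scale \<open>s\<close>. With r^2 = |x|^2 + s^2, s^3 <= r^3 leaves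
  32 s / r^2; then r^(-1/2) <= s^(-1/2) reduces the singularity to r^(-3/2), whose integral is
  bounded uniformly in \<open>s\<close>, and keeps a factor sqrt s.\<close>

lemma norm_approx_id_le:
  assumes s: "s > 0"
  shows "norm x * approx_id s x \<le> 32 * sqrt s * (x \<bullet> x + s^2) powr (- 3/4)"
proof -
  define r where "r = sqrt (x \<bullet> x + s^2)"
  have p: "x \<bullet> x + s^2 > 0" using s by (simp add: add_nonneg_pos)
  have r2: "x \<bullet> x + s^2 = r^2" using p by (simp add: r_def)
  have r: "r > 0" "s \<le> r" "norm x \<le> r"
    using p s by (auto simp: r_def intro!: real_le_rsqrt simp: power2_norm_eq_inner)
  have "norm x * approx_id s x \<le> r * (1 * (32 * s^4 / (r^2)^3))"
    unfolding approx_id_def r2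
    using r cutoff_bounds s by (intro mult_mono mult_nonneg_nonneg) auto
  also have "\<dots> = 32 * s * s^3 / r^5" using r by (simp add: field_simps eval_nat_numeral)
  also have "\<dots> \<le> 32 * s * r^3 / r^5" using r s by (intro divide_right_mono mult_left_mono power_mono) auto
  also have "\<dots> = 32 * (s * (r^2) powr (-1))" using r by (simp add: powr_minus field_simps eval_nat_numeral)
  also have "(r^2) powr (-1) = (r^2) powr (-1/4) * (r^2) powr (-3/4)" by (simp add: powr_add[symmetric])
  also have "s * ((r^2) powr (-1/4) * (r^2) powr (-3/4)) \<le> s * ((s^2) powr (-1/4) * (r^2) powr (-3/4))"
    using r s by (intro mult_left_mono mult_right_mono powr_mono2') (auto intro: power_mono)
  also have "(s^2) powr (-1/4) = s powr (-1/2)" using s by (simp add: powr_powr flip: powr_numeral)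
  also have "s * (s powr (-1/2) * (r^2) powr (-3/4)) = sqrt s * (r^2) powr (-3/4)"
    using powr_mult_base[of s "-1/2"] s by (simp add: powr_half_sqrt)
  finally show ?thesis unfolding r2 by simp
qed

text \<open>Pairing the Hessian with the bilaplacian of the kernel gives its value at 0 times a mass
  of at least 9, plus an oscillation term. The Lipschitz constant in that term involves third
  derivatives of \<open>u\<close> and is not controlled, which is harmless: it multiplies sqrt s,
  while \<open>W\<close> does not depend on \<open>s\<close>.\<close>

lemma hessian_representation:
  fixes u :: "real^2 \<Rightarrow> real"
  assumes u: "smooth_on (ball 0 2) u"
    and W: "\<And>s. s \<in> {0<..1/2} \<Longrightarrow>
      \<bar>integral unit_box (\<lambda>x. lap u x * lap (pd k (pd l (biharm s))) x)\<bar>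
      + \<bar>integral unit_box (\<lambda>x. pd k (pd l u) x * cut_err s (x \<bullet> x))\<bar> \<le> W"
  shows "9 * \<bar>pd k (pd l u) 0\<bar> \<le> W"
proof -
  define v where "v = pd k (pd l u)"
  have vs: "smooth_on (ball 0 2) v" unfolding v_def by (intro smooth_on_pd u)
  note vc = continuous_on_subset[OF smooth_on_continuous[OF vs] unit_box_subset_ball]
  have "\<exists>B\<ge>0. \<forall>x\<in>unit_box. \<bar>pd i v x\<bar> \<le> B" for i
    by (rule continuous_on_unit_box_bounded, rule continuous_on_subset[OF smooth_on_continuous[OF smooth_on_pd[OF vs]] unit_box_subset_ball])
  then obtain B1 B2 where B: "B1 \<ge> 0" "B2 \<ge> 0" "\<And>x. x \<in> unit_box \<Longrightarrow> \<bar>pd 1 v x\<bar> \<le> B1" "\<And>x. x \<in> unit_box \<Longrightarrow> \<bar>pd 2 v x\<bar> \<le> B2"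
    by metis
  have zb: "0 \<in> unit_box" by (simp add: unit_box_iff)
  define L where "L = 2 * (B1 + B2)"
  have L0: "L \<ge> 0" using B by (simp add: L_def)
  have lip: "\<bar>v x - v 0\<bar> \<le> L * norm x" if "x \<in> unit_box" for x
  proof -
    have "norm (v x - v 0) \<le> real CARD(2) * (B1 + B2) * norm (x - 0)"
    proof (rule pd_lipschitz[OF _ open_ball unit_box_subset_ball vs _ that zb])
      show "convex unit_box" unfolding unit_box_def by (rule convex_box)
      show "norm (pd i v y) \<le> B1 + B2" if "y \<in> unit_box" for y i
        using B(1,2) B(3,4)[OF that] exhaust_2[of i] by auto
    qed
    then show ?thesis by (simp add: L_def)
  qed
  obtain C where C: "C > 0" "\<And>s. s \<in> {0<..1} \<Longrightarrow> integral unit_box (\<lambda>x. (x \<bullet> x + s^2) powr (- 3/4)) \<le> C"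
    using integral_tau_powr_bounded by blast
  have main: "9 * \<bar>v 0\<bar> \<le> W + 32 * L * C * sqrt s" if s: "s \<in> {0<..1/2}" for s
  proof -
    have s0: "s > 0" "s \<noteq> 0" "s \<in> {0<..1}" using s by auto
    note ca = smooth_on_UNIV_continuous[OF smooth_on_approx_id[OF s0(1)]]
    note ce = smooth_on_UNIV_continuous[OF smooth_on_cut_err[OF s0(1)]]
    have "integral unit_box (\<lambda>x. lap u x * lap (pd k (pd l (biharm s))) x) = integral unit_box (\<lambda>x. v x * lap (lap (biharm s)) x)"
      unfolding v_def by (rule integral_lap_lap_pd[OF u smooth_on_biharm[OF s0(1)] biharm_supported])
    also have "\<dots> = integral unit_box (\<lambda>x. v x * approx_id s x + v x * cut_err s (x \<bullet> x))"
      by (simp add: lap_lap_biharm_eq[OF s0(1)] distrib_left)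
    also have "\<dots> = integral unit_box (\<lambda>x. v x * approx_id s x) + integral unit_box (\<lambda>x. v x * cut_err s (x \<bullet> x))"
      by (intro integral_add unit_box_integrable continuous_intros vc ca ce)
    finally have 1: "\<bar>integral unit_box (\<lambda>x. v x * approx_id s x)\<bar> \<le> W" using W[OF s] unfolding v_def by linarith
    have "integral unit_box (\<lambda>x. v x * approx_id s x) = integral unit_box (\<lambda>x. v 0 * approx_id s x + (v x - v 0) * approx_id s x)"
      by (simp add: algebra_simps)
    also have "\<dots> = integral unit_box (\<lambda>x. v 0 * approx_id s x) + integral unit_box (\<lambda>x. (v x - v 0) * approx_id s x)"
      by (intro integral_add unit_box_integrable continuous_intros vc ca)
    finally have 2: "integral unit_box (\<lambda>x. v x * approx_id s x) = v 0 * integral unit_box (approx_id s) + integral unit_box (\<lambda>x. (v x - v 0) * approx_id s x)"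
      by simp
    have "\<bar>integral unit_box (\<lambda>x. (v x - v 0) * approx_id s x)\<bar> \<le> integral unit_box (\<lambda>x. 32 * L * sqrt s * (x \<bullet> x + s^2) powr (- 3/4))"
    proof (rule abs_integral_unit_box_le)
      fix x assume x: "x \<in> unit_box"
      have "\<bar>(v x - v 0) * approx_id s x\<bar> \<le> L * norm x * approx_id s x"
        using lip[OF x] approx_id_nonneg[of s x] by (simp add: abs_mult mult_right_mono)
      also have "\<dots> \<le> L * (32 * sqrt s * (x \<bullet> x + s^2) powr (- 3/4))"
        using mult_left_mono[OF norm_approx_id_le[OF s0(1), of x] L0] by (simp add: mult.assoc)
      finally show "\<bar>(v x - v 0) * approx_id s x\<bar> \<le> 32 * L * sqrt s * (x \<bullet> x + s^2) powr (- 3/4)"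
        by (simp add: mult_ac)
    qed (intro continuous_intros vc ca continuous_tau_powr s0)+
    also have "\<dots> = 32 * L * sqrt s * integral unit_box (\<lambda>x. (x \<bullet> x + s^2) powr (- 3/4))" by simp
    also have "\<dots> \<le> 32 * L * sqrt s * C" using C(2)[OF s0(3)] L0 s0 by (intro mult_left_mono) auto
    finally have 3: "\<bar>integral unit_box (\<lambda>x. (v x - v 0) * approx_id s x)\<bar> \<le> 32 * L * C * sqrt s" by (simp add: mult_ac)
    have "9 * \<bar>v 0\<bar> \<le> \<bar>v 0 * integral unit_box (approx_id s)\<bar>"
      using integral_approx_id_ge[OF s] by (simp add: abs_mult mult.commute mult_left_mono)
    then show ?thesis using 1 2 3 by linarith
  qed
  have "9 * \<bar>v 0\<bar> \<le> W"
  proof (rule field_le_epsilon)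
    fix e :: real assume e: "e > 0"
    define K where "K = 32 * L * C + 1"
    have K: "K > 0" "32 * L * C \<le> K" using L0 C(1) by (auto simp: K_def intro: add_nonneg_pos)
    define s where "s = min (1/2) ((e / K)^2)"
    have s: "s \<in> {0<..1/2}" using e K by (simp add: s_def)
    have "sqrt s \<le> e / K" using e K by (intro real_le_lsqrt) (auto simp: s_def)
    then have "32 * L * C * sqrt s \<le> K * (e / K)" using K s by (intro mult_mono) auto
    then show "9 * \<bar>v 0\<bar> \<le> W + e" using main[OF s] K by simp
  qed
  then show ?thesis by (simp add: v_def)
qed

subsection \<open>The interior estimate on a disc of unit size\<close>

lemma norm_matrix_vector_le: "norm (A *v x) \<le> norm A * norm (x::real^'n::finite)" for A :: "real^'n^'m::finite"
proof -
  have "norm (A *v x) \<le> L2_set (\<lambda>i. norm (A $ i) * norm x) UNIV"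
    unfolding norm_vec_def[of "A *v x"]
    by (rule L2_set_mono) (use Cauchy_Schwarz_ineq2 in \<open>auto simp: matrix_vector_mul_component\<close>)
  also have "\<dots> = norm A * norm x" unfolding norm_vec_def[of A] by (rule L2_set_left_distrib[symmetric]) simp
  finally show ?thesis .
qed

lemma bounded_bilinear_matrix_vector:
  "bounded_bilinear (\<lambda>(A::real^'n::finite^'m::finite) x. A *v x)"
proof
  show "\<exists>K. \<forall>(a::real^'n^'m) b. norm (a *v b) \<le> norm a * norm b * K"
    using norm_matrix_vector_le by (intro exI[of _ 1]) auto
qed (auto simp: matrix_vector_mult_add_rdistrib matrix_vector_right_distrib matrix_vector_mult_scaleR scaleR_matrix_vector_assoc)

lemma kernel_constant_exists:
  "\<exists>C\<ge>1. (\<forall>s\<in>{0<..1}. integral unit_box (\<lambda>x. (x \<bullet> x + s^2) powr (- 3/4)) \<le> C \<and>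
     (\<forall>x\<in>unit_box. \<forall>k l m.
       \<bar>pd k (pd l (biharm s)) x\<bar> \<le> C * (x \<bullet> x + s^2) powr (- 1/2) \<and>
       \<bar>pd m (pd k (pd l (biharm s))) x\<bar> \<le> C * (x \<bullet> x + s^2) powr (- 1/2) \<and>
       norm x * \<bar>lap (pd k (pd l (biharm s))) x\<bar> \<le> C * (x \<bullet> x + s^2) powr (- 1/2) \<and>
       \<bar>cut_err s (x \<bullet> x)\<bar> \<le> C \<and> \<bar>pd l (\<lambda>x. cut_err s (x \<bullet> x)) x\<bar> \<le> C))"
proof -
  obtain C1 where C1: "C1 > 0" "\<And>s x k l m. s \<in> {0<..1} \<Longrightarrow> x \<in> unit_box \<Longrightarrow>
     \<bar>pd k (pd l (biharm s)) x\<bar> * sqrt (x \<bullet> x + s^2) \<le> C1 \<and>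
     \<bar>pd m (pd k (pd l (biharm s))) x\<bar> * sqrt (x \<bullet> x + s^2) \<le> C1 \<and>
     \<bar>lap (pd k (pd l (biharm s))) x\<bar> * (x \<bullet> x + s^2) \<le> C1"
    using biharm_bounds by blast
  obtain C2 where C2: "C2 > 0" "\<And>s x l. s \<in> {0<..1} \<Longrightarrow> x \<in> unit_box \<Longrightarrow>
     \<bar>cut_err s (x \<bullet> x)\<bar> \<le> C2 \<and> \<bar>pd l (\<lambda>x. cut_err s (x \<bullet> x)) x\<bar> \<le> C2"
    using cut_err_bounds by blast
  obtain C3 where C3: "C3 > 0" "\<And>s. s \<in> {0<..1} \<Longrightarrow> integral unit_box (\<lambda>x. (x \<bullet> x + s^2) powr (- 3/4)) \<le> C3"
    using integral_tau_powr_bounded by blast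
  define C where "C = C1 + C2 + C3 + 1"
  have C: "C \<ge> 1" "C1 \<le> C" "C2 \<le> C" "C3 \<le> C" using C1 C2 C3 by (auto simp: C_def)
  have "\<bar>pd k (pd l (biharm s)) x\<bar> \<le> C * (x \<bullet> x + s^2) powr (- 1/2) \<and>
       \<bar>pd m (pd k (pd l (biharm s))) x\<bar> \<le> C * (x \<bullet> x + s^2) powr (- 1/2) \<and>
       norm x * \<bar>lap (pd k (pd l (biharm s))) x\<bar> \<le> C * (x \<bullet> x + s^2) powr (- 1/2)"
    if s: "s \<in> {0<..1}" and x: "x \<in> unit_box" for s x k l m
  proof -
    define r where "r = sqrt (x \<bullet> x + s^2)"
    have p: "x \<bullet> x + s^2 > 0" using s by (simp add: add_nonneg_pos)
    then have r: "r > 0" "x \<bullet> x + s^2 = r^2" "norm x \<le> r"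
      by (auto simp: r_def intro!: real_le_rsqrt simp: power2_norm_eq_inner)
    have pw: "(x \<bullet> x + s^2) powr (- 1/2) = 1 / r"
      using p by (simp add: r_def powr_minus powr_half_sqrt field_simps)
    have *: "\<bar>y\<bar> \<le> C * (1 / r)" if "\<bar>y\<bar> * r \<le> C1" for y
      using order_trans[OF that C(2)] r by (simp add: field_simps)
    have "norm x * \<bar>lap (pd k (pd l (biharm s))) x\<bar> * r \<le> r * \<bar>lap (pd k (pd l (biharm s))) x\<bar> * r"
      using r by (intro mult_right_mono) auto
    also have "\<dots> \<le> C1" using C1(2)[OF s x, of k l k] unfolding r(2) by (simp add: power2_eq_square mult_ac)
    finally have "\<bar>norm x * lap (pd k (pd l (biharm s))) x\<bar> * r \<le> C1" by (simp add: abs_mult)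
    from *[OF this] have "norm x * \<bar>lap (pd k (pd l (biharm s))) x\<bar> \<le> C * (1 / r)" by (simp add: abs_mult)
    then show ?thesis unfolding pw using * C1(2)[OF s x, of k l m] unfolding r_def[symmetric] by blast
  qed
  then show ?thesis using C C2(2) C3(2) by (intro exI[of _ C]) (meson order_trans)
qed

text \<open>Fixed globally by choice, so that estimates obtained in different instances of the
  locales below refer to one and the same number, independent of map, metric and disc.\<close>

definition kernel_const :: real where
  "kernel_const = (SOME C. C \<ge> 1 \<and> (\<forall>s\<in>{0<..1}. integral unit_box (\<lambda>x. (x \<bullet> x + s^2) powr (- 3/4)) \<le> C \<and>
     (\<forall>x\<in>unit_box. \<forall>k l m.
       \<bar>pd k (pd l (biharm s)) x\<bar> \<le> C * (x \<bullet> x + s^2) powr (- 1/2) \<and>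
       \<bar>pd m (pd k (pd l (biharm s))) x\<bar> \<le> C * (x \<bullet> x + s^2) powr (- 1/2) \<and>
       norm x * \<bar>lap (pd k (pd l (biharm s))) x\<bar> \<le> C * (x \<bullet> x + s^2) powr (- 1/2) \<and>
       \<bar>cut_err s (x \<bullet> x)\<bar> \<le> C \<and> \<bar>pd l (\<lambda>x. cut_err s (x \<bullet> x)) x\<bar> \<le> C)))"

lemma kernel_const_ge_1: "kernel_const \<ge> 1"
  and kernel_const:
  "s \<in> {0<..1} \<Longrightarrow> integral unit_box (\<lambda>x. (x \<bullet> x + s^2) powr (- 3/4)) \<le> kernel_const"
  "s \<in> {0<..1} \<Longrightarrow> x \<in> unit_box \<Longrightarrow> \<bar>pd k (pd l (biharm s)) x\<bar> \<le> kernel_const * (x \<bullet> x + s^2) powr (- 1/2)"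
  "s \<in> {0<..1} \<Longrightarrow> x \<in> unit_box \<Longrightarrow> \<bar>pd m (pd k (pd l (biharm s))) x\<bar> \<le> kernel_const * (x \<bullet> x + s^2) powr (- 1/2)"
  "s \<in> {0<..1} \<Longrightarrow> x \<in> unit_box \<Longrightarrow> norm x * \<bar>lap (pd k (pd l (biharm s))) x\<bar> \<le> kernel_const * (x \<bullet> x + s^2) powr (- 1/2)"
  "s \<in> {0<..1} \<Longrightarrow> x \<in> unit_box \<Longrightarrow> \<bar>cut_err s (x \<bullet> x)\<bar> \<le> kernel_const"
  "s \<in> {0<..1} \<Longrightarrow> x \<in> unit_box \<Longrightarrow> \<bar>pd l (\<lambda>x. cut_err s (x \<bullet> x)) x\<bar> \<le> kernel_const"
  using someI_ex[OF kernel_constant_exists, folded kernel_const_def] by blast+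

text \<open>Applied with \<open>b\<close> = |Z| and h^2 of size 1/|z|. The function h^3 is
  integrable uniformly in the regularisation, while b^3 is at most b^2 times a bound for b and hence
  small with the energy.\<close>

lemma young_cubic:
  fixes b h \<eta> :: real
  assumes "b \<ge> 0" "h \<ge> 0" "\<eta> > 0"
  shows "b * h^2 \<le> \<eta> * h^3 + b^3 / \<eta>^2"
proof (cases "b \<le> \<eta> * h")
  case True
  then have "b * h^2 \<le> (\<eta> * h) * h^2" by (rule mult_right_mono) simp
  also have "\<dots> = \<eta> * h^3" by (simp add: power3_eq_cube power2_eq_square)
  finally show ?thesis using assms by (simp add: add_increasing2)
next
  case False
  then have "h \<le> b / \<eta>" using assms by (simp add: field_simps)
  then have "h^2 \<le> (b / \<eta>)^2" using assms by (intro power_mono) auto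
  then have "b * h^2 \<le> b * (b / \<eta>)^2" using assms by (intro mult_left_mono) auto
  also have "\<dots> = b^3 / \<eta>^2" by (simp add: power3_eq_cube power2_eq_square)
  finally show ?thesis using assms by (simp add: add_increasing)
qed

lemma integral_lap_supported_eq_0:
  assumes "smooth_on UNIV h" "\<And>x. x \<notin> cball 0 1 \<Longrightarrow> h x = 0"
  shows "integral unit_box (lap h) = (0::real)"
proof -
  have "lap (\<lambda>x. 1) x = (0::real)" for x :: "real^2"
  proof -
    have "pd i (\<lambda>x. c) = (\<lambda>x. 0::real)" for c and i :: 2 by (rule ext) (simp add: pd_eq[OF has_derivative_const])
    then show ?thesis by (simp add: lap_def)
  qed
  then show ?thesis
    using integral_lap_by_parts[OF smooth_on_const[OF open_ball, of 0 2 1] assms] by simp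
qed

lemma continuous_on_unit_box_smooth:
  fixes f :: "real^2 \<Rightarrow> 'b::real_normed_vector"
  shows "smooth_on (ball 0 2) f \<Longrightarrow> continuous_on unit_box f"
  using smooth_on_continuous unit_box_subset_ball continuous_on_subset by blast

text \<open>The rescaled situation, stripped of its geometry: \<open>M\<close> is the ambient metric
  along \<open>\<Psi>\<close>, \<open>G\<close> the Christoffel term that turns the Hessian into the
  covariant one, \<open>E\<close> the conformal factor. The constant \<open>c\<close> is structural,
  \<open>K\<close> bounds the Hessian, \<open>\<omega>\<close> measures the deviation from a flat
  metric. The Willmore equation survives only as \<open>weak\<close>. Functions live on
  \<open>ball 0 2\<close>, integrals on \<open>unit_box\<close>, and test functions are supported in
  \<open>cball 0 1\<close>.\<close>

locale unit_disc =
  fixes \<Psi> :: "real^2 \<Rightarrow> real^'m::finite" and M :: "real^2 \<Rightarrow> real^'m^'m"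
    and G :: "real^2 \<Rightarrow> 2 \<Rightarrow> 2 \<Rightarrow> real^'m" and E :: "real^2 \<Rightarrow> real" and c K \<omega> :: real
  assumes c: "c \<ge> 1" and K: "K \<ge> 0" and om: "0 \<le> \<omega>" "\<omega> \<le> 1"
    and smooth: "smooth_on (ball 0 2) \<Psi>"
    and cont: "continuous_on unit_box M" "\<And>i j. continuous_on unit_box (\<lambda>z. G z i j)" "continuous_on unit_box E"
    and E_bounds: "\<And>z. z \<in> unit_box \<Longrightarrow> 1 / c \<le> E z" "\<And>z. z \<in> unit_box \<Longrightarrow> E z \<le> c"
    and M_sym: "\<And>z u w. z \<in> unit_box \<Longrightarrow> u \<bullet> (M z *v w) = w \<bullet> (M z *v u)"
    and M_pos: "\<And>z w. z \<in> unit_box \<Longrightarrow> norm w ^ 2 / 2 \<le> w \<bullet> (M z *v w)"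
    and M_le: "\<And>z w. z \<in> unit_box \<Longrightarrow> norm (M z *v w) \<le> 2 * norm w"
    and conf: "\<And>z i j. z \<in> unit_box \<Longrightarrow> pd i \<Psi> z \<bullet> (M z *v pd j \<Psi> z) = (if i = j then E z else 0)"
    and D1: "\<And>z i. z \<in> unit_box \<Longrightarrow> norm (pd i \<Psi> z) \<le> c"
    and D2: "\<And>z i j. z \<in> unit_box \<Longrightarrow> norm (pd i (pd j \<Psi>) z) \<le> K"
    and G_le: "\<And>z i j. z \<in> unit_box \<Longrightarrow> norm (G z i j) \<le> \<omega>"
    and M_lip: "\<And>z w. z \<in> unit_box \<Longrightarrow> norm (M z *v w - M 0 *v w) \<le> \<omega> * norm z * norm w"
    and E_lip: "\<And>z. z \<in> unit_box \<Longrightarrow> \<bar>E z - E 0\<bar> \<le> c * (1 + K) * norm z"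
    and G_lip: "\<And>z i j. z \<in> unit_box \<Longrightarrow> norm (G z i j - G 0 i j) \<le> \<omega> * (1 + K) * norm z"
    and weak: "\<And>\<zeta> v. smooth_on UNIV \<zeta> \<Longrightarrow> (\<And>x. x \<notin> cball 0 1 \<Longrightarrow> \<zeta> x = 0) \<Longrightarrow>
      \<bar>integral unit_box (\<lambda>z. (lap \<Psi> z + G z 1 1 + G z 2 2) \<bullet> (M z *v v) / E z * lap \<zeta> z)\<bar>
      \<le> c * (1 + K) * norm v * integral unit_box (\<lambda>z. norm (lap \<Psi> z + G z 1 1 + G z 2 2) * (\<bar>\<zeta> z\<bar> + \<bar>pd 1 \<zeta> z\<bar> + \<bar>pd 2 \<zeta> z\<bar>))"
begin

text \<open>\<open>C2\<close> is the covariant Hessian, \<open>Z\<close> its trace, and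
  \<open>A2\<close> its normal part: the tangent frame is \<open>M\<close>-orthogonal with squared
  length \<open>E\<close>, so projecting amounts to dividing by \<open>E\<close>.\<close>

definition Z :: "real^2 \<Rightarrow> real^'m" where "Z z = lap \<Psi> z + G z 1 1 + G z 2 2"
definition C2 :: "real^2 \<Rightarrow> 2 \<Rightarrow> 2 \<Rightarrow> real^'m" where "C2 z i j = pd i (pd j \<Psi>) z + G z i j"
definition A2 :: "real^2 \<Rightarrow> 2 \<Rightarrow> 2 \<Rightarrow> real^'m" where
  "A2 z i j = C2 z i j - (\<Sum>n\<in>UNIV. (C2 z i j \<bullet> (M z *v pd n \<Psi> z) / E z) *\<^sub>R pd n \<Psi> z)"

lemma zero_mem: "0 \<in> unit_box" by (simp add: unit_box_iff)

lemma E_pos: "z \<in> unit_box \<Longrightarrow> E z > 0"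
  using E_bounds(1)[of z] c by (smt (verit) divide_pos_pos)

lemma inverse_E: "z \<in> unit_box \<Longrightarrow> inverse (E z) \<le> c"
  using E_bounds(1)[of z] E_pos[of z] c by (simp add: field_simps)

lemma cont_Z: "continuous_on unit_box Z"
  unfolding Z_def[abs_def] by (intro continuous_intros cont continuous_on_unit_box_smooth smooth_on_lap smooth open_ball)

lemma cont_A: "continuous_on unit_box (\<lambda>z. A2 z i j)"
  unfolding A2_def C2_def using E_pos
  by (intro continuous_intros cont continuous_on_unit_box_smooth smooth_on_pd smooth bounded_bilinear.continuous_on[OF bounded_bilinear_matrix_vector]) fastforce

lemma Z_le: assumes "z \<in> unit_box" shows "norm (Z z) \<le> 2 * (1 + K)"
  unfolding Z_def lap_def
  using D2[OF assms, of 1 1] D2[OF assms, of 2 2] G_le[OF assms, of 1 1] G_le[OF assms, of 2 2] om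
    norm_triangle_ineq[of "pd 1 (pd 1 \<Psi>) z + pd 2 (pd 2 \<Psi>) z + G z 1 1" "G z 2 2"]
    norm_triangle_ineq[of "pd 1 (pd 1 \<Psi>) z + pd 2 (pd 2 \<Psi>) z" "G z 1 1"]
    norm_triangle_ineq[of "pd 1 (pd 1 \<Psi>) z" "pd 2 (pd 2 \<Psi>) z"] unfolding distrib_left by linarith

lemma pd_linear_form:
  "z \<in> ball 0 2 \<Longrightarrow> pd i (\<lambda>x. w \<bullet> \<Psi> x) z = w \<bullet> pd i \<Psi> z"
  "z \<in> ball 0 2 \<Longrightarrow> pd i (pd j (\<lambda>x. w \<bullet> \<Psi> x)) z = w \<bullet> pd i (pd j \<Psi>) z"
proof -
  show 1: "pd i (\<lambda>x. w \<bullet> \<Psi> x) z = w \<bullet> pd i \<Psi> z" if "z \<in> ball 0 2" for z i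
    by (rule pd_inner_left[OF open_ball that smooth])
  assume z: "z \<in> ball 0 2"
  have "pd i (pd j (\<lambda>x. w \<bullet> \<Psi> x)) z = pd i (\<lambda>x. w \<bullet> pd j \<Psi> x) z"
    by (rule pd_cong_open[OF open_ball z 1])
  also have "\<dots> = w \<bullet> pd i (pd j \<Psi>) z" by (rule pd_inner_left[OF open_ball z smooth_on_pd[OF smooth]])
  finally show "pd i (pd j (\<lambda>x. w \<bullet> \<Psi> x)) z = w \<bullet> pd i (pd j \<Psi>) z" .
qed

text \<open>
  The constant \<open>(M 0 *v v) \<bullet> (G 0 1 1 + G 0 2 2)\<close> may be subtracted since \<open>\<Delta>\<zeta>\<close> has mean zero; after that
  every error carries a factor \<open>|z|\<close>, which tames the singularity of \<open>\<Delta>\<zeta>\<close>.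
\<close>

lemma tested_equation:
  assumes s: "s \<in> {0<..1}" and \<eta>: "0 < \<eta>" and e2: "integral unit_box (\<lambda>z. norm (Z z) ^ 2) \<le> e2"
  shows "\<bar>integral unit_box (\<lambda>x. lap (\<lambda>x. (M 0 *v v) \<bullet> \<Psi> x) x * lap (pd k (pd l (biharm s))) x)\<bar>
    \<le> 20 * c^2 * kernel_const^2 * (1 + K) * norm v * (\<eta> + (1 + K) * e2 / \<eta>^2 + \<omega>)"
proof -
  let ?kc = kernel_const
  let ?\<zeta> = "pd k (pd l (biharm s))"
  let ?h = "\<lambda>x::real^2. (x \<bullet> x + s^2) powr (- 1/2)" and ?h3 = "\<lambda>x::real^2. (x \<bullet> x + s^2) powr (- 3/4)"
  let ?b = "G 0 1 1 + G 0 2 2"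
  note kc = kernel_const[OF s] and kc1 = kernel_const_ge_1
  have s0: "s > 0" "s \<noteq> 0" using s by auto
  have nz: "x \<bullet> x + s^2 \<noteq> 0" for x :: "real^2" using s0 by (simp add: add_nonneg_eq_0_iff)
  have \<zeta>s: "smooth_on UNIV ?\<zeta>" by (intro smooth_on_pd smooth_on_biharm s0)
  have \<zeta>0: "?\<zeta> x = 0" if "x \<notin> cball 0 1" for x
  proof -
    have "pd l (biharm s) y = 0" if "y \<notin> cball 0 1" for y by (rule pd_supported[OF biharm_supported that])
    then show ?thesis using pd_supported[of "pd l (biharm s)"] that by blast
  qed
  note c\<zeta> = smooth_on_UNIV_continuous[OF \<zeta>s] smooth_on_UNIV_continuous[OF smooth_on_pd[OF \<zeta>s]]
    smooth_on_UNIV_continuous[OF smooth_on_lap[OF open_UNIV \<zeta>s]]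
  define P where "P z = Z z \<bullet> (M z *v v) / E z" for z
  define u where "u = (\<lambda>x. (M 0 *v v) \<bullet> \<Psi> x)"
  have us: "smooth_on (ball 0 2) u" unfolding u_def by (rule smooth_on_inner_left[OF open_ball smooth])
  have cP: "continuous_on unit_box P"
    unfolding P_def using E_pos by (intro continuous_intros cont cont_Z bounded_bilinear.continuous_on[OF bounded_bilinear_matrix_vector]) fastforce
  have cu: "continuous_on unit_box (lap u)" by (intro continuous_on_unit_box_smooth smooth_on_lap us open_ball)
  have ch: "continuous_on unit_box ?h" "continuous_on unit_box ?h3" by (intro continuous_tau_powr s0)+
  have lapu: "lap u z = (M 0 *v v) \<bullet> lap \<Psi> z" if "z \<in> unit_box" for z
    using that unit_box_subset_ball unfolding lap_def u_def by (auto simp: pd_linear_form inner_add_right)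
  have M0v: "norm (M 0 *v v) \<le> 2 * norm v" by (rule M_le[OF zero_mem])
  \<comment> \<open>The weak equation has variable coefficients, the representation formula needs
    the flat Laplacian. Freezing \<open>E\<close>, \<open>M\<close> and \<open>G\<close> at the
    centre costs this error, and each of the four pieces in \<open>eq\<close> carries one Lipschitz
    factor |z|.\<close>
  have err: "\<bar>E 0 * P z - lap u z - (M 0 *v v) \<bullet> ?b\<bar> \<le> 7 * c^2 * (1 + K) * norm v * norm z * (norm (Z z) + \<omega>)"
    if z: "z \<in> unit_box" for z
  proof -
    have c2: "c \<le> c^2" "1 \<le> c^2" using c by (auto simp: power2_eq_square intro: one_le_mult_iff[THEN iffD2] order_trans[OF _ mult_left_mono[of 1 c c]])
    have Ez: "E z > 0" by (rule E_pos[OF z])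
    have "(M 0 *v v) \<bullet> lap \<Psi> z = Z z \<bullet> (M 0 *v v) - (G z 1 1 + G z 2 2) \<bullet> (M 0 *v v)"
      by (simp add: Z_def inner_add_left inner_commute[of "M 0 *v v"])
    moreover have "E z * P z = Z z \<bullet> (M z *v v)" using Ez by (simp add: P_def)
    ultimately have eq: "E 0 * P z - lap u z - (M 0 *v v) \<bullet> ?b
       = - ((E z - E 0) * P z) + Z z \<bullet> (M z *v v - M 0 *v v) + (G z 1 1 - G 0 1 1) \<bullet> (M 0 *v v) + (G z 2 2 - G 0 2 2) \<bullet> (M 0 *v v)"
      unfolding lapu[OF z] by (simp add: algebra_simps inner_add_left inner_diff_left inner_diff_right inner_commute)
    have "\<bar>Z z \<bullet> (M z *v v)\<bar> \<le> norm (Z z) * (2 * norm v)"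
      using Cauchy_Schwarz_ineq2[of "Z z" "M z *v v"] M_le[OF z, of v] by (meson mult_left_mono norm_ge_zero order_trans)
    then have "\<bar>P z\<bar> \<le> (norm (Z z) * (2 * norm v)) * c"
      unfolding P_def divide_inverse using inverse_E[OF z] Ez by (intro abs_mult_le) auto
    then have e1: "\<bar>(E z - E 0) * P z\<bar> \<le> (c * (1 + K) * norm z) * ((norm (Z z) * (2 * norm v)) * c)"
      by (intro abs_mult_le E_lip z)
    have "\<bar>Z z \<bullet> (M z *v v - M 0 *v v)\<bar> \<le> norm (Z z) * (\<omega> * norm z * norm v)"
      using Cauchy_Schwarz_ineq2[of "Z z" "M z *v v - M 0 *v v"] M_lip[OF z, of v] by (meson mult_left_mono norm_ge_zero order_trans)
    also have "\<dots> \<le> norm (Z z) * (1 * norm z * norm v)"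
      using om by (intro mult_left_mono mult_right_mono) auto
    also have "\<dots> \<le> c^2 * (1 + K) * (norm (Z z) * (1 * norm z * norm v))"
    proof -
      have "1 * (norm (Z z) * (1 * norm z * norm v)) \<le> c^2 * (1 + K) * (norm (Z z) * (1 * norm z * norm v))"
        using mult_mono[of 1 "c^2" 1 "1 + K"] c2 K by (intro mult_right_mono) auto
      then show ?thesis by simp
    qed
    finally have e2: "\<bar>Z z \<bullet> (M z *v v - M 0 *v v)\<bar> \<le> c^2 * (1 + K) * (norm (Z z) * norm z * norm v)" by simp
    have e3: "\<bar>(G z i j - G 0 i j) \<bullet> (M 0 *v v)\<bar> \<le> c^2 * (1 + K) * (2 * \<omega> * norm z * norm v)" for i j
    proof -
      have "\<bar>(G z i j - G 0 i j) \<bullet> (M 0 *v v)\<bar> \<le> (\<omega> * (1 + K) * norm z) * (2 * norm v)"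
        using Cauchy_Schwarz_ineq2[of "G z i j - G 0 i j" "M 0 *v v"] mult_mono[OF G_lip[OF z] M0v] om K by (meson norm_ge_zero order_trans mult_nonneg_nonneg add_nonneg_nonneg zero_le_one)
      also have "\<dots> = 1 * ((1 + K) * (2 * \<omega> * norm z * norm v))" by simp
      also have "\<dots> \<le> c^2 * ((1 + K) * (2 * \<omega> * norm z * norm v))"
        using c2 om K by (intro mult_right_mono) auto
      finally show ?thesis by simp
    qed
    have "\<bar>E 0 * P z - lap u z - (M 0 *v v) \<bullet> ?b\<bar>
       \<le> (c * (1 + K) * norm z) * ((norm (Z z) * (2 * norm v)) * c) + c^2 * (1 + K) * (norm (Z z) * norm z * norm v)
        + c^2 * (1 + K) * (2 * \<omega> * norm z * norm v) + c^2 * (1 + K) * (2 * \<omega> * norm z * norm v)"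
      unfolding eq using e1 e2 e3[of 1 1] e3[of 2 2] by linarith
    also have "\<dots> = c^2 * (1 + K) * norm v * norm z * (3 * norm (Z z) + 4 * \<omega>)"
      by (simp add: algebra_simps power2_eq_square)
    also have "\<dots> \<le> c^2 * (1 + K) * norm v * norm z * (7 * norm (Z z) + 7 * \<omega>)"
      using K om by (intro mult_left_mono add_mono mult_right_mono mult_nonneg_nonneg) auto
    finally show ?thesis by (simp add: algebra_simps)
  qed
  define I where "I = integral unit_box (\<lambda>z. norm (Z z) * ?h z)"
  define J where "J = integral unit_box ?h"
  have lz0: "integral unit_box (lap ?\<zeta>) = 0" by (rule integral_lap_supported_eq_0[OF \<zeta>s \<zeta>0])
  have cI: "(\<lambda>z. norm (Z z) * ?h z) integrable_on unit_box" "?h integrable_on unit_box"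
    by (intro unit_box_integrable continuous_intros cont_Z ch)+
  have I0: "I \<ge> 0" unfolding I_def by (rule integral_nonneg[OF cI(1)]) simp
  have K1: "0 \<le> c * (1 + K) * norm v" "0 \<le> 7 * c^2 * (1 + K) * norm v" using K c by auto
  have w1: "\<bar>integral unit_box (\<lambda>z. P z * lap ?\<zeta> z)\<bar> \<le> c * (1 + K) * norm v * (3 * ?kc * I)"
  proof -
    have "integral unit_box (\<lambda>z. norm (Z z) * (\<bar>?\<zeta> z\<bar> + \<bar>pd 1 ?\<zeta> z\<bar> + \<bar>pd 2 ?\<zeta> z\<bar>)) \<le> integral unit_box (\<lambda>z. 3 * ?kc * (norm (Z z) * ?h z))"
    proof (rule integral_unit_box_mono)
      fix z assume z: "z \<in> unit_box"
      have "\<bar>?\<zeta> z\<bar> + \<bar>pd 1 ?\<zeta> z\<bar> + \<bar>pd 2 ?\<zeta> z\<bar> \<le> 3 * (?kc * ?h z)"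
        using kc(2,3)[OF z, of k l] kc(3)[OF z, of 1 k l] kc(3)[OF z, of 2 k l] kc(2)[OF z, of k l] by linarith
      then have "norm (Z z) * (\<bar>?\<zeta> z\<bar> + \<bar>pd 1 ?\<zeta> z\<bar> + \<bar>pd 2 ?\<zeta> z\<bar>) \<le> norm (Z z) * (3 * (?kc * ?h z))"
        by (rule mult_left_mono) simp
      then show "norm (Z z) * (\<bar>?\<zeta> z\<bar> + \<bar>pd 1 ?\<zeta> z\<bar> + \<bar>pd 2 ?\<zeta> z\<bar>) \<le> 3 * ?kc * (norm (Z z) * ?h z)" by (simp add: mult_ac)
    qed (intro continuous_intros cont_Z ch c\<zeta>)+
    also have "\<dots> = 3 * ?kc * I" by (simp add: I_def)
    finally show ?thesis
      using weak[OF \<zeta>s \<zeta>0, of v] unfolding P_def Z_def using K1(1) by (meson mult_left_mono order_trans)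
  qed
  have w2: "\<bar>integral unit_box (\<lambda>z. (E 0 * P z - lap u z - (M 0 *v v) \<bullet> ?b) * lap ?\<zeta> z)\<bar>
      \<le> 7 * c^2 * (1 + K) * norm v * ?kc * (I + \<omega> * J)"
  proof -
    have "\<bar>integral unit_box (\<lambda>z. (E 0 * P z - lap u z - (M 0 *v v) \<bullet> ?b) * lap ?\<zeta> z)\<bar>
      \<le> integral unit_box (\<lambda>z. 7 * c^2 * (1 + K) * norm v * ?kc * (norm (Z z) * ?h z + \<omega> * ?h z))"
    proof (rule abs_integral_unit_box_le)
      fix z assume z: "z \<in> unit_box"
      have "\<bar>(E 0 * P z - lap u z - (M 0 *v v) \<bullet> ?b) * lap ?\<zeta> z\<bar>
         \<le> 7 * c^2 * (1 + K) * norm v * norm z * (norm (Z z) + \<omega>) * \<bar>lap ?\<zeta> z\<bar>"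
        by (rule abs_mult_le[OF err[OF z] order_refl])
      also have "\<dots> = 7 * c^2 * (1 + K) * norm v * (norm (Z z) + \<omega>) * (norm z * \<bar>lap ?\<zeta> z\<bar>)" by (simp add: mult_ac)
      also have "\<dots> \<le> 7 * c^2 * (1 + K) * norm v * (norm (Z z) + \<omega>) * (?kc * ?h z)"
        using K1(2) om by (intro mult_left_mono kc(4)[OF z]) auto
      also have "\<dots> = 7 * c^2 * (1 + K) * norm v * ?kc * (norm (Z z) * ?h z + \<omega> * ?h z)" by (simp add: algebra_simps)
      finally show "\<bar>(E 0 * P z - lap u z - (M 0 *v v) \<bullet> ?b) * lap ?\<zeta> z\<bar>
        \<le> 7 * c^2 * (1 + K) * norm v * ?kc * (norm (Z z) * ?h z + \<omega> * ?h z)" .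
    qed (intro continuous_intros cont_Z ch c\<zeta> cP cu)+
    also have "\<dots> = 7 * c^2 * (1 + K) * norm v * ?kc * integral unit_box (\<lambda>z. norm (Z z) * ?h z + \<omega> * ?h z)"
      by (rule integral_mult_right)
    also have "integral unit_box (\<lambda>z. norm (Z z) * ?h z + \<omega> * ?h z) = I + \<omega> * J"
      unfolding I_def J_def by (subst integral_add) (auto intro!: unit_box_integrable continuous_intros cont_Z ch simp: nz)
    finally show ?thesis .
  qed
  have "integral unit_box (\<lambda>z. (E 0 * P z - lap u z - (M 0 *v v) \<bullet> ?b) * lap ?\<zeta> z)
     = integral unit_box (\<lambda>z. E 0 * (P z * lap ?\<zeta> z) - lap u z * lap ?\<zeta> z - (M 0 *v v) \<bullet> ?b * lap ?\<zeta> z)"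
    by (simp add: algebra_simps)
  also have "\<dots> = integral unit_box (\<lambda>z. E 0 * (P z * lap ?\<zeta> z) - lap u z * lap ?\<zeta> z) - integral unit_box (\<lambda>z. (M 0 *v v) \<bullet> ?b * lap ?\<zeta> z)"
    by (intro integral_diff unit_box_integrable continuous_intros c\<zeta> cP cu)
  also have "integral unit_box (\<lambda>z. E 0 * (P z * lap ?\<zeta> z) - lap u z * lap ?\<zeta> z)
      = integral unit_box (\<lambda>z. E 0 * (P z * lap ?\<zeta> z)) - integral unit_box (\<lambda>z. lap u z * lap ?\<zeta> z)"
    by (intro integral_diff unit_box_integrable continuous_intros c\<zeta> cP cu)
  finally have "integral unit_box (\<lambda>z. lap u z * lap ?\<zeta> z) = E 0 * integral unit_box (\<lambda>z. P z * lap ?\<zeta> z)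
      - integral unit_box (\<lambda>z. (E 0 * P z - lap u z - (M 0 *v v) \<bullet> ?b) * lap ?\<zeta> z)"
    using lz0 by simp
  moreover have "\<bar>E 0 * integral unit_box (\<lambda>z. P z * lap ?\<zeta> z)\<bar> \<le> c * (c * (1 + K) * norm v * (3 * ?kc * I))"
    by (rule abs_mult_le[OF _ w1]) (use E_pos[OF zero_mem] E_bounds(2)[OF zero_mem] in auto)
  ultimately have "\<bar>integral unit_box (\<lambda>z. lap u z * lap ?\<zeta> z)\<bar>
     \<le> c * (c * (1 + K) * norm v * (3 * ?kc * I)) + 7 * c^2 * (1 + K) * norm v * ?kc * (I + \<omega> * J)"
    using w2 by linarith
  also have "\<dots> = c^2 * (1 + K) * norm v * ?kc * (10 * I + 7 * (\<omega> * J))"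
    by (simp add: algebra_simps power2_eq_square)
  finally have main: "\<bar>integral unit_box (\<lambda>z. lap u z * lap ?\<zeta> z)\<bar> \<le> c^2 * (1 + K) * norm v * ?kc * (10 * I + 7 * (\<omega> * J))" .
  have hh: "?h x = ((x \<bullet> x + s^2) powr (-1/4))^2" "?h3 x = ((x \<bullet> x + s^2) powr (-1/4))^3" for x
    using s0 by (simp_all add: powr_power add_nonneg_eq_0_iff)
  \<comment> \<open>The smallness of the energy enters here. Cauchy-Schwarz would need 1/|z| in L^2;
    instead \<open>young_cubic\<close> splits the integrand, and |Z|^3 <= 2 (1 + K) |Z|^2 brings
    back the energy.\<close>
  have Ib: "I \<le> \<eta> * ?kc + 2 * (1 + K) * e2 / \<eta>^2"
  proof -
    have "I \<le> integral unit_box (\<lambda>z. \<eta> * ?h3 z + 2 * (1 + K) / \<eta>^2 * norm (Z z) ^ 2)"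
      unfolding I_def
    proof (rule integral_unit_box_mono)
      fix z assume z: "z \<in> unit_box"
      have "norm (Z z) * ?h z \<le> \<eta> * ?h3 z + norm (Z z) ^ 3 / \<eta>^2"
        unfolding hh by (rule young_cubic) (use \<eta> in auto)
      moreover have "norm (Z z) ^ 3 \<le> 2 * (1 + K) * norm (Z z) ^ 2"
        using mult_right_mono[OF Z_le[OF z], of "norm (Z z) ^ 2"] by (simp add: power3_eq_cube power2_eq_square)
      then have "norm (Z z) ^ 3 / \<eta>^2 \<le> 2 * (1 + K) * norm (Z z) ^ 2 / \<eta>^2" by (rule divide_right_mono) simp
      ultimately show "norm (Z z) * ?h z \<le> \<eta> * ?h3 z + 2 * (1 + K) / \<eta>^2 * norm (Z z) ^ 2" by simp
    qed (use \<eta> in \<open>auto intro!: continuous_intros cont_Z ch simp: nz\<close>)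
    also have "\<dots> = \<eta> * integral unit_box ?h3 + 2 * (1 + K) / \<eta>^2 * integral unit_box (\<lambda>z. norm (Z z) ^ 2)"
      by (subst integral_add) (use \<eta> in \<open>auto intro!: unit_box_integrable continuous_intros cont_Z ch simp: nz\<close>)
    also have "\<dots> \<le> \<eta> * ?kc + 2 * (1 + K) / \<eta>^2 * e2"
      using kc(1) e2 \<eta> K by (intro add_mono mult_left_mono) auto
    finally show ?thesis by simp
  qed
  have Jb: "J \<le> 2 * ?kc"
  proof -
    have "J \<le> integral unit_box (\<lambda>z. 2 * ?h3 z)" unfolding J_def
    proof (rule integral_unit_box_mono)
      fix z assume z: "z \<in> unit_box"
      have t: "0 < z \<bullet> z + s^2" "z \<bullet> z + s^2 \<le> 3"
        using normsq_unit_box[OF z] s by (auto simp: add_nonneg_pos power_le_one intro!: add_mono[of _ 2 _ 1, simplified])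
      have "(z \<bullet> z + s^2) powr (1/4) \<le> 3 powr (1/4)" using t by (intro powr_mono2) auto
      also have "\<dots> \<le> 16 powr (1/4)" by (intro powr_mono2) auto
      also have "(16::real) powr (1/4) = 2" using powr_powr[of 2 4 "1/4"] by simp
      finally have "(z \<bullet> z + s^2) powr (1/4) * ?h3 z \<le> 2 * ?h3 z" by (rule mult_right_mono) simp
      then show "?h z \<le> 2 * ?h3 z" by (simp add: powr_add[symmetric])
    qed (intro continuous_intros ch)+
    also have "\<dots> \<le> 2 * ?kc" using kc(1) by simp
    finally show ?thesis .
  qed
  have J0: "J \<ge> 0" unfolding J_def by (rule integral_nonneg[OF cI(2)]) simp
  have "(\<lambda>z. norm (Z z) ^ 2) integrable_on unit_box" by (intro unit_box_integrable continuous_intros cont_Z)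
  from integral_nonneg[OF this] e2 have e20: "e2 \<ge> 0" by simp
  have "10 * I + 7 * (\<omega> * J) \<le> 10 * (\<eta> * ?kc + 2 * (1 + K) * e2 / \<eta>^2) + 7 * (\<omega> * (2 * ?kc))"
    using Ib Jb om by (intro add_mono mult_left_mono) auto
  also have "\<dots> \<le> 10 * (\<eta> * ?kc) + 20 * ((1 + K) * e2 / \<eta>^2) * ?kc + 14 * (\<omega> * ?kc)"
  proof -
    define y where "y = (1 + K) * e2 / \<eta>^2"
    have "20 * y * 1 \<le> 20 * y * ?kc" using kc1 e20 K by (intro mult_left_mono) (auto simp: y_def)
    moreover have "2 * (1 + K) * e2 / \<eta>^2 = 2 * y" by (simp add: y_def)
    ultimately show ?thesis unfolding y_def[symmetric] by (simp add: distrib_left)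
  qed
  also have "\<dots> \<le> 20 * (\<eta> * ?kc) + 20 * ((1 + K) * e2 / \<eta>^2) * ?kc + 20 * (\<omega> * ?kc)"
    using \<eta> om kc1 by (intro add_mono order_refl mult_right_mono) auto
  also have "\<dots> = ?kc * (20 * (\<eta> + (1 + K) * e2 / \<eta>^2 + \<omega>))" by (simp add: algebra_simps)
  finally have "c^2 * (1 + K) * norm v * ?kc * (10 * I + 7 * (\<omega> * J))
     \<le> c^2 * (1 + K) * norm v * ?kc * (?kc * (20 * (\<eta> + (1 + K) * e2 / \<eta>^2 + \<omega>)))"
    using K1 kc1 K c by (intro mult_left_mono) auto
  also have "\<dots> = 20 * c^2 * ?kc^2 * (1 + K) * norm v * (\<eta> + (1 + K) * e2 / \<eta>^2 + \<omega>)"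
    by (simp add: power2_eq_square)
  finally show ?thesis using main unfolding u_def by linarith
qed

end

context unit_disc
begin

definition test_bound :: "real \<Rightarrow> real \<Rightarrow> real" where
  "test_bound \<eta> e2 = 20 * c^2 * kernel_const^2 * (1 + K) * (\<eta> + (1 + K) * e2 / \<eta>^2 + \<omega>)"

text \<open>The bound \<open>R\<close> for the cutoff error is left open because it is obtained in
  two ways: by integrating by parts for an arbitrary direction, and by splitting the Hessian for a
  direction normal at the centre.\<close>

lemma hessian_tested:
  assumes \<eta>: "0 < \<eta>" and e2: "integral unit_box (\<lambda>z. norm (Z z) ^ 2) \<le> e2"
    and R: "\<And>s. s \<in> {0<..1/2} \<Longrightarrow>
      \<bar>integral unit_box (\<lambda>x. pd k (pd l (\<lambda>x. (M 0 *v v) \<bullet> \<Psi> x)) x * cut_err s (x \<bullet> x))\<bar> \<le> R"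
  shows "9 * \<bar>(M 0 *v v) \<bullet> pd k (pd l \<Psi>) 0\<bar> \<le> norm v * test_bound \<eta> e2 + R"
proof -
  have us: "smooth_on (ball 0 2) (\<lambda>x. (M 0 *v v) \<bullet> \<Psi> x)" by (rule smooth_on_inner_left[OF open_ball smooth])
  have "9 * \<bar>pd k (pd l (\<lambda>x. (M 0 *v v) \<bullet> \<Psi> x)) 0\<bar> \<le> norm v * test_bound \<eta> e2 + R"
  proof (rule hessian_representation[OF us])
    fix s :: real assume s: "s \<in> {0<..1/2}"
    then have "s \<in> {0<..1}" by simp
    from tested_equation[OF this \<eta> e2, of v k l]
    have "\<bar>integral unit_box (\<lambda>x. lap (\<lambda>x. (M 0 *v v) \<bullet> \<Psi> x) x * lap (pd k (pd l (biharm s))) x)\<bar> \<le> norm v * test_bound \<eta> e2"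
      by (simp add: test_bound_def mult_ac)
    then show "\<bar>integral unit_box (\<lambda>x. lap (\<lambda>x. (M 0 *v v) \<bullet> \<Psi> x) x * lap (pd k (pd l (biharm s))) x)\<bar>
      + \<bar>integral unit_box (\<lambda>x. pd k (pd l (\<lambda>x. (M 0 *v v) \<bullet> \<Psi> x)) x * cut_err s (x \<bullet> x))\<bar> \<le> norm v * test_bound \<eta> e2 + R"
      using R[OF s] by linarith
  qed
  then show ?thesis by (simp add: pd_linear_form)
qed

text \<open>The direction is the Hessian entry itself, and positivity of \<open>M 0\<close> turns
  the pairing into its squared norm. In the cutoff term one derivative is moved onto
  \<open>cut_err\<close>, leaving only first derivatives of the map, which are bounded by
  \<open>c\<close>. The leading constant is therefore free of \<open>K\<close>.\<close>

lemma hessian_bound: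
  assumes \<eta>: "0 < \<eta>" and e2: "integral unit_box (\<lambda>z. norm (Z z) ^ 2) \<le> e2"
  shows "norm (pd k (pd l \<Psi>) 0) \<le> 8 * c * kernel_const + \<bar>test_bound \<eta> e2\<bar>"
proof -
  define v where "v = pd k (pd l \<Psi>) 0"
  define u where "u = (\<lambda>x. (M 0 *v v) \<bullet> \<Psi> x)"
  have us: "smooth_on (ball 0 2) u" unfolding u_def by (rule smooth_on_inner_left[OF open_ball smooth])
  have M0v: "norm (M 0 *v v) \<le> 2 * norm v" by (rule M_le[OF zero_mem])
  have ul: "\<bar>pd l u z\<bar> \<le> 2 * norm v * c" if z: "z \<in> unit_box" for z
  proof -
    have "pd l u z = (M 0 *v v) \<bullet> pd l \<Psi> z"
      unfolding u_def using z unit_box_subset_ball by (intro pd_linear_form) auto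
    then show ?thesis
      using order_trans[OF Cauchy_Schwarz_ineq2 mult_mono[OF M0v D1[OF z, of l]]] by simp
  qed
  have "\<bar>integral unit_box (\<lambda>x. pd k (pd l u) x * cut_err s (x \<bullet> x))\<bar> \<le> 4 * (2 * norm v * c * kernel_const)"
    if s: "s \<in> {0<..1/2}" for s
  proof -
    have s0: "s > 0" "s \<in> {0<..1}" using s by auto
    note sc = smooth_on_cut_err[OF s0(1)]
    have "integral unit_box (\<lambda>x. pd k (pd l u) x * cut_err s (x \<bullet> x)) = - integral unit_box (\<lambda>x. pd l u x * pd k (\<lambda>x. cut_err s (x \<bullet> x)) x)"
      by (rule integral_by_parts[OF smooth_on_pd[OF us] sc cut_err_supported[OF s0(1)]])
    moreover have "\<bar>integral unit_box (\<lambda>x. pd l u x * pd k (\<lambda>x. cut_err s (x \<bullet> x)) x)\<bar> \<le> integral unit_box (\<lambda>x. 2 * norm v * c * kernel_const)"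
      by (rule abs_integral_unit_box_le)
        (intro continuous_intros continuous_on_unit_box_smooth smooth_on_pd us smooth_on_UNIV_continuous sc abs_mult_le ul kernel_const(6)[OF s0(2)]; assumption)+
    moreover have "integral unit_box (\<lambda>x. 2 * norm v * c * kernel_const) = 4 * (2 * norm v * c * kernel_const)"
      using measure_unit_box by (simp add: unit_box_def)
    ultimately show ?thesis by linarith
  qed
  from hessian_tested[OF \<eta> e2 this[unfolded u_def]]
  have "9 * \<bar>(M 0 *v v) \<bullet> v\<bar> \<le> norm v * test_bound \<eta> e2 + 4 * (2 * norm v * c * kernel_const)"
    by (simp add: v_def)
  moreover have "norm v ^ 2 / 2 \<le> (M 0 *v v) \<bullet> v" using M_pos[OF zero_mem, of v] by (simp add: inner_commute)
  ultimately have "norm v * norm v \<le> norm v * (8 * c * kernel_const + \<bar>test_bound \<eta> e2\<bar>)"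
    using mult_left_mono[OF abs_ge_self[of "test_bound \<eta> e2"], of "norm v"] mult_nonneg_nonneg[of "norm v" "\<bar>test_bound \<eta> e2\<bar>"]
      mult_nonneg_nonneg[of "norm v * c" kernel_const] kernel_const_ge_1 c
    by (simp add: power2_eq_square distrib_left mult_ac)
  then show ?thesis unfolding v_def[symmetric]
    using kernel_const_ge_1 c by (cases "norm v = 0") (auto intro: add_nonneg_nonneg)
qed

text \<open>With \<open>v\<close> the normal part at the centre, the cutoff term is estimated
  without integrating by parts. The normal part of the Hessian is small in L^2. The tangential part
  is of size K + \<omega> and meets \<open>M 0 *v v\<close> only through the rotation of the tangent
  plane, of size K.\<close>

lemma second_ff_bound:
  assumes \<eta>: "0 < \<eta>" and e2: "integral unit_box (\<lambda>z. norm (Z z) ^ 2) \<le> e2"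
    and e2A: "integral unit_box (\<lambda>z. norm (A2 z k l) ^ 2) \<le> e2"
  shows "norm (A2 0 k l) \<le> \<bar>test_bound \<eta> e2\<bar> + kernel_const * (8 * \<eta> + 2 * e2 / \<eta> + 128 * c^2 * K * (K + \<omega>) + 12 * \<omega>)"
proof -
  define v where "v = A2 0 k l"
  define u where "u = (\<lambda>x. (M 0 *v v) \<bullet> \<Psi> x)"
  let ?kc = kernel_const
  have us: "smooth_on (ball 0 2) u" unfolding u_def by (rule smooth_on_inner_left[OF open_ball smooth])
  have M0v: "norm (M 0 *v v) \<le> 2 * norm v" by (rule M_le[OF zero_mem])
  have E0: "E 0 > 0" by (rule E_pos[OF zero_mem])
  have orth: "(M 0 *v v) \<bullet> pd n \<Psi> 0 = 0" for n
  proof -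
    have "(M 0 *v v) \<bullet> pd n \<Psi> 0 = v \<bullet> (M 0 *v pd n \<Psi> 0)"
      using M_sym[OF zero_mem, of v "pd n \<Psi> 0"] by (simp add: inner_commute)
    also have "\<dots> = 0"
      using exhaust_2[of n] E0 unfolding v_def A2_def
      by (auto simp: inner_diff_left inner_add_left sum_2 conf[OF zero_mem])
    finally show ?thesis .
  qed
  \<comment> \<open>\<open>M 0 *v v\<close> annihilates the tangent vectors at 0, and on the box
    these move by at most \<open>4 * K\<close>.\<close>
  have near: "\<bar>(M 0 *v v) \<bullet> pd n \<Psi> z\<bar> \<le> 8 * K * norm v" if z: "z \<in> unit_box" for z n
  proof -
    have "norm (pd n \<Psi> z - pd n \<Psi> 0) \<le> real CARD(2) * K * norm (z - 0)"
      by (rule pd_lipschitz[OF _ open_ball unit_box_subset_ball smooth_on_pd[OF smooth] _ z zero_mem])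
        (use D2 in \<open>auto simp: unit_box_def convex_box\<close>)
    also have "\<dots> \<le> 2 * K * 2" using z unit_box_subset_ball K by (intro mult_mono) auto
    finally have d: "norm (pd n \<Psi> z - pd n \<Psi> 0) \<le> 4 * K" by simp
    have "(M 0 *v v) \<bullet> pd n \<Psi> z = (M 0 *v v) \<bullet> (pd n \<Psi> z - pd n \<Psi> 0)" by (simp add: inner_diff_right orth)
    then have "\<bar>(M 0 *v v) \<bullet> pd n \<Psi> z\<bar> \<le> (2 * norm v) * (4 * K)"
      using order_trans[OF Cauchy_Schwarz_ineq2 mult_mono[OF M0v d]] by simp
    then show ?thesis by (simp add: mult_ac)
  qed
  have hess: "\<bar>pd k (pd l u) z\<bar> \<le> norm v * (2 * norm (A2 z k l) + (32 * c^2 * K * (K + \<omega>) + 2 * \<omega>))" if z: "z \<in> unit_box" for z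
  proof -
    have z2: "z \<in> ball 0 2" using z unit_box_subset_ball by blast
    have "norm (C2 z k l) \<le> K + \<omega>"
      unfolding C2_def using norm_triangle_ineq[of "pd k (pd l \<Psi>) z" "G z k l"] D2[OF z, of k l] G_le[OF z, of k l] by linarith
    moreover have "norm (M z *v pd n \<Psi> z) \<le> 2 * c" for n using M_le[OF z, of "pd n \<Psi> z"] D1[OF z, of n] by linarith
    ultimately have "\<bar>C2 z k l \<bullet> (M z *v pd n \<Psi> z)\<bar> \<le> (K + \<omega>) * (2 * c)" for n
      using order_trans[OF Cauchy_Schwarz_ineq2 mult_mono] K om c by (meson add_nonneg_nonneg norm_ge_zero)
    then have "\<bar>C2 z k l \<bullet> (M z *v pd n \<Psi> z) / E z\<bar> \<le> (K + \<omega>) * (2 * c) * c" for n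
      unfolding divide_inverse by (rule abs_mult_le) (use inverse_E[OF z] E_pos[OF z] in auto)
    then have t: "\<bar>(C2 z k l \<bullet> (M z *v pd n \<Psi> z) / E z) * ((M 0 *v v) \<bullet> pd n \<Psi> z)\<bar> \<le> (K + \<omega>) * (2 * c) * c * (8 * K * norm v)" for n
      using near[OF z] by (rule abs_mult_le)
    have q: "pd k (pd l \<Psi>) z = A2 z k l + (\<Sum>n\<in>UNIV. (C2 z k l \<bullet> (M z *v pd n \<Psi> z) / E z) *\<^sub>R pd n \<Psi> z) - G z k l"
      by (simp add: A2_def) (simp add: C2_def)
    have "pd k (pd l u) z = (M 0 *v v) \<bullet> A2 z k l
        + ((C2 z k l \<bullet> (M z *v pd 1 \<Psi> z) / E z) * ((M 0 *v v) \<bullet> pd 1 \<Psi> z)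
        + (C2 z k l \<bullet> (M z *v pd 2 \<Psi> z) / E z) * ((M 0 *v v) \<bullet> pd 2 \<Psi> z)) - (M 0 *v v) \<bullet> G z k l"
      unfolding u_def pd_linear_form(2)[OF z2] q by (simp add: inner_diff_right inner_add_right sum_2)
    moreover have "\<bar>(M 0 *v v) \<bullet> A2 z k l\<bar> \<le> (2 * norm v) * norm (A2 z k l)"
      using order_trans[OF Cauchy_Schwarz_ineq2 mult_mono[OF M0v order_refl]] by simp
    moreover have "\<bar>(M 0 *v v) \<bullet> G z k l\<bar> \<le> (2 * norm v) * \<omega>"
      using order_trans[OF Cauchy_Schwarz_ineq2 mult_mono[OF M0v G_le[OF z]]] by simp
    ultimately have "\<bar>pd k (pd l u) z\<bar> \<le> (2 * norm v) * norm (A2 z k l) + ((K + \<omega>) * (2 * c) * c * (8 * K * norm v)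
        + (K + \<omega>) * (2 * c) * c * (8 * K * norm v)) + (2 * norm v) * \<omega>"
      using t[of 1] t[of 2] by linarith
    also have "\<dots> = norm v * (2 * norm (A2 z k l) + (32 * c^2 * K * (K + \<omega>) + 2 * \<omega>))"
      by (simp add: algebra_simps power2_eq_square)
    finally show ?thesis .
  qed
  define D where "D = 32 * c^2 * K * (K + \<omega>) + 2 * \<omega>"
  have D0: "D \<ge> 0" unfolding D_def using K om by simp
  define R where "R = norm v * ?kc * (8 * \<eta> + 2 * e2 / \<eta> + 4 * D)"
  have "\<bar>integral unit_box (\<lambda>x. pd k (pd l u) x * cut_err s (x \<bullet> x))\<bar> \<le> R"
    if s: "s \<in> {0<..1/2}" for s
  proof -
    have s0: "s > 0" "s \<in> {0<..1}" using s by auto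
    note sc = smooth_on_cut_err[OF s0(1)]
    have "\<bar>integral unit_box (\<lambda>x. pd k (pd l u) x * cut_err s (x \<bullet> x))\<bar>
      \<le> integral unit_box (\<lambda>z. norm v * ?kc * (2 * \<eta> + D) + norm v * ?kc * 2 / \<eta> * norm (A2 z k l) ^ 2)"
    proof (rule abs_integral_unit_box_le)
      fix z assume z: "z \<in> unit_box"
      \<comment> \<open>Linear in \<open>A2\<close> but known only in L^2: either the value is below
        \<open>\<eta>\<close> or it is dominated by its square over \<open>\<eta>\<close>.\<close>
      have "norm (A2 z k l) \<le> \<eta> + norm (A2 z k l) ^ 2 / \<eta>"
      proof (cases "norm (A2 z k l) \<le> \<eta>")
        case True then show ?thesis using \<eta> by (simp add: add_increasing2)
      next
        case False
        then have "norm (A2 z k l) * \<eta> \<le> norm (A2 z k l) ^ 2" using \<eta> by (simp add: power2_eq_square mult_left_mono)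
        then have "norm (A2 z k l) \<le> norm (A2 z k l) ^ 2 / \<eta>" using \<eta> by (simp add: field_simps)
        then show ?thesis using \<eta> by linarith
      qed
      then have "norm v * (2 * norm (A2 z k l) + D) \<le> norm v * (2 * (\<eta> + norm (A2 z k l) ^ 2 / \<eta>) + D)"
        by (intro mult_left_mono) auto
      then have "\<bar>pd k (pd l u) z * cut_err s (z \<bullet> z)\<bar> \<le> norm v * (2 * (\<eta> + norm (A2 z k l) ^ 2 / \<eta>) + D) * ?kc"
        using hess[OF z, folded D_def] by (intro abs_mult_le kernel_const(5)[OF s0(2) z]) simp
      also have "\<dots> = norm v * ?kc * (2 * \<eta> + D) + norm v * ?kc * 2 / \<eta> * norm (A2 z k l) ^ 2"
        by (simp add: algebra_simps)
      finally show "\<bar>pd k (pd l u) z * cut_err s (z \<bullet> z)\<bar> \<le> norm v * ?kc * (2 * \<eta> + D) + norm v * ?kc * 2 / \<eta> * norm (A2 z k l) ^ 2" .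
    next
      show "continuous_on unit_box (\<lambda>x. pd k (pd l u) x * cut_err s (x \<bullet> x))"
        by (intro continuous_on_mult continuous_on_unit_box_smooth smooth_on_pd us smooth_on_UNIV_continuous[OF sc])
    qed (use \<eta> in \<open>auto intro!: continuous_intros cont_A\<close>)
    also have "\<dots> = integral unit_box (\<lambda>z. norm v * ?kc * (2 * \<eta> + D)) + integral unit_box (\<lambda>z. norm v * ?kc * 2 / \<eta> * norm (A2 z k l) ^ 2)"
      by (rule integral_add) (use \<eta> in \<open>auto intro!: unit_box_integrable continuous_intros cont_A\<close>)
    also have "integral unit_box (\<lambda>z. norm v * ?kc * (2 * \<eta> + D)) = 4 * (norm v * ?kc * (2 * \<eta> + D))"
      using measure_unit_box by (simp add: unit_box_def)
    also have "integral unit_box (\<lambda>z. norm v * ?kc * 2 / \<eta> * norm (A2 z k l) ^ 2) = norm v * ?kc * 2 / \<eta> * integral unit_box (\<lambda>z. norm (A2 z k l) ^ 2)"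
      by (rule integral_mult_right)
    also have "\<dots> \<le> norm v * ?kc * 2 / \<eta> * e2" using \<eta> kernel_const_ge_1 by (intro mult_left_mono e2A) auto
    finally show ?thesis by (simp add: R_def algebra_simps)
  qed
  from hessian_tested[OF \<eta> e2 this[unfolded u_def]]
  have T: "9 * \<bar>(M 0 *v v) \<bullet> pd k (pd l \<Psi>) 0\<bar> \<le> norm v * test_bound \<eta> e2 + R" .
  have "(M 0 *v v) \<bullet> pd k (pd l \<Psi>) 0 = (M 0 *v v) \<bullet> v - (M 0 *v v) \<bullet> G 0 k l"
  proof -
    have "pd k (pd l \<Psi>) 0 = v + (\<Sum>n\<in>UNIV. (C2 0 k l \<bullet> (M 0 *v pd n \<Psi> 0) / E 0) *\<^sub>R pd n \<Psi> 0) - G 0 k l"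
      unfolding v_def by (simp add: A2_def) (simp add: C2_def)
    then show ?thesis by (simp add: inner_diff_right inner_add_right sum_2 orth)
  qed
  moreover have "norm v ^ 2 / 2 \<le> (M 0 *v v) \<bullet> v" using M_pos[OF zero_mem, of v] by (simp add: inner_commute)
  moreover have "\<bar>(M 0 *v v) \<bullet> G 0 k l\<bar> \<le> (2 * norm v) * \<omega>"
    using order_trans[OF Cauchy_Schwarz_ineq2 mult_mono[OF M0v G_le[OF zero_mem]]] by simp
  ultimately have "9 * (norm v ^ 2 / 2) \<le> norm v * test_bound \<eta> e2 + R + 9 * (2 * norm v * \<omega>)" using T by linarith
  also have "norm v * test_bound \<eta> e2 \<le> norm v * \<bar>test_bound \<eta> e2\<bar>" by (intro mult_left_mono) auto
  finally have f: "9 * (norm v ^ 2 / 2) \<le> norm v * (\<bar>test_bound \<eta> e2\<bar> + ?kc * (8 * \<eta> + 2 * e2 / \<eta> + 4 * D) + 18 * \<omega>)"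
    by (simp add: R_def algebra_simps)
  have "9/2 * norm v \<le> \<bar>test_bound \<eta> e2\<bar> + ?kc * (8 * \<eta> + 2 * e2 / \<eta> + 4 * D) + 18 * \<omega>"
  proof (cases "norm v = 0")
    case True
    have "(\<lambda>z. norm (Z z) ^ 2) integrable_on unit_box" by (intro unit_box_integrable continuous_intros cont_Z)
    from integral_nonneg[OF this] e2 have "e2 \<ge> 0" by simp
    then show ?thesis using True D0 om \<eta> kernel_const_ge_1 by simp
  next
    case False
    then have "norm v > 0" by simp
    moreover have "norm v * (9/2 * norm v) \<le> norm v * (\<bar>test_bound \<eta> e2\<bar> + ?kc * (8 * \<eta> + 2 * e2 / \<eta> + 4 * D) + 18 * \<omega>)"
      using f by (simp add: power2_eq_square)
    ultimately show ?thesis by (simp only: mult_le_cancel_left_pos)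
  qed
  from mult_left_mono[OF this, of 2] have h: "9 * norm v \<le> 2 * (\<bar>test_bound \<eta> e2\<bar> + ?kc * (8 * \<eta> + 2 * e2 / \<eta> + 4 * D) + 18 * \<omega>)" by simp
  have "18 * \<omega> \<le> ?kc * (18 * \<omega>)" using kernel_const_ge_1 om mult_right_mono[of 1 ?kc "18 * \<omega>"] by simp
  then have "9 * norm v \<le> 2 * (\<bar>test_bound \<eta> e2\<bar> + ?kc * (8 * \<eta> + 2 * e2 / \<eta> + 4 * D + 18 * \<omega>))" using h by (simp add: distrib_left)
  moreover have "0 \<le> ?kc * (8 * \<eta> + 2 * e2 / \<eta> + 4 * D)"
  proof -
    have "(\<lambda>z. norm (Z z) ^ 2) integrable_on unit_box" by (intro unit_box_integrable continuous_intros cont_Z)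
    from integral_nonneg[OF this] e2 have "e2 \<ge> 0" by simp
    then show ?thesis using kernel_const_ge_1 \<eta> D0 by (intro mult_nonneg_nonneg) auto
  qed
  ultimately have "9 * norm v \<le> 9 * (\<bar>test_bound \<eta> e2\<bar> + ?kc * (8 * \<eta> + 2 * e2 / \<eta> + 4 * D) + ?kc * (4 * \<omega>))"
    by (simp add: distrib_left)
  then have "norm v \<le> \<bar>test_bound \<eta> e2\<bar> + ?kc * (8 * \<eta> + 2 * e2 / \<eta> + 4 * D) + ?kc * (4 * \<omega>)"
    by (simp only: mult_le_cancel_left_pos zero_less_numeral)
  also have "\<dots> = \<bar>test_bound \<eta> e2\<bar> + ?kc * (8 * \<eta> + 2 * e2 / \<eta> + 128 * c^2 * K * (K + \<omega>) + 12 * \<omega>)"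
    by (simp add: D_def algebra_simps)
  finally show ?thesis by (simp add: v_def)
qed

end

subsection \<open>The Willmore integrand\<close>

definition gram :: "real^'m^'m::finite \<Rightarrow> (2 \<Rightarrow> real^'m) \<Rightarrow> 2 \<Rightarrow> 2 \<Rightarrow> real" where
  "gram M p i j = p i \<bullet> (M *v p j)"

definition gram_det :: "real^'m^'m::finite \<Rightarrow> (2 \<Rightarrow> real^'m) \<Rightarrow> real" where
  "gram_det M p = gram M p 1 1 * gram M p 2 2 - gram M p 1 2 ^ 2"

text \<open>The trace of \<open>C\<close> with respect to the induced metric, multiplied by the Gram
  determinant so that no inverse matrix occurs.\<close>

definition mean_num :: "real^'m^'m::finite \<Rightarrow> (2 \<Rightarrow> real^'m) \<Rightarrow> (2 \<Rightarrow> 2 \<Rightarrow> real^'m) \<Rightarrow> real^'m" where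
  "mean_num M p C = gram M p 2 2 *\<^sub>R C 1 1 - gram M p 1 2 *\<^sub>R (C 1 2 + C 2 1) + gram M p 1 1 *\<^sub>R C 2 2"

text \<open>The integrand |H|^2 times area, written as an explicit algebraic expression in metric,
  first and covariant second derivatives. The subtracted bracket is the tangential part of the
  trace, formed with the adjugate of the Gram matrix.\<close>

definition dens :: "real^'m^'m::finite \<Rightarrow> (2 \<Rightarrow> real^'m) \<Rightarrow> (2 \<Rightarrow> 2 \<Rightarrow> real^'m) \<Rightarrow> real" where
  "dens M p C = ((mean_num M p C \<bullet> (M *v mean_num M p C)) * gram_det M p
     - (gram M p 2 2 * (mean_num M p C \<bullet> (M *v p 1))^2
        - 2 * gram M p 1 2 * (mean_num M p C \<bullet> (M *v p 1)) * (mean_num M p C \<bullet> (M *v p 2))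
        + gram M p 1 1 * (mean_num M p C \<bullet> (M *v p 2))^2)) / (4 * gram_det M p ^ 2 * sqrt (gram_det M p))"

text \<open>With first derivatives scaled by s0 and second ones by s0/\<rho>, the factor is
  1/\<rho>^2, which the area element cancels: the scale invariance of the Willmore energy.\<close>

lemma dens_scale:
  assumes s: "s > 0"
  shows "dens M (\<lambda>i. s *\<^sub>R p i) (\<lambda>i j. r *\<^sub>R C i j) = r^2 / s^2 * dens M p C"
proof -
  have g: "gram M (\<lambda>i. s *\<^sub>R p i) i j = s^2 * gram M p i j" for i j
    by (simp add: gram_def matrix_vector_mult_scaleR power2_eq_square)
  have d: "gram_det M (\<lambda>i. s *\<^sub>R p i) = s^4 * gram_det M p"
    by (simp add: gram_det_def g algebra_simps power2_eq_square power4_eq_xxxx)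
  have n: "mean_num M (\<lambda>i. s *\<^sub>R p i) (\<lambda>i j. r *\<^sub>R C i j) = (s^2 * r) *\<^sub>R mean_num M p C"
    by (simp add: mean_num_def g scaleR_add_right scaleR_diff_right mult_ac)
  have sq: "sqrt (s^4 * gram_det M p) = s^2 * sqrt (gram_det M p)"
  proof -
    have "sqrt (s^4) = s^2" by (rule real_sqrt_unique) (auto simp: power_mult[symmetric])
    then show ?thesis by (simp add: real_sqrt_mult)
  qed
  define N where "N = mean_num M p C"
  define D where "D = gram_det M p"
  define X where "X = (N \<bullet> (M *v N)) * D - (gram M p 2 2 * (N \<bullet> (M *v p 1))^2
        - 2 * gram M p 1 2 * (N \<bullet> (M *v p 1)) * (N \<bullet> (M *v p 2)) + gram M p 1 1 * (N \<bullet> (M *v p 2))^2)"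
  define a1 a2 a3 where "a1 = N \<bullet> (M *v p 1)" and "a2 = N \<bullet> (M *v p 2)" and "a3 = N \<bullet> (M *v N)"
  have num: "((s^2 * r) * ((s^2 * r) * a3)) * (s^4 * D) - (s^2 * gram M p 2 2 * (s * ((s^2 * r) * a1))^2
     - 2 * (s^2 * gram M p 1 2) * (s * ((s^2 * r) * a1)) * (s * ((s^2 * r) * a2)) + s^2 * gram M p 1 1 * (s * ((s^2 * r) * a2))^2) = s^8 * r^2 * X"
    unfolding X_def a1_def[symmetric] a2_def[symmetric] a3_def[symmetric] by algebra
  have "dens M (\<lambda>i. s *\<^sub>R p i) (\<lambda>i j. r *\<^sub>R C i j) = (s^8 * r^2 * X) / (4 * (s^4 * D)^2 * (s^2 * sqrt D))"
    unfolding dens_def n d sq g N_def[symmetric] D_def[symmetric] sq[folded D_def] num[symmetric]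
    by (simp only: matrix_vector_mult_scaleR inner_scaleR_left inner_scaleR_right a1_def a2_def a3_def)
  also have "\<dots> = r^2 / s^2 * (X / (4 * D^2 * sqrt D))"
    using s by (simp add: power_mult_distrib power_mult[symmetric])
  finally show ?thesis by (simp add: dens_def X_def N_def D_def)
qed

lemma matrix_inv_eqI:
  fixes A B :: "real^'n::finite^'n"
  assumes "A ** B = mat 1" "B ** A = mat 1" shows "matrix_inv A = B"
  unfolding matrix_inv_def
proof (rule some_equality)
  fix B' assume "A ** B' = mat 1 \<and> B' ** A = mat 1"
  then have "B' = B' ** (A ** B)" using assms by simp
  also have "\<dots> = B" using \<open>A ** B' = mat 1 \<and> B' ** A = mat 1\<close> by (simp add: matrix_mul_assoc)
  finally show "B' = B" .
qed (use assms in simp)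

lemma ginner_eq: "ginner g y u v = u \<bullet> (g y *v v)"
  unfolding ginner_def inner_vec_def matrix_vector_mult_def
  by (simp add: sum_distrib_left mult_ac)

lemma matrix_sym_inner: "transpose A = A \<Longrightarrow> u \<bullet> (A *v w) = w \<bullet> (A *v (u::real^'n::finite))"
  by (metis dot_lmul_matrix inner_commute vector_transpose_matrix transpose_matrix_vector)

lemma induced_metric_inverse:
  assumes sym: "transpose (g (F x)) = g (F x)"
  defines "G \<equiv> gram (g (F x)) (\<lambda>i. pd i F x)" and "D \<equiv> gram_det (g (F x)) (\<lambda>i. pd i F x)"
  assumes D: "D \<noteq> 0"
  shows "matrix_inv (induced_metric g F x) $ 1 $ 1 = G 2 2 / D" "matrix_inv (induced_metric g F x) $ 1 $ 2 = - (G 1 2 / D)"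
    "matrix_inv (induced_metric g F x) $ 2 $ 1 = - (G 1 2 / D)" "matrix_inv (induced_metric g F x) $ 2 $ 2 = G 1 1 / D"
proof -
  define B :: "real^2^2" where "B = vector [vector [G 2 2 / D, - (G 1 2 / D)], vector [- (G 1 2 / D), G 1 1 / D]]"
  have s: "G 2 1 = G 1 2" unfolding G_def gram_def by (rule matrix_sym_inner[OF sym])
  have Dd: "D = G 1 1 * G 2 2 - G 1 2 * G 1 2" by (simp add: D_def gram_det_def G_def power2_eq_square)
  have I: "induced_metric g F x $ i $ j = G i j" for i j by (simp add: induced_metric_def ginner_eq G_def gram_def)
  have "induced_metric g F x ** B = mat 1" "B ** induced_metric g F x = mat 1"
    using D unfolding vec_eq_iff forall_2 matrix_matrix_mult_def mat_def
    by (simp_all add: I s B_def sum_2 field_simps) (simp_all add: Dd)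
  then have "matrix_inv (induced_metric g F x) = B" by (rule matrix_inv_eqI)
  then show "matrix_inv (induced_metric g F x) $ 1 $ 1 = G 2 2 / D" "matrix_inv (induced_metric g F x) $ 1 $ 2 = - (G 1 2 / D)"
    "matrix_inv (induced_metric g F x) $ 2 $ 1 = - (G 1 2 / D)" "matrix_inv (induced_metric g F x) $ 2 $ 2 = G 1 1 / D"
    by (simp_all add: B_def)
qed

lemma willmore_integrand_eq:
  assumes sym: "transpose (g (F x)) = g (F x)" and D: "gram_det (g (F x)) (\<lambda>i. pd i F x) > 0"
  shows "ginner g (F x) (mean_curv g F x) (mean_curv g F x) * area_density g F x
    = dens (g (F x)) (\<lambda>i. pd i F x) (cov_deriv2 g F x)"
proof -
  define M where "M = g (F x)"
  define p where "p = (\<lambda>i. pd i F x)"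
  define C where "C = cov_deriv2 g F x"
  define G where "G = gram M p"
  define d where "d = gram_det M p"
  have d0: "d > 0" using D by (simp add: d_def M_def p_def)
  have ip: "u \<bullet> (M *v w) = w \<bullet> (M *v u)" for u w unfolding M_def by (rule matrix_sym_inner[OF sym])
  note inv = induced_metric_inverse[of g F x, OF sym, folded M_def p_def, folded d_def G_def, OF less_imp_neq[OF d0, symmetric]]
  define a where "a = G 2 2 / d" define b where "b = - (G 1 2 / d)" define e where "e = G 1 1 / d"
  note inv' = inv[folded a_def b_def e_def]
  have G21: "G 2 1 = G 1 2" unfolding G_def gram_def by (rule ip)
  have Dd: "d = G 1 1 * G 2 2 - G 1 2 * G 1 2" by (simp add: d_def gram_det_def G_def power2_eq_square)
  define T where "T = a *\<^sub>R C 1 1 + b *\<^sub>R (C 1 2 + C 2 1) + e *\<^sub>R C 2 2"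
  define t1 where "t1 = T \<bullet> (M *v p 1)" define t2 where "t2 = T \<bullet> (M *v p 2)"
  define al where "al = a * t1 + b * t2" define be where "be = b * t1 + e * t2"
  have np: "normal_proj g F x v = v - ((a * (v \<bullet> (M *v p 1)) + b * (v \<bullet> (M *v p 2))) *\<^sub>R p 1
      + (b * (v \<bullet> (M *v p 1)) + e * (v \<bullet> (M *v p 2))) *\<^sub>R p 2)" for v
    unfolding normal_proj_def sum_2 inv' ginner_eq M_def[symmetric] p_def
    by (simp add: algebra_simps)
  have H: "mean_curv g F x = (1/2) *\<^sub>R (T - (al *\<^sub>R p 1 + be *\<^sub>R p 2))"
  proof -
    have "mean_curv g F x = (1/2) *\<^sub>R (a *\<^sub>R normal_proj g F x (C 1 1) + b *\<^sub>R normal_proj g F x (C 1 2)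
      + (b *\<^sub>R normal_proj g F x (C 2 1) + e *\<^sub>R normal_proj g F x (C 2 2)))"
      unfolding mean_curv_def second_ff_def C_def sum_2 inv' ..
    also have "\<dots> = (1/2) *\<^sub>R (T - (al *\<^sub>R p 1 + be *\<^sub>R p 2))"
      unfolding np al_def be_def t1_def t2_def T_def
      by (simp add: inner_add_left scaleR_add_left scaleR_add_right scaleR_diff_right algebra_simps)
    finally show ?thesis .
  qed
  have r1: "al * G 1 1 + be * G 1 2 = t1" and r2: "al * G 1 2 + be * G 2 2 = t2"
  proof -
    have "a * G 1 1 + b * G 1 2 = 1" "a * G 1 2 + b * G 2 2 = 0" "b * G 1 1 + e * G 1 2 = 0" "b * G 1 2 + e * G 2 2 = 1"
      unfolding a_def b_def e_def using d0 by (simp_all add: field_simps) (simp_all add: Dd)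
    then show "al * G 1 1 + be * G 1 2 = t1" "al * G 1 2 + be * G 2 2 = t2"
      unfolding al_def be_def by algebra+
  qed
  have "ginner g (F x) (mean_curv g F x) (mean_curv g F x)
     = 1/4 * ((T - (al *\<^sub>R p 1 + be *\<^sub>R p 2)) \<bullet> (M *v (T - (al *\<^sub>R p 1 + be *\<^sub>R p 2))))"
    unfolding ginner_eq H M_def[symmetric] by (simp add: matrix_vector_mult_scaleR)
  also have "(T - (al *\<^sub>R p 1 + be *\<^sub>R p 2)) \<bullet> (M *v (T - (al *\<^sub>R p 1 + be *\<^sub>R p 2)))
     = T \<bullet> (M *v T) - 2 * al * t1 - 2 * be * t2 + (al * (al * G 1 1 + be * G 1 2) + be * (al * G 1 2 + be * G 2 2))"
    unfolding t1_def t2_def G_def gram_def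
    using ip[of "p 1" T] ip[of "p 2" T] ip[of "p 2" "p 1"]
    by (simp add: matrix_vector_mult_diff_distrib matrix_vector_right_distrib matrix_vector_mult_scaleR
        inner_diff_left inner_diff_right inner_add_left inner_add_right algebra_simps)
  also have "\<dots> = T \<bullet> (M *v T) - (a * t1^2 + 2 * b * t1 * t2 + e * t2^2)"
    unfolding r1 r2 by (simp add: al_def be_def algebra_simps power2_eq_square)
  finally have W: "ginner g (F x) (mean_curv g F x) (mean_curv g F x) = 1/4 * (T \<bullet> (M *v T) - (a * t1^2 + 2 * b * t1 * t2 + e * t2^2))" .
  have N: "mean_num M p C = d *\<^sub>R T"
    unfolding mean_num_def T_def a_def b_def e_def G_def[symmetric] using d0
    by (simp add: scaleR_add_right scaleR_diff_right)
  have area: "area_density g F x = sqrt d"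
  proof -
    have "induced_metric g F x $ i $ j = G i j" for i j
      by (simp add: induced_metric_def ginner_eq G_def gram_def M_def p_def)
    then show ?thesis by (simp add: area_density_def det_2 G21 Dd)
  qed
  have abe: "G 2 2 = a * d" "G 1 2 = - b * d" "G 1 1 = e * d" using d0 by (simp_all add: a_def b_def e_def)
  have gen: "d^2 * (r * r) * Y / (4 * d^2 * r) = 1/4 * Y * r" if "r \<noteq> 0" for r Y :: real
    using d0 that by (simp add: field_simps)
  have sq: "sqrt d \<noteq> 0" "sqrt d * sqrt d = d" using d0 by auto
  have "dens M p C = (d * d * (T \<bullet> (M *v T)) * d - (a * d * (d * t1)^2 - 2 * (- b * d) * (d * t1) * (d * t2) + e * d * (d * t2)^2)) / (4 * d^2 * sqrt d)"
    unfolding dens_def N d_def[symmetric] G_def[symmetric] abe t1_def t2_def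
    by (simp add: matrix_vector_mult_scaleR)
  also have "\<dots> = d^3 * (T \<bullet> (M *v T) - (a * t1^2 + 2 * b * t1 * t2 + e * t2^2)) / (4 * d^2 * sqrt d)"
    by (simp add: algebra_simps power2_eq_square power3_eq_cube)
  also have "d^3 = d^2 * (sqrt d * sqrt d)" using sq by (simp add: power3_eq_cube power2_eq_square)
  also have "d^2 * (sqrt d * sqrt d) * (T \<bullet> (M *v T) - (a * t1^2 + 2 * b * t1 * t2 + e * t2^2)) / (4 * d^2 * sqrt d)
     = 1/4 * (T \<bullet> (M *v T) - (a * t1^2 + 2 * b * t1 * t2 + e * t2^2)) * sqrt d"
    by (rule gen[OF sq(1)])
  finally show ?thesis unfolding W area by (simp add: M_def p_def C_def)
qed

subsection \<open>One-parameter families and the first variation\<close>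

text \<open>Precisely what differentiation under the integral over the compact box requires: a
  derivative in time at every point and joint continuity of the family and of this
  derivative.\<close>

definition fam_deriv :: "real \<Rightarrow> (real \<Rightarrow> real^2 \<Rightarrow> 'b::real_normed_vector) \<Rightarrow> (real \<Rightarrow> real^2 \<Rightarrow> 'b) \<Rightarrow> bool" where
  "fam_deriv e f f' \<longleftrightarrow>
     (\<forall>t\<in>{-e<..<e}. \<forall>z\<in>unit_box. ((\<lambda>t. f t z) has_vector_derivative f' t z) (at t)) \<and>
     continuous_on ({-e<..<e} \<times> unit_box) (\<lambda>x. f' (fst x) (snd x)) \<and>
     continuous_on ({-e<..<e} \<times> unit_box) (\<lambda>x. f (fst x) (snd x))"

text \<open>The derivative is hidden, so that closure rules prove regularity of the energy density
  structurally; its value is computed pointwise and only at time 0.\<close>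

definition fam_C1 :: "real \<Rightarrow> (real \<Rightarrow> real^2 \<Rightarrow> 'b::real_normed_vector) \<Rightarrow> bool" where
  "fam_C1 e f \<longleftrightarrow> (\<exists>f'. fam_deriv e f f')"

lemma fam_derivI:
  assumes "\<And>t z. t \<in> {-e<..<e} \<Longrightarrow> z \<in> unit_box \<Longrightarrow> ((\<lambda>t. f t z) has_vector_derivative f' t z) (at t)"
    "continuous_on ({-e<..<e} \<times> unit_box) (\<lambda>x. f' (fst x) (snd x))"
    "continuous_on ({-e<..<e} \<times> unit_box) (\<lambda>x. f (fst x) (snd x))"
  shows "fam_C1 e f"
  unfolding fam_C1_def fam_deriv_def by (intro exI[of _ f'] conjI ballI assms)

lemma fam_derivD:
  assumes "fam_deriv e f f'"
  shows "t \<in> {-e<..<e} \<Longrightarrow> z \<in> unit_box \<Longrightarrow> ((\<lambda>t. f t z) has_vector_derivative f' t z) (at t)"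
    "continuous_on ({-e<..<e} \<times> unit_box) (\<lambda>x. f' (fst x) (snd x))"
    "continuous_on ({-e<..<e} \<times> unit_box) (\<lambda>x. f (fst x) (snd x))"
  using assms by (simp_all add: fam_deriv_def)

lemma fam_C1_affine:
  assumes "continuous_on unit_box f" "continuous_on unit_box w"
  shows "fam_C1 e (\<lambda>t z. f z + t *\<^sub>R w z)"
proof (rule fam_derivI)
  show "((\<lambda>t. f z + t *\<^sub>R w z) has_vector_derivative w z) (at t)" for t z
    by (auto intro!: derivative_eq_intros)
  have c: "continuous_on ({-e<..<e} \<times> unit_box) (\<lambda>x. h (snd x))" if "continuous_on unit_box h" for h :: "real^2 \<Rightarrow> 'a"
    by (rule continuous_on_compose2[OF that continuous_on_snd[OF continuous_on_id]]) auto
  show "continuous_on ({-e<..<e} \<times> unit_box) (\<lambda>x. w (snd x))" by (rule c[OF assms(2)])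
  show "continuous_on ({-e<..<e} \<times> unit_box) (\<lambda>x. f (snd x) + fst x *\<^sub>R w (snd x))"
    by (intro continuous_on_add continuous_on_scaleR continuous_on_fst continuous_on_id c assms)
qed

lemma fam_C1_const: "continuous_on unit_box f \<Longrightarrow> fam_C1 e (\<lambda>t. f)"
  using fam_C1_affine[of f "\<lambda>_. 0" e] by simp

lemma fam_C1_add:
  assumes "fam_C1 e f" "fam_C1 e g" shows "fam_C1 e (\<lambda>t z. f t z + g t z)"
proof -
  from assms obtain f' g' where "fam_deriv e f f'" "fam_deriv e g g'" unfolding fam_C1_def by blast
  note F = fam_derivD[OF this(1)] and G = fam_derivD[OF this(2)]
  show ?thesis
    by (rule fam_derivI[where f' = "\<lambda>t z. f' t z + g' t z"])
      (intro has_vector_derivative_add continuous_on_add F G; assumption)+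
qed

lemma (in bounded_bilinear) fam_C1_prod:
  assumes "fam_C1 e f" "fam_C1 e g" shows "fam_C1 e (\<lambda>t z. prod (f t z) (g t z))"
proof -
  from assms obtain f' g' where "fam_deriv e f f'" "fam_deriv e g g'" unfolding fam_C1_def by blast
  note F = fam_derivD[OF this(1)] and G = fam_derivD[OF this(2)]
  show ?thesis
    by (rule fam_derivI[where f' = "\<lambda>t z. prod (f t z) (g' t z) + prod (f' t z) (g t z)"])
      (intro has_vector_derivative continuous_on_add continuous_on F G; assumption)+
qed

lemmas fam_C1_scaleR = bounded_bilinear.fam_C1_prod[OF bounded_bilinear_scaleR]
lemmas fam_C1_mult = bounded_bilinear.fam_C1_prod[OF bounded_bilinear_mult]
lemmas fam_C1_inner = bounded_bilinear.fam_C1_prod[OF bounded_bilinear_inner]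
lemmas fam_C1_mv = bounded_bilinear.fam_C1_prod[OF bounded_bilinear_matrix_vector]

lemma fam_C1_diff:
  assumes "fam_C1 e f" "fam_C1 e g" shows "fam_C1 e (\<lambda>t z. f t z - g t z)"
proof -
  have "fam_C1 e (\<lambda>t z. f t z + (-1) *\<^sub>R g t z)"
    by (intro fam_C1_add fam_C1_scaleR assms fam_C1_const continuous_on_const)
  then show ?thesis by simp
qed

lemma fam_C1_sum:
  assumes "\<And>i. i \<in> S \<Longrightarrow> fam_C1 e (f i)" shows "fam_C1 e (\<lambda>t z. \<Sum>i\<in>S. f i t z)"
  using assms by (induction S rule: infinite_finite_induct)
    (auto intro: fam_C1_add fam_C1_const continuous_on_const)

lemma fam_C1_compose:
  fixes y :: "real \<Rightarrow> real^2 \<Rightarrow> 'a::euclidean_space"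
  assumes y: "fam_C1 e y" and U: "open U" "smooth_on U h" and yU: "\<And>t z. t \<in> {-e<..<e} \<Longrightarrow> z \<in> unit_box \<Longrightarrow> y t z \<in> U"
  shows "fam_C1 e (\<lambda>t z. h (y t z))"
proof -
  from y obtain y' where "fam_deriv e y y'" unfolding fam_C1_def by blast
  note y' = fam_derivD[OF this]
  note hd = smooth_on_has_derivative[OF U]
  let ?h' = "\<lambda>t z. \<Sum>b\<in>Basis. (y' t z \<bullet> b) *\<^sub>R frechet_derivative h (at (y t z)) b"
  show ?thesis
  proof (rule fam_derivI[where f' = ?h'])
    fix t z assume tz: "t \<in> {-e<..<e}" "z \<in> unit_box"
    have "((\<lambda>t. h (y t z)) has_derivative (\<lambda>r. frechet_derivative h (at (y t z)) (r *\<^sub>R y' t z))) (at t)"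
      by (rule has_derivative_compose[where g = h and f = "\<lambda>t. y t z" and x = t,
            OF y'(1)[OF tz, unfolded has_vector_derivative_def] hd[OF yU[OF tz]]])
    moreover have "frechet_derivative h (at (y t z)) (r *\<^sub>R y' t z) = r *\<^sub>R ?h' t z" for r
      using linear_cmul[OF has_derivative_linear[OF hd[OF yU[OF tz]]]]
        linear_basis_expansion[OF has_derivative_linear[OF hd[OF yU[OF tz]]], of "y' t z"] by simp
    ultimately show "((\<lambda>t. h (y t z)) has_vector_derivative ?h' t z) (at t)" by (simp add: has_vector_derivative_def)
  next
    have "continuous_on ({-e<..<e} \<times> unit_box) (\<lambda>x. frechet_derivative h (at (y (fst x) (snd x))) b)" for b
      by (rule continuous_on_compose2[OF smooth_on_continuous[OF smooth_on_derivative[OF U(2)]] y'(3)]) (use yU in auto)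
    then show "continuous_on ({-e<..<e} \<times> unit_box) (\<lambda>x. ?h' (fst x) (snd x))"
      by (intro continuous_intros y'(2))
    show "continuous_on ({-e<..<e} \<times> unit_box) (\<lambda>x. h (y (fst x) (snd x)))"
      by (rule continuous_on_compose2[OF smooth_on_continuous[OF U(2)] y'(3)]) (use yU in auto)
  qed
qed

lemma smooth_on_sqrt: "smooth_on {0<..} sqrt"
  by (rule smooth_on_cong[OF _ _ smooth_on_powr[of "1/2"]]) (auto simp: powr_half_sqrt)

lemma fam_C1_sqrt:
  assumes "fam_C1 e f" "\<And>t z. t \<in> {-e<..<e} \<Longrightarrow> z \<in> unit_box \<Longrightarrow> f t z > 0"
  shows "fam_C1 e (\<lambda>t z. sqrt (f t z))"
  by (rule fam_C1_compose[OF assms(1) _ smooth_on_sqrt]) (use assms(2) in auto)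

lemma fam_C1_inverse:
  assumes "fam_C1 e f" "\<And>t z. t \<in> {-e<..<e} \<Longrightarrow> z \<in> unit_box \<Longrightarrow> f t z \<noteq> (0::real)"
  shows "fam_C1 e (\<lambda>t z. inverse (f t z))"
  by (rule fam_C1_compose[OF assms(1) _ smooth_on_inverse]) (use assms(2) in auto)

text \<open>Joint regularity licenses differentiation under the integral, while the integrand
  \<open>R\<close> comes from a separate pointwise computation. Uniqueness of derivatives matches
  the two and also transfers continuity to \<open>R\<close>.\<close>

lemma fam_C1_integral:
  fixes f :: "real \<Rightarrow> real^2 \<Rightarrow> real"
  assumes f: "fam_C1 e f" and e: "e > 0" and R: "\<And>z. z \<in> unit_box \<Longrightarrow> ((\<lambda>t. f t z) has_real_derivative R z) (at 0)"
  shows "((\<lambda>t. integral unit_box (f t)) has_real_derivative integral unit_box R) (at 0)"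
    and "continuous_on unit_box R"
proof -
  from f obtain f' where "fam_deriv e f f'" unfolding fam_C1_def by blast
  note f' = fam_derivD[OF this]
  have eq: "f' 0 z = R z" if "z \<in> unit_box" for z
    using R[OF that] f'(1)[of 0 z] e that vector_derivative_unique_at
    unfolding has_real_derivative_iff_has_vector_derivative by auto
  have slice: "continuous_on unit_box (\<lambda>z. h t z)" if "continuous_on ({-e<..<e} \<times> unit_box) (\<lambda>x. h (fst x) (snd x))" "t \<in> {-e<..<e}"
    for h :: "real \<Rightarrow> real^2 \<Rightarrow> real" and t
  proof -
    have "continuous_on unit_box (\<lambda>z. (t, z))" by (intro continuous_intros)
    moreover have "(\<lambda>z. (t, z)) ` unit_box \<subseteq> {-e<..<e} \<times> unit_box" using that(2) by auto
    ultimately show ?thesis using continuous_on_compose2[OF that(1)] by fastforce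
  qed
  have "((\<lambda>t. integral (cbox (-1) 1) (f t)) has_vector_derivative integral (cbox (-1) 1) (f' 0)) (at 0 within {-e<..<e})"
  proof (rule leibniz_rule_vector_derivative)
    show "((\<lambda>t. f t z) has_vector_derivative f' t z) (at t within {-e<..<e})" if "t \<in> {-e<..<e}" "z \<in> cbox (-1) 1" for t z
      by (rule has_vector_derivative_at_within, rule f'(1)[OF that(1)]) (use that(2) in \<open>simp add: unit_box_def\<close>)
    show "continuous_on ({-e<..<e} \<times> cbox (-1) 1) (\<lambda>(t, z). f' t z)"
      using f'(2) by (simp add: unit_box_def split_beta)
    show "f t integrable_on cbox (-1) 1" if "t \<in> {-e<..<e}" for t
      using unit_box_integrable[OF slice[OF f'(3) that]] by (simp add: unit_box_def)
  qed (use e in auto)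
  moreover have "at 0 within {-e<..<e} = at 0" using e by (intro at_within_open) auto
  ultimately have "((\<lambda>t. integral unit_box (f t)) has_vector_derivative integral unit_box (f' 0)) (at 0)"
    by (simp add: unit_box_def)
  moreover have "integral unit_box (f' 0) = integral unit_box R" by (rule integral_cong[OF eq])
  ultimately show "((\<lambda>t. integral unit_box (f t)) has_real_derivative integral unit_box R) (at 0)"
    by (simp add: has_real_derivative_iff_has_vector_derivative)
  show "continuous_on unit_box R"
    using slice[OF f'(2), of 0] e eq by (simp cong: continuous_on_cong)
qed

lemma fam_C1_gram:
  assumes "fam_C1 e M" "\<And>i. fam_C1 e (\<lambda>t z. p t z i)"
  shows "fam_C1 e (\<lambda>t z. gram (M t z) (p t z) i j)"
  unfolding gram_def by (intro fam_C1_inner fam_C1_mv assms)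

lemma fam_C1_dens:
  assumes M: "fam_C1 e M" and p: "\<And>i. fam_C1 e (\<lambda>t z. p t z i)" and C: "\<And>i j. fam_C1 e (\<lambda>t z. C t z i j)"
    and d: "\<And>t z. t \<in> {-e<..<e} \<Longrightarrow> z \<in> unit_box \<Longrightarrow> gram_det (M t z) (p t z) > 0"
  shows "fam_C1 e (\<lambda>t z. dens (M t z) (p t z) (C t z))"
proof -
  note G = fam_C1_gram[OF M p]
  have D: "fam_C1 e (\<lambda>t z. gram_det (M t z) (p t z))"
    unfolding gram_det_def power2_eq_square by (intro fam_C1_diff fam_C1_mult G)
  have N: "fam_C1 e (\<lambda>t z. mean_num (M t z) (p t z) (C t z))"
    unfolding mean_num_def by (intro fam_C1_add fam_C1_diff fam_C1_scaleR G C)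
  have I: "fam_C1 e (\<lambda>t z. inverse (4 * (gram_det (M t z) (p t z) * gram_det (M t z) (p t z)) * sqrt (gram_det (M t z) (p t z))))"
    by (intro fam_C1_inverse fam_C1_mult fam_C1_const continuous_on_const D fam_C1_sqrt) (use d in \<open>auto simp: less_imp_neq[THEN not_sym]\<close>)
  show ?thesis
    unfolding dens_def divide_inverse power2_eq_square
    by (intro fam_C1_mult I fam_C1_diff fam_C1_add fam_C1_inner fam_C1_mv N M p G D fam_C1_const continuous_on_const)
qed

text \<open>At time 0 the determinant is E^2 with derivative E (a11' + a22'). The bracket is
  quadratic in \<open>s1\<close> and \<open>s2\<close>, which vanish at 0, so it contributes
  nothing. What remains is the derivative of A D^(-3/2) / 4, whence the factor 3/8.\<close>

lemma dens_quotient_deriv: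
  assumes d: "(A has_real_derivative A') (at 0)" "(a11 has_real_derivative a11') (at 0)" "(a12 has_real_derivative a12') (at 0)"
    "(a22 has_real_derivative a22') (at 0)" "(s1 has_real_derivative s1') (at 0)" "(s2 has_real_derivative s2') (at 0)"
    and v: "a11 0 = E" "a22 0 = E" "a12 0 = 0" "s1 0 = 0" "s2 0 = 0" "E > (0::real)"
  shows "((\<lambda>t. (A t * (a11 t * a22 t - a12 t ^ 2) - (a22 t * (s1 t)^2 - 2 * a12 t * s1 t * s2 t + a11 t * (s2 t)^2))
     / (4 * (a11 t * a22 t - a12 t ^ 2)^2 * sqrt (a11 t * a22 t - a12 t ^ 2)))
    has_real_derivative A' / (4 * E^3) - 3/8 * A 0 * (a11' + a22') / E^4) (at 0)"
proof -
  let ?D = "\<lambda>t. a11 t * a22 t - a12 t ^ 2" and ?D' = "E * (a11' + a22')"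
  let ?S = "\<lambda>t. a22 t * (s1 t)^2 - 2 * a12 t * s1 t * s2 t + a11 t * (s2 t)^2"
  have D0: "?D 0 = E^2" using v by (simp add: power2_eq_square)
  have sq: "sqrt (E^2) = E" using v by simp
  have D: "(?D has_real_derivative ?D') (at 0)"
    using v by (auto intro!: derivative_eq_intros d simp: algebra_simps)
  have S: "(?S has_real_derivative 0) (at 0)"
    using v by (auto intro!: derivative_eq_intros d)
  have u: "((\<lambda>t. A t * ?D t - ?S t) has_real_derivative A' * E^2 + ?D' * A 0 - 0) (at 0)"
    using DERIV_diff[OF DERIV_mult[OF d(1) D] S] D0 by simp
  have r: "((\<lambda>t. sqrt (?D t)) has_real_derivative ?D' * (inverse E / 2)) (at 0)"
    using DERIV_chain2[OF DERIV_real_sqrt D] D0 sq v(6) by (simp add: mult.commute)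
  have w: "((\<lambda>t. 4 * ?D t ^ 2 * sqrt (?D t)) has_real_derivative (4 * (2 * ?D' * E^2)) * E + ?D' * (inverse E / 2) * (4 * (E^2)^2)) (at 0)"
  proof -
    have "((\<lambda>t. 4 * ?D t ^ 2) has_real_derivative 4 * (2 * ?D' * E^2)) (at 0)"
      by (rule DERIV_cong[OF DERIV_cmult[OF DERIV_power[OF D, of 2], of 4]]) (simp add: D0)
    from DERIV_mult[OF this r] show ?thesis using D0 sq by simp
  qed
  have nz: "4 * ?D 0 ^ 2 * sqrt (?D 0) \<noteq> 0" using D0 sq v(6) by simp
  have S0: "?S 0 = 0" using v by simp
  have q: "((A' * E^2 + ?D' * A 0 - 0) * (4 * (E^2)^2 * E) - (A 0 * E^2 - 0) * ((4 * (2 * ?D' * E^2)) * E + ?D' * (inverse E / 2) * (4 * (E^2)^2)))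
     / ((4 * (E^2)^2 * E) * (4 * (E^2)^2 * E)) = A' / (4 * E^3) - 3/8 * A 0 * (a11' + a22') / E^4"
    using v(6) by (simp add: field_simps eval_nat_numeral)
  show ?thesis
    using DERIV_divide[OF u w nz] unfolding D0 sq S0 q .
qed

text \<open>Since \<open>Z\<close> is normal at \<open>t = 0\<close>, the tangential part of the trace enters the energy only to second order.\<close>

definition var_form :: "real^'m^'m::finite \<Rightarrow> real^'m^'m \<Rightarrow> (2 \<Rightarrow> real^'m) \<Rightarrow> (2 \<Rightarrow> real^'m)
    \<Rightarrow> (2 \<Rightarrow> 2 \<Rightarrow> real^'m) \<Rightarrow> (2 \<Rightarrow> 2 \<Rightarrow> real^'m) \<Rightarrow> real \<Rightarrow> real" where
  "var_form M M' p p' C C' E =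
    (let dG = (\<lambda>i j. p i \<bullet> (M' *v p j) + p' i \<bullet> (M *v p j) + p i \<bullet> (M *v p' j)); Z = C 1 1 + C 2 2 in
      Z \<bullet> (M *v (C' 1 1 + C' 2 2)) / (2 * E)
    + Z \<bullet> (M *v (dG 2 2 *\<^sub>R C 1 1 - dG 1 2 *\<^sub>R (C 1 2 + C 2 1) + dG 1 1 *\<^sub>R C 2 2)) / (2 * E^2)
    + Z \<bullet> (M' *v Z) / (4 * E) - 3/8 * (Z \<bullet> (M *v Z)) * (dG 1 1 + dG 2 2) / E^2)"

lemma dens_deriv:
  fixes M :: "real \<Rightarrow> real^'m^'m::finite"
  assumes M: "(M has_vector_derivative M') (at 0)" and p: "\<And>i. ((\<lambda>t. p t i) has_vector_derivative p' i) (at 0)"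
    and C: "\<And>i j. ((\<lambda>t. C t i j) has_vector_derivative C' i j) (at 0)"
    and sym: "\<And>u w. u \<bullet> (M 0 *v w) = w \<bullet> (M 0 *v u)"
    and gram: "\<And>i j. gram (M 0) (p 0) i j = (if i = j then E else 0)" and E: "E > 0"
    and normal: "\<And>k. (C 0 1 1 + C 0 2 2) \<bullet> (M 0 *v p 0 k) = 0"
  shows "((\<lambda>t. dens (M t) (p t) (C t)) has_real_derivative var_form (M 0) M' (p 0) p' (C 0) C' E) (at 0)"
proof -
  note mv = bounded_bilinear.has_vector_derivative[OF bounded_bilinear_matrix_vector]
  note inn = bounded_bilinear.has_vector_derivative[OF bounded_bilinear_inner]
  define dG where "dG = (\<lambda>i j. p 0 i \<bullet> (M' *v p 0 j) + p' i \<bullet> (M 0 *v p 0 j) + p 0 i \<bullet> (M 0 *v p' j))"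
  define Z where "Z = C 0 1 1 + C 0 2 2"
  have G: "((\<lambda>t. gram (M t) (p t) i j) has_vector_derivative dG i j) (at 0)" for i j
    unfolding gram_def dG_def
    using inn[OF p[of i] mv[OF M p[of j]]] by (simp add: inner_add_right algebra_simps)
  define N where "N = (\<lambda>t. mean_num (M t) (p t) (C t))"
  define N' where "N' = (dG 2 2 *\<^sub>R C 0 1 1 - dG 1 2 *\<^sub>R (C 0 1 2 + C 0 2 1) + dG 1 1 *\<^sub>R C 0 2 2) + E *\<^sub>R (C' 1 1 + C' 2 2)"
  have N0: "N 0 = E *\<^sub>R Z" by (simp add: N_def mean_num_def gram Z_def scaleR_add_right)
  note sc = bounded_bilinear.has_vector_derivative[OF bounded_bilinear_scaleR]
  have N: "(N has_vector_derivative N') (at 0)"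
  proof -
    have "(N has_vector_derivative
       ((gram (M 0) (p 0) 2 2 *\<^sub>R C' 1 1 + dG 2 2 *\<^sub>R C 0 1 1)
        - (gram (M 0) (p 0) 1 2 *\<^sub>R (C' 1 2 + C' 2 1) + dG 1 2 *\<^sub>R (C 0 1 2 + C 0 2 1)))
        + (gram (M 0) (p 0) 1 1 *\<^sub>R C' 2 2 + dG 1 1 *\<^sub>R C 0 2 2)) (at 0)"
      unfolding N_def mean_num_def
      by (intro has_vector_derivative_add has_vector_derivative_diff sc G C)
    then show ?thesis by (simp add: gram N'_def scaleR_add_right algebra_simps)
  qed
  have A: "((\<lambda>t. N t \<bullet> (M t *v N t)) has_vector_derivative 2 * E * (Z \<bullet> (M 0 *v N')) + E^2 * (Z \<bullet> (M' *v Z))) (at 0)"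
  proof -
    have h: "((\<lambda>t. N t \<bullet> (M t *v N t)) has_vector_derivative N 0 \<bullet> (M 0 *v N' + M' *v N 0) + N' \<bullet> (M 0 *v N 0)) (at 0)"
      by (rule inn[OF N mv[OF M N]])
    have "N 0 \<bullet> (M 0 *v N' + M' *v N 0) + N' \<bullet> (M 0 *v N 0) = 2 * E * (Z \<bullet> (M 0 *v N')) + E^2 * (Z \<bullet> (M' *v Z))"
      unfolding sym[of N' "N 0"] by (simp add: N0 inner_add_right matrix_vector_mult_scaleR power2_eq_square algebra_simps)
    with h show ?thesis by (simp only:)
  qed
  have s: "((\<lambda>t. N t \<bullet> (M t *v p t k)) has_vector_derivative N 0 \<bullet> (M 0 *v p' k + M' *v p 0 k) + N' \<bullet> (M 0 *v p 0 k)) (at 0)" for k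
    by (rule inn[OF N mv[OF M p[of k]]])
  have s0: "N 0 \<bullet> (M 0 *v p 0 k) = 0" for k using normal[of k] by (simp add: N0 Z_def)
  have Q: "((\<lambda>t. dens (M t) (p t) (C t)) has_real_derivative
     (2 * E * (Z \<bullet> (M 0 *v N')) + E^2 * (Z \<bullet> (M' *v Z))) / (4 * E^3) - 3/8 * (N 0 \<bullet> (M 0 *v N 0)) * (dG 1 1 + dG 2 2) / E^4) (at 0)"
    unfolding dens_def gram_det_def N_def[symmetric, THEN fun_cong]
    by (rule dens_quotient_deriv[OF A[folded has_real_derivative_iff_has_vector_derivative]
          G[of 1 1, folded has_real_derivative_iff_has_vector_derivative]
          G[of 1 2, folded has_real_derivative_iff_has_vector_derivative]
          G[of 2 2, folded has_real_derivative_iff_has_vector_derivative]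
          s[of 1, folded has_real_derivative_iff_has_vector_derivative]
          s[of 2, folded has_real_derivative_iff_has_vector_derivative]])
      (use gram E s0 in auto)
  define B where "B = dG 2 2 *\<^sub>R C 0 1 1 - dG 1 2 *\<^sub>R (C 0 1 2 + C 0 2 1) + dG 1 1 *\<^sub>R C 0 2 2"
  have zn: "Z \<bullet> (M 0 *v N') = Z \<bullet> (M 0 *v B) + E * (Z \<bullet> (M 0 *v (C' 1 1 + C' 2 2)))"
    by (simp add: N'_def B_def matrix_vector_right_distrib[of _ "_ + _" "E *\<^sub>R _"] inner_add_right matrix_vector_mult_scaleR)
  have nn: "N 0 \<bullet> (M 0 *v N 0) = E^2 * (Z \<bullet> (M 0 *v Z))" by (simp add: N0 matrix_vector_mult_scaleR power2_eq_square)
  have "(2 * E * (Z \<bullet> (M 0 *v N')) + E^2 * (Z \<bullet> (M' *v Z))) / (4 * E^3) - 3/8 * (N 0 \<bullet> (M 0 *v N 0)) * (dG 1 1 + dG 2 2) / E^4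
    = Z \<bullet> (M 0 *v (C' 1 1 + C' 2 2)) / (2 * E) + Z \<bullet> (M 0 *v B) / (2 * E^2)
    + Z \<bullet> (M' *v Z) / (4 * E) - 3/8 * (Z \<bullet> (M 0 *v Z)) * (dG 1 1 + dG 2 2) / E^2"
    unfolding zn nn using E by (simp add: field_simps eval_nat_numeral)
  also have "\<dots> = var_form (M 0) M' (p 0) p' (C 0) C' E"
    unfolding var_form_def Let_def Z_def B_def dG_def ..
  finally show ?thesis using Q by simp
qed

subsection \<open>The Levi-Civita connection\<close>

lemma smooth_on_linear_image:
  fixes f :: "'a::euclidean_space \<Rightarrow> 'b::euclidean_space"
  assumes "open S" "smooth_on S f" "bounded_linear h"
  shows "smooth_on S (\<lambda>x. h (f x))"
  by (rule smooth_on_compose[OF assms(1) open_UNIV _ assms(2) smooth_on_bounded_linear[OF open_UNIV assms(3)]]) simp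

lemma smooth_on_entry:
  fixes g :: "'a::euclidean_space \<Rightarrow> real^'n::finite^'m::finite"
  assumes "open S" "smooth_on S g" shows "smooth_on S (\<lambda>y. g y $ i $ j)"
  by (rule smooth_on_linear_image[OF assms]) (intro bounded_linear_compose[OF bounded_linear_vec_nth bounded_linear_vec_nth])

lemma smooth_on_sum:
  "open S \<Longrightarrow> (\<And>i. i \<in> I \<Longrightarrow> smooth_on S (f i)) \<Longrightarrow> smooth_on S (\<lambda>x. \<Sum>i\<in>I. f i x)"
  unfolding smooth_on_def using Ck_on_sum[of S I] by blast

lemma smooth_on_prod:
  fixes f :: "'i \<Rightarrow> 'a::euclidean_space \<Rightarrow> real"
  assumes "open S" "\<And>i. i \<in> I \<Longrightarrow> smooth_on S (f i)" shows "smooth_on S (\<lambda>x. \<Prod>i\<in>I. f i x)"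
  using assms(2) by (induction I rule: infinite_finite_induct) (auto intro: smooth_on_const smooth_on_mult assms(1))

lemma smooth_on_det:
  fixes A :: "'a::euclidean_space \<Rightarrow> real^'n::finite^'n"
  assumes "open S" "\<And>i j. smooth_on S (\<lambda>y. A y $ i $ j)" shows "smooth_on S (\<lambda>y. det (A y))"
  unfolding det_def by (intro smooth_on_sum smooth_on_mult smooth_on_prod smooth_on_const assms)

lemma matrix_inv_right:
  fixes A :: "real^'n::finite^'n"
  assumes "det A \<noteq> 0" shows "A ** matrix_inv A = mat 1"
proof -
  have "invertible A" using assms by (simp add: invertible_det_nz)
  then have "\<exists>B. A ** B = mat 1 \<and> B ** A = mat 1" by (simp add: invertible_def)
  from someI_ex[OF this] show ?thesis unfolding matrix_inv_def by blast
qed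

text \<open>Cramer's rule expresses the entries of the inverse as polynomials over the determinant,
  which is what makes the Christoffel symbols visibly smooth.\<close>

lemma matrix_inv_cramer:
  fixes A :: "real^'n::finite^'n"
  assumes "det A \<noteq> 0"
  shows "matrix_inv A $ i $ j = det (\<chi> r s. if s = i then axis j 1 $ r else A $ r $ s) * inverse (det A)"
proof -
  have "A *v (\<chi> i. matrix_inv A $ i $ j) = axis j 1"
  proof -
    have "(A *v (\<chi> i. matrix_inv A $ i $ j)) $ r = (A ** matrix_inv A) $ r $ j" for r
      by (simp add: matrix_vector_mult_def matrix_matrix_mult_def)
    then show ?thesis by (auto simp: vec_eq_iff matrix_inv_right[OF assms] mat_def axis_def)
  qed
  then have "(\<chi> i. matrix_inv A $ i $ j) = (\<chi> k. det (\<chi> r s. if s = k then axis j 1 $ r else A $ r $ s) / det A)"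
    using cramer[OF assms] by blast
  then have "(\<chi> i. matrix_inv A $ i $ j) $ i = (\<chi> k. det (\<chi> r s. if s = k then axis j 1 $ r else A $ r $ s) / det A) $ i"
    by (rule arg_cong)
  then show ?thesis by (simp add: divide_inverse)
qed

lemma smooth_on_matrix_inv:
  fixes A :: "'a::euclidean_space \<Rightarrow> real^'n::finite^'n"
  assumes S: "open S" and A: "\<And>i j. smooth_on S (\<lambda>y. A y $ i $ j)" and nz: "\<And>y. y \<in> S \<Longrightarrow> det (A y) \<noteq> 0"
  shows "smooth_on S (\<lambda>y. matrix_inv (A y) $ i $ j)"
proof (rule smooth_on_cong[OF S matrix_inv_cramer[OF nz, symmetric]])
  have e: "smooth_on S (\<lambda>y. (\<chi> r s. if s = i then axis j 1 $ r else A y $ r $ s) $ r $ s)" for r s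
    using A[of r s] smooth_on_const[OF S, of "axis j 1 $ r"] by (cases "s = i") auto
  have inv: "smooth_on S (\<lambda>y. inverse (det (A y)))"
    by (rule smooth_on_compose[OF S _ _ smooth_on_det[OF S A] smooth_on_inverse]) (use nz in auto)
  show "smooth_on S (\<lambda>y. det (\<chi> r s. if s = i then axis j 1 $ r else A y $ r $ s) * inverse (det (A y)))"
    by (intro smooth_on_mult S inv smooth_on_det e)
qed auto

lemma det_nonzero_of_pos:
  fixes A :: "real^'n::finite^'n"
  assumes "\<And>v. v \<noteq> 0 \<Longrightarrow> v \<bullet> (A *v v) > 0" shows "det A \<noteq> 0"
proof
  assume "det A = 0"
  then have "\<not> invertible A" by (simp add: invertible_det_nz)
  then obtain v where "v \<noteq> 0" "A *v v = 0" unfolding invertible_left_inverse matrix_left_invertible_ker by blast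
  then show False using assms[of v] by simp
qed

definition chris_vec :: "'m::finite metric_tensor \<Rightarrow> real^'m \<Rightarrow> 'm \<Rightarrow> 'm \<Rightarrow> real^'m" where
  "chris_vec g y \<alpha> \<beta> = (\<chi> \<gamma>. christoffel g y \<gamma> \<alpha> \<beta>)"

text \<open>The Christoffel symbols of the first kind. Being linear in the derivatives of
  \<open>g\<close>, they can be differentiated and estimated without touching the inverse matrix;
  \<open>g_chris_vec\<close> relates the two kinds.\<close>

definition chris_low :: "'m::finite metric_tensor \<Rightarrow> real^'m \<Rightarrow> 'm \<Rightarrow> 'm \<Rightarrow> real^'m" where
  "chris_low g y \<alpha> \<beta> = (\<chi> \<delta>. (pd \<alpha> (\<lambda>z. g z $ \<beta> $ \<delta>) y + pd \<beta> (\<lambda>z. g z $ \<alpha> $ \<delta>) y - pd \<delta> (\<lambda>z. g z $ \<alpha> $ \<beta>) y) / 2)"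

definition chris :: "'m::finite metric_tensor \<Rightarrow> real^'m \<Rightarrow> real^'m \<Rightarrow> real^'m \<Rightarrow> real^'m" where
  "chris g y u v = (\<Sum>\<alpha>\<in>UNIV. \<Sum>\<beta>\<in>UNIV. (u $ \<alpha> * v $ \<beta>) *\<^sub>R chris_vec g y \<alpha> \<beta>)"

lemma cov_deriv2_eq: "cov_deriv2 g \<Phi> x i j = pd i (pd j \<Phi>) x + chris g (\<Phi> x) (pd i \<Phi> x) (pd j \<Phi> x)"
  by (simp add: cov_deriv2_def chris_def chris_vec_def vec_eq_iff mult_ac)

lemma chris_scale: "chris g y (a *\<^sub>R u) (b *\<^sub>R v) = (a * b) *\<^sub>R chris g y u v"
  by (simp add: chris_def scaleR_sum_right mult_ac)

locale smooth_metric =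
  fixes g :: "'m::finite metric_tensor" and U :: "(real^'m) set"
  assumes U: "open U" and smooth: "smooth_on U g"
    and sym: "\<And>y. y \<in> U \<Longrightarrow> transpose (g y) = g y"
    and pos: "\<And>y v. y \<in> U \<Longrightarrow> v \<noteq> 0 \<Longrightarrow> v \<bullet> (g y *v v) > 0"
begin

lemma entry: "smooth_on U (\<lambda>z. g z $ \<alpha> $ \<beta>)" by (rule smooth_on_entry[OF U smooth])

lemma det_nz: "y \<in> U \<Longrightarrow> det (g y) \<noteq> 0" by (rule det_nonzero_of_pos) (rule pos)

lemma smooth_christoffel: "smooth_on U (\<lambda>y. christoffel g y \<gamma> \<alpha> \<beta>)"
proof -
  have m: "smooth_on U (\<lambda>y. - f y)" if "smooth_on U f" for f :: "real^'m \<Rightarrow> real"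
    using smooth_on_mult[OF U smooth_on_const[OF U, of "-1"] that] by simp
  have "smooth_on U (\<lambda>y. (\<Sum>\<delta>\<in>UNIV. matrix_inv (g y) $ \<gamma> $ \<delta> *
     (pd \<alpha> (\<lambda>z. g z $ \<beta> $ \<delta>) y + pd \<beta> (\<lambda>z. g z $ \<alpha> $ \<delta>) y + - pd \<delta> (\<lambda>z. g z $ \<alpha> $ \<beta>) y)) * (1/2))"
    by (intro smooth_on_mult smooth_on_sum smooth_on_add smooth_on_pd smooth_on_const smooth_on_matrix_inv m entry U det_nz)
  then show ?thesis by (simp add: christoffel_def[abs_def])
qed

lemma smooth_vec: 
  fixes f :: "real^'m \<Rightarrow> real^'m"
  assumes "\<And>i. smooth_on U (\<lambda>y. f y $ i)" shows "smooth_on U f"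
proof -
  have "smooth_on U (\<lambda>y. \<Sum>i\<in>UNIV. f y $ i *\<^sub>R (axis i 1 :: real^'m))"
    by (intro smooth_on_sum smooth_on_scaleR smooth_on_const U assms)
  then show ?thesis by (simp only: axis_expansion)
qed

lemma smooth_chris_vec: "smooth_on U (\<lambda>y. chris_vec g y \<alpha> \<beta>)"
  by (rule smooth_vec) (simp add: chris_vec_def smooth_christoffel)

lemma g_chris_vec: "y \<in> U \<Longrightarrow> g y *v chris_vec g y \<alpha> \<beta> = chris_low g y \<alpha> \<beta>"
proof -
  assume y: "y \<in> U"
  have "chris_vec g y \<alpha> \<beta> = matrix_inv (g y) *v chris_low g y \<alpha> \<beta>"
    by (simp add: chris_vec_def chris_low_def christoffel_def vec_eq_iff matrix_vector_mult_def sum_divide_distrib)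
  then show ?thesis by (simp add: matrix_vector_mul_assoc matrix_inv_right[OF det_nz[OF y]])
qed

lemma pd_sym: "y \<in> U \<Longrightarrow> pd \<gamma> (\<lambda>z. g z $ \<alpha> $ \<beta>) y = pd \<gamma> (\<lambda>z. g z $ \<beta> $ \<alpha>) y"
proof (rule pd_cong_open[OF U])
  fix z assume "z \<in> U"
  then have "transpose (g z) $ \<beta> $ \<alpha> = g z $ \<beta> $ \<alpha>" using sym by simp
  then show "g z $ \<alpha> $ \<beta> = g z $ \<beta> $ \<alpha>" by (simp add: transpose_def)
qed

lemma chris_vec_sym: assumes "y \<in> U" shows "chris_vec g y \<alpha> \<beta> = chris_vec g y \<beta> \<alpha>"
  unfolding chris_vec_def christoffel_def pd_sym[OF assms, of _ \<alpha> \<beta>] by (simp add: add.commute)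

lemma chris_sym: "y \<in> U \<Longrightarrow> chris g y u v = chris g y v u"
  unfolding chris_def by (subst sum.swap) (simp add: chris_vec_sym mult.commute)

definition dg :: "real^'m \<Rightarrow> real^'m \<Rightarrow> real^'m^'m" where "dg y u = frechet_derivative g (at y) u"

lemma dg_deriv: "y \<in> U \<Longrightarrow> (g has_derivative dg y) (at y)"
  unfolding dg_def by (rule smooth_on_has_derivative[OF U smooth])

lemma dg_entry: assumes "y \<in> U" shows "dg y u $ \<beta> $ \<delta> = (\<Sum>\<alpha>\<in>UNIV. u $ \<alpha> * pd \<alpha> (\<lambda>z. g z $ \<beta> $ \<delta>) y)"
proof -
  have "((\<lambda>z. g z $ \<beta> $ \<delta>) has_derivative (\<lambda>u. dg y u $ \<beta> $ \<delta>)) (at y)"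
    by (rule bounded_linear.has_derivative[OF bounded_linear_compose[OF bounded_linear_vec_nth bounded_linear_vec_nth] dg_deriv[OF assms]])
  from has_derivative_axis_sum[OF this, of u] show ?thesis by simp
qed

text \<open>Metric compatibility at a point: in the sum of the two first-kind symbols with the last
  indices exchanged, two of the three derivatives of \<open>g\<close> cancel by symmetry and the
  derivative along \<open>u\<close> is left.\<close>

lemma chris_low_inner:
  assumes "y \<in> U"
  shows "(g y *v chris g y u a) \<bullet> b + (g y *v chris g y u b) \<bullet> a = a \<bullet> (dg y u *v b)"
proof -
  let ?p = "\<lambda>\<alpha> \<beta> \<delta>. pd \<alpha> (\<lambda>z. g z $ \<beta> $ \<delta>) y"
  have l: "(g y *v chris g y u a) \<bullet> b = (\<Sum>\<alpha>\<in>UNIV. \<Sum>\<beta>\<in>UNIV. \<Sum>\<delta>\<in>UNIV. u $ \<alpha> * a $ \<beta> * b $ \<delta> * ((?p \<alpha> \<beta> \<delta> + ?p \<beta> \<alpha> \<delta> - ?p \<delta> \<alpha> \<beta>) / 2))" for a b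
  proof -
    have "g y *v chris g y u a = (\<Sum>\<alpha>\<in>UNIV. \<Sum>\<beta>\<in>UNIV. (u $ \<alpha> * a $ \<beta>) *\<^sub>R chris_low g y \<alpha> \<beta>)"
      unfolding chris_def by (simp add: linear_sum[OF matrix_vector_mul_linear] matrix_vector_mult_scaleR g_chris_vec[OF assms])
    moreover have "chris_low g y \<alpha> \<beta> \<bullet> b = (\<Sum>\<delta>\<in>UNIV. ((?p \<alpha> \<beta> \<delta> + ?p \<beta> \<alpha> \<delta> - ?p \<delta> \<alpha> \<beta>) / 2) * b $ \<delta>)" for \<alpha> \<beta>
      by (simp add: chris_low_def inner_vec_def)
    ultimately show ?thesis by (simp add: inner_sum_left sum_distrib_left mult_ac)
  qed
  have "(g y *v chris g y u b) \<bullet> a = (\<Sum>\<alpha>\<in>UNIV. \<Sum>\<beta>\<in>UNIV. \<Sum>\<delta>\<in>UNIV. u $ \<alpha> * a $ \<beta> * b $ \<delta> * ((?p \<alpha> \<beta> \<delta> + ?p \<delta> \<alpha> \<beta> - ?p \<beta> \<alpha> \<delta>) / 2))"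
    unfolding l
  proof (rule sum.cong[OF refl])
    fix \<alpha>
    show "(\<Sum>\<beta>\<in>UNIV. \<Sum>\<delta>\<in>UNIV. u $ \<alpha> * b $ \<beta> * a $ \<delta> * ((?p \<alpha> \<beta> \<delta> + ?p \<beta> \<alpha> \<delta> - ?p \<delta> \<alpha> \<beta>) / 2))
       = (\<Sum>\<beta>\<in>UNIV. \<Sum>\<delta>\<in>UNIV. u $ \<alpha> * a $ \<beta> * b $ \<delta> * ((?p \<alpha> \<beta> \<delta> + ?p \<delta> \<alpha> \<beta> - ?p \<beta> \<alpha> \<delta>) / 2))"
      by (subst sum.swap) (simp add: pd_sym[OF assms, of \<alpha>] mult_ac)
  qed
  then have "(g y *v chris g y u a) \<bullet> b + (g y *v chris g y u b) \<bullet> a = (\<Sum>\<alpha>\<in>UNIV. \<Sum>\<beta>\<in>UNIV. \<Sum>\<delta>\<in>UNIV. u $ \<alpha> * a $ \<beta> * b $ \<delta> * ?p \<alpha> \<beta> \<delta>)"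
    unfolding l[of a b] by (simp add: sum.distrib[symmetric] field_simps)
  also have "\<dots> = (\<Sum>\<beta>\<in>UNIV. \<Sum>\<delta>\<in>UNIV. \<Sum>\<alpha>\<in>UNIV. u $ \<alpha> * a $ \<beta> * b $ \<delta> * ?p \<alpha> \<beta> \<delta>)"
    by (subst sum.swap, rule sum.cong[OF refl], rule sum.swap)
  also have "\<dots> = a \<bullet> (dg y u *v b)"
    by (simp add: inner_vec_def[of a] matrix_vector_mult_def dg_entry[OF assms] sum_distrib_left sum_distrib_right mult_ac)
  finally show ?thesis .
qed

lemma metric_compatible:
  assumes F: "open S" "smooth_on S F" "x \<in> S" "F x \<in> U"
  shows "((\<lambda>x. pd i F x \<bullet> (g (F x) *v pd j F x)) has_derivative D) (at x) \<Longrightarrow>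
    D (axis l 1) = cov_deriv2 g F x l i \<bullet> (g (F x) *v pd j F x) + pd i F x \<bullet> (g (F x) *v cov_deriv2 g F x l j)"
proof -
  assume D: "((\<lambda>x. pd i F x \<bullet> (g (F x) *v pd j F x)) has_derivative D) (at x)"
  let ?DF = "frechet_derivative F (at x)" and ?D = "\<lambda>i. frechet_derivative (pd i F) (at x)"
  have dF: "(F has_derivative ?DF) (at x)" and d: "(pd k F has_derivative ?D k) (at x)" for k
    using smooth_on_has_derivative[OF F(1)] smooth_on_pd F by blast+
  have dgF: "((\<lambda>x. g (F x)) has_derivative (\<lambda>h. dg (F x) (?DF h))) (at x)"
    by (rule has_derivative_compose[OF dF dg_deriv[OF F(4)]])
  note mv = bounded_bilinear.FDERIV[OF bounded_bilinear_matrix_vector dgF d]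
  have "((\<lambda>x. pd i F x \<bullet> (g (F x) *v pd j F x)) has_derivative
      (\<lambda>h. pd i F x \<bullet> (g (F x) *v ?D j h + dg (F x) (?DF h) *v pd j F x) + ?D i h \<bullet> (g (F x) *v pd j F x))) (at x)"
    by (rule has_derivative_inner[OF d mv])
  from has_derivative_unique[OF D this]
  have "D (axis l 1) = pd i F x \<bullet> (g (F x) *v pd l (pd j F) x + dg (F x) (pd l F x) *v pd j F x) + pd l (pd i F) x \<bullet> (g (F x) *v pd j F x)"
    by (simp add: pd_def)
  moreover have "u \<bullet> (g (F x) *v w) = (g (F x) *v u) \<bullet> w" for u w
    using matrix_sym_inner[OF sym[OF F(4)], of u w] by (simp add: inner_commute)
  then have "chris g (F x) (pd l F x) (pd i F x) \<bullet> (g (F x) *v pd j F x) = (g (F x) *v chris g (F x) (pd l F x) (pd i F x)) \<bullet> pd j F x" .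
  moreover have "pd i F x \<bullet> (g (F x) *v chris g (F x) (pd l F x) (pd j F x)) = (g (F x) *v chris g (F x) (pd l F x) (pd j F x)) \<bullet> pd i F x"
    by (rule inner_commute)
  moreover note chris_low_inner[OF F(4), of "pd l F x" "pd i F x" "pd j F x"]
  ultimately show ?thesis
    unfolding cov_deriv2_eq inner_add_left inner_add_right matrix_vector_right_distrib by linarith
qed

text \<open>Differentiating conformality gives <C11, e1> = (d1 h)/2, and orthogonality of e1 and e2
  with C12 = C21 gives <C22, e1> = -<e2, C12> = -(d1 h)/2. The two cancel, and likewise along
  e2.\<close>

lemma mean_curvature_normal:
  assumes S: "open S" "smooth_on S F" "x \<in> S" and FU: "F ` S \<subseteq> U"
    and conf: "\<And>x i j. x \<in> S \<Longrightarrow> pd i F x \<bullet> (g (F x) *v pd j F x) = (if i = j then h x else 0)"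
  shows "(cov_deriv2 g F x 1 1 + cov_deriv2 g F x 2 2) \<bullet> (g (F x) *v pd k F x) = 0"
proof -
  let ?C = "cov_deriv2 g F x"
  have xU: "F x \<in> U" using S FU by blast
  have ip: "u \<bullet> (g (F x) *v w) = w \<bullet> (g (F x) *v u)" for u w
    by (rule matrix_sym_inner[OF sym[OF xU]])
  have C: "?C 1 2 = ?C 2 1" unfolding cov_deriv2_eq pd_commute[OF S(1,3,2), of 1 2] chris_sym[OF xU, of "pd 1 F x"] ..
  have sE: "smooth_on S (\<lambda>x. g (F x))" by (rule smooth_on_compose[OF S(1) U FU S(2) smooth])
  have sm: "smooth_on S (\<lambda>x. pd i F x \<bullet> (g (F x) *v pd j F x))" for i j
    unfolding smooth_on_def
    using bounded_bilinear.Ck_on_bilinear[OF bounded_bilinear_inner S(1)] bounded_bilinear.Ck_on_bilinear[OF bounded_bilinear_matrix_vector S(1)]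
      smooth_on_pd[OF S(2)] sE unfolding smooth_on_def by blast
  define T where "T = (\<lambda>l i j. pd l (\<lambda>x. pd i F x \<bullet> (g (F x) *v pd j F x)) x)"
  have T: "T l i j = ?C l i \<bullet> (g (F x) *v pd j F x) + pd i F x \<bullet> (g (F x) *v ?C l j)" for l i j
    unfolding T_def pd_def[of l]
    by (rule metric_compatible[OF S xU smooth_on_has_derivative[OF S(1) sm S(3)]])
  have T12: "T l 1 2 = 0" for l
  proof -
    have "T l 1 2 = pd l (\<lambda>x. 0) x" unfolding T_def by (rule pd_cong_open[OF S(1,3)]) (use conf in auto)
    then show ?thesis by (simp add: pd_eq[OF has_derivative_const])
  qed
  have Td: "T l 1 1 = T l 2 2" for l
    unfolding T_def by (rule pd_cong_open[OF S(1,3)]) (use conf in auto)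
  have "?C 1 1 \<bullet> (g (F x) *v pd 1 F x) + ?C 2 2 \<bullet> (g (F x) *v pd 1 F x) = 0"
    using T[of 1 1 1] T[of 1 2 2] Td[of 1] T[of 2 1 2] T12[of 2] ip[of "pd 1 F x" "?C 1 1"] ip[of "pd 2 F x" "?C 1 2"] ip[of "pd 1 F x" "?C 2 2"]
    unfolding C by linarith
  moreover have "?C 1 1 \<bullet> (g (F x) *v pd 2 F x) + ?C 2 2 \<bullet> (g (F x) *v pd 2 F x) = 0"
    using T[of 2 1 1] T[of 2 2 2] Td[of 2] T[of 1 1 2] T12[of 1] ip[of "pd 1 F x" "?C 2 1"] ip[of "pd 2 F x" "?C 2 2"] ip[of "pd 1 F x" "?C 1 2"] ip[of "pd 2 F x" "?C 1 1"]
    unfolding C by linarith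
  ultimately show ?thesis using exhaust_2[of k] by (auto simp: inner_add_left)
qed

end

subsection \<open>Decay of the connection at the origin\<close>

lemma bigo_finite_family:
  fixes f :: "'i \<Rightarrow> 'a::topological_space \<Rightarrow> real"
  assumes "finite I" "\<And>i. i \<in> I \<Longrightarrow> f i \<in> O[F](k)"
  shows "\<exists>C>0. \<forall>\<^sub>F y in F. \<forall>i\<in>I. \<bar>f i y\<bar> \<le> C * \<bar>k y\<bar>"
proof -
  have "\<forall>i\<in>I. \<exists>c. c > 0 \<and> (\<forall>\<^sub>F y in F. \<bar>f i y\<bar> \<le> c * \<bar>k y\<bar>)"
  proof
    fix i assume "i \<in> I"
    from landau_o.bigE[OF assms(2)[OF this]] obtain c where "c > 0" "\<forall>\<^sub>F y in F. norm (f i y) \<le> c * norm (k y)" .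
    then show "\<exists>c. c > 0 \<and> (\<forall>\<^sub>F y in F. \<bar>f i y\<bar> \<le> c * \<bar>k y\<bar>)" by (auto intro!: exI[of _ c])
  qed
  from bchoice[OF this] obtain c where c: "\<And>i. i \<in> I \<Longrightarrow> c i > 0" "\<And>i. i \<in> I \<Longrightarrow> \<forall>\<^sub>F y in F. \<bar>f i y\<bar> \<le> c i * \<bar>k y\<bar>" by blast
  define C where "C = (\<Sum>i\<in>I. c i) + 1"
  have le: "c i \<le> C" if "i \<in> I" for i
    using member_le_sum[OF that, of c] c(1) assms(1) by (simp add: C_def less_imp_le)
  have "C > 0" using sum_nonneg[of I c] c(1) by (simp add: C_def less_imp_le add_nonneg_pos)
  moreover have "\<forall>\<^sub>F y in F. \<forall>i\<in>I. \<bar>f i y\<bar> \<le> c i * \<bar>k y\<bar>"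
    by (rule eventually_ball_finite[OF assms(1)]) (use c(2) in blast)
  then have "\<forall>\<^sub>F y in F. \<forall>i\<in>I. \<bar>f i y\<bar> \<le> C * \<bar>k y\<bar>"
  proof (rule eventually_mono)
    fix y assume *: "\<forall>i\<in>I. \<bar>f i y\<bar> \<le> c i * \<bar>k y\<bar>"
    show "\<forall>i\<in>I. \<bar>f i y\<bar> \<le> C * \<bar>k y\<bar>"
      using * mult_right_mono[OF le abs_ge_zero] by (auto intro: order_trans)
  qed
  ultimately show ?thesis by blast
qed

text \<open>Removes the Kronecker delta from the decay hypothesis. Equality holds at every point
  since both functions have the same set of derivatives there.\<close>

lemma pd_minus_const: "pd i (\<lambda>y. f y - c) = pd i (f :: real^'n::finite \<Rightarrow> real)"
proof
  fix x
  have "((\<lambda>y. f y - c) has_derivative D) (at x) \<longleftrightarrow> (f has_derivative D) (at x)" for D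
  proof
    assume "((\<lambda>y. f y - c) has_derivative D) (at x)"
    from has_derivative_add[OF this has_derivative_const[of c]] show "(f has_derivative D) (at x)" by simp
  next
    assume "(f has_derivative D) (at x)"
    from has_derivative_diff[OF this has_derivative_const[of c]] show "((\<lambda>y. f y - c) has_derivative D) (at x)" by simp
  qed
  then show "pd i (\<lambda>y. f y - c) x = pd i f x" unfolding pd_def frechet_derivative_def by presburger
qed

lemma norm_matrix_vector_entries_le:
  fixes A :: "real^'m::finite^'m"
  assumes "\<And>\<alpha> \<beta>. \<bar>A $ \<alpha> $ \<beta>\<bar> \<le> B" shows "norm (A *v v) \<le> real CARD('m)^2 * B * norm v"
proof -
  have "norm (A *v v) \<le> (\<Sum>\<alpha>\<in>UNIV. \<bar>(A *v v) $ \<alpha>\<bar>)" by (rule norm_le_l1_cart)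
  also have "\<dots> \<le> (\<Sum>\<alpha>\<in>(UNIV::'m set). \<Sum>\<beta>\<in>(UNIV::'m set). B * norm v)"
  proof (rule sum_mono)
    fix \<alpha> :: 'm
    have "\<bar>(A *v v) $ \<alpha>\<bar> \<le> (\<Sum>\<beta>\<in>UNIV. \<bar>A $ \<alpha> $ \<beta> * v $ \<beta>\<bar>)" unfolding matrix_vector_mult_def by (simp add: sum_abs)
    also have "\<dots> \<le> (\<Sum>\<beta>\<in>(UNIV::'m set). B * norm v)"
      by (intro sum_mono abs_mult_le assms component_le_norm_cart)
    finally show "\<bar>(A *v v) $ \<alpha>\<bar> \<le> (\<Sum>\<beta>\<in>(UNIV::'m set). B * norm v)" .
  qed
  finally show ?thesis by (simp add: power2_eq_square)
qed

lemma norm_vec_entries_le: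
  assumes "\<And>i. \<bar>(v::real^'m::finite) $ i\<bar> \<le> B" shows "norm v \<le> real CARD('m) * B"
proof -
  have "norm v \<le> (\<Sum>i\<in>UNIV. \<bar>v $ i\<bar>)" by (rule norm_le_l1_cart)
  also have "\<dots> \<le> (\<Sum>i\<in>(UNIV::'m set). B)" by (rule sum_mono) (rule assms)
  finally show ?thesis by simp
qed

lemma frechet_derivative_le_pd:
  fixes f :: "real^'m::finite \<Rightarrow> real"
  assumes "(f has_derivative D) (at y)" "\<And>i. \<bar>pd i f y\<bar> \<le> B" shows "\<bar>D u\<bar> \<le> real CARD('m) * (B * norm u)"
proof -
  have "\<bar>D u\<bar> \<le> (\<Sum>i\<in>UNIV. \<bar>u $ i * pd i f y\<bar>)" by (subst has_derivative_axis_sum[OF assms(1)]) (simp add: sum_abs)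
  also have "\<dots> \<le> (\<Sum>i\<in>(UNIV::'m set). norm u * B)" by (intro sum_mono abs_mult_le component_le_norm_cart assms)
  finally show ?thesis by (simp add: mult_ac)
qed

context smooth_metric
begin

text \<open>The derivative V' of the Christoffel vector V is found by differentiating
  \<open>g *v V = chris_low\<close> in two ways. This yields g V' = (derivative of
  \<open>chris_low\<close>) - dg V, and near-flatness of \<open>g\<close> inverts it at the cost of
  a factor 2.\<close>

lemma connection_bounds:
  assumes y: "y \<in> U" and b: "0 \<le> b0" "0 \<le> b1" "0 \<le> b2"
    and h0: "\<And>\<alpha> \<beta>. \<bar>g y $ \<alpha> $ \<beta> - (if \<alpha> = \<beta> then 1 else 0)\<bar> \<le> b0" and small: "real CARD('m)^2 * b0 \<le> 1/2"
    and h1: "\<And>\<alpha> \<beta> \<gamma>. \<bar>pd \<gamma> (\<lambda>z. g z $ \<alpha> $ \<beta>) y\<bar> \<le> b1"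
    and h2: "\<And>\<alpha> \<beta> \<gamma> \<delta>. \<bar>pd \<delta> (pd \<gamma> (\<lambda>z. g z $ \<alpha> $ \<beta>)) y\<bar> \<le> b2"
  shows "norm v ^ 2 / 2 \<le> v \<bullet> (g y *v v)" and "norm (g y *v v) \<le> 2 * norm v"
    and "norm (dg y u *v v) \<le> real CARD('m)^3 * b1 * norm u * norm v"
    and "norm (chris_vec g y \<alpha> \<beta>) \<le> 4 * real CARD('m) * b1"
    and "norm (frechet_derivative (\<lambda>y. chris_vec g y \<alpha> \<beta>) (at y) u) \<le> (4 * real CARD('m)^2 * b2 + 8 * real CARD('m)^4 * b1^2) * norm u"
proof -
  let ?m = "real CARD('m)"
  have m1: "?m \<ge> 1" by simp
  have near: "norm (g y *v w - w) \<le> norm w / 2" for w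
  proof -
    have "norm ((g y - mat 1) *v w) \<le> ?m^2 * b0 * norm w"
      by (rule norm_matrix_vector_entries_le) (use h0 in \<open>simp add: mat_def\<close>)
    also have "\<dots> \<le> 1/2 * norm w" by (rule mult_right_mono[OF small]) simp
    finally show ?thesis by (simp add: matrix_vector_mult_diff_rdistrib)
  qed
  have low: "norm w ^ 2 / 2 \<le> w \<bullet> (g y *v w)" for w
  proof -
    have "\<bar>w \<bullet> (g y *v w - w)\<bar> \<le> norm w * (norm w / 2)"
      by (rule order_trans[OF Cauchy_Schwarz_ineq2 mult_left_mono[OF near]]) simp
    moreover have "w \<bullet> (g y *v w) = norm w ^ 2 + w \<bullet> (g y *v w - w)"
      by (simp add: inner_diff_right power2_norm_eq_inner)
    ultimately show ?thesis by (simp add: power2_eq_square)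
  qed
  show "norm v ^ 2 / 2 \<le> v \<bullet> (g y *v v)" by (rule low)
  show "norm (g y *v v) \<le> 2 * norm v"
  proof -
    have "norm (g y *v v) \<le> norm (g y *v v - v) + norm v" using norm_triangle_ineq[of "g y *v v - v" v] by simp
    then show ?thesis using near[of v] norm_ge_zero[of v] by linarith
  qed
  have inv: "norm w \<le> 2 * norm (g y *v w)" for w
  proof (cases "norm w = 0")
    case False
    have "norm w * norm w \<le> norm w * (2 * norm (g y *v w))"
      using low[of w] norm_cauchy_schwarz[of w "g y *v w"] by (simp add: power2_eq_square)
    then show ?thesis using False by simp
  qed simp
  have dgb: "norm (dg y u *v v) \<le> ?m^3 * b1 * norm u * norm v" for u v
  proof -
    have "norm (dg y u *v v) \<le> ?m^2 * (?m * (b1 * norm u)) * norm v"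
    proof (rule norm_matrix_vector_entries_le)
      fix \<alpha> \<beta>
      have "((\<lambda>z. g z $ \<alpha> $ \<beta>) has_derivative (\<lambda>u. dg y u $ \<alpha> $ \<beta>)) (at y)"
        by (rule bounded_linear.has_derivative[OF bounded_linear_compose[OF bounded_linear_vec_nth bounded_linear_vec_nth] dg_deriv[OF y]])
      from frechet_derivative_le_pd[OF this h1] show "\<bar>dg y u $ \<alpha> $ \<beta>\<bar> \<le> ?m * (b1 * norm u)" .
    qed
    then show ?thesis by (simp add: power3_eq_cube power2_eq_square mult_ac)
  qed
  show "norm (dg y u *v v) \<le> ?m^3 * b1 * norm u * norm v" by (rule dgb)
  have cl: "norm (chris_low g y \<alpha> \<beta>) \<le> ?m * (2 * b1)" for \<alpha> \<beta>
  proof (rule norm_vec_entries_le)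
    fix \<delta> show "\<bar>chris_low g y \<alpha> \<beta> $ \<delta>\<bar> \<le> 2 * b1"
      using h1[of \<alpha> \<beta> \<delta>] h1[of \<beta> \<alpha> \<delta>] h1[of \<delta> \<alpha> \<beta>] b(2) unfolding chris_low_def by (simp add: abs_le_iff)
  qed
  have cv: "norm (chris_vec g y \<alpha> \<beta>) \<le> 4 * ?m * b1" for \<alpha> \<beta>
    using inv[of "chris_vec g y \<alpha> \<beta>"] cl[of \<alpha> \<beta>] unfolding g_chris_vec[OF y] by simp
  show "norm (chris_vec g y \<alpha> \<beta>) \<le> 4 * ?m * b1" by (rule cv)
  let ?V = "\<lambda>y. chris_vec g y \<alpha> \<beta>"
  let ?V' = "frechet_derivative ?V (at y)"
  have V: "(?V has_derivative ?V') (at y)" by (rule smooth_on_has_derivative[OF U smooth_chris_vec y])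
  have GV: "((\<lambda>y. g y *v ?V y) has_derivative (\<lambda>h. g y *v ?V' h + dg y h *v ?V y)) (at y)"
    by (rule bounded_bilinear.FDERIV[OF bounded_bilinear_matrix_vector dg_deriv[OF y] V])
  have L: "(chris_low g) = (\<lambda>y \<alpha> \<beta>. chris_low g y \<alpha> \<beta>)" by simp
  have GL: "((\<lambda>y. chris_low g y \<alpha> \<beta>) has_derivative (\<lambda>h. g y *v ?V' h + dg y h *v ?V y)) (at y)"
    by (rule has_derivative_transform_within_open[OF GV U y]) (rule g_chris_vec)
  have lowd: "norm (g y *v ?V' u + dg y u *v ?V y) \<le> ?m * (2 * (?m * (b2 * norm u)))"
  proof (rule norm_vec_entries_le)
    fix \<delta>
    let ?f = "\<lambda>\<alpha> \<beta> \<gamma>. pd \<alpha> (\<lambda>z. g z $ \<beta> $ \<gamma>)"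
    let ?D = "\<lambda>\<alpha> \<beta> \<gamma>. frechet_derivative (?f \<alpha> \<beta> \<gamma>) (at y)"
    have f: "(?f \<alpha> \<beta> \<gamma> has_derivative ?D \<alpha> \<beta> \<gamma>) (at y)" for \<alpha> \<beta> \<gamma>
      by (rule smooth_on_has_derivative[OF U smooth_on_pd[OF entry] y])
    have fb: "\<bar>?D \<alpha> \<beta> \<gamma> u\<bar> \<le> ?m * (b2 * norm u)" for \<alpha> \<beta> \<gamma>
      by (rule frechet_derivative_le_pd[OF f h2])
    have "((\<lambda>y. chris_low g y \<alpha> \<beta> $ \<delta>) has_derivative (\<lambda>h. (g y *v ?V' h + dg y h *v ?V y) $ \<delta>)) (at y)"
      by (rule bounded_linear.has_derivative[OF bounded_linear_vec_nth GL])
    moreover have "((\<lambda>y. chris_low g y \<alpha> \<beta> $ \<delta>) has_derivative (\<lambda>h. (?D \<alpha> \<beta> \<delta> h + ?D \<beta> \<alpha> \<delta> h - ?D \<delta> \<alpha> \<beta> h) / 2)) (at y)"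
    proof -
      have nth: "chris_low g y \<alpha> \<beta> $ \<delta> = (?f \<alpha> \<beta> \<delta> y + ?f \<beta> \<alpha> \<delta> y - ?f \<delta> \<alpha> \<beta> y) * (1/2)" for y
        by (simp add: chris_low_def)
      have "((\<lambda>y. (?f \<alpha> \<beta> \<delta> y + ?f \<beta> \<alpha> \<delta> y - ?f \<delta> \<alpha> \<beta> y) * (1/2)) has_derivative
         (\<lambda>h. (?D \<alpha> \<beta> \<delta> h + ?D \<beta> \<alpha> \<delta> h - ?D \<delta> \<alpha> \<beta> h) * (1/2))) (at y)"
        by (rule has_derivative_mult_left[OF has_derivative_diff[OF has_derivative_add[OF f f] f]])
      then show ?thesis unfolding nth by simp
    qed
    ultimately have "(\<lambda>h. (g y *v ?V' h + dg y h *v ?V y) $ \<delta>) = (\<lambda>h. (?D \<alpha> \<beta> \<delta> h + ?D \<beta> \<alpha> \<delta> h - ?D \<delta> \<alpha> \<beta> h) / 2)"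
      by (rule has_derivative_unique)
    then have e: "(g y *v ?V' u + dg y u *v ?V y) $ \<delta> = (?D \<alpha> \<beta> \<delta> u + ?D \<beta> \<alpha> \<delta> u - ?D \<delta> \<alpha> \<beta> u) / 2" by (rule fun_cong)
    show "\<bar>(g y *v ?V' u + dg y u *v ?V y) $ \<delta>\<bar> \<le> 2 * (?m * (b2 * norm u))"
      unfolding e using fb[of \<alpha> \<beta> \<delta>] fb[of \<beta> \<alpha> \<delta>] fb[of \<delta> \<alpha> \<beta>] by (simp add: abs_le_iff)
  qed
  have d2: "norm (dg y u *v ?V y) \<le> ?m^3 * b1 * norm u * (4 * ?m * b1)"
    by (rule order_trans[OF dgb mult_left_mono[OF cv]]) (use b in simp)
  have "norm (?V' u) \<le> 2 * norm (g y *v ?V' u)" by (rule inv)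
  also have "norm (g y *v ?V' u) \<le> norm (g y *v ?V' u + dg y u *v ?V y) + norm (dg y u *v ?V y)"
    by (metis add_diff_cancel_right' norm_triangle_ineq4)
  also have "\<dots> \<le> ?m * (2 * (?m * (b2 * norm u))) + ?m^3 * b1 * norm u * (4 * ?m * b1)" by (rule add_mono[OF lowd d2])
  finally have "norm (?V' u) \<le> 2 * (?m * (2 * (?m * (b2 * norm u))) + ?m^3 * b1 * norm u * (4 * ?m * b1))" by simp
  also have "\<dots> = (4 * ?m^2 * b2 + 8 * ?m^4 * b1^2) * norm u" by (simp add: algebra_simps eval_nat_numeral)
  finally show "norm (?V' u) \<le> (4 * ?m^2 * b2 + 8 * ?m^4 * b1^2) * norm u" .
qed

text \<open>One constant for all indices, on a punctured ball. The derivative of the connection has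
  a part quadratic in first derivatives of \<open>g\<close>, of order |y|^(2\<tau> - 2), which is
  dominated by |y|^(\<tau> - 2) for |y| <= 1.\<close>

lemma connection_decay:
  assumes tau: "0 < \<tau>" "\<tau> \<le> 1" and Ueq: "U = ball 0 1 - {0}"
    and decay: "\<And>\<alpha> \<beta>. bigO_derivs 2 \<tau> (\<lambda>y. g y $ \<alpha> $ \<beta> - (if \<alpha> = \<beta> then 1 else 0))"
  shows "\<exists>C r. C \<ge> 1 \<and> 0 < r \<and> r \<le> 1 \<and> (\<forall>y. 0 < norm y \<and> norm y < r \<longrightarrow> (\<forall>u v \<alpha> \<beta>.
     norm v ^ 2 / 2 \<le> v \<bullet> (g y *v v) \<and> norm (g y *v v) \<le> 2 * norm v \<and>
     norm (dg y u *v v) \<le> C * norm y powr (\<tau> - 1) * norm u * norm v \<and>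
     norm (chris_vec g y \<alpha> \<beta>) \<le> C * norm y powr (\<tau> - 1) \<and>
     norm (frechet_derivative (\<lambda>y. chris_vec g y \<alpha> \<beta>) (at y) u) \<le> C * norm y powr (\<tau> - 2) * norm u))"
proof -
  let ?m = "real CARD('m)"
  let ?h = "\<lambda>\<alpha> \<beta> y. g y $ \<alpha> $ \<beta> - (if \<alpha> = \<beta> then 1 else 0)"
  have 0: "?h \<alpha> \<beta> \<in> O[at 0](\<lambda>y. norm y powr \<tau>)" for \<alpha> \<beta>
    using decay[of \<alpha> \<beta>] unfolding bigO_derivs_def by (auto dest: spec[of _ "[]"])
  have 1: "pd \<gamma> (\<lambda>z. g z $ \<alpha> $ \<beta>) \<in> O[at 0](\<lambda>y. norm y powr (\<tau> - 1))" for \<alpha> \<beta> \<gamma>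
    using decay[of \<alpha> \<beta>, unfolded bigO_derivs_def, rule_format, of "[\<gamma>]"] by (simp add: pd_minus_const)
  have 2: "pd \<delta> (pd \<gamma> (\<lambda>z. g z $ \<alpha> $ \<beta>)) \<in> O[at 0](\<lambda>y. norm y powr (\<tau> - 2))" for \<alpha> \<beta> \<gamma> \<delta>
    using decay[of \<alpha> \<beta>, unfolded bigO_derivs_def, rule_format, of "[\<delta>, \<gamma>]"] by (simp add: pd_minus_const)
  have "\<exists>C>0. \<forall>\<^sub>F y in at 0. \<forall>p\<in>(UNIV::('m \<times> 'm) set). \<bar>?h (fst p) (snd p) y\<bar> \<le> C * \<bar>norm y powr \<tau>\<bar>"
    by (rule bigo_finite_family[OF finite]) (rule 0)
  then obtain C0 where C0: "C0 > 0" "\<forall>\<^sub>F y in at 0. \<forall>p\<in>(UNIV::('m \<times> 'm) set). \<bar>?h (fst p) (snd p) y\<bar> \<le> C0 * \<bar>norm y powr \<tau>\<bar>"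
    by blast
  have "\<exists>C>0. \<forall>\<^sub>F y in at 0. \<forall>p\<in>(UNIV::('m \<times> 'm \<times> 'm) set).
      \<bar>pd (snd (snd p)) (\<lambda>z. g z $ fst p $ fst (snd p)) y\<bar> \<le> C * \<bar>norm y powr (\<tau> - 1)\<bar>"
    by (rule bigo_finite_family[OF finite]) (rule 1)
  then obtain C1 where C1: "C1 > 0" "\<forall>\<^sub>F y in at 0. \<forall>p\<in>(UNIV::('m \<times> 'm \<times> 'm) set).
      \<bar>pd (snd (snd p)) (\<lambda>z. g z $ fst p $ fst (snd p)) y\<bar> \<le> C1 * \<bar>norm y powr (\<tau> - 1)\<bar>"
    by blast
  have "\<exists>C>0. \<forall>\<^sub>F y in at 0. \<forall>p\<in>(UNIV::('m \<times> 'm \<times> 'm \<times> 'm) set).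
      \<bar>pd (snd (snd (snd p))) (pd (fst (snd (snd p))) (\<lambda>z. g z $ fst p $ fst (snd p))) y\<bar> \<le> C * \<bar>norm y powr (\<tau> - 2)\<bar>"
    by (rule bigo_finite_family[OF finite]) (rule 2)
  then obtain C2 where C2: "C2 > 0" "\<forall>\<^sub>F y in at 0. \<forall>p\<in>(UNIV::('m \<times> 'm \<times> 'm \<times> 'm) set).
      \<bar>pd (snd (snd (snd p))) (pd (fst (snd (snd p))) (\<lambda>z. g z $ fst p $ fst (snd p))) y\<bar> \<le> C2 * \<bar>norm y powr (\<tau> - 2)\<bar>"
    by blast
  have "\<forall>\<^sub>F y in at 0. (\<forall>\<alpha> \<beta>. \<bar>?h \<alpha> \<beta> y\<bar> \<le> C0 * norm y powr \<tau>) \<and> (\<forall>\<alpha> \<beta> \<gamma>. \<bar>pd \<gamma> (\<lambda>z. g z $ \<alpha> $ \<beta>) y\<bar> \<le> C1 * norm y powr (\<tau> - 1))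
     \<and> (\<forall>\<alpha> \<beta> \<gamma> \<delta>. \<bar>pd \<delta> (pd \<gamma> (\<lambda>z. g z $ \<alpha> $ \<beta>)) y\<bar> \<le> C2 * norm y powr (\<tau> - 2))"
    using C0(2) C1(2) C2(2) by eventually_elim (auto simp: split_paired_all)
  then obtain r1 where r1: "r1 > 0" and H: "\<And>y. y \<noteq> 0 \<Longrightarrow> norm y < r1 \<Longrightarrow>
      (\<forall>\<alpha> \<beta>. \<bar>?h \<alpha> \<beta> y\<bar> \<le> C0 * norm y powr \<tau>) \<and> (\<forall>\<alpha> \<beta> \<gamma>. \<bar>pd \<gamma> (\<lambda>z. g z $ \<alpha> $ \<beta>) y\<bar> \<le> C1 * norm y powr (\<tau> - 1))
     \<and> (\<forall>\<alpha> \<beta> \<gamma> \<delta>. \<bar>pd \<delta> (pd \<gamma> (\<lambda>z. g z $ \<alpha> $ \<beta>)) y\<bar> \<le> C2 * norm y powr (\<tau> - 2))"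
    unfolding eventually_at by (auto simp: dist_norm)
  \<comment> \<open>Chosen so that |y|^\<tau> <= q forces the entrywise error to satisfy the
    smallness condition of \<open>connection_bounds\<close>.\<close>
  define q where "q = 1 / (2 * ?m^2 * C0)"
  have q: "q > 0" using C0 by (simp add: q_def)
  define r where "r = min 1 (min r1 (q powr (1 / \<tau>)))"
  have r: "0 < r" "r \<le> 1" "r \<le> r1" "r \<le> q powr (1 / \<tau>)" using r1 q by (auto simp: r_def)
  define C where "C = ?m^3 * C1 + 4 * ?m * C1 + (4 * ?m^2 * C2 + 8 * ?m^4 * C1^2) + 1"
  have C: "C \<ge> 1" "?m^3 * C1 \<le> C" "4 * ?m * C1 \<le> C" "4 * ?m^2 * C2 + 8 * ?m^4 * C1^2 \<le> C"
    unfolding C_def using C1 C2 by (auto intro!: add_nonneg_nonneg simp: algebra_simps)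
  have "norm v ^ 2 / 2 \<le> v \<bullet> (g y *v v) \<and> norm (g y *v v) \<le> 2 * norm v \<and>
     norm (dg y u *v v) \<le> C * norm y powr (\<tau> - 1) * norm u * norm v \<and>
     norm (chris_vec g y \<alpha> \<beta>) \<le> C * norm y powr (\<tau> - 1) \<and>
     norm (frechet_derivative (\<lambda>y. chris_vec g y \<alpha> \<beta>) (at y) u) \<le> C * norm y powr (\<tau> - 2) * norm u"
    if y: "0 < norm y" "norm y < r" for y u v \<alpha> \<beta>
  proof -
    have yU: "y \<in> U" using y r by (auto simp: Ueq)
    have y0: "y \<noteq> 0" "norm y < r1" using y r by auto
    have t0: "norm y powr \<tau> \<le> q"
    proof -
      have "norm y powr \<tau> \<le> (q powr (1 / \<tau>)) powr \<tau>" using y r tau by (intro powr_mono2) auto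
      also have "\<dots> = q" using tau q by (simp add: powr_powr)
      finally show ?thesis .
    qed
    have small: "?m^2 * (C0 * norm y powr \<tau>) \<le> 1/2"
    proof -
      have "?m^2 * (C0 * norm y powr \<tau>) \<le> ?m^2 * (C0 * q)" using t0 C0 by (intro mult_left_mono) auto
      also have "\<dots> = 1/2" using C0 by (simp add: q_def)
      finally show ?thesis .
    qed
    note cb = connection_bounds[OF yU, of "C0 * norm y powr \<tau>" "C1 * norm y powr (\<tau> - 1)" "C2 * norm y powr (\<tau> - 2)",
        OF _ _ _ _ small]
    have hyps: "0 \<le> C0 * norm y powr \<tau>" "0 \<le> C1 * norm y powr (\<tau> - 1)" "0 \<le> C2 * norm y powr (\<tau> - 2)"
      using C0 C1 C2 by auto
    note cb' = cb[OF hyps H[OF y0, THEN conjunct1, rule_format] H[OF y0, THEN conjunct2, THEN conjunct1, rule_format]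
       H[OF y0, THEN conjunct2, THEN conjunct2, rule_format]]
    have p: "0 \<le> norm y powr (\<tau> - 1)" "0 \<le> norm y powr (\<tau> - 2)" by auto
    have pp: "(norm y powr (\<tau> - 1))^2 \<le> norm y powr (\<tau> - 2)"
    proof -
      have "(norm y powr (\<tau> - 1))^2 = norm y powr (2 * \<tau> - 2)" using y by (simp add: powr_power algebra_simps)
      also have "\<dots> \<le> norm y powr (\<tau> - 2)" using y r tau by (intro powr_mono') auto
      finally show ?thesis .
    qed
    have e3: "norm (dg y u *v v) \<le> C * norm y powr (\<tau> - 1) * norm u * norm v"
    proof -
      have "norm (dg y u *v v) \<le> (?m^3 * C1) * (norm y powr (\<tau> - 1) * norm u * norm v)" using cb'(3)[of u v] by (simp add: mult_ac)
      also have "\<dots> \<le> C * (norm y powr (\<tau> - 1) * norm u * norm v)" by (rule mult_right_mono[OF C(2)]) auto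
      finally show ?thesis by (simp add: mult_ac)
    qed
    have e4: "norm (chris_vec g y \<alpha> \<beta>) \<le> C * norm y powr (\<tau> - 1)"
      using cb'(4)[of \<alpha> \<beta>] mult_right_mono[OF C(3) p(1)] by (simp add: mult_ac)
    have e5: "norm (frechet_derivative (\<lambda>y. chris_vec g y \<alpha> \<beta>) (at y) u) \<le> C * norm y powr (\<tau> - 2) * norm u"
    proof -
      have "4 * ?m^2 * (C2 * norm y powr (\<tau> - 2)) + 8 * ?m^4 * (C1 * norm y powr (\<tau> - 1))^2
         = (4 * ?m^2 * C2) * norm y powr (\<tau> - 2) + (8 * ?m^4 * C1^2) * (norm y powr (\<tau> - 1))^2"
        by (simp add: power_mult_distrib)
      also have "\<dots> \<le> (4 * ?m^2 * C2) * norm y powr (\<tau> - 2) + (8 * ?m^4 * C1^2) * norm y powr (\<tau> - 2)"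
        by (intro add_left_mono mult_left_mono pp) auto
      also have "\<dots> = (4 * ?m^2 * C2 + 8 * ?m^4 * C1^2) * norm y powr (\<tau> - 2)" by (simp add: distrib_right)
      also have "\<dots> \<le> C * norm y powr (\<tau> - 2)" by (rule mult_right_mono[OF C(4) p(2)])
      finally have "(4 * ?m^2 * (C2 * norm y powr (\<tau> - 2)) + 8 * ?m^4 * (C1 * norm y powr (\<tau> - 1))^2) * norm u \<le> C * norm y powr (\<tau> - 2) * norm u"
        by (rule mult_right_mono) simp
      then show ?thesis using cb'(5)[of \<alpha> \<beta> u] by linarith
    qed
    show ?thesis using cb'(1,2)[of v] e3 e4 e5 by blast
  qed
  then show ?thesis using C(1) r(1,2) by (intro exI[of _ C] exI[of _ r]) blast
qed

end

subsection \<open>The weak Euler-Lagrange equation on a rescaled disc\<close>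

text \<open>The tube lemma: compactness of the box turns an open condition at time 0 into one that
  holds on a whole time interval, uniformly in space.\<close>

lemma fam_tube:
  fixes f :: "real \<Rightarrow> real^2 \<Rightarrow> 'b::{metric_space,heine_borel}"
  assumes "continuous_on ({-e<..<e} \<times> unit_box) (\<lambda>x. f (fst x) (snd x))" "e > 0" "open W"
    and W: "\<And>z. z \<in> unit_box \<Longrightarrow> f 0 z \<in> W"
  obtains e' where "e' > 0" "e' \<le> e" "\<And>t z. t \<in> {-e'<..<e'} \<Longrightarrow> z \<in> unit_box \<Longrightarrow> f t z \<in> W"
proof -
  have 0: "0 \<in> {-e<..<e}" using assms(2) by simp
  have "continuous_on unit_box (f 0)"
  proof -
    have "continuous_on unit_box (\<lambda>z. (0::real, z))" by (intro continuous_intros)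
    moreover have "(\<lambda>z. (0::real, z)) ` unit_box \<subseteq> {-e<..<e} \<times> unit_box" using 0 by auto
    ultimately show ?thesis using continuous_on_compose2[OF assms(1)] by fastforce
  qed
  then have "compact (f 0 ` unit_box)" by (rule compact_continuous_image[OF _ compact_unit_box])
  then obtain \<delta> where \<delta>: "\<delta> > 0" "(\<Union>x\<in>f 0 ` unit_box. ball x \<delta>) \<subseteq> W"
    using compact_subset_open_imp_ball_epsilon_subset[OF _ assms(3)] W by (metis image_subsetI)
  have "\<delta> / 2 > 0" using \<delta> by simp
  obtain X0 where X: "0 \<in> X0" "open X0" "\<forall>t\<in>X0 \<inter> {-e<..<e}. \<forall>z\<in>unit_box.
      dist ((\<lambda>x. f (fst x) (snd x)) (t, z)) ((\<lambda>x. f (fst x) (snd x)) (0, z)) \<le> \<delta> / 2"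
    by (rule continuous_on_prod_compactE[OF assms(1) compact_unit_box 0 \<open>\<delta> / 2 > 0\<close>])
  have X0: "0 \<in> X0" "open X0" "\<And>t z. t \<in> X0 \<inter> {-e<..<e} \<Longrightarrow> z \<in> unit_box \<Longrightarrow> dist (f t z) (f 0 z) \<le> \<delta> / 2"
    using X by simp_all
  from X0(1,2) obtain e1 where e1: "e1 > 0" "ball 0 e1 \<subseteq> X0" using openE by blast
  show ?thesis
  proof (rule that[of "min e e1"])
    fix t z assume t: "t \<in> {- min e e1<..<min e e1}" and z: "z \<in> unit_box"
    then have "t \<in> X0 \<inter> {-e<..<e}" using e1(2) by (auto simp: subset_iff dist_norm)
    from X0(3)[OF this z] have "f t z \<in> ball (f 0 z) \<delta>" using \<delta>(1) by (simp add: dist_commute)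
    then show "f t z \<in> W" using \<delta>(2) z by blast
  qed (use e1 assms(2) in auto)
qed

lemma pd_rescale:
  fixes F :: "real^2 \<Rightarrow> 'b::real_normed_vector"
  assumes "open S" "smooth_on S F" "x1 + \<rho> *\<^sub>R z \<in> S"
  shows "pd i (\<lambda>z. a *\<^sub>R F (x1 + \<rho> *\<^sub>R z)) z = (a * \<rho>) *\<^sub>R pd i F (x1 + \<rho> *\<^sub>R z)"
proof -
  let ?D = "frechet_derivative F (at (x1 + \<rho> *\<^sub>R z))"
  have d: "(F has_derivative ?D) (at (x1 + \<rho> *\<^sub>R z))" by (rule smooth_on_has_derivative[OF assms])
  have "((\<lambda>z. x1 + \<rho> *\<^sub>R z) has_derivative (\<lambda>h. \<rho> *\<^sub>R h)) (at z)" by (auto intro!: derivative_eq_intros)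
  from has_derivative_scaleR_right[OF has_derivative_compose[where g = F and f = "\<lambda>z. x1 + \<rho> *\<^sub>R z" and x = z, OF this d], of a]
  have "pd i (\<lambda>z. a *\<^sub>R F (x1 + \<rho> *\<^sub>R z)) z = a *\<^sub>R ?D (\<rho> *\<^sub>R axis i 1)" by (rule pd_eq)
  then show ?thesis using linear_cmul[OF has_derivative_linear[OF d]] by (simp add: pd_def)
qed

lemma pd_pd_rescale:
  fixes F :: "real^2 \<Rightarrow> 'b::real_normed_vector"
  assumes S: "open S" "smooth_on S F" and T: "open T" "z \<in> T" "\<And>z. z \<in> T \<Longrightarrow> x1 + \<rho> *\<^sub>R z \<in> S"
  shows "pd i (pd j (\<lambda>z. a *\<^sub>R F (x1 + \<rho> *\<^sub>R z))) z = (a * \<rho> * \<rho>) *\<^sub>R pd i (pd j F) (x1 + \<rho> *\<^sub>R z)"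
proof -
  have "pd i (pd j (\<lambda>z. a *\<^sub>R F (x1 + \<rho> *\<^sub>R z))) z = pd i (\<lambda>z. (a * \<rho>) *\<^sub>R pd j F (x1 + \<rho> *\<^sub>R z)) z"
    by (rule pd_cong_open[OF T(1,2)]) (rule pd_rescale[OF S T(3)])
  also have "\<dots> = (a * \<rho> * \<rho>) *\<^sub>R pd i (pd j F) (x1 + \<rho> *\<^sub>R z)"
    by (rule pd_rescale[OF S(1) smooth_on_pd[OF S(2)] T(3)[OF T(2)]])
  finally show ?thesis .
qed

lemma pd_scaleR_const:
  fixes f :: "real^'n::finite \<Rightarrow> real"
  assumes "open S" "x \<in> S" "smooth_on S f" shows "pd i (\<lambda>x. f x *\<^sub>R v) x = pd i f x *\<^sub>R v"
  using pd_eq[OF has_derivative_scaleR_left[OF smooth_on_has_derivative[OF assms(1,3,2)]]]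
  by (simp add: pd_def)

text \<open>A positive Gram determinant is an open and continuous condition on the varied map; this
  converts it back into injectivity of the differential.\<close>

lemma gram_independent:
  assumes "gram_det M p \<noteq> 0" and sym: "p 1 \<bullet> (M *v p 2) = p 2 \<bullet> (M *v p 1)"
    and z: "a *\<^sub>R p 1 + b *\<^sub>R p 2 = 0"
  shows "a = 0 \<and> b = (0::real)"
proof -
  have j: "a * gram M p 1 j + b * gram M p 2 j = 0" for j
  proof -
    have "(a *\<^sub>R p 1 + b *\<^sub>R p 2) \<bullet> (M *v p j) = a * gram M p 1 j + b * gram M p 2 j"
      by (simp add: inner_add_left gram_def)
    then show ?thesis by (simp add: z)
  qed
  have s: "gram M p 2 1 = gram M p 1 2" using sym by (simp add: gram_def)
  have "gram_det M p * a = 0" "gram_det M p * b = 0"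
    using j[of 1] j[of 2] unfolding gram_det_def s by algebra+
  then show ?thesis using assms(1) by simp
qed

locale willmore_immersion =
  fixes g :: "'m::finite metric_tensor" and \<Phi> :: "real^2 \<Rightarrow> real^'m" and lam :: "real^2 \<Rightarrow> real"
  assumes metric: "riemannian_metric_on (ball 0 1) g"
    and metric_smooth: "smooth_on (ball 0 1 - {0}) g"
    and maps: "\<Phi> ` (ball 0 1 - {0}) \<subseteq> ball 0 1 - {0}"
    and immersion: "immersion_on (ball 0 1 - {0}) \<Phi>"
    and conformal: "\<And>x i j. x \<in> ball 0 1 - {0} \<Longrightarrow>
         ginner g (\<Phi> x) (pd i \<Phi> x) (pd j \<Phi> x) = exp (2 * lam x) * (if i = j then 1 else 0)"
    and willmore: "willmore_on (ball 0 1 - {0}) (ball 0 1 - {0}) g \<Phi>"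

sublocale willmore_immersion \<subseteq> smooth_metric g "ball 0 1 - {0}"
proof
  show "open (ball 0 1 - {0} :: (real^'m) set)" by (intro open_Diff) auto
  show "smooth_on (ball 0 1 - {0}) g" by (rule metric_smooth)
  show "transpose (g y) = g y" if "y \<in> ball 0 1 - {0}" for y
    using metric that unfolding riemannian_metric_on_def by blast
  show "v \<bullet> (g y *v v) > 0" if "y \<in> ball 0 1 - {0}" "v \<noteq> 0" for y v
    using metric that unfolding riemannian_metric_on_def ginner_eq by blast
qed

context willmore_immersion
begin

lemma S_open: "open (ball 0 1 - {0} :: (real^2) set)" by (intro open_Diff) auto

lemma smooth_Phi: "smooth_on (ball 0 1 - {0}) \<Phi>" using immersion by (simp add: immersion_on_def)

end

text \<open>Three scales: \<open>\<rho>\<close> for lengths in the domain, \<open>s0\<close> as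
  reference value for the conformal factor exp lam, and their product \<open>len\<close> for lengths
  in the target. In these units the first derivatives of \<open>Psi\<close> have size exp lam /
  s0.\<close>

locale rescaled_disc = willmore_immersion g \<Phi> lam
  for g :: "'m::finite metric_tensor" and \<Phi> :: "real^2 \<Rightarrow> real^'m" and lam :: "real^2 \<Rightarrow> real" +
  fixes x1 :: "real^2" and \<rho> s0 :: real
  assumes rho: "\<rho> > 0" and s0: "s0 > 0"
    and disc: "\<And>z. z \<in> ball 0 2 \<Longrightarrow> x1 + \<rho> *\<^sub>R z \<in> ball 0 1 - {0}"
begin

abbreviation "S \<equiv> (ball 0 1 - {0} :: (real^2) set)"
abbreviation "U \<equiv> (ball 0 1 - {0} :: (real^'m) set)"

definition len :: real where "len = \<rho> * s0"
definition pt :: "real^2 \<Rightarrow> real^2" where "pt z = x1 + \<rho> *\<^sub>R z"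
definition Psi :: "real^2 \<Rightarrow> real^'m" where "Psi z = (1 / len) *\<^sub>R \<Phi> (x1 + \<rho> *\<^sub>R z)"
definition MM :: "real^2 \<Rightarrow> real^'m^'m" where "MM z = g (\<Phi> (pt z))"
text \<open>Christoffel symbols scale like an inverse length, and \<open>len\<close> makes them
  dimensionless. Then the Hessian of \<open>Psi\<close> plus \<open>GG\<close> is
  \<open>\<rho> / s0\<close> times the covariant Hessian of the original map
  (\<open>cov_Psi\<close>).\<close>

definition GG :: "real^2 \<Rightarrow> 2 \<Rightarrow> 2 \<Rightarrow> real^'m" where
  "GG z i j = len *\<^sub>R chris g (\<Phi> (pt z)) (pd i Psi z) (pd j Psi z)"
definition EE :: "real^2 \<Rightarrow> real" where "EE z = exp (2 * lam (pt z)) / s0^2"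

lemma len: "len > 0" using rho s0 by (simp add: len_def)

lemma pt_in: "z \<in> ball 0 2 \<Longrightarrow> pt z \<in> S" using disc by (simp add: pt_def)

lemma Phi_pt: "z \<in> ball 0 2 \<Longrightarrow> \<Phi> (pt z) \<in> U" using pt_in maps by blast

lemma smooth_comp_pt:
  fixes h :: "real^2 \<Rightarrow> 'b::real_normed_vector"
  assumes "smooth_on S h" shows "smooth_on (ball 0 2) (\<lambda>z. h (pt z))"
  unfolding pt_def
proof (rule smooth_on_compose[OF open_ball S_open _ _ assms])
  show "smooth_on (ball 0 2) (\<lambda>z. x1 + \<rho> *\<^sub>R z)" using smooth_on_affine[OF open_ball, of 0 2 \<rho> x1] by (simp add: add.commute)
qed (use disc in auto)

lemma smooth_Psi: "smooth_on (ball 0 2) Psi"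
  using smooth_on_scaleR[OF open_ball smooth_on_const[OF open_ball, of 0 2 "1 / len"] smooth_comp_pt[OF smooth_Phi]]
  by (simp add: Psi_def[abs_def] pt_def)

lemma smooth_comp_Phi_pt: "smooth_on U h \<Longrightarrow> smooth_on (ball 0 2) (\<lambda>z. h (\<Phi> (pt z)))"
  by (rule smooth_on_compose[OF open_ball U _ smooth_comp_pt[OF smooth_Phi]]) (use Phi_pt in auto)

lemma pd_Psi: "z \<in> ball 0 2 \<Longrightarrow> pd i Psi z = (1 / s0) *\<^sub>R pd i \<Phi> (pt z)"
  unfolding Psi_def[abs_def] pt_def using pd_rescale[OF S_open smooth_Phi disc, where a = "1 / len"] rho by (simp add: len_def)

lemma pd_pd_Psi:
  assumes "z \<in> ball 0 2" shows "pd i (pd j Psi) z = (\<rho> / s0) *\<^sub>R pd i (pd j \<Phi>) (pt z)"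
  unfolding Psi_def[abs_def] pt_def using pd_pd_rescale[OF S_open smooth_Phi open_ball assms disc, where a = "1 / len"] rho
  by (simp add: len_def)

lemma conf_Psi: "z \<in> ball 0 2 \<Longrightarrow> pd i Psi z \<bullet> (MM z *v pd j Psi z) = (if i = j then EE z else 0)"
  using conformal[OF pt_in, of z i j] s0
  by (simp add: pd_Psi MM_def EE_def ginner_eq matrix_vector_mult_scaleR power2_eq_square)

lemma cov_Psi: "z \<in> ball 0 2 \<Longrightarrow> pd i (pd j Psi) z + GG z i j = (\<rho> / s0) *\<^sub>R cov_deriv2 g \<Phi> (pt z) i j"
  using s0 by (simp add: cov_deriv2_eq GG_def pd_Psi pd_pd_Psi chris_scale len_def scaleR_add_right)

lemma trace_normal: "z \<in> ball 0 2 \<Longrightarrow> (lap Psi z + GG z 1 1 + GG z 2 2) \<bullet> (MM z *v pd k Psi z) = 0"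
proof -
  assume z: "z \<in> ball 0 2"
  have "(cov_deriv2 g \<Phi> (pt z) 1 1 + cov_deriv2 g \<Phi> (pt z) 2 2) \<bullet> (g (\<Phi> (pt z)) *v pd k \<Phi> (pt z)) = 0"
    by (rule mean_curvature_normal[OF S_open smooth_Phi pt_in[OF z] maps, where h = "\<lambda>x. exp (2 * lam x)"])
      (use conformal in \<open>auto simp: ginner_eq\<close>)
  moreover have "lap Psi z + GG z 1 1 + GG z 2 2 = (pd 1 (pd 1 Psi) z + GG z 1 1) + (pd 2 (pd 2 Psi) z + GG z 2 2)"
    by (simp add: lap_def)
  then have "lap Psi z + GG z 1 1 + GG z 2 2 = (\<rho> / s0) *\<^sub>R (cov_deriv2 g \<Phi> (pt z) 1 1 + cov_deriv2 g \<Phi> (pt z) 2 2)"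
    unfolding cov_Psi[OF z] by (simp add: scaleR_add_right)
  ultimately show ?thesis by (simp add: MM_def pd_Psi[OF z] matrix_vector_mult_scaleR)
qed

lemma M_sym': "z \<in> ball 0 2 \<Longrightarrow> u \<bullet> (MM z *v w) = w \<bullet> (MM z *v u)"
  unfolding MM_def by (rule matrix_sym_inner[OF sym[OF Phi_pt]])

lemma EE_pos: "EE z > 0" using s0 by (simp add: EE_def)

end

context smooth_metric
begin

definition dchris :: "real^'m \<Rightarrow> real^'m \<Rightarrow> real^'m \<Rightarrow> real^'m \<Rightarrow> real^'m" where
  "dchris y w a b = (\<Sum>\<alpha>\<in>UNIV. \<Sum>\<beta>\<in>UNIV. (a $ \<alpha> * b $ \<beta>) *\<^sub>R frechet_derivative (\<lambda>y. chris_vec g y \<alpha> \<beta>) (at y) w)"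

lemma compose_has_vector_derivative:
  fixes h :: "real^'m \<Rightarrow> 'b::real_normed_vector"
  assumes h: "smooth_on U h" and y: "(y has_vector_derivative y') (at t)" "y t \<in> U"
  shows "((\<lambda>t. h (y t)) has_vector_derivative frechet_derivative h (at (y t)) y') (at t)"
proof -
  let ?D = "frechet_derivative h (at (y t))"
  have d: "(h has_derivative ?D) (at (y t))" by (rule smooth_on_has_derivative[OF U h y(2)])
  from has_derivative_compose[where g = h and f = y and x = t, OF y(1)[unfolded has_vector_derivative_def] d]
  show ?thesis unfolding has_vector_derivative_def using linear_cmul[OF has_derivative_linear[OF d]] by simp
qed

lemma chris_has_vector_derivative:
  assumes y: "(y has_vector_derivative y') (at t)" "y t \<in> U"
    and a: "(a has_vector_derivative a') (at t)" and b: "(b has_vector_derivative b') (at t)"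
  shows "((\<lambda>t. chris g (y t) (a t) (b t)) has_vector_derivative
     dchris (y t) y' (a t) (b t) + chris g (y t) a' (b t) + chris g (y t) (a t) b') (at t)"
proof -
  have nth: "((\<lambda>t. f t $ \<alpha>) has_vector_derivative f' $ \<alpha>) (at t)" if "(f has_vector_derivative f') (at t)" for f f' and \<alpha> :: 'm
    using bounded_linear.has_vector_derivative[OF bounded_linear_vec_nth that] .
  note V = compose_has_vector_derivative[OF smooth_chris_vec y]
  have "((\<lambda>t. chris g (y t) (a t) (b t)) has_vector_derivative
     (\<Sum>\<alpha>\<in>UNIV. \<Sum>\<beta>\<in>UNIV. (a t $ \<alpha> * b t $ \<beta>) *\<^sub>R frechet_derivative (\<lambda>y. chris_vec g y \<alpha> \<beta>) (at (y t)) y'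
        + (a t $ \<alpha> * b' $ \<beta> + a' $ \<alpha> * b t $ \<beta>) *\<^sub>R chris_vec g (y t) \<alpha> \<beta>)) (at t)"
    unfolding chris_def
    by (intro has_vector_derivative_sum bounded_bilinear.has_vector_derivative[OF bounded_bilinear_scaleR]
        bounded_bilinear.has_vector_derivative[OF bounded_bilinear_mult] nth a b V)
  then show ?thesis
    by (simp add: dchris_def chris_def sum.distrib scaleR_add_left algebra_simps)
qed

end

section \<open>The variation in a fixed direction and the vanishing of its first variation\<close>

context rescaled_disc
begin

text \<open>The variation in the original coordinates; the factor \<open>len\<close> makes the
  rescaled map move by \<open>t * \<zeta>\<close> in direction \<open>v\<close>. The functions
  \<open>vary\<close>, \<open>varp\<close> and \<open>varC\<close> are its value, first derivatives
  and covariant Hessian read off on the unit scale.\<close>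

definition varF :: "(real^2 \<Rightarrow> real) \<Rightarrow> real^'m \<Rightarrow> real \<Rightarrow> real^2 \<Rightarrow> real^'m" where
  "varF \<zeta> v t x = \<Phi> x + (t * (len * \<zeta> ((1 / \<rho>) *\<^sub>R (x - x1)))) *\<^sub>R v"
definition vary :: "(real^2 \<Rightarrow> real) \<Rightarrow> real^'m \<Rightarrow> real \<Rightarrow> real^2 \<Rightarrow> real^'m" where
  "vary \<zeta> v t z = \<Phi> (pt z) + t *\<^sub>R ((len * \<zeta> z) *\<^sub>R v)"
definition varp :: "(real^2 \<Rightarrow> real) \<Rightarrow> real^'m \<Rightarrow> real \<Rightarrow> real^2 \<Rightarrow> 2 \<Rightarrow> real^'m" where
  "varp \<zeta> v t z i = pd i Psi z + t *\<^sub>R (pd i \<zeta> z *\<^sub>R v)"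
definition varC :: "(real^2 \<Rightarrow> real) \<Rightarrow> real^'m \<Rightarrow> real \<Rightarrow> real^2 \<Rightarrow> 2 \<Rightarrow> 2 \<Rightarrow> real^'m" where
  "varC \<zeta> v t z i j = (pd i (pd j Psi) z + t *\<^sub>R (pd i (pd j \<zeta>) z *\<^sub>R v))
     + len *\<^sub>R chris g (vary \<zeta> v t z) (varp \<zeta> v t z i) (varp \<zeta> v t z j)"

lemma varF_pt: "varF \<zeta> v t (pt z) = vary \<zeta> v t z"
  using rho by (simp add: varF_def vary_def pt_def)

lemma smooth_shift: "smooth_on UNIV \<zeta> \<Longrightarrow> smooth_on UNIV (\<lambda>x. \<zeta> ((1 / \<rho>) *\<^sub>R (x - x1)))"
  for \<zeta> :: "real^2 \<Rightarrow> real"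
proof -
  assume z: "smooth_on UNIV \<zeta>"
  have "smooth_on UNIV (\<lambda>x. \<zeta> ((1 / \<rho>) *\<^sub>R x + (- (1 / \<rho>) *\<^sub>R x1)))"
    by (rule smooth_on_compose[OF open_UNIV open_UNIV _ smooth_on_affine[OF open_UNIV] z]) simp
  then show ?thesis by (simp add: scaleR_diff_right)
qed

lemma smooth_varF: "smooth_on UNIV \<zeta> \<Longrightarrow> smooth_on S (varF \<zeta> v t)"
  unfolding varF_def[abs_def]
  by (intro smooth_on_add smooth_Phi S_open smooth_on_scaleR smooth_on_mult smooth_on_const
      smooth_on_subset[OF smooth_shift subset_UNIV])

lemma jets_varF:
  assumes \<zeta>: "smooth_on UNIV \<zeta>" and z: "z \<in> ball 0 2"
  shows "pd i (varF \<zeta> v t) (pt z) = s0 *\<^sub>R varp \<zeta> v t z i"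
    and "pd i (pd j (varF \<zeta> v t)) (pt z) = (s0 / \<rho>) *\<^sub>R (pd i (pd j Psi) z + t *\<^sub>R (pd i (pd j \<zeta>) z *\<^sub>R v))"
proof -
  define H where "H = (\<lambda>z. (1 / len) *\<^sub>R varF \<zeta> v t (x1 + \<rho> *\<^sub>R z))"
  have \<zeta>': "smooth_on (ball 0 2) \<zeta>" by (rule smooth_on_subset[OF \<zeta>]) simp
  have t\<zeta>: "smooth_on (ball 0 2) (\<lambda>z. t * \<zeta> z)" by (intro smooth_on_mult smooth_on_const \<zeta>' open_ball)
  have Heq: "H = (\<lambda>z. Psi z + (t * \<zeta> z) *\<^sub>R v)"
    using varF_pt[of \<zeta> v t] len by (auto simp: H_def Psi_def vary_def pt_def fun_eq_iff scaleR_add_right)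
  have pt\<zeta>: "pd i (\<lambda>z. t * f z) z = t * pd i f z" if "smooth_on (ball 0 2) f" "z \<in> ball 0 2" for f :: "real^2 \<Rightarrow> real" and z i
    using pd_mult[OF open_ball that(2) smooth_on_const[OF open_ball] that(1), of i t]
    by (simp add: pd_eq[OF has_derivative_const])
  have p1: "pd i H z = varp \<zeta> v t z i" if "z \<in> ball 0 2" for z i
    unfolding Heq
    by (subst pd_add[OF open_ball that smooth_Psi smooth_on_scaleR[OF open_ball t\<zeta> smooth_on_const[OF open_ball]]],
        subst pd_scaleR_const[OF open_ball that t\<zeta>], subst pt\<zeta>[OF \<zeta>' that]) (simp add: varp_def)
  have p2: "pd i (pd j H) z = pd i (pd j Psi) z + t *\<^sub>R (pd i (pd j \<zeta>) z *\<^sub>R v)" if zb: "z \<in> ball 0 2" for z i j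
  proof -
    have t\<zeta>': "smooth_on (ball 0 2) (\<lambda>z. t * pd j \<zeta> z)" by (intro smooth_on_mult smooth_on_const smooth_on_pd \<zeta>' open_ball)
    have "pd i (pd j H) z = pd i (\<lambda>z. pd j Psi z + (t * pd j \<zeta> z) *\<^sub>R v) z"
      by (rule pd_cong_open[OF open_ball zb]) (simp add: p1 varp_def)
    also have "\<dots> = pd i (pd j Psi) z + t *\<^sub>R (pd i (pd j \<zeta>) z *\<^sub>R v)"
      by (subst pd_add[OF open_ball zb smooth_on_pd[OF smooth_Psi] smooth_on_scaleR[OF open_ball t\<zeta>' smooth_on_const[OF open_ball]]],
        subst pd_scaleR_const[OF open_ball zb t\<zeta>'], subst pt\<zeta>[OF smooth_on_pd[OF \<zeta>'] zb]) simp
    finally show ?thesis .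
  qed
  have "pd i H z = (1 / len * \<rho>) *\<^sub>R pd i (varF \<zeta> v t) (pt z)"
    unfolding H_def pt_def by (rule pd_rescale[OF S_open smooth_varF[OF \<zeta>] disc[OF z]])
  then show "pd i (varF \<zeta> v t) (pt z) = s0 *\<^sub>R varp \<zeta> v t z i"
    using p1[OF z, of i] rho s0 by (simp add: len_def)
  have "pd i (pd j H) z = (1 / len * \<rho> * \<rho>) *\<^sub>R pd i (pd j (varF \<zeta> v t)) (pt z)"
    unfolding H_def pt_def by (rule pd_pd_rescale[OF S_open smooth_varF[OF \<zeta>] open_ball z disc])
  then have "pd i (pd j (varF \<zeta> v t)) (pt z) = (s0 / \<rho>) *\<^sub>R pd i (pd j H) z"
    using rho s0 by (simp add: len_def)
  then show "pd i (pd j (varF \<zeta> v t)) (pt z) = (s0 / \<rho>) *\<^sub>R (pd i (pd j Psi) z + t *\<^sub>R (pd i (pd j \<zeta>) z *\<^sub>R v))"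
    unfolding p2[OF z] .
qed

lemma cov_varF:
  assumes "smooth_on UNIV \<zeta>" "z \<in> ball 0 2"
  shows "cov_deriv2 g (varF \<zeta> v t) (pt z) i j = (s0 / \<rho>) *\<^sub>R varC \<zeta> v t z i j"
  unfolding cov_deriv2_eq jets_varF[OF assms] varF_pt varC_def chris_scale
  using rho by (simp add: scaleR_add_right len_def)

lemma fam_vary:
  assumes \<zeta>: "smooth_on UNIV \<zeta>"
  shows "fam_C1 e (vary \<zeta> v)" "fam_C1 e (\<lambda>t z. varp \<zeta> v t z i)"
proof -
  have c: "continuous_on unit_box f" if "smooth_on (ball 0 2) f" for f :: "real^2 \<Rightarrow> 'x::real_normed_vector"
    using smooth_on_continuous[OF that] unit_box_subset_ball continuous_on_subset by blast
  note cz = smooth_on_UNIV_continuous[OF \<zeta>] smooth_on_UNIV_continuous[OF smooth_on_pd[OF \<zeta>]]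
  show "fam_C1 e (vary \<zeta> v)" unfolding vary_def[abs_def]
    by (intro fam_C1_affine c smooth_comp_pt smooth_Phi continuous_intros cz)
  show "fam_C1 e (\<lambda>t z. varp \<zeta> v t z i)" unfolding varp_def
    by (intro fam_C1_affine c smooth_on_pd smooth_Psi continuous_intros cz)
qed

lemma fam_varC:
  assumes \<zeta>: "smooth_on UNIV \<zeta>" and y: "\<And>t z. t \<in> {-e<..<e} \<Longrightarrow> z \<in> unit_box \<Longrightarrow> vary \<zeta> v t z \<in> U"
  shows "fam_C1 e (\<lambda>t z. varC \<zeta> v t z i j)"
proof -
  have c: "continuous_on unit_box (pd i (pd j Psi))"
    by (rule continuous_on_subset[OF smooth_on_continuous[OF smooth_on_pd[OF smooth_on_pd[OF smooth_Psi]]] unit_box_subset_ball])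
  have nth: "fam_C1 e (\<lambda>t z. varp \<zeta> v t z i $ \<alpha>)" for i \<alpha>
    by (rule fam_C1_compose[OF fam_vary(2)[OF \<zeta>] open_UNIV smooth_on_bounded_linear[OF open_UNIV bounded_linear_vec_nth]]) simp
  have 1: "fam_C1 e (\<lambda>t z. pd i (pd j Psi) z + t *\<^sub>R (pd i (pd j \<zeta>) z *\<^sub>R v))"
    by (intro fam_C1_affine c continuous_intros smooth_on_UNIV_continuous[OF smooth_on_pd[OF smooth_on_pd[OF \<zeta>]]])
  have 2: "fam_C1 e (\<lambda>t z. chris g (vary \<zeta> v t z) (varp \<zeta> v t z i) (varp \<zeta> v t z j))"
    unfolding chris_def
    by (intro fam_C1_sum fam_C1_scaleR fam_C1_mult nth fam_C1_compose[OF fam_vary(1)[OF \<zeta>] U smooth_chris_vec] y)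
  show ?thesis unfolding varC_def
    by (intro fam_C1_add 1 fam_C1_scaleR 2 fam_C1_const continuous_on_const)
qed

lemma vary_0: "vary \<zeta> v 0 z = \<Phi> (pt z)" and varp_0: "varp \<zeta> v 0 z = (\<lambda>i. pd i Psi z)"
  and varC_0: "varC \<zeta> v 0 z = (\<lambda>i j. pd i (pd j Psi) z + GG z i j)"
  by (simp_all add: vary_def varp_def varC_def GG_def fun_eq_iff)

lemma box_ball: "z \<in> unit_box \<Longrightarrow> z \<in> ball 0 2" using unit_box_subset_ball by blast

lemma gram_0: "z \<in> ball 0 2 \<Longrightarrow> gram (MM z) (\<lambda>i. pd i Psi z) i j = (if i = j then EE z else 0)"
  using conf_Psi by (simp add: gram_def)

text \<open>Two successive shrinkings of the time interval: first the image must stay where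
  \<open>g\<close> is smooth, and only then does the Gram determinant depend continuously on
  time.\<close>

lemma admissible_time:
  assumes \<zeta>: "smooth_on UNIV \<zeta>"
  obtains e where "e > 0" "\<And>t z. t \<in> {-e<..<e} \<Longrightarrow> z \<in> unit_box \<Longrightarrow> vary \<zeta> v t z \<in> U"
    "\<And>t z. t \<in> {-e<..<e} \<Longrightarrow> z \<in> unit_box \<Longrightarrow> gram_det (g (vary \<zeta> v t z)) (varp \<zeta> v t z) > 0"
proof -
  have "fam_C1 1 (vary \<zeta> v)" by (rule fam_vary(1)[OF \<zeta>])
  then obtain f' where "fam_deriv 1 (vary \<zeta> v) f'" unfolding fam_C1_def by blast
  note c1 = fam_derivD(3)[OF this]
  have v0: "vary \<zeta> v 0 z \<in> U" if "z \<in> unit_box" for z using Phi_pt[OF box_ball[OF that]] by (simp only: vary_0)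
  obtain e1 where e1: "e1 > 0" "e1 \<le> 1" "\<And>t z. t \<in> {-e1<..<e1} \<Longrightarrow> z \<in> unit_box \<Longrightarrow> vary \<zeta> v t z \<in> U"
    using fam_tube[OF c1 zero_less_one U v0] by (metis (no_types, lifting))
  have M: "fam_C1 e1 (\<lambda>t z. g (vary \<zeta> v t z))"
    by (rule fam_C1_compose[OF fam_vary(1)[OF \<zeta>] U smooth]) (rule e1(3))
  note G = fam_C1_gram[OF M fam_vary(2)[OF \<zeta>]]
  have "fam_C1 e1 (\<lambda>t z. gram_det (g (vary \<zeta> v t z)) (varp \<zeta> v t z))"
    unfolding gram_det_def power2_eq_square by (intro fam_C1_diff fam_C1_mult G)
  then obtain d' where "fam_deriv e1 (\<lambda>t z. gram_det (g (vary \<zeta> v t z)) (varp \<zeta> v t z)) d'" unfolding fam_C1_def by blast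
  note c2 = fam_derivD(3)[OF this]
  have g0: "gram_det (g (vary \<zeta> v 0 z)) (varp \<zeta> v 0 z) \<in> {0<..}" if "z \<in> unit_box" for z
    using gram_0[OF box_ball[OF that], unfolded MM_def] EE_pos[of z] by (simp add: vary_0 varp_0 gram_det_def)
  obtain e where e: "e > 0" "e \<le> e1" "\<And>t z. t \<in> {-e<..<e} \<Longrightarrow> z \<in> unit_box \<Longrightarrow> gram_det (g (vary \<zeta> v t z)) (varp \<zeta> v t z) \<in> {0<..}"
    using fam_tube[OF c2 e1(1) open_greaterThan g0] by (metis (no_types, lifting))
  show ?thesis by (rule that[OF e(1)]) (use e e1 in auto)
qed

lemma pt_image_compact: "compact (pt ` unit_box)"
proof -
  have "continuous_on unit_box pt" unfolding pt_def[abs_def] by (intro continuous_intros)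
  then show ?thesis by (rule compact_continuous_image[OF _ compact_unit_box])
qed

lemma pt_inverse: "pt ((1 / \<rho>) *\<^sub>R (x - x1)) = x"
  using rho by (simp add: pt_def)

lemma outside_support:
  assumes "\<And>z. z \<notin> cball 0 1 \<Longrightarrow> \<zeta> z = 0" "x \<notin> pt ` unit_box" shows "varF \<zeta> v t x = \<Phi> x"
proof -
  have "(1 / \<rho>) *\<^sub>R (x - x1) \<notin> unit_box" using assms(2) pt_inverse by (metis image_eqI)
  then have "(1 / \<rho>) *\<^sub>R (x - x1) \<notin> cball 0 1" using cball_subset_unit_box by blast
  then show ?thesis using assms(1) by (simp add: varF_def)
qed

lemma smooth_varF_joint:
  assumes \<zeta>: "smooth_on UNIV \<zeta>"
  shows "smooth_on ({-e<..<e} \<times> S) (\<lambda>(t, x). varF \<zeta> v t x)"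
proof -
  let ?T = "{-e<..<e} \<times> S"
  have o: "open ?T" by (intro open_Times open_greaterThanLessThan S_open)
  have s: "smooth_on ?T (snd :: real \<times> (real^2) \<Rightarrow> _)" by (rule smooth_on_bounded_linear[OF o bounded_linear_snd])
  have f: "smooth_on ?T (fst :: real \<times> (real^2) \<Rightarrow> _)" by (rule smooth_on_bounded_linear[OF o bounded_linear_fst])
  have 1: "smooth_on ?T (\<lambda>p. \<Phi> (snd p))" by (rule smooth_on_compose[OF o S_open _ s smooth_Phi]) auto
  have 2: "smooth_on ?T (\<lambda>p. \<zeta> ((1 / \<rho>) *\<^sub>R (snd p - x1)))" by (rule smooth_on_compose[OF o open_UNIV _ s smooth_shift[OF \<zeta>]]) auto
  show ?thesis unfolding varF_def split_beta
    by (intro smooth_on_add smooth_on_scaleR smooth_on_mult smooth_on_const o 1 2 f)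
qed

lemma immersion_varF:
  assumes \<zeta>: "smooth_on UNIV \<zeta>" "\<And>z. z \<notin> cball 0 1 \<Longrightarrow> \<zeta> z = 0"
    and y: "\<And>z. z \<in> unit_box \<Longrightarrow> vary \<zeta> v t z \<in> U"
    and d: "\<And>z. z \<in> unit_box \<Longrightarrow> gram_det (g (vary \<zeta> v t z)) (varp \<zeta> v t z) > 0"
  shows "immersion_on S (varF \<zeta> v t)"
  unfolding immersion_on_def
proof (intro conjI ballI)
  show sm: "smooth_on S (varF \<zeta> v t)" by (rule smooth_varF[OF \<zeta>(1)])
  fix x assume x: "x \<in> S"
  show "inj (frechet_derivative (varF \<zeta> v t) (at x))"
  proof (cases "x \<in> pt ` unit_box")
    case False
    have "frechet_derivative (varF \<zeta> v t) (at x) = frechet_derivative \<Phi> (at x)"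
      by (rule frechet_derivative_cong_open[of "- (pt ` unit_box)"])
        (use False outside_support[OF \<zeta>(2)] compact_imp_closed[OF pt_image_compact] in auto)
    then show ?thesis using immersion x by (simp add: immersion_on_def)
  next
    case True
    then obtain z where z: "z \<in> unit_box" "x = pt z" by blast
    let ?D = "frechet_derivative (varF \<zeta> v t) (at x)"
    have hd: "(varF \<zeta> v t has_derivative ?D) (at x)" by (rule smooth_on_has_derivative[OF S_open sm x])
    have "a = 0" if "?D a = 0" for a
    proof -
      have "?D a = (\<Sum>i\<in>UNIV. a $ i *\<^sub>R pd i (varF \<zeta> v t) x)" by (rule has_derivative_axis_sum[OF hd])
      then have "s0 *\<^sub>R (a $ 1 *\<^sub>R varp \<zeta> v t z 1 + a $ 2 *\<^sub>R varp \<zeta> v t z 2) = ?D a"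
        by (simp add: scaleR_add_right z(2) jets_varF(1)[OF \<zeta>(1) box_ball[OF z(1)]] sum_2 mult.commute)
      then have "a $ 1 *\<^sub>R varp \<zeta> v t z 1 + a $ 2 *\<^sub>R varp \<zeta> v t z 2 = 0" using that s0 by simp
      from gram_independent[OF _ matrix_sym_inner[OF sym[OF y[OF z(1)]]] this] d[OF z(1)]
      show "a = 0" by (simp add: vec_eq_iff forall_2)
    qed
    then show ?thesis using linear_injective_0[OF has_derivative_linear[OF hd]] by blast
  qed
qed

lemma integral_pt:
  fixes h q :: "real^2 \<Rightarrow> real"
  assumes h: "\<And>z. z \<in> unit_box \<Longrightarrow> h (pt z) = q z" and q: "continuous_on unit_box q"
  shows "(LINT x:pt ` unit_box|lborel. h x) = \<rho>^2 * integral unit_box q"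
proof -
  have K: "pt ` unit_box = cbox (x1 - \<rho> *\<^sub>R 1) (x1 + \<rho> *\<^sub>R 1)"
  proof -
    have "x \<in> pt ` unit_box \<longleftrightarrow> (1 / \<rho>) *\<^sub>R (x - x1) \<in> unit_box" for x
      using pt_inverse rho by (force simp: pt_def)
    then show ?thesis using rho
      by (simp add: set_eq_iff unit_box_def mem_box_cart divide_simps) (smt (verit))
  qed
  have ch: "continuous_on (pt ` unit_box) h"
  proof -
    have e: "h x = q ((1 / \<rho>) *\<^sub>R (x - x1))" if "x \<in> pt ` unit_box" for x
    proof -
      from that obtain z where z: "z \<in> unit_box" "x = pt z" by blast
      have "(1 / \<rho>) *\<^sub>R (pt z - x1) = z" using rho by (simp add: pt_def)
      then show ?thesis using h[OF z(1)] z(2) by simp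
    qed
    have "continuous_on (pt ` unit_box) (\<lambda>x. q ((1 / \<rho>) *\<^sub>R (x - x1)))"
    proof (rule continuous_on_compose2[OF q])
      show "continuous_on (pt ` unit_box) (\<lambda>x. (1 / \<rho>) *\<^sub>R (x - x1))" by (intro continuous_intros)
      show "(\<lambda>x. (1 / \<rho>) *\<^sub>R (x - x1)) ` pt ` unit_box \<subseteq> unit_box" using rho by (auto simp: pt_def)
    qed
    then show ?thesis using e continuous_on_cong[OF refl] by (metis (no_types, lifting))
  qed
  have "(LINT x:pt ` unit_box|lborel. h x) = integral (pt ` unit_box) h"
    by (rule set_borel_integral_eq_integral(2)) (simp only: set_integrable_def, rule borel_integrable_compact[OF pt_image_compact ch])
  also have "\<dots> = \<rho>^2 * integral unit_box q"
  proof -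
    have "(h has_integral integral (pt ` unit_box) h) (cbox (x1 - \<rho> *\<^sub>R 1) (x1 + \<rho> *\<^sub>R 1))"
      using integrable_integral[OF integrable_continuous[OF ch[unfolded K]]] K by simp
    from has_integral_affinity'[OF this rho, of x1]
    have "((\<lambda>z. h (\<rho> *\<^sub>R z + x1)) has_integral (integral (pt ` unit_box) h /\<^sub>R \<rho> ^ 2)) (cbox (-1) 1)"
      using rho by simp
    then have "((\<lambda>z. h (pt z)) has_integral (integral (pt ` unit_box) h /\<^sub>R \<rho> ^ 2)) unit_box"
      by (simp add: unit_box_def pt_def add.commute)
    then have "(q has_integral (integral (pt ` unit_box) h /\<^sub>R \<rho> ^ 2)) unit_box"
      by (rule has_integral_eq[rotated]) (rule h)
    from integral_unique[OF this] show ?thesis using rho by (simp add: field_simps)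
  qed
  finally show ?thesis .
qed

text \<open>The factor 1/\<rho>^2 from \<open>dens_scale\<close> cancels \<rho>^2 from the change of
  variables, so no scale is left on the right.\<close>

lemma energy_varF:
  assumes \<zeta>: "smooth_on UNIV \<zeta>"
    and y: "\<And>z. z \<in> unit_box \<Longrightarrow> vary \<zeta> v t z \<in> U"
    and d: "\<And>z. z \<in> unit_box \<Longrightarrow> gram_det (g (vary \<zeta> v t z)) (varp \<zeta> v t z) > 0"
    and cont: "continuous_on unit_box (\<lambda>z. dens (g (vary \<zeta> v t z)) (varp \<zeta> v t z) (varC \<zeta> v t z))"
  shows "willmore_energy g (pt ` unit_box) (varF \<zeta> v t)
    = integral unit_box (\<lambda>z. dens (g (vary \<zeta> v t z)) (varp \<zeta> v t z) (varC \<zeta> v t z))"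
proof -
  let ?h = "\<lambda>x. ginner g (varF \<zeta> v t x) (mean_curv g (varF \<zeta> v t) x) (mean_curv g (varF \<zeta> v t) x) * area_density g (varF \<zeta> v t) x"
  let ?d = "\<lambda>z. dens (g (vary \<zeta> v t z)) (varp \<zeta> v t z) (varC \<zeta> v t z)"
  have h: "?h (pt z) = ?d z / \<rho>^2" if z: "z \<in> unit_box" for z
  proof -
    note zb = box_ball[OF z]
    have p: "(\<lambda>i. pd i (varF \<zeta> v t) (pt z)) = (\<lambda>i. s0 *\<^sub>R varp \<zeta> v t z i)" using jets_varF(1)[OF \<zeta> zb] by simp
    have C: "cov_deriv2 g (varF \<zeta> v t) (pt z) = (\<lambda>i j. (s0 / \<rho>) *\<^sub>R varC \<zeta> v t z i j)"
      using cov_varF[OF \<zeta> zb] by (simp add: fun_eq_iff)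
    have "gram_det (g (vary \<zeta> v t z)) (\<lambda>i. s0 *\<^sub>R varp \<zeta> v t z i) = s0^4 * gram_det (g (vary \<zeta> v t z)) (varp \<zeta> v t z)"
      by (simp add: gram_det_def gram_def matrix_vector_mult_scaleR eval_nat_numeral algebra_simps)
    then have D: "gram_det (g (varF \<zeta> v t (pt z))) (\<lambda>i. pd i (varF \<zeta> v t) (pt z)) > 0"
      unfolding p varF_pt using d[OF z] s0 by simp
    have T: "transpose (g (varF \<zeta> v t (pt z))) = g (varF \<zeta> v t (pt z))" unfolding varF_pt by (rule sym[OF y[OF z]])
    have "?h (pt z) = dens (g (vary \<zeta> v t z)) (\<lambda>i. s0 *\<^sub>R varp \<zeta> v t z i) (\<lambda>i j. (s0 / \<rho>) *\<^sub>R varC \<zeta> v t z i j)"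
      using willmore_integrand_eq[of g "varF \<zeta> v t" "pt z", OF T D] unfolding p C varF_pt .
    also have "\<dots> = (s0 / \<rho>)^2 / s0^2 * ?d z" by (rule dens_scale[OF s0])
    finally show ?thesis using s0 by (simp add: power_divide)
  qed
  have "continuous_on unit_box (\<lambda>z. ?d z / \<rho>^2)" using rho by (intro continuous_on_divide cont continuous_on_const) auto
  from integral_pt[OF h this] show ?thesis unfolding willmore_energy_def integral_divide using rho by simp
qed

definition var_integrand :: "(real^2 \<Rightarrow> real) \<Rightarrow> real^'m \<Rightarrow> real^2 \<Rightarrow> real" where
  "var_integrand \<zeta> v z = var_form (MM z) (dg (\<Phi> (pt z)) ((len * \<zeta> z) *\<^sub>R v)) (\<lambda>i. pd i Psi z) (\<lambda>i. pd i \<zeta> z *\<^sub>R v)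
     (\<lambda>i j. pd i (pd j Psi) z + GG z i j)
     (\<lambda>i j. pd i (pd j \<zeta>) z *\<^sub>R v + len *\<^sub>R (dchris (\<Phi> (pt z)) ((len * \<zeta> z) *\<^sub>R v) (pd i Psi z) (pd j Psi z)
        + chris g (\<Phi> (pt z)) (pd i \<zeta> z *\<^sub>R v) (pd j Psi z) + chris g (\<Phi> (pt z)) (pd i Psi z) (pd j \<zeta> z *\<^sub>R v))) (EE z)"

lemma first_variation_zero:
  assumes \<zeta>: "smooth_on UNIV \<zeta>" "\<And>z. z \<notin> cball 0 1 \<Longrightarrow> \<zeta> z = 0"
  shows "integral unit_box (var_integrand \<zeta> v) = 0" and "continuous_on unit_box (var_integrand \<zeta> v)"
proof -
  obtain e where e: "e > 0" "\<And>t z. t \<in> {-e<..<e} \<Longrightarrow> z \<in> unit_box \<Longrightarrow> vary \<zeta> v t z \<in> U"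
    "\<And>t z. t \<in> {-e<..<e} \<Longrightarrow> z \<in> unit_box \<Longrightarrow> gram_det (g (vary \<zeta> v t z)) (varp \<zeta> v t z) > 0"
    by (rule admissible_time[OF \<zeta>(1), of v]) blast
  let ?d = "\<lambda>t z. dens (g (vary \<zeta> v t z)) (varp \<zeta> v t z) (varC \<zeta> v t z)"
  have M: "fam_C1 e (\<lambda>t z. g (vary \<zeta> v t z))"
    by (rule fam_C1_compose[OF fam_vary(1)[OF \<zeta>(1)] U smooth]) (rule e(2))
  have fd: "fam_C1 e ?d"
    by (rule fam_C1_dens[OF M fam_vary(2)[OF \<zeta>(1)] fam_varC[OF \<zeta>(1)]]) (use e in auto)
  then obtain f' where "fam_deriv e ?d f'" unfolding fam_C1_def by blast
  note cd = fam_derivD(3)[OF this]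
  have slice: "continuous_on unit_box (?d t)" if "t \<in> {-e<..<e}" for t
  proof -
    have "continuous_on unit_box (\<lambda>z. (t, z))" by (intro continuous_intros)
    moreover have "(\<lambda>z. (t, z)) ` unit_box \<subseteq> {-e<..<e} \<times> unit_box" using that by auto
    ultimately show ?thesis using continuous_on_compose2[OF cd] by fastforce
  qed
  have R: "((\<lambda>t. ?d t z) has_real_derivative var_integrand \<zeta> v z) (at 0)" if z: "z \<in> unit_box" for z
  proof -
    note zb = box_ball[OF z]
    have y: "((\<lambda>t. vary \<zeta> v t z) has_vector_derivative (len * \<zeta> z) *\<^sub>R v) (at 0)"
      unfolding vary_def by (auto intro!: derivative_eq_intros)
    have p: "((\<lambda>t. varp \<zeta> v t z i) has_vector_derivative pd i \<zeta> z *\<^sub>R v) (at 0)" for i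
      unfolding varp_def by (auto intro!: derivative_eq_intros)
    have y0: "vary \<zeta> v 0 z \<in> U" using Phi_pt[OF zb] by (simp add: vary_0)
    have M': "((\<lambda>t. g (vary \<zeta> v t z)) has_vector_derivative dg (\<Phi> (pt z)) ((len * \<zeta> z) *\<^sub>R v)) (at 0)"
      using compose_has_vector_derivative[OF smooth y y0] by (simp add: vary_0 dg_def)
    have q: "((\<lambda>t. pd i (pd j Psi) z + t *\<^sub>R (pd i (pd j \<zeta>) z *\<^sub>R v)) has_vector_derivative pd i (pd j \<zeta>) z *\<^sub>R v) (at 0)" for i j
      by (auto intro!: derivative_eq_intros)
    have C: "((\<lambda>t. varC \<zeta> v t z i j) has_vector_derivative pd i (pd j \<zeta>) z *\<^sub>R v + len *\<^sub>R (dchris (\<Phi> (pt z)) ((len * \<zeta> z) *\<^sub>R v) (pd i Psi z) (pd j Psi z)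
        + chris g (\<Phi> (pt z)) (pd i \<zeta> z *\<^sub>R v) (pd j Psi z) + chris g (\<Phi> (pt z)) (pd i Psi z) (pd j \<zeta> z *\<^sub>R v))) (at 0)" for i j
    proof -
      from chris_has_vector_derivative[OF y y0 p p]
      have "((\<lambda>t. chris g (vary \<zeta> v t z) (varp \<zeta> v t z i) (varp \<zeta> v t z j)) has_vector_derivative dchris (\<Phi> (pt z)) ((len * \<zeta> z) *\<^sub>R v) (pd i Psi z) (pd j Psi z)
        + chris g (\<Phi> (pt z)) (pd i \<zeta> z *\<^sub>R v) (pd j Psi z) + chris g (\<Phi> (pt z)) (pd i Psi z) (pd j \<zeta> z *\<^sub>R v)) (at 0)"
        by (simp add: vary_0 varp_0)
      from has_vector_derivative_add[OF q bounded_linear.has_vector_derivative[OF bounded_linear_scaleR_right this]]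
      show ?thesis unfolding varC_def .
    qed
    have n: "((pd 1 (pd 1 Psi) z + GG z 1 1) + (pd 2 (pd 2 Psi) z + GG z 2 2)) \<bullet> (MM z *v pd k Psi z) = 0" for k
      using trace_normal[OF zb, of k] by (simp add: lap_def add_ac)
    have "((\<lambda>t. ?d t z) has_real_derivative var_form (g (vary \<zeta> v 0 z)) (dg (\<Phi> (pt z)) ((len * \<zeta> z) *\<^sub>R v)) (varp \<zeta> v 0 z) (\<lambda>i. pd i \<zeta> z *\<^sub>R v)
     (varC \<zeta> v 0 z)
     (\<lambda>i j. pd i (pd j \<zeta>) z *\<^sub>R v + len *\<^sub>R (dchris (\<Phi> (pt z)) ((len * \<zeta> z) *\<^sub>R v) (pd i Psi z) (pd j Psi z)
        + chris g (\<Phi> (pt z)) (pd i \<zeta> z *\<^sub>R v) (pd j Psi z) + chris g (\<Phi> (pt z)) (pd i Psi z) (pd j \<zeta> z *\<^sub>R v))) (EE z)) (at 0)"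
      by (rule dens_deriv[OF M' p C])
        (use M_sym'[OF zb] gram_0[OF zb] EE_pos n in \<open>simp_all add: vary_0 varp_0 varC_0 MM_def[symmetric]\<close>)
    then show ?thesis by (simp add: var_integrand_def vary_0 varp_0 varC_0 MM_def)
  qed
  note I = fam_C1_integral[OF fd e(1) R]
  show "continuous_on unit_box (var_integrand \<zeta> v)" by (rule I(2))
  have K: "compact (pt ` unit_box)" "pt ` unit_box \<subseteq> S" using pt_image_compact pt_in box_ball by auto
  have img: "varF \<zeta> v t ` S \<subseteq> U" if t: "t \<in> {-e<..<e}" for t
  proof
    fix w assume "w \<in> varF \<zeta> v t ` S"
    then obtain x where x: "x \<in> S" "w = varF \<zeta> v t x" by blast
    show "w \<in> U"
    proof (cases "x \<in> pt ` unit_box")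
      case True
      then show ?thesis using e(2)[OF t] varF_pt x(2) by auto
    next
      case False
      then have "w = \<Phi> x" using outside_support[OF \<zeta>(2) False] x(2) by simp
      then show ?thesis using maps x(1) by blast
    qed
  qed
  have imm: "immersion_on S (varF \<zeta> v t)" if "t \<in> {-e<..<e}" for t
    by (rule immersion_varF[OF \<zeta> e(2)[OF that] e(3)[OF that]])
  have "((\<lambda>t. willmore_energy g (pt ` unit_box) (varF \<zeta> v t)) has_real_derivative 0) (at 0)"
    proof (rule willmore[unfolded willmore_on_def, rule_format], intro conjI ballI)
    show "varF \<zeta> v t x = \<Phi> x" if "x \<in> S - pt ` unit_box" for t x
      using outside_support[of \<zeta> x, OF \<zeta>(2)] that by blast
    show "varF \<zeta> v 0 x = \<Phi> x" for x by (simp add: varF_def)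
  qed (use e(1) K smooth_varF_joint[OF \<zeta>(1)] imm img in blast)+
  then have "((\<lambda>t. integral unit_box (?d t)) has_real_derivative 0) (at 0)"
  proof (rule has_field_derivative_transform_within_open[where S = "{-e<..<e}"])
    fix t assume t: "t \<in> {-e<..<e}"
    show "willmore_energy g (pt ` unit_box) (varF \<zeta> v t) = integral unit_box (?d t)"
      by (rule energy_varF[OF \<zeta>(1) e(2)[OF t] e(3)[OF t] slice[OF t]])
  qed (use e in auto)
  from DERIV_unique[OF I(1) this] show "integral unit_box (var_integrand \<zeta> v) = 0" .
qed

end

section \<open>From the first variation to the hypotheses of the interior estimate\<close>

lemma norm_smult_le: "\<bar>a\<bar> \<le> A \<Longrightarrow> norm x \<le> B \<Longrightarrow> norm (a *\<^sub>R x) \<le> A * (B::real)"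
  by (simp add: mult_mono')

lemma abs_inner_le: "norm x \<le> A \<Longrightarrow> norm y \<le> B \<Longrightarrow> \<bar>x \<bullet> y\<bar> \<le> A * B"
  using Cauchy_Schwarz_ineq2[of x y] mult_mono'[of "norm x" A "norm y" B] by simp

text \<open>Every term of the first variation contains Z. The one with the Laplacian
  \<open>L\<close> of the profile is split off. The others are linear in \<open>W\<close>, which
  bounds |v| times the profile and its gradient, and carry at most one factor 1 + K. The four terms
  contribute 4, 12, 1/2 and 9, hence 26.\<close>

lemma var_form_bound:
  fixes M M' :: "real^'m^'m::finite"
  assumes c: "c \<ge> 2" and K: "K \<ge> 0" and W: "W \<ge> 0"
    and M: "\<And>w. norm (M *v w) \<le> 2 * norm w" and M': "\<And>w. norm (M' *v w) \<le> W * norm w"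
    and p: "\<And>i. norm (p i) \<le> c" and p': "\<And>i. norm (p' i) \<le> W"
    and C: "\<And>i j. norm (C i j) \<le> c^2 * (1 + K)"
    and C': "C' 1 1 + C' 2 2 = L *\<^sub>R v + D" "norm D \<le> 4 * c^2 * W"
    and E: "E > 0" "inverse E \<le> c"
  shows "\<bar>var_form M M' p p' C C' E - (C 1 1 + C 2 2) \<bullet> (M *v v) / E * L / 2\<bar>
     \<le> 26 * c^6 * (1 + K) * (norm (C 1 1 + C 2 2) * W)"
proof -
  define Z where "Z = C 1 1 + C 2 2"
  define dG where "dG = (\<lambda>i j. p i \<bullet> (M' *v p j) + p' i \<bullet> (M *v p j) + p i \<bullet> (M *v p' j))"
  define B where "B = dG 2 2 *\<^sub>R C 1 1 - dG 1 2 *\<^sub>R (C 1 2 + C 2 1) + dG 1 1 *\<^sub>R C 2 2"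
  define z where "z = norm Z"
  define k where "k = 1 + K"
  have k: "k \<ge> 1" using K by (simp add: k_def)
  have z: "z \<ge> 0" by (simp add: z_def)
  have c0: "c \<ge> 0" "c \<ge> 1" using c by auto
  note C = C[folded k_def]
  have zZ: "z \<le> 2 * (c^2 * k)" unfolding z_def Z_def using norm_triangle_ineq[of "C 1 1" "C 2 2"] C[of 1 1] C[of 2 2] by linarith
  have Mle: "norm (M *v w) \<le> 2 * A" if "norm w \<le> A" for w A using M[of w] that by linarith
  have M'le: "norm (M' *v w) \<le> W * A" if "norm w \<le> A" for w A by (rule order_trans[OF M' mult_left_mono[OF that W]])
  have cW: "2 * (c * W) \<le> c^2 * W" using c W unfolding power2_eq_square mult.assoc by (intro mult_right_mono) auto
  have dG: "\<bar>dG i j\<bar> \<le> 3 * (c^2 * W)" for i j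
  proof -
    have 1: "\<bar>p i \<bullet> (M' *v p j)\<bar> \<le> c * (W * c)" by (intro abs_inner_le p M'le)
    have 2: "\<bar>p' i \<bullet> (M *v p j)\<bar> \<le> W * (2 * c)" by (intro abs_inner_le p' Mle p)
    have 3: "\<bar>p i \<bullet> (M *v p' j)\<bar> \<le> c * (2 * W)" by (intro abs_inner_le p' Mle p)
    have "\<bar>dG i j\<bar> \<le> c * (W * c) + W * (2 * c) + c * (2 * W)" using 1 2 3 unfolding dG_def by linarith
    also have "\<dots> = c^2 * W + 2 * (2 * (c * W))" by (simp add: power2_eq_square)
    also have "\<dots> \<le> 3 * (c^2 * W)" using cW by (simp add: mult_ac)
    finally show ?thesis .
  qed
  have nB: "norm B \<le> 12 * (c^2 * W) * (c^2 * k)"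
  proof -
    have a: "norm (dG 2 2 *\<^sub>R C 1 1) \<le> (3 * (c^2 * W)) * (c^2 * k)" "norm (dG 1 1 *\<^sub>R C 2 2) \<le> (3 * (c^2 * W)) * (c^2 * k)"
      by (intro norm_smult_le dG C)+
    have "norm (C 1 2 + C 2 1) \<le> 2 * (c^2 * k)" using norm_triangle_ineq[of "C 1 2" "C 2 1"] C[of 1 2] C[of 2 1] by linarith
    then have b: "norm (dG 1 2 *\<^sub>R (C 1 2 + C 2 1)) \<le> (3 * (c^2 * W)) * (2 * (c^2 * k))" by (intro norm_smult_le dG)
    have "norm B \<le> norm (dG 2 2 *\<^sub>R C 1 1) + norm (dG 1 2 *\<^sub>R (C 1 2 + C 2 1)) + norm (dG 1 1 *\<^sub>R C 2 2)"
      unfolding B_def using norm_triangle_ineq[of "dG 2 2 *\<^sub>R C 1 1 - dG 1 2 *\<^sub>R (C 1 2 + C 2 1)" "dG 1 1 *\<^sub>R C 2 2"]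
        norm_triangle_ineq4[of "dG 2 2 *\<^sub>R C 1 1" "dG 1 2 *\<^sub>R (C 1 2 + C 2 1)"] by linarith
    then show ?thesis using a b by linarith
  qed
  have iE: "inverse E \<ge> 0" "\<bar>inverse E\<bar> \<le> c" using E by auto
  have iE2: "\<bar>inverse E ^ 2\<bar> \<le> c^2" using E by (simp add: power_mono)
  have up: "x * c^n \<le> x * c^6" if "x \<ge> 0" "n \<le> 6" for x n
    using that c0 by (intro mult_left_mono power_increasing) auto
  have zW: "z * W \<ge> 0" "k * (z * W) \<ge> 0" "z * W \<le> k * (z * W)"
    using z W k mult_right_mono[of 1 k "z * W"] by auto
  define t1 where "t1 = Z \<bullet> (M *v D) * inverse E / 2"
  define t2 where "t2 = Z \<bullet> (M *v B) * inverse E ^ 2 / 2"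
  define t3 where "t3 = Z \<bullet> (M' *v Z) * inverse E / 4"
  define t4 where "t4 = 3/8 * ((Z \<bullet> (M *v Z)) * (dG 1 1 + dG 2 2) * inverse E ^ 2)"
  have eq: "var_form M M' p p' C C' E - Z \<bullet> (M *v v) / E * L / 2 = t1 + t2 + t3 - t4"
  proof -
    have "var_form M M' p p' C C' E = Z \<bullet> (M *v (C' 1 1 + C' 2 2)) / (2 * E) + Z \<bullet> (M *v B) / (2 * E^2)
        + Z \<bullet> (M' *v Z) / (4 * E) - 3/8 * (Z \<bullet> (M *v Z)) * (dG 1 1 + dG 2 2) / E^2"
      unfolding var_form_def Let_def Z_def B_def dG_def ..
    moreover have "Z \<bullet> (M *v (C' 1 1 + C' 2 2)) = L * (Z \<bullet> (M *v v)) + Z \<bullet> (M *v D)"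
      unfolding C' matrix_vector_right_distrib inner_add_right matrix_vector_mult_scaleR by simp
    moreover have "(L * a + d) / (2 * E) + q / (2 * E^2) + r / (4 * E) - 3/8 * s * w / E^2 - a / E * L / 2
        = d * inverse E / 2 + q * inverse E ^ 2 / 2 + r * inverse E / 4 - 3/8 * (s * w * inverse E ^ 2)" for a d q r s w
      using E(1) by (simp add: field_simps)
    ultimately show ?thesis unfolding t1_def t2_def t3_def t4_def by (simp only:)
  qed
  have 1: "\<bar>t1\<bar> \<le> 4 * (k * (z * W)) * c^6"
  proof -
    have "\<bar>Z \<bullet> (M *v D) * inverse E\<bar> \<le> (z * (2 * (4 * c^2 * W))) * c"
      by (intro abs_mult_le abs_inner_le Mle C' iE) (simp add: z_def)
    also have "\<dots> = 8 * (z * W) * c^3" by (simp add: eval_nat_numeral)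
    also have "\<dots> \<le> 8 * (z * W) * c^6" by (rule up) (use zW in auto)
    also have "\<dots> \<le> 8 * (k * (z * W)) * c^6" using zW c0 by (intro mult_right_mono) auto
    finally show ?thesis by (simp add: t1_def)
  qed
  have 2: "\<bar>t2\<bar> \<le> 12 * (k * (z * W)) * c^6"
  proof -
    have "\<bar>Z \<bullet> (M *v B) * inverse E ^ 2\<bar> \<le> (z * (2 * (12 * (c^2 * W) * (c^2 * k)))) * c^2"
      by (intro abs_mult_le abs_inner_le Mle nB iE2) (simp add: z_def)
    also have "\<dots> = 24 * (k * (z * W)) * c^6" by (simp add: eval_nat_numeral)
    finally show ?thesis by (simp add: t2_def)
  qed
  have 3: "\<bar>t3\<bar> \<le> 1/2 * (k * (z * W)) * c^6"
  proof -
    have "\<bar>Z \<bullet> (M' *v Z) * inverse E\<bar> \<le> (z * (W * (2 * (c^2 * k)))) * c"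
      by (intro abs_mult_le abs_inner_le M'le iE) (use zZ in \<open>simp_all add: z_def\<close>)
    also have "\<dots> = 2 * (k * (z * W)) * c^3" by (simp add: eval_nat_numeral)
    also have "\<dots> \<le> 2 * (k * (z * W)) * c^6" by (rule up) (use zW in auto)
    finally show ?thesis by (simp add: t3_def)
  qed
  have 4: "\<bar>t4\<bar> \<le> 9 * (k * (z * W)) * c^6"
  proof -
    have "\<bar>dG 1 1 + dG 2 2\<bar> \<le> 6 * (c^2 * W)" using dG[of 1 1] dG[of 2 2] by linarith
    then have "\<bar>(Z \<bullet> (M *v Z)) * (dG 1 1 + dG 2 2) * inverse E ^ 2\<bar> \<le> (z * (2 * (2 * (c^2 * k))) * (6 * (c^2 * W))) * c^2"
      by (intro abs_mult_le abs_inner_le Mle iE2) (use zZ in \<open>simp_all add: z_def\<close>)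
    also have "\<dots> = 24 * (k * (z * W)) * c^6" by (simp add: eval_nat_numeral)
    finally show ?thesis using abs_mult[of "3/8" "(Z \<bullet> (M *v Z)) * (dG 1 1 + dG 2 2) * inverse E ^ 2"] unfolding t4_def by linarith
  qed
  have "\<bar>t1 + t2 + t3 - t4\<bar> \<le> 26 * (k * (z * W)) * c^6"
    using 1 2 3 4 mult_nonneg_nonneg[OF zW(2) zero_le_power[OF c0(1), of 6]] by linarith
  then show ?thesis unfolding eq[symmetric] Z_def[symmetric] k_def[symmetric] z_def[symmetric] by (simp add: mult_ac)
qed

lemma (in smooth_metric) dchris_scale:
  assumes "y \<in> U" shows "dchris y (r *\<^sub>R w) a b = r *\<^sub>R dchris y w a b"
proof -
  have "frechet_derivative (\<lambda>y. chris_vec g y \<alpha> \<beta>) (at y) (r *\<^sub>R w) = r *\<^sub>R frechet_derivative (\<lambda>y. chris_vec g y \<alpha> \<beta>) (at y) w" for \<alpha> \<beta>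
    by (rule linear_cmul[OF has_derivative_linear[OF smooth_on_has_derivative[OF U smooth_chris_vec assms]]])
  then show ?thesis by (simp add: dchris_def scaleR_sum_right mult_ac)
qed

text \<open>\<open>\<alpha>\<close> bounds the metric derivative and the connection in scale
  invariant form and will be a multiple of |\<Phi>|^\<tau>. The bound
  \<open>2 * c0^3 * \<alpha> \<le> 1\<close> makes \<open>om\<close> admissible as the parameter
  \<open>\<omega>\<close> of the unit disc, and the upper bound \<open>c0 / 2\<close> for
  \<open>EE\<close> gives first derivatives of squared norm at most \<open>c0\<close>.\<close>

locale controlled_disc = rescaled_disc g \<Phi> lam x1 \<rho> s0
  for g :: "'m::finite metric_tensor" and \<Phi> :: "real^2 \<Rightarrow> real^'m" and lam :: "real^2 \<Rightarrow> real" and x1 \<rho> s0 +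
  fixes c0 \<alpha> K :: real
  assumes c0: "c0 \<ge> 2" and K: "K \<ge> 0" and \<alpha>: "0 \<le> \<alpha>" "2 * c0^3 * \<alpha> \<le> 1"
    and metric_pos: "\<And>z w. z \<in> unit_box \<Longrightarrow> norm w ^ 2 / 2 \<le> w \<bullet> (MM z *v w)"
    and metric_le: "\<And>z w. z \<in> unit_box \<Longrightarrow> norm (MM z *v w) \<le> 2 * norm w"
    and dg_le: "\<And>z u w. z \<in> unit_box \<Longrightarrow> len * norm (dg (\<Phi> (pt z)) u *v w) \<le> \<alpha> * norm u * norm w"
    and chris_le: "\<And>z u w. z \<in> unit_box \<Longrightarrow> len * norm (chris g (\<Phi> (pt z)) u w) \<le> \<alpha> * norm u * norm w"
    and dchris_le: "\<And>z a u w. z \<in> unit_box \<Longrightarrow> len^2 * norm (dchris (\<Phi> (pt z)) a u w) \<le> \<alpha> * norm a * norm u * norm w"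
    and factor: "\<And>z. z \<in> unit_box \<Longrightarrow> 1 / c0 \<le> EE z" "\<And>z. z \<in> unit_box \<Longrightarrow> EE z \<le> c0 / 2"
    and hessian_le: "\<And>z i j. z \<in> unit_box \<Longrightarrow> norm (pd i (pd j Psi) z) \<le> K"
begin

abbreviation "om \<equiv> 2 * c0^3 * \<alpha>"

lemma pd_Psi_le: "z \<in> unit_box \<Longrightarrow> norm (pd i Psi z) \<le> c0"
proof -
  assume z: "z \<in> unit_box"
  have "norm (pd i Psi z) ^ 2 / 2 \<le> EE z" using metric_pos[OF z, of "pd i Psi z"] conf_Psi[OF box_ball[OF z], of i i] by simp
  then have "norm (pd i Psi z) ^ 2 \<le> c0" using factor(2)[OF z] by linarith
  also have "\<dots> \<le> c0^2" using c0 by (intro self_le_power) auto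
  finally have "norm (pd i Psi z) ^ 2 \<le> c0^2" .
  then show ?thesis by (rule power2_le_imp_le) (use c0 in linarith)
qed

lemma \<alpha>_le: "\<alpha> * c0 ^ n \<le> om" if "n \<le> 3"
proof -
  have "c0 ^ n \<le> c0 ^ 3" using c0 that by (intro power_increasing) linarith+
  then have 1: "\<alpha> * c0 ^ n \<le> \<alpha> * c0 ^ 3" using \<alpha>(1) by (rule mult_left_mono)
  have "0 \<le> c0^3" using c0 by (intro zero_le_power) linarith
  then have 2: "0 \<le> \<alpha> * c0^3" using \<alpha>(1) by (intro mult_nonneg_nonneg)
  have "om = \<alpha> * c0^3 + \<alpha> * c0^3" by (simp only: mult_2 distrib_right mult.commute[of _ \<alpha>] distrib_left)
  then show ?thesis using 1 2 by linarith
qed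

lemma \<alpha>_1: "\<alpha> \<le> 1" using \<alpha>_le[of 0] \<alpha> by simp

lemma GG_le: "z \<in> unit_box \<Longrightarrow> norm (GG z i j) \<le> \<alpha> * c0^2"
proof -
  assume z: "z \<in> unit_box"
  have "norm (GG z i j) \<le> \<alpha> * norm (pd i Psi z) * norm (pd j Psi z)"
    using chris_le[OF z] len by (simp add: GG_def)
  also have "\<dots> \<le> \<alpha> * c0 * c0" using pd_Psi_le[OF z] \<alpha> c0 by (intro mult_mono mult_nonneg_nonneg) auto
  finally show ?thesis by (simp add: power2_eq_square)
qed

lemma smooth_MM: "smooth_on (ball 0 2) MM"
  unfolding MM_def[abs_def] by (rule smooth_comp_Phi_pt[OF smooth])

lemma smooth_GG: "smooth_on (ball 0 2) (\<lambda>z. GG z i j)"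
  unfolding GG_def chris_def
  by (intro smooth_on_scaleR smooth_on_const open_ball smooth_on_sum smooth_on_mult smooth_comp_Phi_pt smooth_chris_vec
      smooth_on_linear_image[OF open_ball smooth_on_pd[OF smooth_Psi] bounded_linear_vec_nth])

lemma Phi_pt_derivative:
  assumes "z \<in> ball 0 2"
  shows "((\<lambda>t. \<Phi> (pt (z + t *\<^sub>R axis k 1))) has_vector_derivative len *\<^sub>R pd k Psi z) (at 0)"
proof -
  have e: "(\<lambda>t. \<Phi> (pt (z + t *\<^sub>R axis k 1))) = (\<lambda>t. len *\<^sub>R Psi (z + t *\<^sub>R axis k 1))"
    using len by (simp add: Psi_def pt_def fun_eq_iff)
  show ?thesis unfolding e
    using bounded_linear.has_vector_derivative[OF bounded_linear_scaleR_right pd_vector_derivative[OF open_ball smooth_Psi, of z 0 k]] assms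
    by simp
qed

text \<open>The derivative falls on the base point, costing three first derivatives of the map, or
  on one of the two arguments, costing a Hessian; each carries the factor
  \<open>\<alpha>\<close>.\<close>

lemma pd_GG_le: assumes z: "z \<in> unit_box" shows "norm (pd k (\<lambda>z. GG z i j) z) \<le> \<alpha> * c0^3 * (1 + K)"
proof -
  note zb = box_ball[OF z]
  have q: "((\<lambda>t. pd i Psi (z + t *\<^sub>R axis k 1)) has_vector_derivative pd k (pd i Psi) z) (at 0)" for i
    using pd_vector_derivative[OF open_ball smooth_on_pd[OF smooth_Psi], of z 0 k] zb by simp
  have U: "\<Phi> (pt (z + 0 *\<^sub>R axis k 1)) \<in> U" using Phi_pt[OF zb] by simp
  define D where "D = dchris (\<Phi> (pt z)) (len *\<^sub>R pd k Psi z) (pd i Psi z) (pd j Psi z)"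
  define X where "X = chris g (\<Phi> (pt z)) (pd k (pd i Psi) z) (pd j Psi z)"
  define Y where "Y = chris g (\<Phi> (pt z)) (pd i Psi z) (pd k (pd j Psi) z)"
  have "((\<lambda>t. GG (z + t *\<^sub>R axis k 1) i j) has_vector_derivative len *\<^sub>R (D + X + Y)) (at 0)"
    unfolding GG_def D_def X_def Y_def
    using bounded_linear.has_vector_derivative[OF bounded_linear_scaleR_right chris_has_vector_derivative[OF Phi_pt_derivative[OF zb] U q q]]
    by simp
  moreover have "((\<lambda>t. GG (z + t *\<^sub>R axis k 1) i j) has_vector_derivative pd k (\<lambda>z. GG z i j) z) (at 0)"
    using pd_vector_derivative[OF open_ball smooth_GG, of z 0 k] zb by simp
  ultimately have e: "pd k (\<lambda>z. GG z i j) z = len *\<^sub>R (D + X + Y)" by (rule vector_derivative_unique_at[symmetric])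
  have "len * norm D = len^2 * norm (dchris (\<Phi> (pt z)) (pd k Psi z) (pd i Psi z) (pd j Psi z))"
  proof -
    have "D = len *\<^sub>R dchris (\<Phi> (pt z)) (pd k Psi z) (pd i Psi z) (pd j Psi z)"
      unfolding D_def by (rule dchris_scale[OF Phi_pt[OF zb]])
    then show ?thesis using len by (simp add: power2_eq_square)
  qed
  also have "\<dots> \<le> \<alpha> * norm (pd k Psi z) * norm (pd i Psi z) * norm (pd j Psi z)" by (rule dchris_le[OF z])
  also have "\<dots> \<le> \<alpha> * c0 * c0 * c0" using pd_Psi_le[OF z] \<alpha> c0 by (intro mult_mono mult_nonneg_nonneg) auto
  finally have 1: "len * norm D \<le> \<alpha> * c0 * c0 * c0" .
  have "len * norm X \<le> \<alpha> * norm (pd k (pd i Psi) z) * norm (pd j Psi z)" unfolding X_def by (rule chris_le[OF z])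
  also have "\<dots> \<le> \<alpha> * K * c0" using pd_Psi_le[OF z] hessian_le[OF z] \<alpha> c0 K by (intro mult_mono mult_nonneg_nonneg) auto
  finally have 2: "len * norm X \<le> \<alpha> * K * c0" .
  have "len * norm Y \<le> \<alpha> * norm (pd i Psi z) * norm (pd k (pd j Psi) z)" unfolding Y_def by (rule chris_le[OF z])
  also have "\<dots> \<le> \<alpha> * c0 * K" using pd_Psi_le[OF z] hessian_le[OF z] \<alpha> c0 K by (intro mult_mono mult_nonneg_nonneg) auto
  finally have 3: "len * norm Y \<le> \<alpha> * c0 * K" .
  have "norm (D + X + Y) \<le> norm D + norm X + norm Y"
    using norm_triangle_ineq[of "D + X" Y] norm_triangle_ineq[of D X] by linarith
  then have "len * norm (D + X + Y) \<le> len * (norm D + norm X + norm Y)" using len by (intro mult_left_mono) auto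
  then have "norm (len *\<^sub>R (D + X + Y)) \<le> len * norm D + len * norm X + len * norm Y" using len by (simp add: distrib_left)
  also have "\<dots> \<le> \<alpha> * c0 * c0 * c0 + \<alpha> * K * c0 + \<alpha> * c0 * K" using 1 2 3 by linarith
  also have "\<dots> = \<alpha> * c0^3 + (\<alpha> * K) * (2 * c0)" by (simp add: power3_eq_cube)
  also have "(\<alpha> * K) * (2 * c0) \<le> (\<alpha> * K) * c0^3"
  proof (rule mult_left_mono)
    have "2 * 1 \<le> c0 * c0" using c0 by (intro mult_mono) auto
    then show "2 * c0 \<le> c0^3" using c0 mult_right_mono[of 2 "c0 * c0" c0] by (simp add: power3_eq_cube)
  qed (use \<alpha> K in auto)
  finally show ?thesis unfolding e by (simp add: algebra_simps)
qed

lemma pd_MM_le: assumes z: "z \<in> unit_box" shows "norm (pd k (\<lambda>z. MM z *v w) z) \<le> \<alpha> * c0 * norm w"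
proof -
  note zb = box_ball[OF z]
  have U: "\<Phi> (pt (z + 0 *\<^sub>R axis k 1)) \<in> U" using Phi_pt[OF zb] by simp
  have "((\<lambda>t. MM (z + t *\<^sub>R axis k 1)) has_vector_derivative dg (\<Phi> (pt z)) (len *\<^sub>R pd k Psi z)) (at 0)"
    using compose_has_vector_derivative[OF smooth Phi_pt_derivative[OF zb] U] by (simp add: MM_def dg_def)
  then have "((\<lambda>t. MM (z + t *\<^sub>R axis k 1) *v w) has_vector_derivative dg (\<Phi> (pt z)) (len *\<^sub>R pd k Psi z) *v w) (at 0)"
    by (rule bounded_linear.has_vector_derivative[OF bounded_bilinear.bounded_linear_left[OF bounded_bilinear_matrix_vector]])
  moreover have "smooth_on (ball 0 2) (\<lambda>z. MM z *v w)"
    by (rule smooth_on_linear_image[OF open_ball smooth_MM]) (rule bounded_bilinear.bounded_linear_left[OF bounded_bilinear_matrix_vector])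
  from pd_vector_derivative[OF open_ball this, of z 0 k] zb
  have "((\<lambda>t. MM (z + t *\<^sub>R axis k 1) *v w) has_vector_derivative pd k (\<lambda>z. MM z *v w) z) (at 0)" by simp
  ultimately have "pd k (\<lambda>z. MM z *v w) z = dg (\<Phi> (pt z)) (len *\<^sub>R pd k Psi z) *v w" by (rule vector_derivative_unique_at[symmetric])
  also have "\<dots> = len *\<^sub>R (dg (\<Phi> (pt z)) (pd k Psi z) *v w)"
    using linear_cmul[OF has_derivative_linear[OF dg_deriv[OF Phi_pt[OF zb]]]] by (simp add: scaleR_matrix_vector_assoc)
  finally have "norm (pd k (\<lambda>z. MM z *v w) z) \<le> \<alpha> * norm (pd k Psi z) * norm w" using dg_le[OF z] len by simp
  also have "\<dots> \<le> \<alpha> * c0 * norm w" using pd_Psi_le[OF z] \<alpha> c0 by (intro mult_mono mult_nonneg_nonneg) auto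
  finally show ?thesis .
qed

lemma zero_box: "0 \<in> unit_box" by (simp add: unit_box_iff)

lemma box_lipschitz:
  fixes f :: "real^2 \<Rightarrow> 'b::real_normed_vector"
  assumes "smooth_on (ball 0 2) f" "\<And>z i. z \<in> unit_box \<Longrightarrow> norm (pd i f z) \<le> B" "z \<in> unit_box"
  shows "norm (f z - f 0) \<le> 2 * B * norm z"
  using pd_lipschitz[OF _ open_ball unit_box_subset_ball assms(1,2,3) zero_box] by (simp add: unit_box_def convex_box)

lemma MM_lip: assumes z: "z \<in> unit_box" shows "norm (MM z *v w - MM 0 *v w) \<le> om * norm z * norm w"
proof -
  have s: "smooth_on (ball 0 2) (\<lambda>z. MM z *v w)"
    by (rule smooth_on_linear_image[OF open_ball smooth_MM]) (rule bounded_bilinear.bounded_linear_left[OF bounded_bilinear_matrix_vector])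
  have "norm (MM z *v w - MM 0 *v w) \<le> 2 * (\<alpha> * c0 * norm w) * norm z" by (rule box_lipschitz[OF s pd_MM_le z])
  also have "\<dots> = 2 * (\<alpha> * c0^1) * (norm w * norm z)" by simp
  also have "\<alpha> * c0^1 \<le> \<alpha> * c0^3" using \<alpha> c0 by (intro mult_left_mono power_increasing) auto
  finally show ?thesis by (simp add: mult_ac mult_right_mono)
qed

lemma GG_lip: assumes z: "z \<in> unit_box" shows "norm (GG z i j - GG 0 i j) \<le> om * (1 + K) * norm z"
  using box_lipschitz[OF smooth_GG pd_GG_le z] by (simp add: mult_ac)

text \<open>\<open>EE\<close> is the squared metric length of \<open>pd 1 Psi\<close>, so its
  oscillation is governed by the Hessian bound and the oscillation of the metric.\<close>

lemma EE_lip: assumes z: "z \<in> unit_box" shows "\<bar>EE z - EE 0\<bar> \<le> 60 * c0^6 * (1 + K) * norm z"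
proof -
  let ?p = "pd 1 Psi"
  note p = pd_Psi_le[OF z, of 1] pd_Psi_le[OF zero_box, of 1]
  have E: "EE z = ?p z \<bullet> (MM z *v ?p z)" if "z \<in> unit_box" for z using conf_Psi[OF box_ball[OF that], of 1 1] by simp
  have d: "norm (?p z - ?p 0) \<le> 2 * K * norm z" by (rule box_lipschitz[OF smooth_on_pd[OF smooth_Psi] hessian_le z])
  have e: "EE z - EE 0 = (?p z - ?p 0) \<bullet> (MM z *v ?p z) + ?p 0 \<bullet> (MM z *v ?p z - MM 0 *v ?p z) + ?p 0 \<bullet> (MM 0 *v (?p z - ?p 0))"
    unfolding E[OF z] E[OF zero_box] by (simp add: inner_diff_left inner_diff_right matrix_vector_mult_diff_distrib)
  have m: "norm (MM z *v ?p z) \<le> 2 * c0" "norm (MM 0 *v (?p z - ?p 0)) \<le> 2 * (2 * K * norm z)"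
    using metric_le[OF z, of "?p z"] metric_le[OF zero_box, of "?p z - ?p 0"] p d by linarith+
  have "norm (MM z *v ?p z - MM 0 *v ?p z) \<le> om * norm z * norm (?p z)" by (rule MM_lip[OF z])
  also have "\<dots> \<le> 1 * norm z * c0" using \<alpha> p c0 by (intro mult_mono mult_nonneg_nonneg) auto
  finally have l: "norm (MM z *v ?p z - MM 0 *v ?p z) \<le> 1 * norm z * c0" .
  have "\<bar>EE z - EE 0\<bar> \<le> (2 * K * norm z) * (2 * c0) + c0 * (1 * norm z * c0) + c0 * (2 * (2 * K * norm z))"
    using abs_inner_le[OF d m(1)] abs_inner_le[OF p(2) l] abs_inner_le[OF p(2) m(2)] unfolding e by linarith
  also have "\<dots> = (8 * c0) * (K * norm z) + c0^2 * norm z" by (simp add: power2_eq_square)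
  also have "\<dots> \<le> (60 * c0^6) * (K * norm z) + (60 * c0^6) * norm z"
  proof (intro add_mono mult_right_mono)
    have "c0^1 \<le> c0^6" "c0^2 \<le> c0^6" using c0 by (intro power_increasing; simp)+
    then have "c0 \<le> c0^6" "c0^2 \<le> c0^6" "0 \<le> c0^6" using c0 by auto
    then show "8 * c0 \<le> 60 * c0^6" "c0^2 \<le> 60 * c0^6" by linarith+
  qed (use K in auto)
  finally show ?thesis by (simp add: algebra_simps)
qed

lemma continuous_EE: "continuous_on unit_box EE"
proof -
  have "continuous_on unit_box (\<lambda>z. pd 1 Psi z \<bullet> (MM z *v pd 1 Psi z))"
    by (intro continuous_intros continuous_on_unit_box_smooth smooth_on_pd smooth_Psi smooth_MM bounded_bilinear.continuous_on[OF bounded_bilinear_matrix_vector])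
  then show ?thesis using conf_Psi[OF box_ball, of _ 1 1] by (simp cong: continuous_on_cong)
qed

text \<open>Half of the displayed integrand is the leading term of the first variation, and
  \<open>var_form_bound\<close> controls everything else. Since the first variation vanishes,
  doubling 26 gives 52, and 60 leaves room for \<open>EE_lip\<close> and the remaining
  requirements.\<close>

lemma weak_equation:
  assumes \<zeta>: "smooth_on UNIV \<zeta>" "\<And>x. x \<notin> cball 0 1 \<Longrightarrow> \<zeta> x = 0"
  shows "\<bar>integral unit_box (\<lambda>z. (lap Psi z + GG z 1 1 + GG z 2 2) \<bullet> (MM z *v v) / EE z * lap \<zeta> z)\<bar>
      \<le> 60 * c0^6 * (1 + K) * norm v * integral unit_box (\<lambda>z. norm (lap Psi z + GG z 1 1 + GG z 2 2) * (\<bar>\<zeta> z\<bar> + \<bar>pd 1 \<zeta> z\<bar> + \<bar>pd 2 \<zeta> z\<bar>))"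
proof -
  let ?Z = "\<lambda>z. lap Psi z + GG z 1 1 + GG z 2 2" and ?Y = "\<lambda>z. \<bar>\<zeta> z\<bar> + \<bar>pd 1 \<zeta> z\<bar> + \<bar>pd 2 \<zeta> z\<bar>"
  let ?P = "\<lambda>z. ?Z z \<bullet> (MM z *v v) / EE z * lap \<zeta> z"
  have b2: "\<bar>var_integrand \<zeta> v z - ?P z / 2\<bar> \<le> 26 * c0^6 * (1 + K) * (norm (?Z z) * (?Y z * norm v))" if z: "z \<in> unit_box" for z
  proof -
    note zb = box_ball[OF z]
    define C where "C = (\<lambda>i j. pd i (pd j Psi) z + GG z i j)"
    define p where "p = (\<lambda>i. pd i Psi z)"
    define p' where "p' = (\<lambda>i. pd i \<zeta> z *\<^sub>R v)"
    define M' where "M' = dg (\<Phi> (pt z)) ((len * \<zeta> z) *\<^sub>R v)"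
    define D where "D = (\<lambda>i. len *\<^sub>R (dchris (\<Phi> (pt z)) ((len * \<zeta> z) *\<^sub>R v) (p i) (p i)
        + chris g (\<Phi> (pt z)) (p' i) (p i) + chris g (\<Phi> (pt z)) (p i) (p' i)))"
    define C' where "C' = (\<lambda>i j. pd i (pd j \<zeta>) z *\<^sub>R v + len *\<^sub>R (dchris (\<Phi> (pt z)) ((len * \<zeta> z) *\<^sub>R v) (p i) (p j)
        + chris g (\<Phi> (pt z)) (p' i) (p j) + chris g (\<Phi> (pt z)) (p i) (p' j)))"
    define W where "W = ?Y z * norm v"
    have W: "W \<ge> 0" "\<bar>\<zeta> z\<bar> * norm v \<le> W" "\<bar>pd 1 \<zeta> z\<bar> * norm v \<le> W" "\<bar>pd 2 \<zeta> z\<bar> * norm v \<le> W"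
      unfolding W_def by (auto intro!: mult_right_mono)
    have p: "norm (p i) \<le> c0" for i unfolding p_def by (rule pd_Psi_le[OF z])
    have p': "norm (p' i) \<le> W" for i using W(3,4) exhaust_2[of i] by (auto simp: p'_def)
    have Zeq: "?Z z = C 1 1 + C 2 2" by (simp add: C_def lap_def)
    have v: "var_integrand \<zeta> v z = var_form (MM z) M' p p' C C' (EE z)"
      by (simp add: var_integrand_def M'_def p_def p'_def C_def C'_def)
    have Ez: "EE z > 0" "inverse (EE z) \<le> c0"
      using factor(1)[OF z] c0 EE_pos[of z] by (auto simp: field_simps)
    have M'le: "norm (M' *v w) \<le> W * norm w" for w
    proof -
      have "M' = (len * \<zeta> z) *\<^sub>R dg (\<Phi> (pt z)) v"
        unfolding M'_def by (rule linear_cmul[OF has_derivative_linear[OF dg_deriv[OF Phi_pt[OF zb]]]])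
      then have "norm (M' *v w) = \<bar>\<zeta> z\<bar> * (len * norm (dg (\<Phi> (pt z)) v *v w))"
        using len by (simp add: scaleR_matrix_vector_assoc abs_mult flip: scaleR_matrix_vector_assoc)
      also have "\<dots> \<le> \<bar>\<zeta> z\<bar> * (1 * norm v * norm w)"
        using \<alpha>_1 by (intro mult_left_mono order_trans[OF dg_le[OF z]] mult_right_mono) auto
      also have "\<dots> \<le> W * norm w" using mult_right_mono[OF W(2), of "norm w"] by (simp add: mult_ac)
      finally show ?thesis .
    qed
    have Cle: "norm (C i j) \<le> c0^2 * (1 + K)" for i j
    proof -
      have "norm (C i j) \<le> K + \<alpha> * c0^2" unfolding C_def using norm_triangle_le[OF add_mono[OF hessian_le[OF z] GG_le[OF z]]] .
      also have "\<dots> \<le> c0^2 * K + c0^2"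
    proof -
      have "1 * K \<le> c0^2 * K" using one_le_power[of c0 2] c0 K by (intro mult_right_mono) auto
      moreover have "\<alpha> * c0^2 \<le> 1 * c0^2" using \<alpha>_1 by (intro mult_right_mono) auto
      ultimately show ?thesis by simp
    qed
      finally show ?thesis by (simp add: algebra_simps)
    qed
    have D: "norm (D i) \<le> 2 * c0^2 * W" for i
    proof -
      have "dchris (\<Phi> (pt z)) ((len * \<zeta> z) *\<^sub>R v) (p i) (p i) = (len * \<zeta> z) *\<^sub>R dchris (\<Phi> (pt z)) v (p i) (p i)"
        by (rule dchris_scale[OF Phi_pt[OF zb]])
      then have "len * norm (dchris (\<Phi> (pt z)) ((len * \<zeta> z) *\<^sub>R v) (p i) (p i)) = \<bar>\<zeta> z\<bar> * (len^2 * norm (dchris (\<Phi> (pt z)) v (p i) (p i)))"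
        using len by (simp add: abs_mult power2_eq_square)
      also have "\<dots> \<le> \<bar>\<zeta> z\<bar> * (\<alpha> * norm v * norm (p i) * norm (p i))" by (intro mult_left_mono dchris_le[OF z]) simp
      also have "\<dots> \<le> \<bar>\<zeta> z\<bar> * (1 * norm v * c0 * c0)"
        using \<alpha>_1 \<alpha> p c0 by (intro mult_left_mono mult_mono mult_nonneg_nonneg) auto
      also have "\<dots> \<le> W * c0^2" using mult_right_mono[OF W(2), of "c0^2"] by (simp add: power2_eq_square mult_ac)
      finally have 1: "len * norm (dchris (\<Phi> (pt z)) ((len * \<zeta> z) *\<^sub>R v) (p i) (p i)) \<le> W * c0^2" .
      have 2: "len * norm (chris g (\<Phi> (pt z)) (p' i) (p i)) \<le> 1 * W * c0"
        using \<alpha>_1 \<alpha> p p' c0 W by (intro order_trans[OF chris_le[OF z]] mult_mono mult_nonneg_nonneg) auto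
      have 3: "len * norm (chris g (\<Phi> (pt z)) (p i) (p' i)) \<le> 1 * c0 * W"
        using \<alpha>_1 \<alpha> p p' c0 W by (intro order_trans[OF chris_le[OF z]] mult_mono mult_nonneg_nonneg) auto
      have nt: "norm (x + y + w) \<le> norm x + norm y + norm w" for x y w :: "real^'m"
        using norm_triangle_ineq[of "x + y" w] norm_triangle_ineq[of x y] by linarith
      have "norm (D i) \<le> len * (norm (dchris (\<Phi> (pt z)) ((len * \<zeta> z) *\<^sub>R v) (p i) (p i))
        + norm (chris g (\<Phi> (pt z)) (p' i) (p i)) + norm (chris g (\<Phi> (pt z)) (p i) (p' i)))"
        unfolding D_def norm_scaleR using len by (intro mult_mono nt) auto
      also have "\<dots> \<le> W * c0^2 + 1 * W * c0 + 1 * c0 * W" using 1 2 3 unfolding distrib_left by linarith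
      also have "\<dots> = c0^2 * W + 2 * c0 * W" by simp
      also have "2 * c0 * W \<le> c0^2 * W" using c0 W unfolding power2_eq_square by (intro mult_right_mono) auto
      finally show ?thesis by (simp only: mult_2 distrib_right mult.assoc)
    qed
    have C': "C' 1 1 + C' 2 2 = lap \<zeta> z *\<^sub>R v + (D 1 + D 2)"
      by (simp add: C'_def D_def lap_def scaleR_add_left)
    have D2: "norm (D 1 + D 2) \<le> 4 * c0^2 * W"
      using norm_triangle_ineq[of "D 1" "D 2"] D[of 1] D[of 2] by linarith
    show ?thesis unfolding v Zeq W_def[symmetric]
      by (rule var_form_bound[where C = C and C' = C' and p = p and p' = p', OF c0 K W(1) metric_le[OF z] M'le p p' Cle C' D2 Ez])
  qed
  note cz = smooth_on_UNIV_continuous[OF \<zeta>(1)] smooth_on_UNIV_continuous[OF smooth_on_pd[OF \<zeta>(1)]]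
    smooth_on_UNIV_continuous[OF smooth_on_lap[OF open_UNIV \<zeta>(1)]]
  note cE = continuous_EE
  have cZ: "continuous_on unit_box ?Z" by (intro continuous_intros continuous_on_unit_box_smooth smooth_on_lap smooth_Psi smooth_GG open_ball)
  have cP: "continuous_on unit_box ?P"
    using EE_pos by (intro continuous_intros cZ cE cz continuous_on_unit_box_smooth smooth_MM bounded_bilinear.continuous_on[OF bounded_bilinear_matrix_vector])
      (auto simp: less_imp_neq[OF EE_pos, symmetric])
  have cY: "continuous_on unit_box (\<lambda>z. norm (?Z z) * ?Y z)" by (intro continuous_intros cZ cz)
  note fv = first_variation_zero[OF \<zeta>, of v]
  have "integral unit_box (\<lambda>z. ?P z / 2) = - integral unit_box (\<lambda>z. var_integrand \<zeta> v z - ?P z / 2)"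
    using integral_diff[OF unit_box_integrable[OF fv(2)] unit_box_integrable[OF continuous_on_divide[OF cP continuous_on_const, of 2]]] fv(1)
    by simp
  moreover have "\<bar>integral unit_box (\<lambda>z. var_integrand \<zeta> v z - ?P z / 2)\<bar>
      \<le> integral unit_box (\<lambda>z. (26 * c0^6 * (1 + K) * norm v) * (norm (?Z z) * ?Y z))"
  proof (rule abs_integral_unit_box_le)
    show "continuous_on unit_box (\<lambda>z. var_integrand \<zeta> v z - ?P z / 2)"
      by (rule continuous_on_diff[OF fv(2) continuous_on_divide[OF cP continuous_on_const]]) auto
    show "continuous_on unit_box (\<lambda>z. (26 * c0^6 * (1 + K) * norm v) * (norm (?Z z) * ?Y z))"
      by (rule continuous_on_mult_left[OF cY])
    show "\<bar>var_integrand \<zeta> v z - ?P z / 2\<bar> \<le> (26 * c0^6 * (1 + K) * norm v) * (norm (?Z z) * ?Y z)" if "z \<in> unit_box" for z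
      using b2[OF that] by (simp only: mult_ac)
  qed
  ultimately have "\<bar>integral unit_box ?P / 2\<bar> \<le> (26 * c0^6 * (1 + K) * norm v) * integral unit_box (\<lambda>z. norm (?Z z) * ?Y z)"
    unfolding integral_divide integral_mult_right by (simp only: abs_minus_cancel)
  moreover have "0 \<le> c0^6 * (1 + K) * norm v * integral unit_box (\<lambda>z. norm (?Z z) * ?Y z)"
    using K c0 by (intro mult_nonneg_nonneg integral_nonneg unit_box_integrable cY) auto
  ultimately show ?thesis by (simp add: mult.assoc)
qed

lemma unit_disc: "unit_disc Psi MM GG EE (60 * c0^6) K om"
proof
  have "c0^1 \<le> c0^6" using c0 by (intro power_increasing) auto
  then have cb: "c0 \<le> 60 * c0^6" "1 \<le> 60 * c0^6" using c0 by simp_all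
  show "60 * c0^6 \<ge> 1" by (rule cb)
  show "0 \<le> om" using \<alpha> c0 by simp
  fix z assume z: "z \<in> unit_box"
  have "1 / (60 * c0^6) \<le> 1 / c0" using cb(1) c0 by (intro divide_left_mono) auto
  then show "1 / (60 * c0^6) \<le> EE z" using factor(1)[OF z] by linarith
  show "EE z \<le> 60 * c0^6" using factor(2)[OF z] cb(1) c0 by linarith
  show "norm (pd i Psi z) \<le> 60 * c0^6" for i using pd_Psi_le[OF z] cb(1) by (rule order_trans)
  show "norm (GG z i j) \<le> om" for i j by (rule order_trans[OF GG_le[OF z] \<alpha>_le]) simp
  show "\<bar>EE z - EE 0\<bar> \<le> 60 * c0 ^ 6 * (1 + K) * norm z" by (rule EE_lip[OF z])
  show "norm (MM z *v w - MM 0 *v w) \<le> om * norm z * norm w" for w by (rule MM_lip[OF z])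
  show "norm (GG z i j - GG 0 i j) \<le> om * (1 + K) * norm z" for i j by (rule GG_lip[OF z])
  show "norm (MM z *v w) \<le> 2 * norm w" for w by (rule metric_le[OF z])
  show "norm w ^ 2 / 2 \<le> w \<bullet> (MM z *v w)" for w by (rule metric_pos[OF z])
  show "u \<bullet> (MM z *v w) = w \<bullet> (MM z *v u)" for u w by (rule M_sym'[OF box_ball[OF z]])
  show "pd i Psi z \<bullet> (MM z *v pd j Psi z) = (if i = j then EE z else 0)" for i j by (rule conf_Psi[OF box_ball[OF z]])
  show "norm (pd i (pd j Psi) z) \<le> K" for i j by (rule hessian_le[OF z])
next
  fix \<zeta> :: "real^2 \<Rightarrow> real" and v assume "smooth_on UNIV \<zeta>" "\<And>x. x \<notin> cball 0 1 \<Longrightarrow> \<zeta> x = 0"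
  then show "\<bar>integral unit_box (\<lambda>z. (lap Psi z + GG z 1 1 + GG z 2 2) \<bullet> (MM z *v v) / EE z * lap \<zeta> z)\<bar>
      \<le> 60 * c0^6 * (1 + K) * norm v * integral unit_box (\<lambda>z. norm (lap Psi z + GG z 1 1 + GG z 2 2) * (\<bar>\<zeta> z\<bar> + \<bar>pd 1 \<zeta> z\<bar> + \<bar>pd 2 \<zeta> z\<bar>))"
    by (rule weak_equation)
qed (intro K \<alpha> smooth_Psi continuous_on_unit_box_smooth smooth_MM smooth_GG continuous_EE)+

end

subsection \<open>Energy and second fundamental form on a disc\<close>

lemma induced_metric_conformal:
  assumes c: "\<And>i j. ginner g (\<Phi> x) (pd i \<Phi> x) (pd j \<Phi> x) = E * (if i = j then 1 else 0)" and E: "E > 0"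
  shows "matrix_inv (induced_metric g \<Phi> x) = (\<chi> i j. if i = j then 1 / E else 0)" and "area_density g \<Phi> x = E"
proof -
  have i: "induced_metric g \<Phi> x = (\<chi> i j. if i = j then E else 0)"
    by (simp add: induced_metric_def c vec_eq_iff)
  show "matrix_inv (induced_metric g \<Phi> x) = (\<chi> i j. if i = j then 1 / E else 0)"
    unfolding i by (rule matrix_inv_eqI)
      (use E in \<open>simp_all add: matrix_matrix_mult_def mat_def vec_eq_iff forall_2 sum_2\<close>)
  show "area_density g \<Phi> x = E" unfolding area_density_def i using E by (simp add: det_2)
qed

sublocale controlled_disc \<subseteq> ud: unit_disc Psi MM GG EE "60 * c0^6" K om
  by (rule unit_disc)

context controlled_disc
begin

abbreviation "energy_density \<equiv> \<lambda>x. second_ff_normsq g \<Phi> x * area_density g \<Phi> x"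

lemma conformal_pt:
  assumes z: "z \<in> ball 0 2"
  shows "ginner g (\<Phi> (pt z)) (pd i \<Phi> (pt z)) (pd j \<Phi> (pt z)) = s0^2 * EE z * (if i = j then 1 else 0)"
  using conformal[OF pt_in[OF z]] s0 by (simp add: EE_def)

lemma second_ff_pt:
  assumes z: "z \<in> unit_box"
  shows "second_ff g \<Phi> (pt z) i j = (s0 / \<rho>) *\<^sub>R ud.A2 z i j"
proof -
  note zb = box_ball[OF z]
  have E: "s0^2 * EE z > 0" using s0 EE_pos by simp
  have cov: "cov_deriv2 g \<Phi> (pt z) i j = (s0 / \<rho>) *\<^sub>R ud.C2 z i j"
    using cov_Psi[OF zb, of i j] rho s0 by (simp add: ud.C2_def)
  have pdP: "pd k \<Phi> (pt z) = s0 *\<^sub>R pd k Psi z" for k using pd_Psi[OF zb, of k] s0 by simp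
  note i = induced_metric_conformal(1)[of g \<Phi> "pt z", OF conformal_pt[OF zb] E]
  show ?thesis
    unfolding second_ff_def normal_proj_def i cov pdP ginner_eq ud.A2_def MM_def[symmetric] sum_2
    using s0 rho EE_pos[of z]
    by (simp add: matrix_vector_mult_scaleR scaleR_diff_right scaleR_add_right power2_eq_square mult_ac)
qed

definition "A2_sq z = (\<Sum>i\<in>UNIV. \<Sum>j\<in>UNIV. ud.A2 z i j \<bullet> (MM z *v ud.A2 z i j))"

text \<open>The squared norm scales like an inverse square of the target length
  \<open>\<rho> * s0\<close>; in the density the area factor removes \<open>s0\<close>, and the
  change of variables will remove \<open>\<rho>\<close>.\<close>

lemma normsq_pt:
  assumes z: "z \<in> unit_box"
  shows "second_ff_normsq g \<Phi> (pt z) = A2_sq z / ((\<rho> * s0)^2 * EE z ^ 2)"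
    and "energy_density (pt z) = A2_sq z / EE z / \<rho>^2"
proof -
  note zb = box_ball[OF z]
  have E: "s0^2 * EE z > 0" using s0 EE_pos by simp
  note i = induced_metric_conformal[of g \<Phi> "pt z", OF conformal_pt[OF zb] E]
  show 1: "second_ff_normsq g \<Phi> (pt z) = A2_sq z / ((\<rho> * s0)^2 * EE z ^ 2)"
    unfolding second_ff_normsq_def Let_def i(1) second_ff_pt[OF z] ginner_eq MM_def[symmetric] A2_sq_def sum_2
    using s0 rho EE_pos[of z] by (simp add: matrix_vector_mult_scaleR field_simps power2_eq_square)
  show "energy_density (pt z) = A2_sq z / EE z / \<rho>^2"
    unfolding 1 i(2) using s0 rho EE_pos[of z] by (simp add: field_simps power2_eq_square)
qed

text \<open>The trace of the covariant Hessian is already normal by conformality, so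
  \<open>Z\<close> is the trace of \<open>A2\<close> and is controlled by the second fundamental
  form alone.\<close>

lemma A2_sq_ge:
  assumes z: "z \<in> unit_box" shows "norm (ud.A2 z i j) ^ 2 \<le> 2 * A2_sq z" "norm (ud.Z z) ^ 2 \<le> 4 * A2_sq z"
proof -
  let ?q = "\<lambda>i j. ud.A2 z i j \<bullet> (MM z *v ud.A2 z i j)"
  have q: "norm (ud.A2 z i j) ^ 2 \<le> 2 * ?q i j" for i j using metric_pos[OF z, of "ud.A2 z i j"] by simp
  have q0: "0 \<le> ?q i j" for i j using q[of i j] zero_le_power2[of "norm (ud.A2 z i j)"] by linarith
  have S: "A2_sq z = ?q 1 1 + ?q 1 2 + ?q 2 1 + ?q 2 2" by (simp add: A2_sq_def sum_2)
  show "norm (ud.A2 z i j) ^ 2 \<le> 2 * A2_sq z"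
    using q[of i j] q0[of 1 1] q0[of 1 2] q0[of 2 1] q0[of 2 2] exhaust_2[of i] exhaust_2[of j] unfolding S by auto
  have Z: "ud.Z z = ud.A2 z 1 1 + ud.A2 z 2 2"
  proof -
    have C: "ud.C2 z 1 1 + ud.C2 z 2 2 = ud.Z z" by (simp add: ud.C2_def ud.Z_def lap_def)
    have t: "ud.C2 z 1 1 \<bullet> (MM z *v pd k Psi z) + ud.C2 z 2 2 \<bullet> (MM z *v pd k Psi z) = 0" for k
      using trace_normal[OF box_ball[OF z], of k] unfolding inner_add_left[symmetric] C by (simp add: ud.Z_def)
    have "ud.A2 z 1 1 + ud.A2 z 2 2 = (ud.C2 z 1 1 + ud.C2 z 2 2)
       - (\<Sum>k\<in>UNIV. ((ud.C2 z 1 1 \<bullet> (MM z *v pd k Psi z) + ud.C2 z 2 2 \<bullet> (MM z *v pd k Psi z)) / EE z) *\<^sub>R pd k Psi z)"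
      by (simp add: ud.A2_def sum_2 add_divide_distrib scaleR_add_left algebra_simps)
    then show ?thesis unfolding t C by simp
  qed
  have "norm (ud.Z z) \<le> norm (ud.A2 z 1 1) + norm (ud.A2 z 2 2)" unfolding Z by (rule norm_triangle_ineq)
  then have "norm (ud.Z z) ^ 2 \<le> (norm (ud.A2 z 1 1) + norm (ud.A2 z 2 2))^2" by (rule power_mono) simp
  also have "\<dots> \<le> 2 * norm (ud.A2 z 1 1)^2 + 2 * norm (ud.A2 z 2 2)^2"
    using sum_squares_bound[of "norm (ud.A2 z 1 1)" "norm (ud.A2 z 2 2)"] by (simp add: power2_sum)
  finally show "norm (ud.Z z) ^ 2 \<le> 4 * A2_sq z" using q[of 1 1] q[of 2 2] q0[of 1 2] q0[of 2 1] unfolding S distrib_left by linarith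
qed

lemma energy_bounds:
  assumes e: "(LINT x:pt ` unit_box|lborel. energy_density x) \<le> e"
  shows "integral unit_box (\<lambda>z. norm (ud.A2 z i j) ^ 2) \<le> 4 * c0 * e" "integral unit_box (\<lambda>z. norm (ud.Z z) ^ 2) \<le> 4 * c0 * e"
proof -
  have cq: "continuous_on unit_box A2_sq" unfolding A2_sq_def[abs_def]
    by (intro continuous_intros ud.cont_A ud.cont bounded_bilinear.continuous_on[OF bounded_bilinear_matrix_vector])
  have nz: "EE z \<noteq> 0" for z using EE_pos[of z] by simp
  have c1: "continuous_on unit_box (\<lambda>z. A2_sq z / EE z / \<rho>^2)" "continuous_on unit_box (\<lambda>z. A2_sq z / EE z)"
    by (intro continuous_on_divide cq continuous_EE continuous_on_const; use nz rho in auto)+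
  have E: "integral unit_box (\<lambda>z. A2_sq z / EE z) \<le> e"
    using integral_pt[OF normsq_pt(2) c1(1)] e rho unfolding integral_divide by simp
  have *: "integral unit_box f \<le> 4 * c0 * e"
    if f: "continuous_on unit_box f" "\<And>z. z \<in> unit_box \<Longrightarrow> f z \<le> 4 * A2_sq z" for f :: "real^2 \<Rightarrow> real"
  proof -
    have "f z \<le> (4 * c0) * (A2_sq z / EE z)" if z: "z \<in> unit_box" for z
    proof -
      have "0 \<le> A2_sq z" using A2_sq_ge(1)[OF z, of 1 1] zero_le_power2[of "norm (ud.A2 z 1 1)"] by linarith
      then have "A2_sq z * EE z \<le> A2_sq z * c0" using factor(2)[OF z] c0 by (intro mult_left_mono) linarith+
      then have "4 * A2_sq z \<le> (4 * c0) * (A2_sq z / EE z)" using EE_pos[of z] by (simp add: field_simps)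
      then show ?thesis using f(2)[OF z] by linarith
    qed
    then have "integral unit_box f \<le> integral unit_box (\<lambda>z. (4 * c0) * (A2_sq z / EE z))"
      by (intro integral_unit_box_mono f continuous_on_mult_left c1)
    also have "\<dots> \<le> 4 * c0 * e" unfolding integral_mult_right using E c0 by (intro mult_left_mono) auto
    finally show ?thesis .
  qed
  have nn: "0 \<le> A2_sq z" if "z \<in> unit_box" for z using A2_sq_ge(1)[OF that, of 1 1] zero_le_power2[of "norm (ud.A2 z 1 1)"] by linarith
  show "integral unit_box (\<lambda>z. norm (ud.A2 z i j) ^ 2) \<le> 4 * c0 * e"
  proof (rule *)
    show "norm (ud.A2 z i j) ^ 2 \<le> 4 * A2_sq z" if "z \<in> unit_box" for z using A2_sq_ge(1)[OF that, of i j] nn[OF that] by linarith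
  qed (intro continuous_intros ud.cont_A)
  show "integral unit_box (\<lambda>z. norm (ud.Z z) ^ 2) \<le> 4 * c0 * e"
    by (rule *[OF _ A2_sq_ge(2)]) (intro continuous_intros ud.cont_Z)
qed

text \<open>Returns from the unit scale to the original one. As \<open>len\<close> will be a fixed
  multiple of |\<Phi>|, the left side is the scale invariant quantity of the theorem.\<close>

lemma second_ff_norm_center:
  assumes T: "\<And>i j. norm (ud.A2 0 i j) \<le> T"
  shows "len * second_ff_norm g \<Phi> x1 \<le> 3 * c0 * T"
proof -
  have T0: "0 \<le> T" using T[of 1 1] norm_ge_zero order_trans by blast
  have pt0: "pt 0 = x1" by (simp add: pt_def)
  have q: "ud.A2 0 i j \<bullet> (MM 0 *v ud.A2 0 i j) \<le> T * (2 * T)" for i j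
    using abs_inner_le[OF T[of i j] order_trans[OF metric_le[OF zero_box, of "ud.A2 0 i j"]], of "2 * T"] T[of i j] by linarith
  have "A2_sq 0 \<le> 8 * T^2" unfolding A2_sq_def sum_2 using q[of 1 1] q[of 1 2] q[of 2 1] q[of 2 2] by (simp add: power2_eq_square)
  also have "\<dots> \<le> (3 * T)^2" by (simp add: power_mult_distrib)
  finally have A: "A2_sq 0 \<le> (3 * T)^2" .
  have iE: "inverse (EE 0) \<le> c0" using factor(1)[OF zero_box] EE_pos[of 0] c0 by (simp add: field_simps)
  have "len^2 * second_ff_normsq g \<Phi> x1 = A2_sq 0 * inverse (EE 0) ^ 2"
    using normsq_pt(1)[OF zero_box] s0 rho EE_pos[of 0] by (simp add: pt0 len_def field_simps)
  also have "\<dots> \<le> (3 * T)^2 * c0^2" using A iE EE_pos[of 0] by (intro mult_mono power_mono) auto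
  finally have "len^2 * second_ff_normsq g \<Phi> x1 \<le> (3 * c0 * T)^2" by (simp add: power_mult_distrib mult_ac)
  then have "sqrt (len^2 * second_ff_normsq g \<Phi> x1) \<le> 3 * c0 * T" using T0 c0 by (intro real_le_lsqrt) auto
  then show ?thesis using len by (simp add: real_sqrt_mult second_ff_norm_def)
qed

end

section \<open>Absolute continuity of the energy and the choice of small parameters\<close>

text \<open>Dominated convergence: since 0 is not in \<open>A\<close>, the truncations to small
  balls tend to 0 at every point. Passing to the absolute value makes the radius work for all
  \<open>B\<close> at once.\<close>

lemma shrinking_integral:
  fixes f :: "'a::euclidean_space \<Rightarrow> real"
  assumes f: "set_integrable lborel A f" and A: "A \<in> sets borel" "0 \<notin> A" and e: "e > 0"
  shows "\<exists>\<delta>>0. \<forall>B. B \<in> sets borel \<and> B \<subseteq> A \<inter> ball 0 \<delta> \<longrightarrow> (LINT x:B|lborel. f x) \<le> e"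
proof -
  let ?h = "\<lambda>n x. indicator (A \<inter> ball 0 (1 / real (Suc n))) x * \<bar>f x\<bar>"
  have int: "set_integrable lborel B (\<lambda>x. \<bar>f x\<bar>)" if "B \<in> sets borel" "B \<subseteq> A" for B
    using set_integrable_abs[OF set_integrable_subset[OF f]] that by simp
  have meas: "set_borel_measurable lborel A f" using f by (simp add: set_integrable_def set_borel_measurable_def)
  have 1: "integrable lborel (\<lambda>x. indicator A x * \<bar>f x\<bar>)" using int[OF A(1)] by (simp add: set_integrable_def)
  have 2: "?h n \<in> borel_measurable lborel" for n
    using int[of "A \<inter> ball 0 (1 / real (Suc n))"] A(1) by (simp add: set_integrable_def)
  have 3: "AE x in lborel. (\<lambda>n. ?h n x) \<longlonglongrightarrow> 0"
  proof (intro AE_I2)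
    fix x :: 'a
    show "(\<lambda>n. ?h n x) \<longlonglongrightarrow> 0"
    proof (cases "x \<in> A")
      case True
      then have "norm x > 0" using A(2) by auto
      then obtain N where N: "1 / real (Suc N) < norm x" using nat_approx_posE by blast
      have "\<forall>\<^sub>F n in sequentially. ?h n x = 0"
      proof (rule eventually_sequentiallyI[of N])
        fix n assume "N \<le> n"
        then have "1 / real (Suc n) \<le> 1 / real (Suc N)" by (simp add: frac_le)
        then show "?h n x = 0" using N by (auto simp: indicator_def)
      qed
      then show ?thesis by (rule tendsto_eventually)
    qed simp
  qed
  have 4: "AE x in lborel. norm (?h n x) \<le> indicator A x * \<bar>f x\<bar>" for n by (auto simp: indicator_def)
  have "(\<lambda>n. integral\<^sup>L lborel (?h n)) \<longlonglongrightarrow> integral\<^sup>L lborel (\<lambda>x::'a. 0::real)"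
    by (rule integral_dominated_convergence[OF _ 2 1 3 4]) simp
  then have "(\<lambda>n. integral\<^sup>L lborel (?h n)) \<longlonglongrightarrow> 0" by simp
  from eventually_happens'[OF sequentially_bot order_tendstoD(2)[OF this e]]
  obtain n where n: "integral\<^sup>L lborel (?h n) < e" by blast
  show ?thesis
  proof (intro exI[of _ "1 / real (Suc n)"] conjI allI impI)
    fix B assume B: "B \<in> sets borel \<and> B \<subseteq> A \<inter> ball 0 (1 / real (Suc n))"
    have "(LINT x:B|lborel. f x) \<le> integral\<^sup>L lborel (?h n)"
      unfolding set_lebesgue_integral_def
    proof (rule integral_mono)
      show "integrable lborel (\<lambda>x. indicator B x *\<^sub>R f x)"
        using set_integrable_subset[OF f] B by (simp add: set_integrable_def)
      show "integrable lborel (?h n)" using int[of "A \<inter> ball 0 (1 / real (Suc n))"] A(1) by (simp add: set_integrable_def)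
      show "indicator B x *\<^sub>R f x \<le> ?h n x" for x using B by (auto simp: indicator_def)
    qed
    then show "(LINT x:B|lborel. f x) \<le> e" using n by linarith
  qed simp
qed

text \<open>The order matters: \<open>\<eta>\<close> is fixed first and takes up part of the
  tolerance, and only then are energy and metric error made small relative to it, because
  \<open>e / \<eta>^2\<close> blows up as \<open>\<eta>\<close> shrinks.\<close>

lemma small_remainder:
  fixes B T :: real
  assumes T: "T > 0" and B: "B \<ge> 0"
  shows "\<exists>\<eta>>0. \<exists>\<epsilon>>0. \<forall>e w. 0 \<le> e \<and> e \<le> \<epsilon> \<and> 0 \<le> w \<and> w \<le> \<epsilon> \<longrightarrow> B * (\<eta> + e / \<eta>^2 + e / \<eta> + w) \<le> T"
proof -
  define \<eta> where "\<eta> = T / (2 * (B + 1))"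
  have \<eta>: "\<eta> > 0" using T B by (simp add: \<eta>_def)
  have b: "B * \<eta> < T" using T B by (simp add: \<eta>_def field_simps) (use T mult_nonneg_nonneg[OF B, of T] in linarith)
  have "((\<lambda>e. B * (\<eta> + e / \<eta>^2 + e / \<eta> + e)) \<longlongrightarrow> B * (\<eta> + 0 / \<eta>^2 + 0 / \<eta> + 0)) (at_right 0)"
    using \<eta> by (intro tendsto_intros) auto
  then have "((\<lambda>e. B * (\<eta> + e / \<eta>^2 + e / \<eta> + e)) \<longlongrightarrow> B * \<eta>) (at_right 0)" by simp
  from eventually_conj[OF order_tendstoD(2)[OF this b] eventually_at_right_less[of 0]]
  obtain \<epsilon> where \<epsilon>: "\<epsilon> > 0" "B * (\<eta> + \<epsilon> / \<eta>^2 + \<epsilon> / \<eta> + \<epsilon>) < T"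
    using eventually_happens'[of "at_right (0::real)"] by (auto simp: trivial_limit_at_right_real)
  have "B * (\<eta> + e / \<eta>^2 + e / \<eta> + w) \<le> T" if "0 \<le> e" "e \<le> \<epsilon>" "0 \<le> w" "w \<le> \<epsilon>" for e w
  proof -
    have "B * (\<eta> + e / \<eta>^2 + e / \<eta> + w) \<le> B * (\<eta> + \<epsilon> / \<eta>^2 + \<epsilon> / \<eta> + \<epsilon>)"
      using that \<eta> B by (intro mult_left_mono add_mono divide_right_mono) auto
    then show ?thesis using \<epsilon> by linarith
  qed
  then show ?thesis using \<eta> \<epsilon>(1) by blast
qed

lemma norm_double_sum_le:
  fixes h :: "'m::finite \<Rightarrow> 'm \<Rightarrow> 'b::real_normed_vector"
  assumes "\<And>\<alpha> \<beta>. norm (h \<alpha> \<beta>) \<le> B"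
  shows "norm (\<Sum>\<alpha>\<in>UNIV. \<Sum>\<beta>\<in>UNIV. (u $ \<alpha> * v $ \<beta>) *\<^sub>R h \<alpha> \<beta>) \<le> real CARD('m)^2 * (B * norm u * norm (v::real^'m))"
proof -
  have "norm (\<Sum>\<alpha>\<in>UNIV. \<Sum>\<beta>\<in>UNIV. (u $ \<alpha> * v $ \<beta>) *\<^sub>R h \<alpha> \<beta>) \<le> (\<Sum>\<alpha>\<in>(UNIV::'m set). \<Sum>\<beta>\<in>(UNIV::'m set). B * norm u * norm v)"
  proof (intro sum_norm_le)
    fix \<alpha> \<beta> :: 'm
    have "norm ((u $ \<alpha> * v $ \<beta>) *\<^sub>R h \<alpha> \<beta>) \<le> norm u * norm v * B"
      unfolding norm_scaleR abs_mult by (intro mult_mono component_le_norm_cart assms mult_nonneg_nonneg) auto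
    then show "norm ((u $ \<alpha> * v $ \<beta>) *\<^sub>R h \<alpha> \<beta>) \<le> B * norm u * norm v" by (simp add: mult_ac)
  qed
  then show ?thesis by (simp add: power2_eq_square mult_ac)
qed

subsection \<open>Decay at the branch point\<close>

locale willmore_branch = willmore_immersion g \<Phi> lam
  for g :: "'m::finite metric_tensor" and \<Phi> :: "real^2 \<Rightarrow> real^'m" and lam :: "real^2 \<Rightarrow> real" +
  fixes \<tau> :: real and n :: nat
  assumes tau: "0 < \<tau>" "\<tau> \<le> 1"
    and decay: "\<And>\<alpha> \<beta>. bigO_derivs 2 \<tau> (\<lambda>y. g y $ \<alpha> $ \<beta> - (if \<alpha> = \<beta> then 1 else 0))"
    and cont: "continuous_on (ball 0 1) \<Phi>"
    and origin: "\<Phi> 0 = 0"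
    and finite_energy: "set_integrable lborel (ball 0 1 - {0}) (\<lambda>x. second_ff_normsq g \<Phi> x * area_density g \<Phi> x)"
    and factor_theta: "(\<lambda>x. exp (lam x)) \<in> \<Theta>[at 0](\<lambda>x. norm x ^ n)"
begin

lemma factor_bounds:
  obtains c1 c2 r where "c1 > 0" "c2 > 0" "0 < r" "r \<le> 1"
    "\<And>x. x \<noteq> 0 \<Longrightarrow> norm x < r \<Longrightarrow> c1 * norm x ^ n \<le> exp (lam x)"
    "\<And>x. x \<noteq> 0 \<Longrightarrow> norm x < r \<Longrightarrow> exp (lam x) \<le> c2 * norm x ^ n"
proof -
  from factor_theta obtain c2 where c2: "c2 > 0" "\<forall>\<^sub>F x in at 0. norm (exp (lam x)) \<le> c2 * norm (norm x ^ n)"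
    unfolding bigtheta_def by (auto elim: landau_o.bigE)
  from factor_theta obtain c1 where c1: "c1 > 0" "\<forall>\<^sub>F x in at 0. norm (exp (lam x)) \<ge> c1 * norm (norm x ^ n)"
    unfolding bigtheta_def by (auto elim: landau_omega.bigE)
  from eventually_conj[OF c1(2) c2(2)] obtain r where r: "r > 0"
    "\<And>x. x \<noteq> 0 \<Longrightarrow> norm x < r \<Longrightarrow> c1 * norm x ^ n \<le> exp (lam x) \<and> exp (lam x) \<le> c2 * norm x ^ n"
    unfolding eventually_at by (auto simp: dist_norm)
  show ?thesis by (rule that[of c1 c2 "min r 1"]) (use c1 c2 r in auto)
qed

lemma Phi_small: assumes "e > 0" obtains r where "0 < r" "r \<le> 1" "\<And>x. norm x < r \<Longrightarrow> norm (\<Phi> x) < e"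
proof -
  have "isCont \<Phi> 0" using cont centre_in_ball[of 0 1] unfolding continuous_on_eq_continuous_at[OF open_ball] by simp
  then obtain r where "r > 0" "\<And>x. norm x < r \<Longrightarrow> norm (\<Phi> x) < e"
    unfolding continuous_at_eps_delta using assms origin by (auto simp: dist_norm)
  then show ?thesis using that[of "min r 1"] by auto
qed

lemma Phi_derivative:
  assumes x: "x \<in> ball 0 1 - {0}" and B: "\<And>i. norm (pd i \<Phi> x) \<le> B"
  shows "norm (frechet_derivative \<Phi> (at x) u) \<le> 2 * B * norm u"
proof -
  have hd: "(\<Phi> has_derivative frechet_derivative \<Phi> (at x)) (at x)" by (rule smooth_on_has_derivative[OF S_open smooth_Phi x])
  have "norm (u $ i *\<^sub>R pd i \<Phi> x) \<le> norm u * B" for i by (intro norm_smult_le component_le_norm_cart B)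
  from this[of 1] this[of 2] show ?thesis
    unfolding has_derivative_axis_sum[OF hd, of u] sum_2
    using norm_triangle_ineq[of "u $ 1 *\<^sub>R pd 1 \<Phi> x" "u $ 2 *\<^sub>R pd 2 \<Phi> x"] by (simp add: mult_ac)
qed

text \<open>The discs below have radius comparable to \<open>|\<Phi>|/e\<^sup>\<lambda>\<close>, so that \<open>|\<Phi>|\<close> is almost constant on them.\<close>

lemma disc_constants:
  obtains c0 \<kappa> A r where "c0 \<ge> 2" "\<kappa> > 0" "A \<ge> 0" "0 < r" "r \<le> 1 / 2"
    "\<And>x0. x0 \<noteq> 0 \<Longrightarrow> norm x0 < r \<Longrightarrow> \<kappa> * norm (\<Phi> x0) / norm x0 ^ n \<le> norm x0 / 2"
    "\<And>x0 x1 \<rho> K. x0 \<noteq> 0 \<Longrightarrow> norm x0 < r \<Longrightarrow> \<rho> > 0 \<Longrightarrow> K \<ge> 0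
       \<Longrightarrow> ball x1 (2 * \<rho>) \<subseteq> ball x0 (\<kappa> * norm (\<Phi> x0) / norm x0 ^ n)
       \<Longrightarrow> (\<And>x i j. x \<in> ball x1 (2 * \<rho>) \<Longrightarrow> norm (pd i (pd j \<Phi>) x) * (\<rho> / norm x0 ^ n) \<le> K)
       \<Longrightarrow> controlled_disc g \<Phi> lam x1 \<rho> (norm x0 ^ n) c0 (A * norm (\<Phi> x0) powr \<tau>) K"
proof -
  let ?S = "ball 0 1 - {0} :: (real^2) set" and ?m = "real CARD('m)"
  obtain C rC where C: "C \<ge> 1" "0 < rC" "rC \<le> 1" and conn: "\<And>y u v \<alpha> \<beta>. 0 < norm y \<Longrightarrow> norm y < rC \<Longrightarrow>
     norm v ^ 2 / 2 \<le> v \<bullet> (g y *v v) \<and> norm (g y *v v) \<le> 2 * norm v \<and>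
     norm (dg y u *v v) \<le> C * norm y powr (\<tau> - 1) * norm u * norm v \<and>
     norm (chris_vec g y \<alpha> \<beta>) \<le> C * norm y powr (\<tau> - 1) \<and>
     norm (frechet_derivative (\<lambda>y. chris_vec g y \<alpha> \<beta>) (at y) u) \<le> C * norm y powr (\<tau> - 2) * norm u"
    using connection_decay[OF tau refl decay] by blast
  obtain c1 c2 r1 where c12: "c1 > 0" "c2 > 0" and r1: "0 < r1" "r1 \<le> 1"
    and lo: "\<And>x. x \<noteq> 0 \<Longrightarrow> norm x < r1 \<Longrightarrow> c1 * norm x ^ n \<le> exp (lam x)"
    and hi: "\<And>x. x \<noteq> 0 \<Longrightarrow> norm x < r1 \<Longrightarrow> exp (lam x) \<le> c2 * norm x ^ n"
    using factor_bounds by metis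
  obtain r2 where r2: "0 < r2" "r2 \<le> 1" "\<And>x. norm x < r2 \<Longrightarrow> norm (\<Phi> x) < rC" using Phi_small[OF C(2)] by metis
  \<comment> \<open>On the disc |x| lies between half and twice |x0|, so exp lam / s0 lies between
    c1 / 2^n and c2 * 2^n. The two squares are the resulting bounds for \<open>EE\<close> and its
    inverse.\<close>
  define c0 where "c0 = 2 + 2 * (c2 * 2 ^ n)^2 + (2 ^ n / c1)^2"
  have c0: "c0 \<ge> 2" "2 * (c2 * 2 ^ n)^2 \<le> c0" "(2 ^ n / c1)^2 \<le> c0" by (simp_all add: c0_def)
  \<comment> \<open>\<open>L * s0\<close> is the Lipschitz constant that \<open>pd_lipschitz\<close>
    yields on the disc: dimension 2 times the bound 2 * c2 * 2^n * s0 for the partial derivatives.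
    With \<kappa> = 1 / (2 L) the map moves by at most half of |\<Phi> x0|.\<close>
  define L where "L = 4 * c2 * 2 ^ n"
  have L: "L > 0" "4 * c2 \<le> L" using c12 by (simp_all add: L_def)
  define \<kappa> where "\<kappa> = 1 / (2 * L)"
  have \<kappa>: "\<kappa> > 0" "\<kappa> * L = 1 / 2" using L by (simp_all add: \<kappa>_def)
  \<comment> \<open>The number of index pairs times the connection constant. The bracket stems from
    len <= \<kappa> d and |\<Phi>| >= d/2: \<open>2 * \<kappa>\<close> for the first-order decay and
    \<open>4 * \<kappa>^2\<close> for the second-order one.\<close>
  define A where "A = ?m^2 * C * (2 * \<kappa> + 4 * \<kappa>^2)"
  have m: "?m^2 \<ge> 1" by simp
  have A: "A \<ge> 0" "C * (2 * \<kappa>) \<le> A" "?m^2 * (C * (2 * \<kappa>)) \<le> A" "?m^2 * (C * (4 * \<kappa>^2)) \<le> A"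
  proof -
    show 1: "A \<ge> 0" "?m^2 * (C * (2 * \<kappa>)) \<le> A" "?m^2 * (C * (4 * \<kappa>^2)) \<le> A"
      unfolding A_def mult.assoc using C \<kappa> by (auto intro!: mult_left_mono)
    have "1 * (C * (2 * \<kappa>)) \<le> ?m^2 * (C * (2 * \<kappa>))" using m C \<kappa> by (intro mult_right_mono) auto
    then show "C * (2 * \<kappa>) \<le> A" using 1 by linarith
  qed
  define Q where "Q = 2 * c0^3 * A + 1"
  \<comment> \<open>Below this value of |\<Phi>| the smallness condition on \<open>\<alpha>\<close>
    in \<open>controlled_disc\<close> holds.\<close>
  define d0 where "d0 = (1 / Q) powr (1 / \<tau>)"
  have cA: "2 * c0^3 * A \<ge> 0" using c0 A by simp
  then have Q: "Q > 0" "2 * c0^3 * A \<le> Q" unfolding Q_def by linarith+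
  then have "d0 > 0" by (simp add: d0_def)
  then obtain r3 where r3: "0 < r3" "r3 \<le> 1" "\<And>x. norm x < r3 \<Longrightarrow> norm (\<Phi> x) < d0" using Phi_small by metis
  define R where "R = min r1 r2"
  have R: "0 < R" "R \<le> r1" "R \<le> r2" "R \<le> 1" using r1 r2 by (auto simp: R_def)
  have rho_S: "x \<in> ?S" if "x \<noteq> 0" "norm x < R" for x using that R by auto
  have Phi_pos: "norm (\<Phi> x) > 0" "norm (\<Phi> x) < rC" if "x \<noteq> 0" "norm x < R" for x
  proof -
    have "\<Phi> x \<in> ball 0 1 - {0}" using maps rho_S[OF that] by blast
    then show "norm (\<Phi> x) > 0" by simp
    show "norm (\<Phi> x) < rC" by (rule r2(3)) (use that R in simp)
  qed
  have pdP: "norm (pd i \<Phi> x) \<le> 2 * (c2 * norm x ^ n)" if x: "x \<noteq> 0" "norm x < R" for x i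
  proof -
    have "norm (pd i \<Phi> x)^2 / 2 \<le> pd i \<Phi> x \<bullet> (g (\<Phi> x) *v pd i \<Phi> x)" using conn Phi_pos[OF x] by blast
    also have "\<dots> = exp (lam x) ^ 2" using conformal[OF rho_S[OF x], of i i] by (simp add: ginner_eq exp_double)
    finally have "norm (pd i \<Phi> x)^2 \<le> (2 * exp (lam x))^2" 
      using zero_le_power2[of "exp (lam x)"] power_mult_distrib[of 2 "exp (lam x)" 2] unfolding power2_eq_square[of 2] by linarith
    then have "norm (pd i \<Phi> x) \<le> 2 * exp (lam x)" by (rule power2_le_imp_le) simp
    moreover have "exp (lam x) \<le> c2 * norm x ^ n" by (rule hi) (use x R in auto)
    ultimately show ?thesis by linarith
  qed
  have ray: "norm (t *\<^sub>R x) < R" if "0 < t" "t < 1" "norm x < R" for t and x :: "real^2"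
  proof -
    have "norm (t *\<^sub>R x) \<le> norm x" using that by (simp add: mult_left_le_one_le)
    then show ?thesis using that(3) by linarith
  qed
  \<comment> \<open>The mean value inequality along the ray to the origin, where \<Phi> vanishes. It
    gives |\<Phi> x| = O(|x|^(n+1)), so that a disc of radius |\<Phi> x0| / |x0|^n, up to a
    constant, stays away from the puncture.\<close>
  have growth: "norm (\<Phi> x) \<le> 4 * c2 * norm x ^ n * norm x" if x: "x \<noteq> 0" "norm x < R" for x
  proof -
    have "\<exists>t\<in>{0<..<1}. norm (\<Phi> (1 *\<^sub>R x) - \<Phi> (0 *\<^sub>R x)) \<le> norm (frechet_derivative \<Phi> (at (t *\<^sub>R x)) ((1 - 0) *\<^sub>R x))"
    proof (rule mvt_general[of 0 1 "\<lambda>t. \<Phi> (t *\<^sub>R x)" "\<lambda>t h. frechet_derivative \<Phi> (at (t *\<^sub>R x)) (h *\<^sub>R x)"])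
      have "(\<lambda>t. t *\<^sub>R x) ` {0..1} \<subseteq> ball 0 1"
      proof safe
        fix t :: real assume "t \<in> {0..1}"
        then have "norm (t *\<^sub>R x) \<le> 1 * norm x" by (simp add: mult_left_le_one_le)
        then have "norm (t *\<^sub>R x) < 1" using x R by linarith
        then show "t *\<^sub>R x \<in> ball 0 1" by simp
      qed
      then show "continuous_on {0..1} (\<lambda>t. \<Phi> (t *\<^sub>R x))"
        by (intro continuous_on_compose2[OF cont] continuous_intros)
      fix t :: real assume t: "0 < t" "t < 1"
      then have "t *\<^sub>R x \<noteq> 0" "norm (t *\<^sub>R x) < R" using x ray[of t x] by auto
      from smooth_on_has_derivative[OF S_open smooth_Phi rho_S[OF this]]
      have d: "(\<Phi> has_derivative frechet_derivative \<Phi> (at (t *\<^sub>R x))) (at (t *\<^sub>R x))" .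
      have "((\<lambda>t. t *\<^sub>R x) has_derivative (\<lambda>h. h *\<^sub>R x)) (at t)" by (auto intro!: derivative_eq_intros)
      from has_derivative_compose[where g = \<Phi> and f = "\<lambda>t. t *\<^sub>R x" and x = t, OF this d]
      show "((\<lambda>t. \<Phi> (t *\<^sub>R x)) has_derivative (\<lambda>h. frechet_derivative \<Phi> (at (t *\<^sub>R x)) (h *\<^sub>R x))) (at t)" .
    qed simp
    then obtain t where t: "0 < t" "t < 1" "norm (\<Phi> x) \<le> norm (frechet_derivative \<Phi> (at (t *\<^sub>R x)) x)"
      by (auto simp: origin)
    have tx: "t *\<^sub>R x \<noteq> 0" "norm (t *\<^sub>R x) < R" using t x ray[of t x] by auto
    note t(3)
    also have "norm (frechet_derivative \<Phi> (at (t *\<^sub>R x)) x) \<le> 2 * (2 * (c2 * norm (t *\<^sub>R x) ^ n)) * norm x"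
      by (rule Phi_derivative[OF rho_S[OF tx] pdP[OF tx]])
    also have "\<dots> \<le> 2 * (2 * (c2 * norm x ^ n)) * norm x"
      using t c12 mult_right_mono[of t 1 "norm x"] by (intro mult_right_mono mult_left_mono power_mono) auto
    finally show ?thesis by simp
  qed
  show ?thesis
  proof (rule that[of c0 \<kappa> A "min (R / 2) r3"])
    fix x0 :: "real^2" assume x0: "x0 \<noteq> 0" "norm x0 < min (R / 2) r3"
    define s0 where "s0 = norm x0 ^ n"
    define d where "d = norm (\<Phi> x0)"
    have s0: "s0 > 0" using x0 by (simp add: s0_def)
    have x0R: "norm x0 < R" using x0 R by simp
    have d: "d > 0" "d < d0" "d \<le> 4 * c2 * s0 * norm x0"
      using Phi_pos[OF x0(1) x0R] r3(3)[of x0] x0 growth[OF x0(1) x0R] by (auto simp: d_def s0_def)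
    have "\<kappa> * d \<le> \<kappa> * (L * s0 * norm x0)"
      using d(3) L \<kappa> s0 by (intro mult_left_mono order_trans[OF d(3)] mult_right_mono) auto
    also have "\<dots> = (\<kappa> * L) * (s0 * norm x0)" by simp
    finally have \<rho>0: "\<kappa> * d / s0 \<le> norm x0 / 2" unfolding \<kappa>(2) using s0 by (simp add: field_simps)
    then show "\<kappa> * norm (\<Phi> x0) / norm x0 ^ n \<le> norm x0 / 2" by (simp add: d_def s0_def)
    have "d powr \<tau> \<le> d0 powr \<tau>" using d tau by (intro powr_mono2) auto
    also have "\<dots> = 1 / Q" using tau Q by (simp add: d0_def powr_powr)
    finally have "2 * c0^3 * A * d powr \<tau> \<le> 2 * c0^3 * A * (1 / Q)" using cA by (rule mult_left_mono)
    also have "\<dots> \<le> 1" using Q by (simp add: divide_simps)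
    finally have small: "2 * c0^3 * (A * d powr \<tau>) \<le> 1" by (simp only: mult.assoc)
    let ?B = "ball x0 (\<kappa> * d / s0)"
    have near: "norm x0 / 2 < norm x \<and> norm x < 2 * norm x0 \<and> x \<noteq> 0 \<and> norm x < R" if "x \<in> ?B" for x
    proof -
      have "norm (x0 - x) < norm x0 / 2" using that \<rho>0 unfolding mem_ball dist_norm by linarith
      then show ?thesis using norm_triangle_ineq2[of x0 x] norm_triangle_ineq2[of x x0] x0
        by (auto simp: norm_minus_commute)
    qed
    have BS: "?B \<subseteq> ?S" using near rho_S by blast
    have close: "d / 2 \<le> norm (\<Phi> x)" if x: "x \<in> ?B" for x
    proof -
      have "norm (\<Phi> x - \<Phi> x0) \<le> real CARD(2) * (2 * (c2 * (2 ^ n * s0))) * norm (x - x0)"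
      proof (rule pd_lipschitz[OF convex_ball S_open BS smooth_Phi _ x])
        fix x i assume x: "x \<in> ?B"
        have "norm x ^ n \<le> (2 * norm x0)^n" using near[OF x] by (intro power_mono) auto
        then have "2 * (c2 * norm x ^ n) \<le> 2 * (c2 * (2 ^ n * s0))" using c12 by (simp add: s0_def power_mult_distrib)
        moreover have "norm (pd i \<Phi> x) \<le> 2 * (c2 * norm x ^ n)" by (rule pdP) (use near[OF x] in auto)
        ultimately show "norm (pd i \<Phi> x) \<le> 2 * (c2 * (2 ^ n * s0))" by linarith
      qed (use d \<kappa> s0 in simp)
      also have "\<dots> = L * s0 * norm (x - x0)" by (simp add: L_def)
      also have "\<dots> \<le> L * s0 * (\<kappa> * d / s0)"
        using x L s0 by (intro mult_left_mono) (auto simp: dist_norm norm_minus_commute)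
      also have "\<dots> = (\<kappa> * L) * d" using s0 by simp
      finally have "norm (\<Phi> x - \<Phi> x0) \<le> d / 2" unfolding \<kappa>(2) by simp
      then show ?thesis using norm_triangle_ineq2[of "\<Phi> x0" "\<Phi> x"] by (simp add: d_def norm_minus_commute)
    qed
    fix x1 :: "real^2" and \<rho> K :: real
    assume \<rho>: "\<rho> > 0" and K: "K \<ge> 0" and sub: "ball x1 (2 * \<rho>) \<subseteq> ball x0 (\<kappa> * norm (\<Phi> x0) / norm x0 ^ n)"
      and hess: "\<And>x i j. x \<in> ball x1 (2 * \<rho>) \<Longrightarrow> norm (pd i (pd j \<Phi>) x) * (\<rho> / norm x0 ^ n) \<le> K"
    have sub': "ball x1 (2 * \<rho>) \<subseteq> ?B" using sub by (simp add: d_def s0_def)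
    then have "2 * \<rho> \<le> \<kappa> * d / s0" using \<rho> zero_le_dist[of x1 x0] unfolding ball_subset_ball_iff by linarith
    then have rs: "\<rho> * s0 \<le> \<kappa> * d" using s0 mult_pos_pos[OF \<rho> s0] pos_le_divide_eq[OF s0, of "2 * \<rho>" "\<kappa> * d"] by linarith
    have in_ball: "x1 + \<rho> *\<^sub>R z \<in> ball x1 (2 * \<rho>)" if "z \<in> ball 0 2" for z using that \<rho> by (simp add: dist_norm)
    have disc: "x1 + \<rho> *\<^sub>R z \<in> ?S" if "z \<in> ball 0 2" for z using in_ball[OF that] sub' BS by blast
    interpret rescaled_disc g \<Phi> lam x1 \<rho> s0
      by unfold_locales (use \<rho> s0 disc in auto)
    have le: "len \<le> \<kappa> * d" using rs by (simp add: len_def)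
    have pt_B: "pt z \<in> ?B" if "z \<in> unit_box" for z using in_ball[OF box_ball[OF that]] sub' by (auto simp: pt_def)
    note npt = near[OF pt_B]
    have y: "0 < norm (\<Phi> (pt z))" "norm (\<Phi> (pt z)) < rC" if "z \<in> unit_box" for z
      using Phi_pos[of "pt z"] npt[OF that] by auto
    have p1: "norm (\<Phi> (pt z)) powr (\<tau> - 1) \<le> 2 * (d powr \<tau> / d)"
      and p2: "norm (\<Phi> (pt z)) powr (\<tau> - 2) \<le> 4 * (d powr \<tau> / d^2)" if z: "z \<in> unit_box" for z
    proof -
      have half: "(d / 2) powr (\<tau> - k) \<le> 2 ^ m * (d powr \<tau> / d ^ m)" if "k = real m" for k m
      proof -
        have "(d / 2) powr (\<tau> - k) = (d powr \<tau> / 2 powr \<tau>) / (d ^ m / 2 ^ m)"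
          using d by (simp add: powr_diff powr_divide that powr_realpow)
        also have "\<dots> = 2 ^ m * (d powr \<tau> / d ^ m) / 2 powr \<tau>" by (simp add: mult_ac)
        also have "\<dots> \<le> 2 ^ m * (d powr \<tau> / d ^ m)" using d tau ge_one_powr_ge_zero[of 2 \<tau>]
          divide_left_mono[of 1 "2 powr \<tau>" "2 ^ m * (d powr \<tau> / d ^ m)"] by simp
        finally show ?thesis .
      qed
      have "norm (\<Phi> (pt z)) powr (\<tau> - 1) \<le> (d / 2) powr (\<tau> - 1)" "norm (\<Phi> (pt z)) powr (\<tau> - 2) \<le> (d / 2) powr (\<tau> - 2)"
        using close[OF pt_B[OF z]] d tau by (intro powr_mono2'; simp)+
      then show "norm (\<Phi> (pt z)) powr (\<tau> - 1) \<le> 2 * (d powr \<tau> / d)" "norm (\<Phi> (pt z)) powr (\<tau> - 2) \<le> 4 * (d powr \<tau> / d^2)"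
        using half[of 1 1] half[of 2 2] by auto
    qed
    have l1: "len * norm (\<Phi> (pt z)) powr (\<tau> - 1) \<le> (2 * \<kappa>) * d powr \<tau>" if z: "z \<in> unit_box" for z
    proof -
      have "len * norm (\<Phi> (pt z)) powr (\<tau> - 1) \<le> (\<kappa> * d) * (2 * (d powr \<tau> / d))"
        using le len p1[OF z] d \<kappa> by (intro mult_mono) auto
      then show ?thesis using d by simp
    qed
    have l2: "len^2 * norm (\<Phi> (pt z)) powr (\<tau> - 2) \<le> (4 * \<kappa>^2) * d powr \<tau>" if z: "z \<in> unit_box" for z
    proof -
      have "len^2 * norm (\<Phi> (pt z)) powr (\<tau> - 2) \<le> (\<kappa> * d)^2 * (4 * (d powr \<tau> / d^2))"
        using le len p2[OF z] d \<kappa> by (intro mult_mono power_mono) auto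
      then show ?thesis using d by (simp add: power_mult_distrib)
    qed
    have "controlled_disc g \<Phi> lam x1 \<rho> s0 c0 (A * d powr \<tau>) K"
    proof unfold_locales
      fix z u w a assume z: "z \<in> unit_box"
      note cn = conn[OF y[OF z]]
      show "norm w ^ 2 / 2 \<le> w \<bullet> (MM z *v w)" "norm (MM z *v w) \<le> 2 * norm w" using cn unfolding MM_def by blast+
      have "len * norm (dg (\<Phi> (pt z)) u *v w) \<le> len * (C * norm (\<Phi> (pt z)) powr (\<tau> - 1) * norm u * norm w)"
        using cn len by (intro mult_left_mono) auto
      also have "\<dots> = (len * norm (\<Phi> (pt z)) powr (\<tau> - 1)) * (C * norm u * norm w)" by simp
      also have "\<dots> \<le> ((2 * \<kappa>) * d powr \<tau>) * (C * norm u * norm w)" using l1[OF z] C by (intro mult_right_mono) auto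
      also have "\<dots> = (C * (2 * \<kappa>)) * (d powr \<tau> * norm u * norm w)" by simp
      also have "\<dots> \<le> A * (d powr \<tau> * norm u * norm w)" using A by (intro mult_right_mono) auto
      finally show "len * norm (dg (\<Phi> (pt z)) u *v w) \<le> A * d powr \<tau> * norm u * norm w" by (simp add: mult.assoc)
      have "norm (chris g (\<Phi> (pt z)) u w) \<le> ?m^2 * ((C * norm (\<Phi> (pt z)) powr (\<tau> - 1)) * norm u * norm w)"
        unfolding chris_def by (rule norm_double_sum_le) (use cn in blast)
      then have "len * norm (chris g (\<Phi> (pt z)) u w) \<le> len * (?m^2 * ((C * norm (\<Phi> (pt z)) powr (\<tau> - 1)) * norm u * norm w))"
        using len by (intro mult_left_mono) auto
      also have "\<dots> = (len * norm (\<Phi> (pt z)) powr (\<tau> - 1)) * (?m^2 * C * norm u * norm w)" by simp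
      also have "\<dots> \<le> ((2 * \<kappa>) * d powr \<tau>) * (?m^2 * C * norm u * norm w)" using l1[OF z] C by (intro mult_right_mono) auto
      also have "\<dots> = (?m^2 * (C * (2 * \<kappa>))) * (d powr \<tau> * norm u * norm w)" by simp
      also have "\<dots> \<le> A * (d powr \<tau> * norm u * norm w)" using A by (intro mult_right_mono) auto
      finally show "len * norm (chris g (\<Phi> (pt z)) u w) \<le> A * d powr \<tau> * norm u * norm w" by (simp add: mult.assoc)
      have "norm (dchris (\<Phi> (pt z)) a u w) \<le> ?m^2 * ((C * norm (\<Phi> (pt z)) powr (\<tau> - 2) * norm a) * norm u * norm w)"
        unfolding dchris_def by (rule norm_double_sum_le) (use cn in blast)
      then have "len^2 * norm (dchris (\<Phi> (pt z)) a u w) \<le> len^2 * (?m^2 * ((C * norm (\<Phi> (pt z)) powr (\<tau> - 2) * norm a) * norm u * norm w))"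
        by (intro mult_left_mono) auto
      also have "\<dots> = (len^2 * norm (\<Phi> (pt z)) powr (\<tau> - 2)) * (?m^2 * C * norm a * norm u * norm w)" by simp
      also have "\<dots> \<le> ((4 * \<kappa>^2) * d powr \<tau>) * (?m^2 * C * norm a * norm u * norm w)" using l2[OF z] C by (intro mult_right_mono) auto
      also have "\<dots> = (?m^2 * (C * (4 * \<kappa>^2))) * (d powr \<tau> * norm a * norm u * norm w)" by simp
      also have "\<dots> \<le> A * (d powr \<tau> * norm a * norm u * norm w)" using A by (intro mult_right_mono) auto
      finally show "len^2 * norm (dchris (\<Phi> (pt z)) a u w) \<le> A * d powr \<tau> * norm a * norm u * norm w" by (simp add: mult.assoc)
      have E: "EE z = (exp (lam (pt z)) / s0)^2" by (simp add: EE_def exp_double power_divide)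
      have n1: "norm (pt z) ^ n \<le> 2 ^ n * s0" "s0 \<le> 2 ^ n * norm (pt z) ^ n"
        using power_mono[of "norm (pt z)" "2 * norm x0" n] power_mono[of "norm x0" "2 * norm (pt z)" n] npt[OF z]
        by (auto simp: s0_def power_mult_distrib)
      have "exp (lam (pt z)) \<le> c2 * norm (pt z) ^ n" by (rule hi) (use npt[OF z] R in auto)
      also have "\<dots> \<le> c2 * (2 ^ n * s0)" using n1 c12 by (intro mult_left_mono) auto
      finally have "exp (lam (pt z)) / s0 \<le> c2 * 2 ^ n" using s0 by (simp add: divide_simps mult_ac)
      then have "EE z \<le> (c2 * 2 ^ n)^2" unfolding E using s0 by (intro power_mono) auto
      then show "EE z \<le> c0 / 2" using c0 by linarith
      have "c1 * norm (pt z) ^ n \<le> exp (lam (pt z))" by (rule lo) (use npt[OF z] R in auto)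
      moreover have "c1 * s0 \<le> c1 * (2 ^ n * norm (pt z) ^ n)" using n1 c12 by (intro mult_left_mono) auto
      ultimately have "c1 * s0 \<le> 2 ^ n * exp (lam (pt z))" using mult_left_mono[of "c1 * norm (pt z) ^ n" "exp (lam (pt z))" "2 ^ n"]
        unfolding mult.left_commute[of c1] by (smt (verit) zero_le_power)
      then have "c1 / 2 ^ n \<le> exp (lam (pt z)) / s0" using s0 by (simp add: field_simps)
      then have "(c1 / 2 ^ n)^2 \<le> EE z" unfolding E using c12 by (intro power_mono) auto
      moreover have "1 / c0 \<le> (c1 / 2 ^ n)^2"
        using c0 c12 divide_left_mono[OF c0(3), of 1] by (simp add: power_divide)
      ultimately show "1 / c0 \<le> EE z" by linarith
    next
      fix z i j assume z: "z \<in> unit_box"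
      show "norm (pd i (pd j Psi) z) \<le> K"
        using hess[OF in_ball[OF box_ball[OF z]], of i j] \<rho> s0 unfolding pd_pd_Psi[OF box_ball[OF z]]
        by (simp add: pt_def s0_def mult.commute)
    qed (use c0 K A small in auto)
    then show "controlled_disc g \<Phi> lam x1 \<rho> (norm x0 ^ n) c0 (A * norm (\<Phi> x0) powr \<tau>) K" by (simp add: d_def s0_def)
  qed (use c0 \<kappa> A R r3 in auto)
qed

end

section \<open>Smallness of the scale invariant second fundamental form\<close>

context unit_disc
begin

text \<open>Brings all errors to one common form and isolates the term quadratic in
  \<open>K\<close>, which cannot be made small through \<open>\<eta>\<close>, energy and
  \<open>\<omega>\<close> but only through the size of the disc.\<close>

lemma remainder_le:
  assumes \<eta>: "\<eta> > 0" and e: "e \<ge> 0"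
  shows "\<bar>test_bound \<eta> e\<bar> \<le> 20 * c^2 * kernel_const^2 * (1 + K)^2 * (\<eta> + e / \<eta>^2 + e / \<eta> + \<omega>)"
    and "kernel_const * (8 * \<eta> + 2 * e / \<eta> + 128 * c^2 * K * (K + \<omega>) + 12 * \<omega>)
      \<le> kernel_const * (128 * c^2 * K^2) + kernel_const * (12 + 128 * c^2 * K) * (\<eta> + e / \<eta>^2 + e / \<eta> + \<omega>)"
proof -
  let ?B = "20 * c^2 * kernel_const^2"
  have B: "?B \<ge> 0" using c by simp
  have q: "e / \<eta>^2 \<ge> 0" "e / \<eta> \<ge> 0" using \<eta> e by auto
  have "\<eta> + (1 + K) * (e / \<eta>^2) + \<omega> \<le> (1 + K) * (\<eta> + e / \<eta>^2 + e / \<eta> + \<omega>)"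
    using mult_nonneg_nonneg[OF K less_imp_le[OF \<eta>]] mult_nonneg_nonneg[OF K q(1)] mult_nonneg_nonneg[OF K q(2)] mult_nonneg_nonneg[OF K om(1)] \<eta> q
    unfolding distrib_left distrib_right mult_1 by linarith
  then have "?B * (1 + K) * (\<eta> + (1 + K) * (e / \<eta>^2) + \<omega>) \<le> ?B * (1 + K) * ((1 + K) * (\<eta> + e / \<eta>^2 + e / \<eta> + \<omega>))"
    using B K by (intro mult_left_mono) auto
  moreover have "0 \<le> ?B * (1 + K) * (\<eta> + (1 + K) * (e / \<eta>^2) + \<omega>)"
    using B K \<eta> om q by (intro mult_nonneg_nonneg add_nonneg_nonneg) auto
  moreover have "test_bound \<eta> e = ?B * (1 + K) * (\<eta> + (1 + K) * (e / \<eta>^2) + \<omega>)"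
    by (simp only: test_bound_def times_divide_eq_right)
  ultimately show "\<bar>test_bound \<eta> e\<bar> \<le> ?B * (1 + K)^2 * (\<eta> + e / \<eta>^2 + e / \<eta> + \<omega>)"
    by (simp only: power2_eq_square[of "1 + K"] mult.assoc abs_of_nonneg)
  let ?s = "\<eta> + e / \<eta>^2 + e / \<eta> + \<omega>"
  have s: "8 * \<eta> + 2 * (e / \<eta>) + 12 * \<omega> \<le> 12 * ?s" using q \<eta> om by simp
  define b where "b = 128 * c^2 * K"
  have "b * \<omega> \<le> b * ?s" unfolding b_def using q \<eta> om K by (intro mult_left_mono) auto
  then have "8 * \<eta> + 2 * (e / \<eta>) + b * (K + \<omega>) + 12 * \<omega> \<le> b * K + (12 + b) * ?s"
    using s unfolding distrib_left[of b K] distrib_right[of 12 b] by linarith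
  then have "8 * \<eta> + 2 * e / \<eta> + 128 * c^2 * K * (K + \<omega>) + 12 * \<omega> \<le> 128 * c^2 * K^2 + (12 + 128 * c^2 * K) * ?s"
    by (simp only: b_def power2_eq_square[of K] mult.assoc times_divide_eq_right)
  then have "kernel_const * (8 * \<eta> + 2 * e / \<eta> + 128 * c^2 * K * (K + \<omega>) + 12 * \<omega>)
    \<le> kernel_const * (128 * c^2 * K^2 + (12 + 128 * c^2 * K) * ?s)"
    using kernel_const_ge_1 by (intro mult_left_mono) auto
  then show "kernel_const * (8 * \<eta> + 2 * e / \<eta> + 128 * c^2 * K * (K + \<omega>) + 12 * \<omega>)
      \<le> kernel_const * (128 * c^2 * K^2) + kernel_const * (12 + 128 * c^2 * K) * ?s"
    by (simp only: distrib_left[of kernel_const "128 * c^2 * K^2"] mult.assoc[of kernel_const])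
qed

end

lemma (in controlled_disc) pt_image_ball: "pt ` unit_box \<subseteq> ball x1 (2 * \<rho>)"
proof
  fix x assume "x \<in> pt ` unit_box"
  then obtain z where z: "z \<in> unit_box" "x = pt z" by blast
  have "norm z < 2" using box_ball[OF z(1)] by simp
  then have "\<rho> * norm z < \<rho> * 2" using rho by (rule mult_strict_left_mono)
  then show "x \<in> ball x1 (2 * \<rho>)" using rho by (simp add: z(2) pt_def dist_norm)
qed

context willmore_branch
begin

text \<open>Order of the choices: the universal \<open>Q\<close> first, then \<open>\<theta>\<close>
  from the tolerance, then \<open>\<eta>\<close> and the energy level, all for fixed
  \<open>\<theta>\<close>, and last the radius around 0.\<close>

lemma second_ff_decay:
  assumes \<epsilon>: "\<epsilon> > 0"
  shows "\<exists>r>0. \<forall>x. x \<noteq> 0 \<and> norm x < r \<longrightarrow> norm (\<Phi> x) * second_ff_norm g \<Phi> x \<le> \<epsilon>"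
proof -
  let ?kc = kernel_const
  let ?f = "\<lambda>x. second_ff_normsq g \<Phi> x * area_density g \<Phi> x"
  obtain c0 \<kappa> A r where c0: "c0 \<ge> 2" and \<kappa>: "\<kappa> > 0" and A: "A \<ge> 0" and r: "0 < r" "r \<le> 1 / 2"
    and rad: "\<And>x0. x0 \<noteq> 0 \<Longrightarrow> norm x0 < r \<Longrightarrow> \<kappa> * norm (\<Phi> x0) / norm x0 ^ n \<le> norm x0 / 2"
    and disc: "\<And>x0 x1 \<rho> K. x0 \<noteq> 0 \<Longrightarrow> norm x0 < r \<Longrightarrow> \<rho> > 0 \<Longrightarrow> K \<ge> 0
       \<Longrightarrow> ball x1 (2 * \<rho>) \<subseteq> ball x0 (\<kappa> * norm (\<Phi> x0) / norm x0 ^ n)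
       \<Longrightarrow> (\<And>x i j. x \<in> ball x1 (2 * \<rho>) \<Longrightarrow> norm (pd i (pd j \<Phi>) x) * (\<rho> / norm x0 ^ n) \<le> K)
       \<Longrightarrow> controlled_disc g \<Phi> lam x1 \<rho> (norm x0 ^ n) c0 (A * norm (\<Phi> x0) powr \<tau>) K"
    using disc_constants by metis
  define c where "c = 60 * c0^6"
  have c: "c \<ge> 1" using c0 one_le_power[of c0 6] unfolding c_def by linarith
  note kc = kernel_const_ge_1
  define R where "R x = \<kappa> * norm (\<Phi> x) / norm x ^ n" for x
  define om where "om x = 2 * c0^3 * (A * norm (\<Phi> x) powr \<tau>)" for x
  define S where "S x = (\<Sum>i\<in>UNIV. \<Sum>j\<in>UNIV. norm (pd i (pd j \<Phi>) x))" for x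
  have S_ge: "norm (pd i (pd j \<Phi>) x) \<le> S x" for i j x
    using exhaust_2[of i] exhaust_2[of j] by (auto simp: S_def sum_2)
  have S0: "S x \<ge> 0" for x unfolding S_def by (intro sum_nonneg) auto
  have Phi_nz: "norm (\<Phi> x) > 0" if "x \<noteq> 0" "norm x < r" for x
  proof -
    have "\<Phi> x \<in> ball 0 1 - {0}" using maps that r by (intro maps[THEN subsetD, OF imageI]) auto
    then show ?thesis by simp
  qed
  have R_pos: "R x > 0" if "x \<noteq> 0" "norm x < r" for x
    using Phi_nz[OF that] \<kappa> that by (simp add: R_def)
  \<comment> \<open>Metric error and energy on the disc around \<open>x0\<close> both tend to 0 with
    \<open>x0\<close>; discs of radius \<open>R x0\<close> stay in the punctured ball because
    \<open>R x0\<close> is at most half of |x0|.\<close>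
  have small: "\<exists>r'>0. r' \<le> r \<and> (\<forall>x0. x0 \<noteq> 0 \<and> norm x0 < r' \<longrightarrow> 0 \<le> om x0 \<and> om x0 \<le> e
      \<and> (\<forall>B. B \<in> sets borel \<and> B \<subseteq> ball x0 (R x0) \<longrightarrow> (LINT x:B|lborel. ?f x) \<le> e))" if e: "e > 0" for e
  proof -
    have "(ball 0 1 - {0} :: (real^2) set) \<in> sets borel" "(0 :: real^2) \<notin> ball 0 1 - {0}" by auto
    from shrinking_integral[OF finite_energy this e] obtain \<delta> where \<delta>: "\<delta> > 0"
      "\<And>B. B \<in> sets borel \<Longrightarrow> B \<subseteq> (ball 0 1 - {0}) \<inter> ball 0 \<delta> \<Longrightarrow> (LINT x:B|lborel. ?f x) \<le> e" by blast
    define q where "q = 2 * c0^3 * A + 1"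
    have q: "q > 0" "2 * c0^3 * A \<le> q" 
    proof -
      have "2 * c0^3 * A \<ge> 0" using c0 A by simp
      then show "q > 0" "2 * c0^3 * A \<le> q" unfolding q_def by linarith+
    qed
    define d0 where "d0 = (e / q) powr (1 / \<tau>)"
    have "d0 > 0" using q e by (simp add: d0_def)
    then obtain r3 where r3: "0 < r3" "\<And>x. norm x < r3 \<Longrightarrow> norm (\<Phi> x) < d0" using Phi_small by metis
    show ?thesis
    proof (intro exI[of _ "min (min r r3) (\<delta> / 2)"] conjI allI impI; (elim conjE)?)
      fix x0 :: "real^2" assume x0: "x0 \<noteq> 0" "norm x0 < min (min r r3) (\<delta> / 2)"
      show "0 \<le> om x0" using c0 A by (simp add: om_def)
      have "norm (\<Phi> x0) powr \<tau> \<le> d0 powr \<tau>" using r3(2)[of x0] x0 tau by (intro powr_mono2) auto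
      also have "\<dots> = e / q" using tau q e by (simp add: d0_def powr_powr)
      finally have "(2 * c0^3 * A) * norm (\<Phi> x0) powr \<tau> \<le> q * (e / q)" using q c0 A by (intro mult_mono) auto
      then show "om x0 \<le> e" using q by (simp add: om_def mult_ac)
      fix B assume B: "B \<in> sets borel" "B \<subseteq> ball x0 (R x0)"
      have Rx: "R x0 \<le> norm x0 / 2" unfolding R_def by (rule rad) (use x0 in auto)
      have x0pos: "norm x0 > 0" using x0 by simp
      have "ball x0 (R x0) \<subseteq> (ball 0 1 - {0}) \<inter> ball 0 \<delta>"
      proof
        fix x assume "x \<in> ball x0 (R x0)"
        then have "norm (x0 - x) < norm x0 / 2" using Rx unfolding mem_ball dist_norm by linarith
        then have "norm x < 2 * norm x0" "norm x > 0"
          using norm_triangle_ineq2[of x x0] norm_triangle_ineq2[of x0 x] norm_minus_commute[of x x0] x0pos by linarith+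
        then show "x \<in> (ball 0 1 - {0}) \<inter> ball 0 \<delta>" using x0 r by auto
      qed
      then show "(LINT x:B|lborel. ?f x) \<le> e" using \<delta>(2)[OF B(1)] B(2) by blast
    qed (use r r3 \<delta> in auto)
  qed
  \<comment> \<open>One more than the sum of four Hessian entries, each at most
    \<open>8 * c * ?kc + 1\<close>, so that reaching \<open>Q\<close> at the centre is
    contradictory.\<close>
  define Q where "Q = 32 * c * ?kc + 5"
  have Q: "Q > 0" using c kc mult_nonneg_nonneg[of c ?kc] unfolding Q_def mult.assoc by linarith
  \<comment> \<open>Point picking: at a maximum of \<open>(R - |x - x\<^sub>0|) S(x)\<close> exceeding \<open>4Q\<close>, rescaling so that \<open>S\<close> equals \<open>Q\<close> at the
    centre and is at most \<open>2Q\<close> around it contradicts the interior estimate.\<close>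
  have "\<exists>r1>0. r1 \<le> r \<and> (\<forall>x0 x. x0 \<noteq> 0 \<and> norm x0 < r1 \<and> x \<in> ball x0 (R x0) \<longrightarrow>
     (R x0 - norm (x - x0)) * S x / norm x0 ^ n \<le> 4 * Q)"
  proof -
    define B where "B = 20 * c^2 * ?kc^2 * (1 + 2 * Q)^2"
    have "B \<ge> 0" by (simp add: B_def)
    from small_remainder[OF zero_less_one this] obtain \<eta> \<epsilon>1 where \<eta>: "\<eta> > 0" "\<epsilon>1 > 0"
      "\<And>e w. 0 \<le> e \<Longrightarrow> e \<le> \<epsilon>1 \<Longrightarrow> 0 \<le> w \<Longrightarrow> w \<le> \<epsilon>1 \<Longrightarrow> B * (\<eta> + e / \<eta>^2 + e / \<eta> + w) \<le> 1" by blast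
    \<comment> \<open>The factor \<open>4 * c0\<close> compensates the loss in
      \<open>energy_bounds\<close>.\<close>
    define e where "e = \<epsilon>1 / (4 * c0)"
    have e: "e > 0" "4 * c0 * e = \<epsilon>1" "e \<le> \<epsilon>1" using \<eta> c0 by (auto simp: e_def field_simps)
    from small[OF e(1)] obtain r1 where r1: "r1 > 0" "r1 \<le> r"
      and om: "\<And>x0. x0 \<noteq> 0 \<Longrightarrow> norm x0 < r1 \<Longrightarrow> 0 \<le> om x0 \<and> om x0 \<le> e"
      and en: "\<And>x0 B. x0 \<noteq> 0 \<Longrightarrow> norm x0 < r1 \<Longrightarrow> B \<in> sets borel \<Longrightarrow> B \<subseteq> ball x0 (R x0) \<Longrightarrow> (LINT x:B|lborel. ?f x) \<le> e"
      by blast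
    have "(R x0 - norm (x - x0)) * S x / norm x0 ^ n \<le> 4 * Q" if x0: "x0 \<noteq> 0" "norm x0 < r1" and x: "x \<in> ball x0 (R x0)" for x0 x
    proof (rule ccontr)
      assume big: "\<not> (R x0 - norm (x - x0)) * S x / norm x0 ^ n \<le> 4 * Q"
      have x0r: "norm x0 < r" using x0 r1 by simp
      define s0 where "s0 = norm x0 ^ n"
      have s0: "s0 > 0" using x0 by (simp add: s0_def)
      define h where "h x = (R x0 - norm (x - x0)) * S x / s0" for x
      have Rx: "R x0 \<le> norm x0 / 2" "R x0 > 0" using rad[OF x0(1) x0r] R_pos[OF x0(1) x0r] by (auto simp: R_def)
      have x0pos: "norm x0 > 0" using x0 by simp
      have sub: "cball x0 (R x0) \<subseteq> ball 0 1 - {0}"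
      proof
        fix y assume "y \<in> cball x0 (R x0)"
        then have "norm (x0 - y) \<le> norm x0 / 2" using Rx unfolding mem_cball dist_norm by linarith
        then have "norm y < 2 * norm x0" "norm y > 0"
          using norm_triangle_ineq2[of y x0] norm_triangle_ineq2[of x0 y] norm_minus_commute[of y x0] x0pos by linarith+
        then show "y \<in> ball 0 1 - {0}" using x0r r by auto
      qed
      have "continuous_on (cball x0 (R x0)) (pd i (pd j \<Phi>))" for i j
        by (rule continuous_on_subset[OF smooth_on_continuous[OF smooth_on_pd[OF smooth_on_pd[OF smooth_Phi]]] sub])
      then have "continuous_on (cball x0 (R x0)) h"
        unfolding h_def S_def using s0 by (intro continuous_intros) auto
      from continuous_attains_sup[OF compact_cball _ this] obtain x1 where x1: "x1 \<in> cball x0 (R x0)"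
        "\<And>y. y \<in> cball x0 (R x0) \<Longrightarrow> h y \<le> h x1" using Rx by auto
      define P where "P = h x1"
      have P: "P > 4 * Q" using big x1(2)[of x] x by (simp add: P_def h_def s0_def)
      define \<delta> where "\<delta> = R x0 - norm (x1 - x0)"
      have hx1: "P = \<delta> * S x1 / s0" by (simp add: P_def h_def \<delta>_def)
      \<comment> \<open>The weight vanishes on the boundary circle, so a maximum exceeding
        \<open>4 * Q\<close> is interior.\<close>
      have \<delta>: "\<delta> > 0"
      proof (rule ccontr)
        assume "\<not> \<delta> > 0"
        then have "P \<le> 0" unfolding hx1 using S0 s0 by (simp add: divide_nonpos_pos mult_nonpos_nonneg)
        then show False using P Q by linarith
      qed
      \<comment> \<open>The scale at which the rescaled Hessian sum equals \<open>Q\<close> at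
        \<open>x1\<close>. As P exceeds 4 Q, this is less than a quarter of the distance \<delta> to
        the boundary.\<close>
      define \<rho> where "\<rho> = Q * \<delta> / P"
      have \<rho>: "\<rho> > 0" "\<rho> \<le> \<delta> / 4" "P * \<rho> = Q * \<delta>"
      proof -
        have P0: "P > 0" using P Q by linarith
        then show "\<rho> > 0" "P * \<rho> = Q * \<delta>" using Q \<delta> by (simp_all add: \<rho>_def)
        have "Q * \<delta> \<le> P / 4 * \<delta>" using P \<delta> by (intro mult_right_mono) auto
        then show "\<rho> \<le> \<delta> / 4" unfolding \<rho>_def pos_divide_le_eq[OF P0] by (simp add: mult.commute)
      qed
      have sub1: "ball x1 (2 * \<rho>) \<subseteq> ball x0 (R x0)"
        unfolding ball_subset_ball_iff using \<rho> \<delta> by (simp add: \<delta>_def dist_norm)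
      have "controlled_disc g \<Phi> lam x1 \<rho> (norm x0 ^ n) c0 (A * norm (\<Phi> x0) powr \<tau>) (2 * Q)"
      proof (rule disc[OF x0(1) x0r \<rho>(1) _ sub1[unfolded R_def]])
        fix y i j assume y: "y \<in> ball x1 (2 * \<rho>)"
        have "norm (x1 - y) < 2 * \<rho>" using y by (simp add: dist_norm)
        \<comment> \<open>Within distance 2 \<rho> <= \<delta>/2 of the maximum point the weight is
          still at least half of \<delta>, so maximality bounds \<open>S y\<close> by twice
          \<open>S x1\<close>.\<close>
        then have near: "\<delta> / 2 \<le> R x0 - norm (y - x0)"
          using \<rho>(2) norm_triangle_ineq[of "y - x1" "x1 - x0"] by (simp add: \<delta>_def norm_minus_commute)
        have "\<delta> / 2 * S y / s0 \<le> h y" unfolding h_def using near S0 s0 by (intro divide_right_mono mult_right_mono) auto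
        also have "\<dots> \<le> P" unfolding P_def by (rule x1(2)) (use sub1 y in auto)
        finally have "\<delta> * (S y / s0) \<le> 2 * P" by simp
        then have "\<rho> * (\<delta> * (S y / s0)) \<le> \<rho> * (2 * P)" using \<rho> by (intro mult_left_mono) auto
        also have "\<dots> = \<delta> * (2 * Q)" using \<rho>(3) by (simp add: mult.commute)
        finally have "\<delta> * (S y * (\<rho> / s0)) \<le> \<delta> * (2 * Q)" by (simp add: mult_ac)
        then have "S y * (\<rho> / s0) \<le> 2 * Q" using \<delta> by (rule mult_left_le_imp_le)
        moreover have "norm (pd i (pd j \<Phi>) y) * (\<rho> / s0) \<le> S y * (\<rho> / s0)"
          using S_ge \<rho> s0 by (intro mult_right_mono) auto
        ultimately show "norm (pd i (pd j \<Phi>) y) * (\<rho> / norm x0 ^ n) \<le> 2 * Q" unfolding s0_def by linarith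
      qed (use Q in simp)
      then interpret D: controlled_disc g \<Phi> lam x1 \<rho> "norm x0 ^ n" c0 "A * norm (\<Phi> x0) powr \<tau>" "2 * Q" .
      have "D.pt ` unit_box \<in> sets borel" by (intro borel_compact D.pt_image_compact)
      from D.energy_bounds(2)[OF en[OF x0 this]] D.pt_image_ball sub1
      have Z: "integral unit_box (\<lambda>z. norm (D.ud.Z z) ^ 2) \<le> \<epsilon>1" unfolding e(2) by blast
      have rem: "\<bar>D.ud.test_bound \<eta> \<epsilon>1\<bar> \<le> 1"
      proof -
        have "\<bar>D.ud.test_bound \<eta> \<epsilon>1\<bar> \<le> B * (\<eta> + \<epsilon>1 / \<eta>^2 + \<epsilon>1 / \<eta> + om x0)"
          using D.ud.remainder_le(1)[OF \<eta>(1), of \<epsilon>1] \<eta>(2) by (simp add: B_def c_def om_def)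
        also have "\<dots> \<le> 1" using om[OF x0] e \<eta> by (intro \<eta>(3)) auto
        finally show ?thesis .
      qed
      have pt0: "D.pt 0 = x1" by (simp add: D.pt_def)
      have q: "(\<rho> / s0) * norm (pd k (pd l \<Phi>) x1) \<le> 8 * c * ?kc + 1" for k l
      proof -
        have "norm (pd k (pd l D.Psi) 0) \<le> 8 * c * ?kc + 1"
          using D.ud.hessian_bound[OF \<eta>(1) Z, of k l] rem unfolding c_def by linarith
        then show ?thesis using \<rho> s0 by (simp add: D.pd_pd_Psi pt0 s0_def)
      qed
      have "(\<rho> / s0) * S x1 \<le> 32 * c * ?kc + 4"
        using q[of 1 1] q[of 1 2] q[of 2 1] q[of 2 2] unfolding S_def sum_2 distrib_left by linarith
      moreover have "(\<rho> / s0) * S x1 = Q"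
      proof -
        have "\<delta> * ((\<rho> / s0) * S x1) = P * \<rho>" unfolding hx1 by simp
        then have "\<delta> * ((\<rho> / s0) * S x1) = \<delta> * Q" unfolding \<rho>(3) by (simp only: mult.commute)
        then show ?thesis using \<delta> mult_left_cancel[of \<delta> "(\<rho> / s0) * S x1" Q] by simp
      qed
      ultimately show False by (simp add: Q_def)
    qed
    then show ?thesis using r1 by blast
  qed
  then obtain r1 where r1: "r1 > 0" "r1 \<le> r"
    and pick: "\<And>x0 x. x0 \<noteq> 0 \<Longrightarrow> norm x0 < r1 \<Longrightarrow> x \<in> ball x0 (R x0) \<Longrightarrow>
     (R x0 - norm (x - x0)) * S x / norm x0 ^ n \<le> 4 * Q" by blast
  \<comment> \<open>Chosen so that \<open>3 * c0 * T = \<epsilon> * \<kappa>\<close>: the loss in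
    \<open>second_ff_norm_center\<close> and the constant in \<open>len\<close> are undone at the
    end.\<close>
  define T where "T = \<epsilon> * \<kappa> / (3 * c0)"
  have T: "T > 0" using \<epsilon> \<kappa> c0 by (simp add: T_def)
  \<comment> \<open>The quadratic term of \<open>remainder_le\<close> becomes
    \<open>L * \<theta>^2\<close>. Dividing by \<open>len\<close>, which is proportional to
    \<theta>, leaves \<open>L * \<theta>\<close>, and this is the gain from shrinking the
    disc.\<close>
  define L where "L = ?kc * (128 * c^2 * (8 * Q)^2)"
  have L: "L > 0" using kc c Q by (simp add: L_def)
  define \<theta> where "\<theta> = min (1 / 4) (T / (2 * L))"
  have \<theta>: "\<theta> > 0" "\<theta> \<le> 1 / 4" "L * \<theta> \<le> T / 2" using T L by (auto simp: \<theta>_def min_def field_simps)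
  \<comment> \<open>At points within half of \<open>R x0\<close> the picked estimate gives R S / s0
    <= 8 Q, and the radius of the new disc is \<theta> times \<open>R x0\<close>.\<close>
  define K where "K = 8 * Q * \<theta>"
  have K: "K \<ge> 0" using Q \<theta> by (simp add: K_def)
  define B where "B = 20 * c^2 * ?kc^2 * (1 + K)^2 + ?kc * (12 + 128 * c^2 * K)"
  have B: "B \<ge> 0" using kc K by (simp add: B_def)
  \<comment> \<open>The total budget is T \<theta>. One half is used by the quadratic term, the
    other is left for the remainders, with \<theta> already fixed.\<close>
  have "T * \<theta> / 2 > 0" using T \<theta> by simp
  from small_remainder[OF this B] obtain \<eta> \<epsilon>1 where \<eta>: "\<eta> > 0" "\<epsilon>1 > 0"
      "\<And>e w. 0 \<le> e \<Longrightarrow> e \<le> \<epsilon>1 \<Longrightarrow> 0 \<le> w \<Longrightarrow> w \<le> \<epsilon>1 \<Longrightarrow> B * (\<eta> + e / \<eta>^2 + e / \<eta> + w) \<le> T * \<theta> / 2" by blast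
  define e where "e = \<epsilon>1 / (4 * c0)"
  have e: "e > 0" "4 * c0 * e = \<epsilon>1" "e \<le> \<epsilon>1" using \<eta> c0 by (auto simp: e_def field_simps)
  from small[OF e(1)] obtain r2 where r2: "r2 > 0" "r2 \<le> r"
      and om: "\<And>x0. x0 \<noteq> 0 \<Longrightarrow> norm x0 < r2 \<Longrightarrow> 0 \<le> om x0 \<and> om x0 \<le> e"
      and en: "\<And>x0 B. x0 \<noteq> 0 \<Longrightarrow> norm x0 < r2 \<Longrightarrow> B \<in> sets borel \<Longrightarrow> B \<subseteq> ball x0 (R x0) \<Longrightarrow> (LINT x:B|lborel. ?f x) \<le> e"
    by blast
  have "norm (\<Phi> x0) * second_ff_norm g \<Phi> x0 \<le> \<epsilon>" if x0: "x0 \<noteq> 0" "norm x0 < min r1 r2" for x0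
  proof -
    have x0r: "norm x0 < r" "norm x0 < r1" "norm x0 < r2" using x0 r1 r2 by auto
    define s0 where "s0 = norm x0 ^ n"
    have s0: "s0 > 0" using x0 by (simp add: s0_def)
    have Rx: "R x0 > 0" using R_pos[OF x0(1) x0r(1)] .
    define \<rho> where "\<rho> = \<theta> * R x0"
    have \<rho>: "\<rho> > 0" "\<rho> \<le> R x0 / 4" using \<theta> Rx mult_right_mono[OF \<theta>(2), of "R x0"] by (simp_all add: \<rho>_def)
    have sub: "ball x0 (2 * \<rho>) \<subseteq> ball x0 (R x0)" using \<rho> Rx by (intro subset_ball) linarith
    have "controlled_disc g \<Phi> lam x0 \<rho> (norm x0 ^ n) c0 (A * norm (\<Phi> x0) powr \<tau>) K"
    proof (rule disc[OF x0(1) x0r(1) \<rho>(1) K sub[unfolded R_def]])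
      fix y i j assume y: "y \<in> ball x0 (2 * \<rho>)"
      then have near: "R x0 / 2 \<le> R x0 - norm (y - x0)" using \<rho>(2) by (simp add: dist_norm norm_minus_commute)
      have "R x0 / 2 * S y / s0 \<le> (R x0 - norm (y - x0)) * S y / s0"
        using near S0 s0 by (intro divide_right_mono mult_right_mono) auto
      also have "\<dots> \<le> 4 * Q" unfolding s0_def by (rule pick) (use x0 x0r sub y in auto)
      finally have "\<theta> * (R x0 / 2 * S y / s0) \<le> \<theta> * (4 * Q)" using \<theta> by (intro mult_left_mono) auto
      then have "S y * (\<rho> / s0) \<le> K" by (simp add: K_def \<rho>_def mult_ac)
      moreover have "norm (pd i (pd j \<Phi>) y) * (\<rho> / s0) \<le> S y * (\<rho> / s0)"
        using S_ge \<rho> s0 by (intro mult_right_mono) auto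
      ultimately show "norm (pd i (pd j \<Phi>) y) * (\<rho> / norm x0 ^ n) \<le> K" unfolding s0_def by linarith
    qed
    then interpret D: controlled_disc g \<Phi> lam x0 \<rho> "norm x0 ^ n" c0 "A * norm (\<Phi> x0) powr \<tau>" K .
    have "D.pt ` unit_box \<in> sets borel" by (intro borel_compact D.pt_image_compact)
    from en[OF x0(1) x0r(3) this] D.pt_image_ball sub
    have E: "(LINT x:D.pt ` unit_box|lborel. ?f x) \<le> e" by blast
    note EB = D.energy_bounds[OF E, unfolded e(2)]
    have "norm (D.ud.A2 0 k l) \<le> T * \<theta>" for k l
    proof -
      let ?s = "\<eta> + \<epsilon>1 / \<eta>^2 + \<epsilon>1 / \<eta> + om x0"
      have 1: "\<bar>D.ud.test_bound \<eta> \<epsilon>1\<bar> \<le> 20 * c^2 * ?kc^2 * (1 + K)^2 * ?s"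
        using D.ud.remainder_le(1)[OF \<eta>(1), of \<epsilon>1] \<eta>(2) by (simp add: c_def om_def)
      have 2: "?kc * (8 * \<eta> + 2 * \<epsilon>1 / \<eta> + 128 * c^2 * K * (K + om x0) + 12 * om x0)
         \<le> ?kc * (128 * c^2 * K^2) + ?kc * (12 + 128 * c^2 * K) * ?s"
        using D.ud.remainder_le(2)[OF \<eta>(1), of \<epsilon>1] \<eta>(2) by (simp add: c_def om_def)
      have 3: "norm (D.ud.A2 0 k l) \<le> \<bar>D.ud.test_bound \<eta> \<epsilon>1\<bar> + ?kc * (8 * \<eta> + 2 * \<epsilon>1 / \<eta> + 128 * c^2 * K * (K + om x0) + 12 * om x0)"
        using D.ud.second_ff_bound[OF \<eta>(1) EB(2) EB(1)] by (simp add: c_def om_def)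
      have 4: "B * ?s \<le> T * \<theta> / 2" using om[OF x0(1) x0r(3)] e \<eta> by (intro \<eta>(3)) auto
      have 5: "?kc * (128 * c^2 * K^2) = \<theta> * (L * \<theta>)" by (simp add: K_def L_def power2_eq_square mult_ac)
      have 6: "\<theta> * (L * \<theta>) \<le> \<theta> * (T / 2)" using \<theta> by (intro mult_left_mono) auto
      have 7: "B * ?s = 20 * c^2 * ?kc^2 * (1 + K)^2 * ?s + ?kc * (12 + 128 * c^2 * K) * ?s" unfolding B_def by (rule distrib_right)
      show ?thesis using 1 2 3 4 5 6 7 by (simp only: mult.commute[of \<theta>] times_divide_eq_left times_divide_eq_right)
    qed
    note A2 = D.second_ff_norm_center[OF this]
    \<comment> \<open>The powers of |x0| in the radius and in the reference factor cancel.\<close>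
    have "D.len = \<theta> * (\<kappa> * norm (\<Phi> x0))" unfolding D.len_def unfolding \<rho>_def R_def using x0(1) by simp
    from A2[unfolded this] have "\<theta> * (\<kappa> * (norm (\<Phi> x0) * second_ff_norm g \<Phi> x0)) \<le> 3 * c0 * (T * \<theta>)"
      by (simp only: mult.assoc)
    also have "\<dots> = \<theta> * (\<kappa> * \<epsilon>)" using c0 by (simp add: T_def)
    finally show ?thesis using \<theta> \<kappa> by simp
  qed
  then show ?thesis using r1 r2 by (intro exI[of _ "min r1 r2"]) auto
qed

section \<open>From points near the branch point to values near the origin\<close>

text \<open>On a compact annulus the map avoids 0 and |\<Phi>| has a positive minimum. Restricting
  to |x| <= \<rho> < 1 is essential, as \<Phi> could tend to 0 at the boundary of the unit
  disc.\<close>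

lemma Phi_proper:
  assumes "\<rho> < 1" "r > 0"
  shows "\<exists>\<delta>>0. \<forall>x. norm x \<le> \<rho> \<and> norm (\<Phi> x) < \<delta> \<longrightarrow> norm x < r"
proof -
  let ?K = "cball 0 \<rho> - ball 0 r :: (real^2) set"
  have K: "compact ?K" by (intro compact_diff compact_cball open_ball)
  have sub: "?K \<subseteq> ball 0 1 - {0}" using assms by auto
  show ?thesis
  proof (cases "?K = {}")
    case True
    then show ?thesis by (intro exI[of _ 1]) force
  next
    case False
    have "continuous_on ?K (\<lambda>x. norm (\<Phi> x))" using sub by (intro continuous_intros continuous_on_subset[OF cont]) auto
    from continuous_attains_inf[OF K False this] obtain x0 where x0: "x0 \<in> ?K" "\<And>x. x \<in> ?K \<Longrightarrow> norm (\<Phi> x0) \<le> norm (\<Phi> x)" by blast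
    have "\<Phi> x0 \<in> ball 0 1 - {0}" using maps sub x0(1) by blast
    then have "norm (\<Phi> x0) > 0" by simp
    moreover have "norm x < r" if "norm x \<le> \<rho>" "norm (\<Phi> x) < norm (\<Phi> x0)" for x
      using x0(2)[of x] that by force
    ultimately show ?thesis by blast
  qed
qed

text \<open>Including \<open>0\<close> in the set gives \<open>\<mu>\<close> a meaning also at radii that \<open>|\<Phi>|\<close> does not attain.\<close>

lemma second_ff_modulus:
  obtains \<mu> :: "real \<Rightarrow> real" where "(\<mu> \<longlongrightarrow> 0) (at_right 0)"
    "\<And>\<rho>. \<rho> < 1 \<Longrightarrow> \<exists>\<delta>>0. \<forall>x. x \<noteq> 0 \<and> norm x < \<rho> \<and> norm (\<Phi> x) < \<delta> \<longrightarrow> norm (\<Phi> x) * second_ff_norm g \<Phi> x \<le> \<mu> (norm (\<Phi> x))"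
proof -
  let ?a = "\<lambda>x. norm (\<Phi> x) * second_ff_norm g \<Phi> x"
  obtain r0 where r0: "r0 > 0" "\<And>x. x \<noteq> 0 \<Longrightarrow> norm x < r0 \<Longrightarrow> ?a x \<le> 1"
    using second_ff_decay[OF zero_less_one] by blast
  \<comment> \<open>Within this radius the quantity is at most 1, so the suprema over level sets of
    |\<Phi>| are finite.\<close>
  define r where "r = min r0 (1 / 2)"
  have r: "r > 0" "r < 1" "\<And>x. x \<noteq> 0 \<Longrightarrow> norm x < r \<Longrightarrow> ?a x \<le> 1" using r0 by (auto simp: r_def)
  define V where "V s = insert 0 {?a x | x. x \<noteq> 0 \<and> norm x < r \<and> norm (\<Phi> x) = s}" for s
  have bdd: "bdd_above (V s)" for s by (rule bdd_aboveI[of _ 1]) (use r(3) in \<open>auto simp: V_def\<close>)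
  show ?thesis
  proof (rule that[of "\<lambda>s. Sup (V s)"])
    show "((\<lambda>s. Sup (V s)) \<longlongrightarrow> 0) (at_right 0)"
    proof (rule tendstoI)
      fix e :: real assume e: "e > 0"
      then obtain r' where r': "r' > 0" "\<And>x. x \<noteq> 0 \<Longrightarrow> norm x < r' \<Longrightarrow> ?a x \<le> e / 2"
        using second_ff_decay[of "e / 2"] by auto
      obtain \<delta> where \<delta>: "\<delta> > 0" "\<And>x. norm x \<le> r \<Longrightarrow> norm (\<Phi> x) < \<delta> \<Longrightarrow> norm x < r'"
        using Phi_proper[OF r(2) r'(1)] by blast
      have "dist (Sup (V s)) 0 < e" if s: "s < \<delta>" for s
      proof -
        have "Sup (V s) \<le> e / 2"
        proof (rule cSup_least)
          fix v assume "v \<in> V s"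
          then show "v \<le> e / 2" using r'(2) \<delta>(2) s e by (auto simp: V_def)
        qed (simp add: V_def)
        moreover have "0 \<le> Sup (V s)" by (rule cSup_upper[OF _ bdd]) (simp add: V_def)
        ultimately show ?thesis using e by simp
      qed
      then show "\<forall>\<^sub>F s in at_right 0. dist (Sup (V s)) 0 < e"
        unfolding eventually_at_right_field using \<delta>(1) by blast
    qed
    fix \<rho> :: real assume "\<rho> < 1"
    then obtain \<delta> where \<delta>: "\<delta> > 0" "\<And>x. norm x \<le> \<rho> \<Longrightarrow> norm (\<Phi> x) < \<delta> \<Longrightarrow> norm x < r"
      using Phi_proper[OF _ r(1)] by blast
    have "?a x \<le> Sup (V (norm (\<Phi> x)))" if "x \<noteq> 0" "norm x < \<rho>" "norm (\<Phi> x) < \<delta>" for x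
      by (rule cSup_upper[OF _ bdd]) (use that \<delta>(2)[of x] in \<open>auto simp: V_def\<close>)
    then show "\<exists>\<delta>>0. \<forall>x. x \<noteq> 0 \<and> norm x < \<rho> \<and> norm (\<Phi> x) < \<delta> \<longrightarrow> ?a x \<le> Sup (V (norm (\<Phi> x)))"
      using \<delta>(1) by blast
  qed
qed

end

theorem theoremI4:
  fixes g :: "real^'m::finite \<Rightarrow> real^'m^'m"
    and \<Phi> :: "real^2 \<Rightarrow> real^'m"
    and lam :: "real^2 \<Rightarrow> real"
    and \<tau> :: real
    and \<theta>\<^sub>0 :: nat
  assumes dim: "CARD('m) \<ge> 3"
    and tau: "0 < \<tau>" "\<tau> \<le> 1"
    and metric: "riemannian_metric_on (ball 0 1) g"
    and metric_smooth: "smooth_on (ball 0 1 - {0}) g"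
    and metric_decay:
      "\<And>\<alpha> \<beta>. bigO_derivs 2 \<tau> (\<lambda>y. g y $ \<alpha> $ \<beta> - (if \<alpha> = \<beta> then 1 else 0))"
    and maps: "\<Phi> ` (ball 0 1 - {0}) \<subseteq> ball 0 1 - {0}"
    and immersion: "immersion_on (ball 0 1 - {0}) \<Phi>"
    and conformal:
      "\<And>x i j. x \<in> ball 0 1 - {0} \<Longrightarrow>
         ginner g (\<Phi> x) (pd i \<Phi> x) (pd j \<Phi> x) = exp (2 * lam x) * (if i = j then 1 else 0)"
    and willmore: "willmore_on (ball 0 1 - {0}) (ball 0 1 - {0}) g \<Phi>"
    and cont: "continuous_on (ball 0 1) \<Phi>"
    and origin: "\<Phi> 0 = 0"
    and finite_energy:
      "set_integrable lborel (ball 0 1 - {0}) (\<lambda>x. second_ff_normsq g \<Phi> x * area_density g \<Phi> x)"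
    and multiplicity: "\<theta>\<^sub>0 \<ge> 1"
    and conformal_factor: "(\<lambda>x. exp (lam x)) \<in> \<Theta>[at 0](\<lambda>x. norm x ^ (\<theta>\<^sub>0 - 1))"
    and grad_lam: "\<And>p. 1 \<le> p \<Longrightarrow> in_Lp p (ball 0 1) (\<lambda>x. norm x *\<^sub>R grad lam x)"
  shows "\<exists>\<mu> :: real \<Rightarrow> real. (\<mu> \<longlongrightarrow> 0) (at_right 0) \<and>
    (\<exists>C. \<forall>\<rho>. 0 < \<rho> \<and> \<rho> < 1 \<longrightarrow>
      (\<exists>\<delta>>0. \<forall>y\<in>\<Phi> ` (ball 0 \<rho> - {0}). norm y < \<delta> \<longrightarrow>
         (\<forall>x\<in>ball 0 \<rho> - {0}. \<Phi> x = y \<longrightarrow>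
            second_ff_norm g \<Phi> x \<le> C * (inverse (norm y) * \<mu> (norm y)))))"
proof -
  interpret willmore_branch g \<Phi> lam \<tau> "\<theta>\<^sub>0 - 1"
    by unfold_locales (fact assms)+
  obtain \<mu> where \<mu>: "(\<mu> \<longlongrightarrow> 0) (at_right 0)"
    "\<And>\<rho>. \<rho> < 1 \<Longrightarrow> \<exists>\<delta>>0. \<forall>x. x \<noteq> 0 \<and> norm x < \<rho> \<and> norm (\<Phi> x) < \<delta> \<longrightarrow> norm (\<Phi> x) * second_ff_norm g \<Phi> x \<le> \<mu> (norm (\<Phi> x))"
    using second_ff_modulus by blast
  show ?thesis
  \<comment> \<open>The constant is 1, since all constants have been absorbed into \<mu>; only
    \<delta> depends on \<rho>.\<close>
  proof (rule exI[of _ \<mu>], rule conjI[OF \<mu>(1)], rule exI[of _ 1], intro allI impI)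
    fix \<rho> :: real assume \<rho>: "0 < \<rho> \<and> \<rho> < 1"
    then obtain \<delta> where \<delta>: "\<delta> > 0"
      "\<And>x. x \<noteq> 0 \<Longrightarrow> norm x < \<rho> \<Longrightarrow> norm (\<Phi> x) < \<delta> \<Longrightarrow> norm (\<Phi> x) * second_ff_norm g \<Phi> x \<le> \<mu> (norm (\<Phi> x))"
      using \<mu>(2)[of \<rho>] by blast
    have "second_ff_norm g \<Phi> x \<le> 1 * (inverse (norm (\<Phi> x)) * \<mu> (norm (\<Phi> x)))"
      if x: "x \<in> ball 0 \<rho> - {0}" "norm (\<Phi> x) < \<delta>" for x
    proof -
      have "x \<in> ball 0 1 - {0}" using x \<rho> by auto
      then have "\<Phi> x \<in> ball 0 1 - {0}" using maps by blast
      then have "norm (\<Phi> x) > 0" by simp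
      then show ?thesis using \<delta>(2)[of x] x by (simp add: field_simps)
    qed
    then show "\<exists>\<delta>>0. \<forall>y\<in>\<Phi> ` (ball 0 \<rho> - {0}). norm y < \<delta> \<longrightarrow> (\<forall>x\<in>ball 0 \<rho> - {0}. \<Phi> x = y \<longrightarrow>
            second_ff_norm g \<Phi> x \<le> 1 * (inverse (norm y) * \<mu> (norm y)))"
      using \<delta>(1) by blast
  qed
qed

end
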